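(* Suppose that the composition law $\#:\mathcal S(\Xi)\times\mathcal S(\Xi)\to\mathcal S(\Xi)$ satisfies Hypotheses A, B and C. Then each of the mappings $\mathbf M,\mathbf N,\mathbf R$ (defined on $\mathcal S(\Xi\times\Xi)$) extends to a unitary operator on the Hilbert space $L^2(\Xi\times\Xi)$.
   Context: Notation. Let $\Xi=\mathbb R^n\times\mathbb R^n$ with points $X=(x,\xi)$, $Y=(y,\eta)$ and symplectic form $\sigma(X,Y)=y\cdot\xi-x\cdot\eta$. $dX$ denotes Lebesgue measure on $\Xi$ multiplied by $(2\pi)^{-n}$, so that the symplectic Fourier transform $(\mathfrak Ff)(Y)=\widehat f(Y)=\int_\Xi e^{-i\sigma(Y,Z)}f(Z)\,dZ$ is unitary in $L^2(\Xi)$ and $\mathfrak F^2=1$. $\langle f,g\rangle=\int_\Xi f(X)g(X)\,dX$ (bilinear), and the same symbol denotes the duality between $\mathcal S'(\Xi)$ and $\mathcal S(\Xi)$ (in either order). Similarly $\langle\!\langle F,G\rangle\!\rangle=\int_\Xi\int_\Xi F(X,Y)G(X,Y)\,dX\,dY$ and its extension to a duality between $\mathcal S'(\Xi\times\Xi)$ and $\mathcal S(\Xi\times\Xi)$. Functions are complex valued. $\mathbf e_X(Z):=e^{i\sigma(X,Z)}$ for $X,Z\in\Xi$. Hypothesis A. $\#:\mathcal S(\Xi)\times\mathcal S(\Xi)\to\mathcal S(\Xi)$ is bilinear, associative and separately continuous, $\mathcal S(\Xi)$ is a $^*$-algebra with the product $\#$ and the involution $f^\#:=\overline f$ (so $\overline{f\#g}=\overline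 g\#\overline f$), and $\int_\Xi (f\#g)(X)\,dX=\int_\Xi f(X)g(X)\,dX$ for all $f,g\in\mathcal S(\Xi)$. Extension. Under Hypothesis A, for $f\in\mathcal S'(\Xi)$, $g\in\mathcal S(\Xi)$, the distributions $f\#g,\ g\#f\in\mathcal S'(\Xi)$ are defined by $\langle f\#g,h\rangle:=\langle f,g\#h\rangle$ and $\langle g\#f,h\rangle:=\langle f,h\#g\rangle$ for $h\in\mathcal S(\Xi)$; these extend $\#$ and satisfy $(f_1\#g)\#f_2=f_1\#(g\#f_2)$ for $f_1,f_2\in\mathcal S(\Xi)$, $g\in\mathcal S'(\Xi)$. Hypothesis B. $f_1\#g\#f_2\in\mathcal S(\Xi)$ for all $f_1,f_2\in\mathcal S(\Xi)$, $g\in\mathcal S'(\Xi)$. Under Hypothesis B one sets, for $g_1,g_2\in\mathcal S'(\Xi)$ and $f,h\in\mathcal S(\Xi)$, $\langle g_1\#f\#g_2,h\rangle:=\langle g_1,f\#g_2\#h\rangle$, which defines $g_1\#f\#g_2\in\mathcal S'(\Xi)$. Hypothesis C. With $\Theta^\#_Z(f):=\mathbf e_{-Z}\#f\#\mathbf e_Z$, for all $f,g\in\mathcal S(\Xi)$ one has $\int_\Xi \langle\Theta^\#_Z(f),g\rangle\,dZ=\int_\Xi f(Z)\,dZ\int_\Xi g(Y)\,dY$. The mappings. $\mathbf R$ and $\mathbf N$ are the linear continuous maps $\mathcal S(\Xi\times\Xi)\to\mathcal S'(\Xi\times\Xi)$ uniquely determined, for all $f_1,f_2,g_1,g_2\in\mathcal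 S(\Xi)$, by $\langle\!\langle\mathbf R(f_1\otimes f_2),g_1\otimes g_2\rangle\!\rangle=\langle g_1\#f_1,g_2\#f_2\rangle$ and $\langle\!\langle\mathbf N(f_1\otimes f_2),g_1\otimes g_2\rangle\!\rangle=\langle\widehat g_1\#f_1,\widehat g_2\#f_2\rangle$. The modulation mapping is $\mathbf M:=\mathbf C\circ\mathbf N$, where $\mathbf C(F):=F\circ C$ and $C(X,Y):=(-X,X-Y)$. Under Hypotheses A and B these maps send $\mathcal S(\Xi\times\Xi)$ continuously into itself, and $[\mathbf M(f\otimes g)](X,Y)=\langle\mathbf e_{-X}\#f,\mathbf e_{X-Y}\#g\rangle:=\langle\mathbf e_{-X},f\#\mathbf e_{X-Y}\#g\rangle$. *)

theory Defs
  imports "HOL-Analysis.Analysis" "HOL-Library.FuncSet"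
begin

section \<open>Locally convex topologies and linear forms\<close>

text \<open>The topology on the set \<open>V\<close> whose subbasic open sets are the balls of the seminorms in \<open>P\<close>,
  centred at points of \<open>V\<close>. Both spaces of functions and spaces of functionals are covered.\<close>

definition seminorm_topology ::
  "('x \<Rightarrow> complex) set \<Rightarrow> (('x \<Rightarrow> complex) \<Rightarrow> real) set \<Rightarrow> ('x \<Rightarrow> complex) topology" where
  "seminorm_topology V P =
     topology_generated_by {{g \<in> V. p (\<lambda>x. g x - f x) < e} | f p e. f \<in> V \<and> p \<in> P \<and> 0 < e}"

definition linear_form_on :: "('x \<Rightarrow> complex) set \<Rightarrow> (('x \<Rightarrow> complex) \<Rightarrow> complex) \<Rightarrow> bool" where
  "linear_form_on V u \<longleftrightarrow>
     (\<forall>f\<in>V. \<forall>g\<in>V. u (\<lambda>x. f x + g x) = u f + u g) \<and>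
     (\<forall>c. \<forall>f\<in>V. u (\<lambda>x. c * f x) = c * u f)"


section \<open>The Schwartz space and its strong dual\<close>

primrec partial_deriv :: "'a list \<Rightarrow> ('a::euclidean_space \<Rightarrow> complex) \<Rightarrow> 'a \<Rightarrow> complex" where
  "partial_deriv [] f = f"
| "partial_deriv (b # bs) f = (\<lambda>x. frechet_derivative (partial_deriv bs f) (at x) b)"

definition schwartz :: "('a::euclidean_space \<Rightarrow> complex) set" where
  "schwartz = {f. \<forall>bs \<in> lists Basis.
      (\<forall>x. partial_deriv bs f differentiable (at x)) \<and>
      (\<forall>k::nat. bounded (range (\<lambda>x. (1 + norm x) ^ k * norm (partial_deriv bs f x))))}"

definition schwartz_seminorm :: "nat \<Rightarrow> 'a list \<Rightarrow> ('a::euclidean_space \<Rightarrow> complex) \<Rightarrow> real" where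
  "schwartz_seminorm k bs f = (SUP x. (1 + norm x) ^ k * norm (partial_deriv bs f x))"

definition schwartz_topology :: "('a::euclidean_space \<Rightarrow> complex) topology" where
  "schwartz_topology =
     seminorm_topology schwartz {schwartz_seminorm k bs | k bs. bs \<in> lists Basis}"

text \<open>Distributions are functionals on all functions that are made \<^const>\<open>extensional\<close>, so that
  equality of distributions is equality in HOL.\<close>

definition tempered :: "(('a::euclidean_space \<Rightarrow> complex) \<Rightarrow> complex) set" where
  "tempered = {u \<in> extensional schwartz.
      linear_form_on schwartz u \<and> continuous_map schwartz_topology euclidean u}"

definition schwartz_bounded :: "('a::euclidean_space \<Rightarrow> complex) set \<Rightarrow> bool" where
  "schwartz_bounded B \<longleftrightarrow> B \<subseteq> schwartz \<and>
     (\<forall>k. \<forall>bs \<in> lists Basis. bdd_above (schwartz_seminorm k bs ` B))"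

definition tempered_topology :: "(('a::euclidean_space \<Rightarrow> complex) \<Rightarrow> complex) topology" where
  "tempered_topology = seminorm_topology tempered
     {\<lambda>u. SUP \<phi>\<in>B. norm (u \<phi>) | B. schwartz_bounded B \<and> B \<noteq> {}}"

definition distr_of :: "'a measure \<Rightarrow> ('a::euclidean_space \<Rightarrow> complex) \<Rightarrow> ('a \<Rightarrow> complex) \<Rightarrow> complex" where
  "distr_of \<mu> f = (\<lambda>h\<in>schwartz. \<integral>x. f x * h x \<partial>\<mu>)"


section \<open>Phase space\<close>

type_synonym 'n phase = "(real^'n) \<times> (real^'n)"

definition sympl :: "'n::finite phase \<Rightarrow> 'n phase \<Rightarrow> real" where
  "sympl X Y = fst Y \<bullet> snd X - fst X \<bullet> snd Y"

definition dX :: "'n::finite phase measure" where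
  "dX = density lborel (\<lambda>_. ennreal (1 / (2 * pi) ^ CARD('n)))"

definition dXdY :: "('n::finite phase \<times> 'n phase) measure" where
  "dXdY = dX \<Otimes>\<^sub>M dX"

definition ee :: "'n::finite phase \<Rightarrow> 'n phase \<Rightarrow> complex" where
  "ee X Z = exp (\<i> * of_real (sympl X Z))"

definition symp_fourier :: "('n::finite phase \<Rightarrow> complex) \<Rightarrow> 'n phase \<Rightarrow> complex" where
  "symp_fourier f Y = (\<integral>Z. exp (- \<i> * of_real (sympl Y Z)) * f Z \<partial>dX)"

definition tensor :: "('a \<Rightarrow> complex) \<Rightarrow> ('b \<Rightarrow> complex) \<Rightarrow> 'a \<times> 'b \<Rightarrow> complex" where
  "tensor f g = (\<lambda>(X, Y). f X * g Y)"


section \<open>Composition laws\<close>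

type_synonym 'n composition =
  "('n phase \<Rightarrow> complex) \<Rightarrow> ('n phase \<Rightarrow> complex) \<Rightarrow> 'n phase \<Rightarrow> complex"

definition hypothesis_A :: "'n::finite composition \<Rightarrow> bool" where
  "hypothesis_A m \<longleftrightarrow>
     (\<forall>f\<in>schwartz. \<forall>g\<in>schwartz. m f g \<in> schwartz) \<and>
     (\<forall>g\<in>schwartz. \<forall>X. linear_form_on schwartz (\<lambda>f. m f g X)) \<and>
     (\<forall>f\<in>schwartz. \<forall>X. linear_form_on schwartz (\<lambda>g. m f g X)) \<and>
     (\<forall>f\<in>schwartz. \<forall>g\<in>schwartz. \<forall>h\<in>schwartz. m (m f g) h = m f (m g h)) \<and>
     (\<forall>g\<in>schwartz. continuous_map schwartz_topology schwartz_topology (\<lambda>f. m f g)) \<and>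
     (\<forall>f\<in>schwartz. continuous_map schwartz_topology schwartz_topology (\<lambda>g. m f g)) \<and>
     (\<forall>f\<in>schwartz. \<forall>g\<in>schwartz.
        (\<lambda>X. cnj (m f g X)) = m (\<lambda>X. cnj (g X)) (\<lambda>X. cnj (f X))) \<and>
     (\<forall>f\<in>schwartz. \<forall>g\<in>schwartz. (\<integral>X. m f g X \<partial>dX) = (\<integral>X. f X * g X \<partial>dX))"

text \<open>The products \<open>u # g\<close> and \<open>g # u\<close> of a distribution \<open>u\<close> and a Schwartz function \<open>g\<close>.\<close>

definition distr_mult ::
  "'n::finite composition \<Rightarrow> (('n phase \<Rightarrow> complex) \<Rightarrow> complex) \<Rightarrow> ('n phase \<Rightarrow> complex)
     \<Rightarrow> ('n phase \<Rightarrow> complex) \<Rightarrow> complex" where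
  "distr_mult m u g = (\<lambda>h\<in>schwartz. u (m g h))"

definition mult_distr ::
  "'n::finite composition \<Rightarrow> ('n phase \<Rightarrow> complex) \<Rightarrow> (('n phase \<Rightarrow> complex) \<Rightarrow> complex)
     \<Rightarrow> ('n phase \<Rightarrow> complex) \<Rightarrow> complex" where
  "mult_distr m g u = (\<lambda>h\<in>schwartz. u (m h g))"

definition hypothesis_B :: "'n::finite composition \<Rightarrow> bool" where
  "hypothesis_B m \<longleftrightarrow>
     (\<forall>f1\<in>schwartz. \<forall>f2\<in>schwartz. \<forall>u\<in>tempered.
        \<exists>\<phi>\<in>schwartz. distr_mult m (mult_distr m f1 u) f2 = distr_of dX \<phi>)"

text \<open>\<open>f1 # u # f2\<close> as a Schwartz function, under \<^const>\<open>hypothesis_B\<close>.\<close>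

definition smooth_sandwich ::
  "'n::finite composition \<Rightarrow> ('n phase \<Rightarrow> complex) \<Rightarrow> (('n phase \<Rightarrow> complex) \<Rightarrow> complex)
     \<Rightarrow> ('n phase \<Rightarrow> complex) \<Rightarrow> 'n phase \<Rightarrow> complex" where
  "smooth_sandwich m f1 u f2 =
     (THE \<phi>. \<phi> \<in> schwartz \<and> distr_mult m (mult_distr m f1 u) f2 = distr_of dX \<phi>)"

text \<open>\<open>u1 # f # u2\<close> for distributions \<open>u1\<close> and \<open>u2\<close>.\<close>

definition distr_sandwich ::
  "'n::finite composition \<Rightarrow> (('n phase \<Rightarrow> complex) \<Rightarrow> complex) \<Rightarrow> ('n phase \<Rightarrow> complex)
     \<Rightarrow> (('n phase \<Rightarrow> complex) \<Rightarrow> complex) \<Rightarrow> ('n phase \<Rightarrow> complex) \<Rightarrow> complex" where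
  "distr_sandwich m u1 f u2 = (\<lambda>h\<in>schwartz. u1 (smooth_sandwich m f u2 h))"

definition Theta ::
  "'n::finite composition \<Rightarrow> 'n phase \<Rightarrow> ('n phase \<Rightarrow> complex) \<Rightarrow> ('n phase \<Rightarrow> complex) \<Rightarrow> complex" where
  "Theta m Z f = distr_sandwich m (distr_of dX (ee (- Z))) f (distr_of dX (ee Z))"

definition hypothesis_C :: "'n::finite composition \<Rightarrow> bool" where
  "hypothesis_C m \<longleftrightarrow>
     (\<forall>f\<in>schwartz. \<forall>g\<in>schwartz.
        (\<integral>Z. Theta m Z f g \<partial>dX) = (\<integral>Z. f Z \<partial>dX) * (\<integral>Y. g Y \<partial>dX))"


section \<open>The mappings R, N and M\<close>

type_synonym 'n double_map =
  "('n phase \<times> 'n phase \<Rightarrow> complex) \<Rightarrow> ('n phase \<times> 'n phase \<Rightarrow> complex) \<Rightarrow> complex"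

definition determined_by ::
  "(('n::finite phase \<Rightarrow> complex) \<Rightarrow> ('n phase \<Rightarrow> complex) \<Rightarrow> ('n phase \<Rightarrow> complex)
     \<Rightarrow> ('n phase \<Rightarrow> complex) \<Rightarrow> complex) \<Rightarrow> 'n double_map \<Rightarrow> bool" where
  "determined_by b T \<longleftrightarrow>
     T \<in> schwartz \<rightarrow>\<^sub>E tempered \<and>
     (\<forall>G\<in>schwartz. linear_form_on schwartz (\<lambda>F. T F G)) \<and>
     continuous_map schwartz_topology tempered_topology T \<and>
     (\<forall>f1\<in>schwartz. \<forall>f2\<in>schwartz. \<forall>g1\<in>schwartz. \<forall>g2\<in>schwartz.
        T (tensor f1 f2) (tensor g1 g2) = b f1 f2 g1 g2)"

definition R_map :: "'n::finite composition \<Rightarrow> 'n double_map" where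
  "R_map m = (THE T. determined_by
     (\<lambda>f1 f2 g1 g2. \<integral>X. m g1 f1 X * m g2 f2 X \<partial>dX) T)"

definition N_map :: "'n::finite composition \<Rightarrow> 'n double_map" where
  "N_map m = (THE T. determined_by
     (\<lambda>f1 f2 g1 g2. \<integral>X. m (symp_fourier g1) f1 X * m (symp_fourier g2) f2 X \<partial>dX) T)"

definition C_change :: "'n::finite phase \<times> 'n phase \<Rightarrow> 'n phase \<times> 'n phase" where
  "C_change = (\<lambda>(X, Y). (- X, X - Y))"

text \<open>Composition \<open>F \<circ> C\<close> of a tempered distribution \<open>F\<close> with the linear bijection
  \<^const>\<open>C_change\<close>, by transposition; no Jacobian appears because \<open>\<bar>det C\<bar> = 1\<close>.\<close>

definition C_map :: "(('n::finite phase \<times> 'n phase \<Rightarrow> complex) \<Rightarrow> complex)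
     \<Rightarrow> ('n phase \<times> 'n phase \<Rightarrow> complex) \<Rightarrow> complex" where
  "C_map u = (\<lambda>G\<in>schwartz. u (G \<circ> inv C_change))"

definition M_map :: "'n::finite composition \<Rightarrow> 'n double_map" where
  "M_map m = (\<lambda>F\<in>schwartz. C_map (N_map m F))"


section \<open>Unitary operators on \<open>L\<^sup>2\<close>\<close>

definition L2 :: "'a measure \<Rightarrow> ('a \<Rightarrow> complex) set" where
  "L2 \<mu> = {f \<in> borel_measurable \<mu>. integrable \<mu> (\<lambda>x. (norm (f x))\<^sup>2)}"

text \<open>Operators on the Hilbert space \<open>L\<^sup>2\<close> act on representatives; all equations, as well as
  well-definedness on classes, are modulo equality almost everywhere.\<close>

definition unitary_on_L2 :: "'a measure \<Rightarrow> (('a \<Rightarrow> complex) \<Rightarrow> 'a \<Rightarrow> complex) \<Rightarrow> bool" where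
  "unitary_on_L2 \<mu> U \<longleftrightarrow>
     (\<forall>f\<in>L2 \<mu>. U f \<in> L2 \<mu>) \<and>
     (\<forall>f\<in>L2 \<mu>. \<forall>g\<in>L2 \<mu>. (AE x in \<mu>. f x = g x) \<longrightarrow> (AE x in \<mu>. U f x = U g x)) \<and>
     (\<forall>f\<in>L2 \<mu>. \<forall>g\<in>L2 \<mu>. AE x in \<mu>. U (\<lambda>y. f y + g y) x = U f x + U g x) \<and>
     (\<forall>c. \<forall>f\<in>L2 \<mu>. AE x in \<mu>. U (\<lambda>y. c * f y) x = c * U f x) \<and>
     (\<forall>f\<in>L2 \<mu>. \<forall>g\<in>L2 \<mu>. (\<integral>x. U f x * cnj (U g x) \<partial>\<mu>) = (\<integral>x. f x * cnj (g x) \<partial>\<mu>)) \<and>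
     (\<forall>g\<in>L2 \<mu>. \<exists>f\<in>L2 \<mu>. AE x in \<mu>. U f x = g x)"

text \<open>A map from \<open>S\<close> to \<open>S'\<close> extends to a unitary operator of \<open>L\<^sup>2\<close>, where \<open>L\<^sup>2\<close> is regarded as
  a subspace of \<open>S'\<close> through \<^const>\<open>distr_of\<close>.\<close>

definition extends_to_unitary :: "'n::finite double_map \<Rightarrow> bool" where
  "extends_to_unitary T \<longleftrightarrow>
     (\<exists>U. unitary_on_L2 dXdY U \<and> (\<forall>F\<in>schwartz. T F = distr_of dXdY (U F)))"

end

theory Submission
  imports Defs "HOL-Probability.Distributions" "HOL-Probability.Sinc_Integral"
    "HOL-Probability.Characteristic_Functions"
begin

text \<open>
  For Schwartz functions \<open>f\<close>, \<open>g\<close> put \<open>K Y = f # e Y # g\<close>, a Schwartz function by Hypothesis B. Associativity and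
  the trace property turn the inner product of two such kernels at the same \<open>Y\<close> into
  \<open>\<langle>\<Theta> Y (cnj f' # f), g # cnj g'\<rangle>\<close>, and Hypothesis C integrates this over \<open>Y\<close> to
  \<open>\<langle>f, f'\<rangle> \<langle>g, g'\<rangle>\<close>. Hence \<open>f \<otimes> g \<mapsto> K\<close> extends to an isometry of \<open>L\<^sup>2\<close>, and \<open>R\<close> is obtained from it by a Fourier
  transform in the second variable. Up to the flip of the two variables, the bilinear form of \<open>R\<close> is symmetric, so the
  adjoint of \<open>R\<close> is an isometry as well and \<open>R\<close> is unitary. Composing with Fourier transforms and with the
  measure-preserving change of variables gives \<open>N\<close> and \<open>M\<close>.

  The maps of the statement, which are only characterised by their values on tensor products, agree with these
  operators because tensor products span a dense subspace of the Schwartz space: a function is the limit of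
  its convolutions with Gaussians, these are limits of Riemann sums of translated Gaussians, and a Gaussian on a
  product is a tensor product.
\<close>

section \<open>The Schwartz space\<close>

text \<open>The symmetry of \<open>R\<close> is cyclicity of the trace: its form is the integral of
  the cyclic word \<open>g1 # f1 # g2 # f2\<close>, and rotating the word by one factor exchanges
  (f1, f2) with (g2, g1). Surjectivity therefore follows from the isometry property itself, without
  any description of the range.

  Hypothesis B provides the kernel for each \<open>Y\<close> separately and only through its
  pairings, so neither joint measurability nor square integrability in both variables is given.
  Hypothesis C is an equation between Bochner integrals and yields integrability only indirectly.

  \<open>R\<close> and \<open>N\<close> are definite descriptions among continuous maps from S into
  its strong dual. An operator of \<open>L\<^sup>2\<close> must first be recognised as such a map,
  by an estimate uniform on bounded sets of test functions, before density can identify the two.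

  Membership in the Schwartz space is mostly proved by exhibiting a class of functions invariant
  under first derivatives, not by computing iterated ones.\<close>

lemma partial_deriv_append: "partial_deriv (bs @ cs) f = partial_deriv bs (partial_deriv cs f)"
  by (induction bs) auto

lemma schwartz_partial_deriv:
  assumes "f \<in> schwartz" "cs \<in> lists Basis"
  shows "partial_deriv cs f \<in> schwartz"
  using assms unfolding schwartz_def mem_Collect_eq
  by (metis append_in_lists_conv partial_deriv_append)

text \<open>The Schwartz space is the largest set of rapidly decreasing differentiable functions closed under partial derivatives.\<close>

lemma schwartz_coinduct:
  fixes f :: "'a::euclidean_space \<Rightarrow> complex"
  assumes "f \<in> A"
    and deriv: "\<And>f. f \<in> A \<Longrightarrow>
      \<exists>D. (\<forall>x. (f has_derivative D x) (at x)) \<and> (\<forall>b\<in>Basis. (\<lambda>x. D x b) \<in> A)"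
    and bd: "\<And>f k. f \<in> A \<Longrightarrow> \<exists>C. \<forall>x. (1 + norm x) ^ k * norm (f x) \<le> C"
  shows "f \<in> schwartz"
proof -
  have *: "partial_deriv bs f \<in> A" if "bs \<in> lists Basis" for bs
    using that
  proof (induction bs)
    case (Cons b bs)
    then obtain D where D: "\<And>x. (partial_deriv bs f has_derivative D x) (at x)" "\<And>b. b\<in>Basis \<Longrightarrow> (\<lambda>x. D x b) \<in> A"
      using deriv[of "partial_deriv bs f"] by auto
    have "partial_deriv (b # bs) f = (\<lambda>x. D x b)"
      using frechet_derivative_at[OF D(1)] by (simp add: fun_eq_iff)
    then show ?case using D Cons by auto
  qed (use assms in auto)
  show ?thesis
    unfolding schwartz_def mem_Collect_eq
  proof (intro ballI conjI allI)
    fix bs :: "'a list" assume bs: "bs \<in> lists Basis"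
    show "partial_deriv bs f differentiable (at x)" for x
      using deriv[OF *[OF bs]] by (auto simp: differentiable_def)
    fix k obtain C where "\<forall>x. (1 + norm x) ^ k * norm (partial_deriv bs f x) \<le> C" using bd[OF *[OF bs]] by blast
    then show "bounded (range (\<lambda>x. (1 + norm x) ^ k * norm (partial_deriv bs f x)))"
      by (intro boundedI[of _ C]) auto
  qed
qed

lemma schwartz_has_derivative:
  assumes "f \<in> schwartz"
  shows "(f has_derivative (\<lambda>h. \<Sum>b\<in>Basis. (h \<bullet> b) *\<^sub>R partial_deriv [b] f x)) (at x)"
proof -
  have "f differentiable (at x)"
    using assms by (auto simp: schwartz_def dest: bspec[of _ _ "[]"])
  then have d: "(f has_derivative frechet_derivative f (at x)) (at x)"
    by (simp add: frechet_derivative_works)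
  then have lin: "linear (frechet_derivative f (at x))" by (rule has_derivative_linear)
  have "frechet_derivative f (at x) = (\<lambda>h. \<Sum>b\<in>Basis. (h \<bullet> b) *\<^sub>R partial_deriv [b] f x)"
    by (rule ext, subst euclidean_representation[symmetric], subst linear_sum[OF lin])
      (simp add: linear_scale[OF lin])
  then show ?thesis using d by simp
qed

lemma partial_derivI:
  assumes "\<And>x. (f has_derivative D x) (at x)"
  shows "partial_deriv [b] f = (\<lambda>x. D x b)"
  using frechet_derivative_at[OF assms] by (simp add: fun_eq_iff)

lemma schwartz_seminorm_ge:
  assumes "f \<in> schwartz" "bs \<in> lists Basis"
  shows "(1 + norm x) ^ k * norm (partial_deriv bs f x) \<le> schwartz_seminorm k bs f"
  unfolding schwartz_seminorm_def
  using assms by (intro cSUP_upper bounded_imp_bdd_above) (auto simp: schwartz_def)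

lemma schwartz_seminorm_leI:
  assumes "\<And>x. (1 + norm x) ^ k * norm (partial_deriv bs f x) \<le> C"
  shows "schwartz_seminorm k bs f \<le> C"
  unfolding schwartz_seminorm_def using assms by (intro cSUP_least) auto

lemma schwartz_seminorm_nonneg:
  "f \<in> schwartz \<Longrightarrow> bs \<in> lists Basis \<Longrightarrow> 0 \<le> schwartz_seminorm k bs f"
  by (rule order_trans[OF _ schwartz_seminorm_ge[where x=0]]) auto

lemma schwartz_decay:
  assumes "f \<in> schwartz"
  shows "(1 + norm x) ^ k * norm (f x) \<le> schwartz_seminorm k [] f"
  using schwartz_seminorm_ge[OF assms, of "[]"] by simp

lemma schwartz_continuous: "f \<in> schwartz \<Longrightarrow> continuous_on A f"
  by (meson continuous_at_imp_continuous_on has_derivative_continuous schwartz_has_derivative)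

lemma schwartz_measurable [measurable_dest]: "f \<in> schwartz \<Longrightarrow> f \<in> borel_measurable borel"
  by (simp add: borel_measurable_continuous_onI schwartz_continuous)

text \<open>Sums of Schwartz functions form a class closed under partial derivatives, so coinduction
  asks only for a first derivative and a decay bound. The other closure properties of the Schwartz
  space follow the same pattern.\<close>

lemma schwartz_add:
  fixes f :: "'a::euclidean_space \<Rightarrow> complex"
  assumes "f \<in> schwartz" "g \<in> schwartz"
  shows "(\<lambda>x. f x + g x) \<in> schwartz"
proof (rule schwartz_coinduct[where A="{\<lambda>x. f x + g x | f g. f \<in> schwartz \<and> g \<in> schwartz}"])
  fix h :: "'a \<Rightarrow> complex" and k
  assume "h \<in> {\<lambda>x. f x + g x | f g. f \<in> schwartz \<and> g \<in> schwartz}"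
  then obtain f g where h: "h = (\<lambda>x. f x + g x)" and fg: "f \<in> schwartz" "g \<in> schwartz" by auto
  show "\<exists>D. (\<forall>x. (h has_derivative D x) (at x)) \<and> (\<forall>b\<in>Basis. (\<lambda>x. D x b) \<in> {\<lambda>x. f x + g x | f g. f \<in> schwartz \<and> g \<in> schwartz})"
    unfolding h
    apply (rule exI conjI allI)+
     apply (rule has_derivative_add schwartz_has_derivative fg)+
    using fg schwartz_partial_deriv[of _ "[b]" for b] apply (fastforce simp: inner_Basis if_distrib if_distribR sum.delta' cong: if_cong)
    done
  show "\<exists>C. \<forall>x. (1 + norm x) ^ k * norm (h x) \<le> C"
    using schwartz_decay[OF fg(1), of _ k] schwartz_decay[OF fg(2), of _ k]
    unfolding h by (intro exI[of _ "schwartz_seminorm k [] f + schwartz_seminorm k [] g"] allI)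
      (smt (verit) distrib_left mult_left_mono norm_ge_zero norm_triangle_ineq zero_le_power)
qed (use assms in auto)

lemma sum_inner_Basis_scaleR [simp]:
  fixes F :: "'a::euclidean_space \<Rightarrow> 'b::real_vector"
  shows "b \<in> Basis \<Longrightarrow> (\<Sum>c\<in>Basis. (b \<bullet> c) *\<^sub>R F c) = F b"
  by (simp add: inner_Basis if_distrib if_distribR sum.delta' cong: if_cong)

lemma schwartz_zero: "(\<lambda>x. 0) \<in> schwartz"
  by (rule schwartz_coinduct[where A="{\<lambda>x. 0}"]) (auto intro!: exI[of _ "\<lambda>x h. 0"])

lemma partial_deriv_single_schwartz: "f \<in> schwartz \<Longrightarrow> b \<in> Basis \<Longrightarrow> partial_deriv [b] f \<in> schwartz"
  by (rule schwartz_partial_deriv) auto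

lemma schwartz_cmult:
  assumes "f \<in> schwartz"
  shows "(\<lambda>x. c * f x) \<in> schwartz"
proof (rule schwartz_coinduct[where A="{\<lambda>x. c * f x | f. f \<in> schwartz}"])
  fix h :: "'a \<Rightarrow> complex" and k
  assume "h \<in> {\<lambda>x. c * f x | f. f \<in> schwartz}"
  then obtain f where h: "h = (\<lambda>x. c * f x)" and f: "f \<in> schwartz" by auto
  show "\<exists>D. (\<forall>x. (h has_derivative D x) (at x)) \<and> (\<forall>b\<in>Basis. (\<lambda>x. D x b) \<in> {\<lambda>x. c * f x | f. f \<in> schwartz})"
    unfolding h
    apply (rule exI conjI allI)+
     apply (rule has_derivative_mult_right schwartz_has_derivative f)+
    using partial_deriv_single_schwartz[OF f] apply auto
    done
  show "\<exists>C. \<forall>x. (1 + norm x) ^ k * norm (h x) \<le> C"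
    unfolding h using schwartz_decay[OF f, of _ k]
    by (intro exI[of _ "norm c * schwartz_seminorm k [] f"] allI) (auto simp: norm_mult mult.left_commute intro!: mult_left_mono)
qed (use assms in auto)

lemma schwartz_cnj:
  assumes "f \<in> schwartz"
  shows "(\<lambda>x. cnj (f x)) \<in> schwartz"
proof (rule schwartz_coinduct[where A="{\<lambda>x. cnj (f x) | f. f \<in> schwartz}"])
  fix h :: "'a \<Rightarrow> complex" and k
  assume "h \<in> {\<lambda>x. cnj (f x) | f. f \<in> schwartz}"
  then obtain f where h: "h = (\<lambda>x. cnj (f x))" and f: "f \<in> schwartz" by auto
  show "\<exists>D. (\<forall>x. (h has_derivative D x) (at x)) \<and> (\<forall>b\<in>Basis. (\<lambda>x. D x b) \<in> {\<lambda>x. cnj (f x) | f. f \<in> schwartz})"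
    unfolding h
    apply (rule exI conjI allI)+
     apply (rule has_derivative_cnj schwartz_has_derivative f)+
    using partial_deriv_single_schwartz[OF f] apply auto
    done
  show "\<exists>C. \<forall>x. (1 + norm x) ^ k * norm (h x) \<le> C"
    unfolding h using schwartz_decay[OF f, of _ k] by auto
qed (use assms in auto)

lemma schwartz_diff:
  assumes "f \<in> schwartz" "g \<in> schwartz"
  shows "(\<lambda>x. f x - g x) \<in> schwartz"
  using schwartz_add[OF assms(1) schwartz_cmult[OF assms(2), of "-1"]] by simp

lemma schwartz_sum:
  assumes "\<And>i. i \<in> I \<Longrightarrow> f i \<in> schwartz"
  shows "(\<lambda>x. \<Sum>i\<in>I. f i x) \<in> schwartz"
  using assms by (induction I rule: infinite_finite_induct) (auto simp: schwartz_zero intro: schwartz_add)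

section \<open>Iterated derivatives and seminorms under linear operations and changes of
  variable\<close>

lemma partial_deriv_add:
  assumes "f \<in> schwartz" "g \<in> schwartz" "bs \<in> lists Basis"
  shows "partial_deriv bs (\<lambda>x. f x + g x) = (\<lambda>x. partial_deriv bs f x + partial_deriv bs g x)"
  using assms(3)
proof (induction bs)
  case (Cons b bs)
  then have S: "partial_deriv bs f \<in> schwartz" "partial_deriv bs g \<in> schwartz"
    using assms schwartz_partial_deriv by auto
  show ?case
    using Cons partial_derivI[OF has_derivative_add[OF schwartz_has_derivative[OF S(1)] schwartz_has_derivative[OF S(2)]], of b]
    by simp
qed auto

lemma partial_deriv_cmult:
  assumes "f \<in> schwartz" "bs \<in> lists Basis"
  shows "partial_deriv bs (\<lambda>x. c * f x) = (\<lambda>x. c * partial_deriv bs f x)"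
  using assms(2)
proof (induction bs)
  case (Cons b bs)
  then have S: "partial_deriv bs f \<in> schwartz"
    using assms schwartz_partial_deriv by auto
  show ?case
    using Cons partial_derivI[OF has_derivative_mult_right[OF schwartz_has_derivative[OF S(1)]], of b c]
    by simp
qed auto

lemma partial_deriv_diff:
  assumes "f \<in> schwartz" "g \<in> schwartz" "bs \<in> lists Basis"
  shows "partial_deriv bs (\<lambda>x. f x - g x) = (\<lambda>x. partial_deriv bs f x - partial_deriv bs g x)"
  using partial_deriv_add[OF assms(1) schwartz_cmult[OF assms(2), of "-1"] assms(3)]
    partial_deriv_cmult[OF assms(2,3), of "-1"] by simp

lemma schwartz_seminorm_triangle:
  assumes "f \<in> schwartz" "g \<in> schwartz" "bs \<in> lists Basis"
  shows "schwartz_seminorm k bs (\<lambda>x. f x + g x) \<le> schwartz_seminorm k bs f + schwartz_seminorm k bs g"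
proof (rule schwartz_seminorm_leI)
  fix x
  have "(1 + norm x) ^ k * norm (partial_deriv bs (\<lambda>x. f x + g x) x)
     \<le> (1 + norm x) ^ k * norm (partial_deriv bs f x) + (1 + norm x) ^ k * norm (partial_deriv bs g x)"
    unfolding partial_deriv_add[OF assms] distrib_left[symmetric]
    by (intro mult_left_mono norm_triangle_ineq) auto
  then show "(1 + norm x) ^ k * norm (partial_deriv bs (\<lambda>x. f x + g x) x) \<le> schwartz_seminorm k bs f + schwartz_seminorm k bs g"
    using schwartz_seminorm_ge[OF assms(1,3), of x k] schwartz_seminorm_ge[OF assms(2,3), of x k] by linarith
qed

lemma partial_deriv_translate:
  assumes "f \<in> schwartz" "bs \<in> lists Basis"
  shows "partial_deriv bs (\<lambda>x. f (x - w)) = (\<lambda>x. partial_deriv bs f (x - w))"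
  using assms(2)
proof (induction bs)
  case (Cons b bs)
  then have S: "partial_deriv bs f \<in> schwartz"
    using assms schwartz_partial_deriv by auto
  have 1: "((\<lambda>x. partial_deriv bs f (x - w)) has_derivative
     (\<lambda>h. \<Sum>b\<in>Basis. (h \<bullet> b) *\<^sub>R partial_deriv [b] (partial_deriv bs f) (x - w))) (at x)" for x
    using has_derivative_compose[OF has_derivative_diff[OF has_derivative_ident has_derivative_const[of w]] schwartz_has_derivative[OF S], of x UNIV]
    by simp
  show ?case using Cons partial_derivI[OF 1] by simp
qed auto

text \<open>Peetre's inequality in its simplest form: a polynomial weight moves from x to x - w at
  the price of the same weight in w. All bounds on translates and convolutions rest on it.\<close>

lemma one_plus_norm_le:
  fixes x w :: "'a::real_normed_vector"
  shows "1 + norm x \<le> (1 + norm (x - w)) * (1 + norm w)"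
proof -
  have "norm x \<le> norm (x - w) + norm w" by (metis diff_add_cancel norm_triangle_ineq)
  moreover have "0 \<le> norm (x - w) * norm w" by simp
  ultimately show ?thesis unfolding distrib_left distrib_right mult_1 mult_1_right by argo
qed

lemma schwartz_translate:
  assumes "f \<in> schwartz"
  shows "(\<lambda>x. f (x - w)) \<in> schwartz"
proof (rule schwartz_coinduct[where A="{\<lambda>x. f (x - w) | f. f \<in> schwartz}"])
  fix h :: "'a \<Rightarrow> complex" and k
  assume "h \<in> {\<lambda>x. f (x - w) | f. f \<in> schwartz}"
  then obtain f where h: "h = (\<lambda>x. f (x - w))" and f: "f \<in> schwartz" by auto
  show "\<exists>D. (\<forall>x. (h has_derivative D x) (at x)) \<and> (\<forall>b\<in>Basis. (\<lambda>x. D x b) \<in> {\<lambda>x. f (x - w) | f. f \<in> schwartz})"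
    unfolding h
    apply (rule exI conjI allI)+
     apply (rule has_derivative_compose[OF has_derivative_diff[OF has_derivative_ident has_derivative_const[of w]] schwartz_has_derivative[OF f]])
    using partial_deriv_single_schwartz[OF f] apply auto
    done
  show "\<exists>C. \<forall>x. (1 + norm x) ^ k * norm (h x) \<le> C"
  proof (intro exI allI)
    fix x
    have "(1 + norm x) ^ k * norm (h x) \<le> ((1 + norm (x - w)) * (1 + norm w)) ^ k * norm (f (x - w))"
      unfolding h by (intro mult_right_mono power_mono one_plus_norm_le) auto
    also have "\<dots> = (1 + norm w) ^ k * ((1 + norm (x - w)) ^ k * norm (f (x - w)))"
      by (simp add: power_mult_distrib)
    also have "\<dots> \<le> (1 + norm w) ^ k * schwartz_seminorm k [] f"
      by (intro mult_left_mono schwartz_decay f) auto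
    finally show "(1 + norm x) ^ k * norm (h x) \<le> (1 + norm w) ^ k * schwartz_seminorm k [] f" .
  qed
qed (use assms in auto)

text \<open>The lower bound on L makes it injective and turns decay in L x into decay in x; along a
  direction in the kernel of L there would be none.\<close>

lemma schwartz_comp_linear:
  fixes L :: "'a::euclidean_space \<Rightarrow> 'b::euclidean_space"
  assumes "f \<in> schwartz" and L: "linear L" and c: "\<And>x. norm x \<le> c * norm (L x)"
  shows "(\<lambda>x. f (L x)) \<in> schwartz"
proof (rule schwartz_coinduct[where A="{\<lambda>x. f (L x) | f. f \<in> schwartz}"])
  have bl: "(L has_derivative L) (at x)" for x
    using L by (simp add: bounded_linear_imp_has_derivative linear_conv_bounded_linear)
  fix h :: "'a \<Rightarrow> complex" and k
  assume "h \<in> {\<lambda>x. f (L x) | f. f \<in> schwartz}"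
  then obtain f where h: "h = (\<lambda>x. f (L x))" and f: "f \<in> schwartz" by auto
  \<comment> \<open>By the chain rule the derivative in direction b is a combination, with the
    constant coefficients \<open>L b \<bullet> c\<close>, of partial derivatives composed with L; it
    stays in the class.\<close>
  have S: "(\<lambda>x. \<Sum>c\<in>Basis. of_real (L b \<bullet> c) * partial_deriv [c] f x) \<in> schwartz" for b
    by (intro schwartz_sum schwartz_cmult partial_deriv_single_schwartz f)
  show "\<exists>D. (\<forall>x. (h has_derivative D x) (at x)) \<and> (\<forall>b\<in>Basis. (\<lambda>x. D x b) \<in> {\<lambda>x. f (L x) | f. f \<in> schwartz})"
    unfolding h
    apply (rule exI conjI allI)+
     apply (rule has_derivative_compose[OF bl schwartz_has_derivative[OF f]])
    using S apply (auto simp: scaleR_conv_of_real)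
    done
  show "\<exists>C. \<forall>x. (1 + norm x) ^ k * norm (h x) \<le> C"
  proof (intro exI allI)
    fix x
    have "1 + norm x \<le> (1 + \<bar>c\<bar>) * (1 + norm (L x))"
      using c[of x] mult_right_mono[OF abs_ge_self[of c], of "norm (L x)"] norm_ge_zero[of "L x"] abs_ge_zero[of c]
      unfolding distrib_left distrib_right mult_1 mult_1_right by argo
    then have "(1 + norm x) ^ k * norm (h x) \<le> ((1 + \<bar>c\<bar>) * (1 + norm (L x))) ^ k * norm (f (L x))"
      unfolding h by (intro mult_right_mono power_mono) auto
    also have "\<dots> = (1 + \<bar>c\<bar>) ^ k * ((1 + norm (L x)) ^ k * norm (f (L x)))"
      by (simp add: power_mult_distrib)
    also have "\<dots> \<le> (1 + \<bar>c\<bar>) ^ k * schwartz_seminorm k [] f"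
      by (intro mult_left_mono schwartz_decay f) auto
    finally show "(1 + norm x) ^ k * norm (h x) \<le> (1 + \<bar>c\<bar>) ^ k * schwartz_seminorm k [] f" .
  qed
qed (use assms in auto)

text \<open>The product rule produces the extra term \<open>l b * f\<close>, so products alone are
  not invariant under differentiation; the class is enlarged to all sums of such a product and a
  Schwartz function.\<close>

lemma schwartz_mult_linear:
  fixes l :: "'a::euclidean_space \<Rightarrow> real"
  assumes "f \<in> schwartz" and l: "linear l"
  shows "(\<lambda>x. of_real (l x) * f x) \<in> schwartz"
proof (rule schwartz_coinduct[where A="{\<lambda>x. of_real (l x) * f x + g x | f g. f \<in> schwartz \<and> g \<in> schwartz}"])
  have bl: "bounded_linear l" using l by (simp add: linear_conv_bounded_linear)
  have dl: "((\<lambda>x. complex_of_real (l x)) has_derivative (\<lambda>h. complex_of_real (l h))) (at x)" for x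
    by (intro bounded_linear_imp_has_derivative bounded_linear_compose[OF bounded_linear_of_real bl, unfolded o_def])
  fix h :: "'a \<Rightarrow> complex" and k
  assume "h \<in> {\<lambda>x. of_real (l x) * f x + g x | f g. f \<in> schwartz \<and> g \<in> schwartz}"
  then obtain f g where h: "h = (\<lambda>x. of_real (l x) * f x + g x)" and f: "f \<in> schwartz" and g: "g \<in> schwartz" by auto
  have S: "(\<lambda>x. of_real (l x) * partial_deriv [b] f x + of_real (l b) * f x + partial_deriv [b] g x)
      \<in> {\<lambda>x. of_real (l x) * f x + g x | f g. f \<in> schwartz \<and> g \<in> schwartz}" if "b \<in> Basis" for b
    apply (rule CollectI, rule exI[of _ "partial_deriv [b] f"], rule exI[of _ "\<lambda>x. of_real (l b) * f x + partial_deriv [b] g x"])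
    using that f g by (auto intro!: schwartz_add schwartz_cmult partial_deriv_single_schwartz simp del: partial_deriv.simps)
  show "\<exists>D. (\<forall>x. (h has_derivative D x) (at x)) \<and> (\<forall>b\<in>Basis. (\<lambda>x. D x b) \<in> {\<lambda>x. of_real (l x) * f x + g x | f g. f \<in> schwartz \<and> g \<in> schwartz})"
    unfolding h
    apply (rule exI conjI allI)+
     apply (rule has_derivative_add has_derivative_mult dl schwartz_has_derivative f g)+
    using S apply (simp del: partial_deriv.simps)
    done
  obtain K where K: "\<And>x. norm (l x) \<le> norm x * K" "K > 0" using bounded_linear.pos_bounded[OF bl] by blast
  show "\<exists>C. \<forall>x. (1 + norm x) ^ k * norm (h x) \<le> C"
  proof (intro exI allI)
    fix x
    have "\<bar>l x\<bar> \<le> K * (1 + norm x)" using K(1)[of x] K(2) by (simp add: distrib_left mult.commute)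
    then have "norm (h x) \<le> K * (1 + norm x) * norm (f x) + norm (g x)"
      unfolding h by (intro order_trans[OF norm_triangle_ineq] add_mono) (auto simp: norm_mult intro!: mult_right_mono)
    then have "(1 + norm x) ^ k * norm (h x) \<le> (1 + norm x) ^ k * (K * (1 + norm x) * norm (f x) + norm (g x))"
      by (intro mult_left_mono) auto
    also have "\<dots> = K * ((1 + norm x) ^ Suc k * norm (f x)) + (1 + norm x) ^ k * norm (g x)"
      by (simp add: algebra_simps)
    also have "\<dots> \<le> K * schwartz_seminorm (Suc k) [] f + schwartz_seminorm k [] g"
      using K(2) by (intro add_mono mult_left_mono schwartz_decay f g) auto
    finally show "(1 + norm x) ^ k * norm (h x) \<le> K * schwartz_seminorm (Suc k) [] f + schwartz_seminorm k [] g" .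
  qed
qed (rule CollectI, rule exI[of _ f], rule exI[of _ "\<lambda>x. 0"], use assms schwartz_zero in auto)

section \<open>Taylor estimates with polynomial weights\<close>

lemma schwartz_difference_bound:
  fixes f :: "'a::euclidean_space \<Rightarrow> complex"
  assumes f: "f \<in> schwartz"
  obtains C where "C \<ge> 0"
    "\<And>x h. norm h \<le> 1 \<Longrightarrow> (1 + norm x) ^ k * norm (f (x + h) - f x) \<le> C * norm h"
proof -
  \<comment> \<open>The mean value inequality is used on the unit ball around x. There
    \<open>1 + norm x \<le> 2 * (1 + norm z)\<close>, and moving the weight from x to z costs the
    factor 2 ^ k.\<close>
  define C where "C = 2 ^ k * (\<Sum>b\<in>Basis. schwartz_seminorm k [b] f)"
  have nn: "(\<Sum>b\<in>Basis. schwartz_seminorm k [b] f) \<ge> 0"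
    by (intro sum_nonneg schwartz_seminorm_nonneg f) auto
  have "(1 + norm x) ^ k * norm (f (x + h) - f x) \<le> C * norm h" if "norm h \<le> 1" for x h :: 'a
  proof -
    let ?f' = "\<lambda>z h. \<Sum>b\<in>Basis. (h \<bullet> b) *\<^sub>R partial_deriv [b] f z"
    have "norm (f (x + h) - f x) \<le> (C / (1 + norm x) ^ k) * norm (x + h - x)"
    proof (rule differentiable_bound[where S="cball x 1" and f'="?f'"])
      show "(f has_derivative ?f' z) (at z within cball x 1)" for z
        using schwartz_has_derivative[OF f] has_derivative_at_withinI by blast
      fix z assume z: "z \<in> cball x 1"
      show "onorm (?f' z) \<le> C / (1 + norm x) ^ k"
      proof (rule onorm_le)
        fix v :: 'a
        have "norm (?f' z v) \<le> (\<Sum>b\<in>Basis. norm v * norm (partial_deriv [b] f z))"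
          by (rule order_trans[OF norm_sum sum_mono]) (auto intro!: mult_right_mono Basis_le_norm)
        also have "\<dots> \<le> (\<Sum>b\<in>Basis. norm v * (2 ^ k * schwartz_seminorm k [b] f / (1 + norm x) ^ k))"
        proof (intro sum_mono mult_left_mono)
          fix b :: 'a assume b: "b \<in> Basis"
          have "norm x \<le> norm z + 1" using z norm_triangle_ineq2[of x z] by (simp add: dist_norm)
          then have "1 + norm x \<le> 2 * (1 + norm z)" using norm_ge_zero[of z] by argo
          then have "(1 + norm x) ^ k \<le> (2 * (1 + norm z)) ^ k" by (intro power_mono) auto
          then have "norm (partial_deriv [b] f z) * (1 + norm x) ^ k \<le> 2 ^ k * ((1 + norm z) ^ k * norm (partial_deriv [b] f z))"
            using mult_left_mono[OF _ norm_ge_zero[of "partial_deriv [b] f z"], of "(1 + norm x) ^ k"]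
            by (metis (no_types, lifting) mult.assoc mult.commute power_mult_distrib)
          also have "\<dots> \<le> 2 ^ k * schwartz_seminorm k [b] f"
            using b by (intro mult_left_mono schwartz_seminorm_ge f) auto
          finally show "norm (partial_deriv [b] f z) \<le> 2 ^ k * schwartz_seminorm k [b] f / (1 + norm x) ^ k"
            by (subst pos_le_divide_eq) (auto intro!: zero_less_power add_pos_nonneg)
        qed auto
        also have "\<dots> = C / (1 + norm x) ^ k * norm v"
          by (simp add: C_def sum_distrib_left sum_distrib_right sum_divide_distrib mult_ac)
        finally show "norm (?f' z v) \<le> C / (1 + norm x) ^ k * norm v" .
      qed
    qed (use that in \<open>auto simp: dist_norm\<close>)
    moreover have "0 < (1 + norm x) ^ k" by (intro zero_less_power add_pos_nonneg) auto
    ultimately show ?thesis by (simp add: field_simps)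
  qed
  moreover have "C \<ge> 0" using nn by (simp add: C_def)
  ultimately show thesis using that by blast
qed

text \<open>Translation is Lipschitz in every weighted sup norm, with a constant growing
  polynomially in the base point w. This growth is what the moments of the other factor of a
  convolution absorb.\<close>

lemma schwartz_translate_bound:
  fixes f :: "'a::euclidean_space \<Rightarrow> complex"
  assumes f: "f \<in> schwartz"
  obtains C where "C \<ge> 0"
    "\<And>x v w. norm (v - w) \<le> 1 \<Longrightarrow> (1 + norm x) ^ k * norm (f (x - v) - f (x - w)) \<le> C * norm (v - w) * (1 + norm w) ^ k"
proof -
  obtain C where C: "C \<ge> 0" "\<And>x h. norm h \<le> 1 \<Longrightarrow> (1 + norm x) ^ k * norm (f (x + h) - f x) \<le> C * norm h"
    using schwartz_difference_bound[OF f] by metis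
  have "(1 + norm x) ^ k * norm (f (x - v) - f (x - w)) \<le> C * norm (v - w) * (1 + norm w) ^ k"
    if "norm (v - w) \<le> 1" for x v w :: 'a
  proof -
    have "(1 + norm x) ^ k * norm (f (x - v) - f (x - w)) \<le> ((1 + norm (x - w)) * (1 + norm w)) ^ k * norm (f (x - v) - f (x - w))"
      by (intro mult_right_mono power_mono one_plus_norm_le) auto
    also have "\<dots> = (1 + norm w) ^ k * ((1 + norm (x - w)) ^ k * norm (f ((x - w) + (w - v)) - f (x - w)))"
      by (simp add: power_mult_distrib)
    also have "\<dots> \<le> (1 + norm w) ^ k * (C * norm (w - v))"
      using that by (intro mult_left_mono C) (auto simp: norm_minus_commute)
    finally show ?thesis by (simp add: norm_minus_commute mult_ac)
  qed
  with C(1) show thesis using that by blast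
qed

text \<open>The remainder is bounded uniformly in x, with a weight, so that it may be integrated.
  This takes the place of dominated convergence when convolutions are differentiated and when
  oscillatory integrals are integrated by parts.\<close>

lemma schwartz_taylor_bound:
  fixes f :: "'a::euclidean_space \<Rightarrow> complex"
  assumes f: "f \<in> schwartz"
  obtains C where "C \<ge> 0"
    "\<And>x h. norm h \<le> 1 \<Longrightarrow>
      (1 + norm x) ^ k * norm (f (x + h) - f x - (\<Sum>b\<in>Basis. (h \<bullet> b) *\<^sub>R partial_deriv [b] f x)) \<le> C * (norm h)\<^sup>2"
proof -
  have "\<forall>b\<in>Basis. \<exists>C\<ge>0. \<forall>x h. norm h \<le> 1 \<longrightarrow> (1 + norm x) ^ k * norm (partial_deriv [b] f (x + h) - partial_deriv [b] f x) \<le> C * norm h"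
    using schwartz_difference_bound[OF partial_deriv_single_schwartz[OF f]] by metis
  then obtain c where c: "\<And>b. b \<in> Basis \<Longrightarrow> c b \<ge> 0"
    "\<And>b x h. b \<in> Basis \<Longrightarrow> norm h \<le> 1 \<Longrightarrow> (1 + norm x) ^ k * norm (partial_deriv [b] f (x + h) - partial_deriv [b] f x) \<le> c b * norm h"
    by metis
  define C where "C = (\<Sum>b\<in>Basis. c b)"
  have "(1 + norm x) ^ k * norm (f (x + h) - f x - (\<Sum>b\<in>Basis. (h \<bullet> b) *\<^sub>R partial_deriv [b] f x)) \<le> C * (norm h)\<^sup>2"
    if h: "norm h \<le> 1" for x h :: 'a
  proof -
    \<comment> \<open>With the linear part at x subtracted, the derivative at z is a difference of
      first partial derivatives, hence of order norm z. The mean value inequality on the ball of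
      radius norm h contributes the second factor norm h.\<close>
    let ?g = "\<lambda>z. f (x + z) - (\<Sum>b\<in>Basis. (z \<bullet> b) *\<^sub>R partial_deriv [b] f x)"
    let ?g' = "\<lambda>z v. \<Sum>b\<in>Basis. (v \<bullet> b) *\<^sub>R (partial_deriv [b] f (x + z) - partial_deriv [b] f x)"
    have pos: "0 < (1 + norm x) ^ k" by (intro zero_less_power add_pos_nonneg) auto
    have "norm (?g h - ?g 0) \<le> (C * norm h / (1 + norm x) ^ k) * norm (h - 0)"
    proof (rule differentiable_bound[where S="cball 0 (norm h)" and f'="?g'"])
      fix z :: 'a assume z: "z \<in> cball 0 (norm h)"
      have "(?g has_derivative (\<lambda>v. (\<Sum>b\<in>Basis. ((0 + v) \<bullet> b) *\<^sub>R partial_deriv [b] f (x + z)) - (\<Sum>b\<in>Basis. (v \<bullet> b) *\<^sub>R partial_deriv [b] f x))) (at z)"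
        by (intro has_derivative_diff has_derivative_sum has_derivative_scaleR_left has_derivative_inner_left has_derivative_ident
            has_derivative_compose[OF has_derivative_add[OF has_derivative_const has_derivative_ident] schwartz_has_derivative[OF f]])
      then show "(?g has_derivative ?g' z) (at z within cball 0 (norm h))"
        unfolding add_0 scaleR_diff_right sum_subtractf by (rule has_derivative_at_withinI)
      show "onorm (?g' z) \<le> C * norm h / (1 + norm x) ^ k"
      proof (rule onorm_le)
        fix v :: 'a
        have "norm (?g' z v) \<le> (\<Sum>b\<in>Basis. norm v * norm (partial_deriv [b] f (x + z) - partial_deriv [b] f x))"
          by (rule order_trans[OF norm_sum sum_mono]) (auto intro!: mult_right_mono Basis_le_norm)
        also have "\<dots> \<le> (\<Sum>b\<in>Basis. norm v * (c b * norm h / (1 + norm x) ^ k))"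
        proof (intro sum_mono mult_left_mono)
          fix b :: 'a assume b: "b \<in> Basis"
          have "(1 + norm x) ^ k * norm (partial_deriv [b] f (x + z) - partial_deriv [b] f x) \<le> c b * norm z"
            using z h by (intro c b) auto
          also have "\<dots> \<le> c b * norm h" using z c(1)[OF b] by (intro mult_left_mono) auto
          finally show "norm (partial_deriv [b] f (x + z) - partial_deriv [b] f x) \<le> c b * norm h / (1 + norm x) ^ k"
            using pos by (simp add: field_simps)
        qed auto
        also have "\<dots> = C * norm h / (1 + norm x) ^ k * norm v"
          by (simp add: C_def sum_distrib_left sum_distrib_right sum_divide_distrib mult_ac)
        finally show "norm (?g' z v) \<le> C * norm h / (1 + norm x) ^ k * norm v" .
      qed
    qed auto
    then show ?thesis using pos by (simp add: field_simps power2_eq_square)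
  qed
  moreover have "C \<ge> 0" using c by (simp add: C_def sum_nonneg)
  ultimately show thesis using that by blast
qed

text \<open>Every basis vector of the product lies in one of the two coordinate spaces, so a partial
  derivative acts on a single factor and the class of tensor products is invariant.\<close>

lemma schwartz_tensor:
  fixes f :: "'a::euclidean_space \<Rightarrow> complex" and g :: "'b::euclidean_space \<Rightarrow> complex"
  assumes "f \<in> schwartz" "g \<in> schwartz"
  shows "tensor f g \<in> schwartz"
proof (rule schwartz_coinduct[where A="{tensor f g | f g. f \<in> schwartz \<and> g \<in> schwartz}"])
  fix h :: "'a \<times> 'b \<Rightarrow> complex" and k
  assume "h \<in> {tensor f g | f g. f \<in> schwartz \<and> g \<in> schwartz}"
  then obtain f g where h: "h = tensor f g" and f: "f \<in> schwartz" and g: "g \<in> schwartz" by auto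
  let ?D = "\<lambda>x h. f (fst x) * (\<Sum>b\<in>Basis. (snd h \<bullet> b) *\<^sub>R partial_deriv [b] g (snd x)) +
       (\<Sum>b\<in>Basis. (fst h \<bullet> b) *\<^sub>R partial_deriv [b] f (fst x)) * g (snd x)"
  have "(h has_derivative ?D x) (at x)" for x
    unfolding h tensor_def case_prod_beta
    by (rule has_derivative_mult[OF has_derivative_compose[OF has_derivative_fst[OF has_derivative_ident] schwartz_has_derivative[OF f]]
        has_derivative_compose[OF has_derivative_snd[OF has_derivative_ident] schwartz_has_derivative[OF g]]])
  moreover have "(\<lambda>x. ?D x b) \<in> {tensor f g | f g. f \<in> schwartz \<and> g \<in> schwartz}" if b: "b \<in> Basis" for b
  proof -
    from b consider c where "c \<in> Basis" "b = (c, 0)" | c where "c \<in> Basis" "b = (0, c)"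
      by (auto simp: Basis_prod_def)
    then show ?thesis
    proof cases
      case 1
      then have "(\<lambda>x. ?D x b) = tensor (partial_deriv [c] f) g" by (auto simp: tensor_def fun_eq_iff)
      then show ?thesis using 1 f g partial_deriv_single_schwartz[of f c] by auto
    next
      case 2
      then have "(\<lambda>x. ?D x b) = tensor f (partial_deriv [c] g)" by (auto simp: tensor_def fun_eq_iff)
      then show ?thesis using 2 f g partial_deriv_single_schwartz[of g c] by auto
    qed
  qed
  ultimately show "\<exists>D. (\<forall>x. (h has_derivative D x) (at x)) \<and> (\<forall>b\<in>Basis. (\<lambda>x. D x b) \<in> {tensor f g | f g. f \<in> schwartz \<and> g \<in> schwartz})"
    by (intro exI[of _ ?D]) auto
  show "\<exists>C. \<forall>x. (1 + norm x) ^ k * norm (h x) \<le> C"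
  proof (intro exI allI)
    fix x :: "'a \<times> 'b"
    have "1 + norm x \<le> 1 + (norm (fst x) + norm (snd x))"
      using norm_Pair_le[of "fst x" "snd x"] by simp
    also have "\<dots> \<le> (1 + norm (fst x)) * (1 + norm (snd x))"
      using mult_nonneg_nonneg[OF norm_ge_zero[of "fst x"] norm_ge_zero[of "snd x"]]
      unfolding distrib_left distrib_right mult_1 mult_1_right by argo
    finally have "(1 + norm x) ^ k * norm (h x) \<le> ((1 + norm (fst x)) * (1 + norm (snd x))) ^ k * norm (h x)"
      by (intro mult_right_mono power_mono) auto
    also have "\<dots> = ((1 + norm (fst x)) ^ k * norm (f (fst x))) * ((1 + norm (snd x)) ^ k * norm (g (snd x)))"
      by (simp add: h tensor_def case_prod_beta norm_mult power_mult_distrib)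
    also have "\<dots> \<le> schwartz_seminorm k [] f * schwartz_seminorm k [] g"
      by (intro mult_mono schwartz_decay f g schwartz_seminorm_nonneg) auto
    finally show "(1 + norm x) ^ k * norm (h x) \<le> schwartz_seminorm k [] f * schwartz_seminorm k [] g" .
  qed
qed (use assms in auto)

section \<open>Gaussians and integrability of Schwartz functions\<close>

text \<open>This follows from \<open>(1 + s / n) ^ n \<le> exp s\<close> with
  \<open>s = t\<^sup>2 / 2\<close>, because \<open>(1 + t)\<^sup>2\<close> is at most
  \<open>4 * n * (1 + s / n)\<close>. The choice n = k + 1 keeps n positive even for k = 0.\<close>

lemma real_power_exp_bound:
  obtains C :: real where "\<And>t. 0 \<le> t \<Longrightarrow> (1 + t) ^ k * exp (- (t\<^sup>2 / 2)) \<le> C"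
proof -
  have "(1 + t) ^ k * exp (- (t\<^sup>2 / 2)) \<le> (4 * Suc k) ^ Suc k" if t: "0 \<le> t" for t :: real
  proof -
    define n where "n = Suc k"
    have n: "real n \<ge> 1" by (simp add: n_def)
    have "(1 + t) ^ k \<le> (1 + t) ^ (2 * n)" using t by (intro power_increasing) (auto simp: n_def)
    also have "\<dots> = ((1 + t)\<^sup>2) ^ n" by (simp add: power_mult)
    also have "\<dots> \<le> (4 * n * (1 + (t\<^sup>2 / 2) / n)) ^ n"
    proof (intro power_mono)
      have "(1 + t)\<^sup>2 + (1 - t)\<^sup>2 = 2 + 2 * t\<^sup>2" by (simp add: power2_eq_square algebra_simps)
      then have "(1 + t)\<^sup>2 \<le> 2 + 2 * t\<^sup>2" using zero_le_power2[of "1 - t"] by linarith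
      also have "\<dots> \<le> 4 * n + 2 * t\<^sup>2" using n by simp
      also have "\<dots> = 4 * n * (1 + (t\<^sup>2 / 2) / n)" using n by (simp add: field_simps)
      finally show "(1 + t)\<^sup>2 \<le> 4 * n * (1 + (t\<^sup>2 / 2) / n)" .
    qed auto
    also have "\<dots> = (4 * n) ^ n * (1 + (t\<^sup>2 / 2) / n) ^ n" by (simp add: power_mult_distrib)
    also have "\<dots> \<le> (4 * n) ^ n * exp (t\<^sup>2 / 2)"
    proof (intro mult_left_mono exp_ge_one_plus_x_over_n_power_n)
      show "- real n \<le> t\<^sup>2 / 2" using n zero_le_power2[of t] by linarith
    qed (auto simp: n_def)
    finally show ?thesis by (simp add: exp_minus field_simps n_def)
  qed
  then show thesis using that by blast
qed

definition gaussian :: "'a::euclidean_space \<Rightarrow> complex" where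
  "gaussian x = of_real (exp (- ((norm x)\<^sup>2 / 2)))"

text \<open>The polynomial multiples of the Gaussian, described by generators, so that closure under
  derivatives and polynomial bounds are both proved by induction.\<close>

inductive_set gaussian_poly :: "('a::euclidean_space \<Rightarrow> complex) set" where
  base: "gaussian \<in> gaussian_poly"
| add: "f \<in> gaussian_poly \<Longrightarrow> g \<in> gaussian_poly \<Longrightarrow> (\<lambda>x. f x + g x) \<in> gaussian_poly"
| cmult: "f \<in> gaussian_poly \<Longrightarrow> (\<lambda>x. c * f x) \<in> gaussian_poly"
| linear: "f \<in> gaussian_poly \<Longrightarrow> (\<lambda>x. of_real (x \<bullet> b) * f x) \<in> gaussian_poly"

lemma gaussian_has_derivative:
  "(gaussian has_derivative (\<lambda>h. - (of_real (x \<bullet> h) * gaussian x))) (at x)"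
proof -
  have "((\<lambda>x. exp (- ((x \<bullet> x) / 2))) has_derivative (\<lambda>h. - (x \<bullet> h) * exp (- ((x \<bullet> x) / 2)))) (at x)"
    by (auto intro!: derivative_eq_intros simp: inner_commute)
  then have "((\<lambda>x. complex_of_real (exp (- ((x \<bullet> x) / 2)))) has_derivative (\<lambda>h. of_real (- (x \<bullet> h) * exp (- ((x \<bullet> x) / 2))))) (at x)"
    by (rule bounded_linear.has_derivative[OF bounded_linear_of_real])
  then show ?thesis unfolding gaussian_def power2_norm_eq_inner by simp
qed

lemma gaussian_schwartz: "(gaussian :: 'a::euclidean_space \<Rightarrow> complex) \<in> schwartz"
proof (rule schwartz_coinduct[where A=gaussian_poly])
  fix f :: "'a \<Rightarrow> complex" assume f: "f \<in> gaussian_poly"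
  then show "\<exists>D. (\<forall>x. (f has_derivative D x) (at x)) \<and> (\<forall>b\<in>Basis. (\<lambda>x. D x b) \<in> gaussian_poly)"
  proof induction
    case base
    have "(\<lambda>x::'a. - (of_real (x \<bullet> b) * gaussian x)) \<in> gaussian_poly" for b
      using gaussian_poly.cmult[OF gaussian_poly.linear[OF gaussian_poly.base], of "-1"] by simp
    then show ?case
      using gaussian_has_derivative by (intro exI[of _ "\<lambda>x h. - (of_real (x \<bullet> h) * gaussian x)"]) blast
  next
    case (add f g)
    then obtain D E where "\<And>x. (f has_derivative D x) (at x)" "\<And>x. (g has_derivative E x) (at x)"
      "\<And>b. b\<in>Basis \<Longrightarrow> (\<lambda>x. D x b) \<in> gaussian_poly" "\<And>b. b\<in>Basis \<Longrightarrow> (\<lambda>x. E x b) \<in> gaussian_poly" by blast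
    then show ?case
      by (intro exI[of _ "\<lambda>x h. D x h + E x h"]) (auto intro: has_derivative_add gaussian_poly.add)
  next
    case (cmult f c)
    then obtain D where "\<And>x. (f has_derivative D x) (at x)"
      "\<And>b. b\<in>Basis \<Longrightarrow> (\<lambda>x. D x b) \<in> gaussian_poly" by blast
    then show ?case
      by (intro exI[of _ "\<lambda>x h. c * D x h"]) (auto intro: has_derivative_mult_right gaussian_poly.cmult)
  next
    case (linear f b)
    then obtain D where D: "\<And>x. (f has_derivative D x) (at x)"
      "\<And>b. b\<in>Basis \<Longrightarrow> (\<lambda>x. D x b) \<in> gaussian_poly" by blast
    have 1: "((\<lambda>x. complex_of_real (x \<bullet> b)) has_derivative (\<lambda>h. complex_of_real (h \<bullet> b))) (at x)" for x
      by (intro bounded_linear.has_derivative[OF bounded_linear_of_real] has_derivative_inner_left has_derivative_ident)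
    show ?case
      using D linear has_derivative_mult[OF 1 D(1)]
      by (intro exI[of _ "\<lambda>x h. of_real (x \<bullet> b) * D x h + of_real (h \<bullet> b) * f x"])
         (auto intro!: gaussian_poly.intros(2,3,4))
  qed
  fix k
  have "\<exists>C k. C \<ge> 0 \<and> (\<forall>x. norm (f x) \<le> C * (1 + norm x) ^ k * norm (gaussian x))"
    using f
  proof induction
    case base
    then show ?case by (intro exI[of _ 1] exI[of _ 0]) auto
  next
    case (add f g)
    then obtain C k D l where *: "C \<ge> 0" "D \<ge> 0" "\<And>x. norm (f x) \<le> C * (1 + norm x) ^ k * norm (gaussian x)"
       "\<And>x. norm (g x) \<le> D * (1 + norm x) ^ l * norm (gaussian x)" by blast
    show ?case
    proof (intro exI[of _ "C + D"] exI[of _ "k + l"] conjI allI)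
      fix x :: 'a
      have "norm (f x + g x) \<le> C * (1 + norm x) ^ k * norm (gaussian x) + D * (1 + norm x) ^ l * norm (gaussian x)"
        using *(3,4)[of x] norm_triangle_ineq[of "f x" "g x"] by linarith
      also have "\<dots> \<le> C * (1 + norm x) ^ (k + l) * norm (gaussian x) + D * (1 + norm x) ^ (k + l) * norm (gaussian x)"
        using *(1,2) by (intro add_mono mult_right_mono mult_left_mono power_increasing) auto
      finally show "norm (f x + g x) \<le> (C + D) * (1 + norm x) ^ (k + l) * norm (gaussian x)"
        by (simp add: distrib_right)
    qed (use * in auto)
  next
    case (cmult f c)
    then obtain C k where *: "C \<ge> 0" "\<And>x. norm (f x) \<le> C * (1 + norm x) ^ k * norm (gaussian x)" by blast
    show ?case
      using * by (intro exI[of _ "norm c * C"] exI[of _ k]) (auto simp: norm_mult mult.assoc intro!: mult_left_mono)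
  next
    case (linear f b)
    then obtain C k where *: "C \<ge> 0" "\<And>x. norm (f x) \<le> C * (1 + norm x) ^ k * norm (gaussian x)" by blast
    show ?case
    proof (intro exI[of _ "C * norm b"] exI[of _ "Suc k"] conjI allI)
      fix x :: 'a
      have "norm (of_real (x \<bullet> b) * f x) \<le> (norm x * norm b) * (C * (1 + norm x) ^ k * norm (gaussian x))"
        unfolding norm_mult using * by (intro mult_mono) (auto intro: Cauchy_Schwarz_ineq2)
      also have "\<dots> \<le> ((1 + norm x) * norm b) * (C * (1 + norm x) ^ k * norm (gaussian x))"
        using * by (intro mult_right_mono) auto
      finally show "norm (of_real (x \<bullet> b) * f x) \<le> C * norm b * (1 + norm x) ^ Suc k * norm (gaussian x)"
        by (simp add: mult_ac)
    qed (use * in auto)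
  qed
  then obtain C l where *: "C \<ge> 0" "\<And>x. norm (f x) \<le> C * (1 + norm x) ^ l * norm (gaussian x)" by blast
  obtain B where B: "\<And>t::real. 0 \<le> t \<Longrightarrow> (1 + t) ^ (k + l) * exp (- (t\<^sup>2 / 2)) \<le> B"
    using real_power_exp_bound[of "k + l"] by metis
  show "\<exists>C. \<forall>x. (1 + norm x) ^ k * norm (f x) \<le> C"
  proof (intro exI allI)
    fix x :: 'a
    have "(1 + norm x) ^ k * norm (f x) \<le> (1 + norm x) ^ k * (C * (1 + norm x) ^ l * norm (gaussian x))"
      by (intro mult_left_mono *) auto
    also have "\<dots> = C * ((1 + norm x) ^ (k + l) * exp (- ((norm x)\<^sup>2 / 2)))" by (simp add: power_add gaussian_def)
    also have "\<dots> \<le> C * B" by (intro mult_left_mono B *) auto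
    finally show "(1 + norm x) ^ k * norm (f x) \<le> C * B" .
  qed
qed (rule gaussian_poly.base)

lemma norm_sq_prod: "(norm (x :: 'a::real_normed_vector \<times> 'b::real_normed_vector))\<^sup>2 = (norm (fst x))\<^sup>2 + (norm (snd x))\<^sup>2"
  by (simp add: norm_prod_def)

lemma gaussian_tensor: "gaussian = tensor gaussian gaussian"
  by (auto simp: fun_eq_iff tensor_def gaussian_def norm_sq_prod exp_add[symmetric] exp_of_real add_divide_distrib simp flip: of_real_mult)

lemma nn_integral_gaussian_real: "(\<integral>\<^sup>+t. ennreal (exp (- (t\<^sup>2 / 2))) \<partial>lborel) = ennreal (sqrt (2 * pi))"
proof -
  have "(\<integral>\<^sup>+t. ennreal (std_normal_density t) \<partial>lborel) = 1"
    using prob_space.emeasure_space_1[OF prob_space_normal_density[of 1 0]] by (simp add: emeasure_density)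
  moreover have "(\<integral>\<^sup>+t. ennreal (exp (- (t\<^sup>2 / 2))) \<partial>lborel) = (\<integral>\<^sup>+t. ennreal (sqrt (2 * pi)) * ennreal (std_normal_density t) \<partial>lborel)"
    by (intro nn_integral_cong) (simp add: std_normal_density_def flip: ennreal_mult')
  ultimately show ?thesis by (simp add: nn_integral_cmult)
qed

lemma gaussian_nn_integral:
  "(\<integral>\<^sup>+x. ennreal (norm (gaussian (x::'a::euclidean_space))) \<partial>lborel) = ennreal (sqrt (2 * pi) ^ DIM('a))"
proof -
  have "ennreal (norm (gaussian x)) = (\<Prod>b\<in>Basis. ennreal (exp (- ((x \<bullet> b)\<^sup>2 / 2))))" for x :: 'a
  proof -
    have "exp (- ((norm x)\<^sup>2 / 2)) = (\<Prod>b\<in>Basis. exp (- ((x \<bullet> b)\<^sup>2 / 2)))"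
      by (subst exp_sum[symmetric]) (auto simp: sum_negf sum_divide_distrib[symmetric] power2_eq_square
         norm_eq_sqrt_inner euclidean_inner[of x x] sum_nonneg)
    then show ?thesis unfolding gaussian_def norm_of_real abs_exp_cancel by (simp add: prod_ennreal)
  qed
  moreover have "(\<integral>\<^sup>+x. (\<Prod>b\<in>Basis. ennreal (exp (- ((x \<bullet> b)\<^sup>2 / 2)))) \<partial>(lborel :: 'a measure))
      = (\<Prod>b\<in>(Basis :: 'a set). \<integral>\<^sup>+t. ennreal (exp (- (t\<^sup>2 / 2))) \<partial>lborel)"
    by (rule nn_integral_lborel_prod) auto
  ultimately show ?thesis
    by (simp add: nn_integral_gaussian_real ennreal_power)
qed

section \<open>Integrability from polynomial decay\<close>

text \<open>The exponent is chosen to compare with a product: each factor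
  \<open>1 + (x \<bullet> b)\<^sup>2\<close> is at most \<open>(1 + norm x)\<^sup>2\<close>. The
  weight is thus dominated by a product of functions of one coordinate, whose integral
  splits.\<close>

lemma weight_integrable:
  "integrable lborel (\<lambda>x::'a::euclidean_space. 1 / (1 + norm x) ^ (2 * DIM('a)))"
proof (rule integrableI_bounded)
  have "integrable lborel (\<lambda>t::real. inverse (1 + t\<^sup>2))"
    using integrable_inverse_1_plus_square by (simp add: set_integrable_def)
  then have fin: "(\<integral>\<^sup>+t. ennreal (inverse (1 + t\<^sup>2)) \<partial>lborel) < \<infinity>"
    by (simp add: integrable_iff_bounded)
  have "(\<integral>\<^sup>+x. ennreal (norm (1 / (1 + norm x) ^ (2 * DIM('a)))) \<partial>(lborel::'a measure))
     \<le> (\<integral>\<^sup>+x. (\<Prod>b\<in>Basis. ennreal (inverse (1 + (x \<bullet> b)\<^sup>2))) \<partial>(lborel::'a measure))"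
  proof (rule nn_integral_mono)
    fix x :: 'a
    have "(\<Prod>b\<in>Basis. 1 + (x \<bullet> b)\<^sup>2) \<le> (\<Prod>b\<in>(Basis::'a set). (1 + norm x)\<^sup>2)"
    proof (rule prod_mono, safe)
      fix b :: 'a assume "b \<in> Basis"
      then have "\<bar>x \<bullet> b\<bar>\<^sup>2 \<le> (norm x)\<^sup>2" by (intro power_mono Basis_le_norm) auto
      moreover have "(1 + norm x)\<^sup>2 = 1 + (norm x)\<^sup>2 + 2 * norm x" by (simp add: power2_eq_square algebra_simps)
      ultimately show "1 + (x \<bullet> b)\<^sup>2 \<le> (1 + norm x)\<^sup>2" by (simp add: add_increasing2)
    qed (auto intro: add_nonneg_nonneg)
    then have "(\<Prod>b\<in>Basis. 1 + (x \<bullet> b)\<^sup>2) \<le> (1 + norm x) ^ (2 * DIM('a))" by (simp add: power_mult)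
    moreover have "0 < (\<Prod>b\<in>Basis. 1 + (x \<bullet> b)\<^sup>2)" by (intro prod_pos) (auto intro: add_pos_nonneg)
    ultimately have "1 / (1 + norm x) ^ (2 * DIM('a)) \<le> 1 / (\<Prod>b\<in>Basis. 1 + (x \<bullet> b)\<^sup>2)"
      by (intro divide_left_mono) (auto intro!: mult_pos_pos zero_less_power add_pos_nonneg)
    then show "ennreal (norm (1 / (1 + norm x) ^ (2 * DIM('a)))) \<le> (\<Prod>b\<in>Basis. ennreal (inverse (1 + (x \<bullet> b)\<^sup>2)))"
      by (subst prod_ennreal) (auto simp: prod_inversef[symmetric] divide_inverse o_def intro!: ennreal_leI)
  qed
  also have "\<dots> = (\<Prod>b\<in>(Basis::'a set). (\<integral>\<^sup>+t. ennreal (inverse (1 + t\<^sup>2)) \<partial>lborel))"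
    by (rule nn_integral_lborel_prod) auto
  also have "\<dots> < \<infinity>" using fin by (simp add: power_less_top_ennreal)
  finally show "(\<integral>\<^sup>+x. ennreal (norm (1 / (1 + norm x) ^ (2 * DIM('a)))) \<partial>(lborel::'a measure)) < \<infinity>" .
qed auto

definition weight_integral :: "'a::euclidean_space itself \<Rightarrow> real" where
  "weight_integral _ = (\<integral>x. 1 / (1 + norm x) ^ (2 * DIM('a)) \<partial>(lborel :: 'a measure))"

lemma weight_integral_nonneg: "0 \<le> weight_integral TYPE('a::euclidean_space)"
  unfolding weight_integral_def by (intro Bochner_Integration.integral_nonneg) auto

lemma weight_bound:
  fixes f :: "'a::euclidean_space \<Rightarrow> complex"
  assumes [measurable]: "f \<in> borel_measurable borel"
    and b: "\<And>x. (1 + norm x) ^ (2 * DIM('a)) * norm (f x) \<le> C"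
  shows "integrable lborel f" "(\<integral>x. norm (f x) \<partial>lborel) \<le> weight_integral TYPE('a) * C"
proof -
  have *: "norm (f x) \<le> C * (1 / (1 + norm x) ^ (2 * DIM('a)))" for x
  proof -
    have "0 < (1 + norm x) ^ (2 * DIM('a))" by (intro zero_less_power add_pos_nonneg) auto
    then show ?thesis using b[of x] by (simp add: field_simps)
  qed
  have w: "integrable lborel (\<lambda>x::'a. C * (1 / (1 + norm x) ^ (2 * DIM('a))))"
    by (intro integrable_mult_right weight_integrable)
  show i: "integrable lborel f"
    by (rule Bochner_Integration.integrable_bound[OF w]) (use order_trans[OF * abs_ge_self] in \<open>auto simp del: abs_divide abs_mult\<close>)
  have "(\<integral>x. norm (f x) \<partial>lborel) \<le> (\<integral>x. C * (1 / (1 + norm x) ^ (2 * DIM('a))) \<partial>(lborel :: 'a measure))"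
    using i by (intro integral_mono w *) auto
  also have "\<dots> = weight_integral TYPE('a) * C" unfolding weight_integral_def by (subst integral_mult_right_zero) simp
  finally show "(\<integral>x. norm (f x) \<partial>lborel) \<le> weight_integral TYPE('a) * C" .
qed

lemma schwartz_integrable: "f \<in> schwartz \<Longrightarrow> integrable lborel f"
  by (rule weight_bound(1)[OF schwartz_measurable schwartz_decay])

lemma schwartz_moment_integrable:
  fixes f :: "'a::euclidean_space \<Rightarrow> complex"
  assumes f: "f \<in> schwartz"
  shows "integrable lborel (\<lambda>x. (1 + norm x) ^ k * norm (f x))"
proof -
  have [measurable]: "f \<in> borel_measurable borel" by (rule schwartz_measurable[OF f])
  have "integrable lborel (\<lambda>x. complex_of_real ((1 + norm x) ^ k * norm (f x)))"
  proof (rule weight_bound(1))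
    show "(1 + norm x) ^ (2 * DIM('a)) * norm (complex_of_real ((1 + norm x) ^ k * norm (f x))) \<le> schwartz_seminorm (2 * DIM('a) + k) [] f" for x
      using schwartz_decay[OF f, of x "2 * DIM('a) + k"]
      by (simp add: norm_mult norm_power power_add mult_ac del: of_real_mult of_real_power of_real_add)
  qed measurable
  then show ?thesis by (simp only: complex_of_real_integrable_eq)
qed

text \<open>The weight is at least 1 and hence at most its own square, which matches the square of
  the seminorm. A single seminorm thereby controls the \<open>L\<^sup>2\<close> norm.\<close>

lemma schwartz_L2_bound:
  fixes f :: "'a::euclidean_space \<Rightarrow> complex"
  assumes f: "f \<in> schwartz"
  shows "integrable lborel (\<lambda>x. (norm (f x))\<^sup>2)"
    "(\<integral>x. (norm (f x))\<^sup>2 \<partial>lborel) \<le> weight_integral TYPE('a) * (schwartz_seminorm (2 * DIM('a)) [] f)\<^sup>2"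
proof -
  have [measurable]: "f \<in> borel_measurable borel" by (rule schwartz_measurable[OF f])
  let ?g = "\<lambda>x. complex_of_real ((norm (f x))\<^sup>2)"
  have *: "(1 + norm x) ^ (2 * DIM('a)) * norm (?g x) \<le> (schwartz_seminorm (2 * DIM('a)) [] f)\<^sup>2" for x
  proof -
    have "(1 + norm x) ^ (2 * DIM('a)) * norm (?g x) \<le> ((1 + norm x) ^ (2 * DIM('a)))\<^sup>2 * (norm (f x))\<^sup>2"
      unfolding norm_of_real abs_power2
      by (intro mult_right_mono self_le_power one_le_power) auto
    also have "\<dots> \<le> (schwartz_seminorm (2 * DIM('a)) [] f)\<^sup>2"
      unfolding power_mult_distrib[symmetric] by (intro power_mono schwartz_decay f) auto
    finally show ?thesis .
  qed
  have m: "?g \<in> borel_measurable borel" by measurable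
  show "integrable lborel (\<lambda>x. (norm (f x))\<^sup>2)"
    using weight_bound(1)[OF m *] by (simp only: complex_of_real_integrable_eq)
  show "(\<integral>x. (norm (f x))\<^sup>2 \<partial>lborel) \<le> weight_integral TYPE('a) * (schwartz_seminorm (2 * DIM('a)) [] f)\<^sup>2"
    using weight_bound(2)[OF m *] by (simp add: norm_power)
qed

section \<open>Convergence in the Schwartz space\<close>

text \<open>Subbasic sets are balls about arbitrary centres, so convergence of the seminorms at l
  has to be carried to another centre by the triangle inequality. It is assumed on V only: on the
  dual space the seminorms are suprema over bounded sets, which behave well only where they are
  finite.\<close>

lemma limitin_seminorm_topology:
  assumes "P \<noteq> {}" "\<And>p. p \<in> P \<Longrightarrow> p (\<lambda>x. 0) = 0" and l: "l \<in> V" and fV: "\<forall>\<^sub>F i in F. f i \<in> V"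
    and lim: "\<And>p. p \<in> P \<Longrightarrow> ((\<lambda>i. p (\<lambda>x. f i x - l x)) \<longlongrightarrow> 0) F"
    and tri: "\<And>p g h k. p \<in> P \<Longrightarrow> g \<in> V \<Longrightarrow> h \<in> V \<Longrightarrow> k \<in> V \<Longrightarrow>
      p (\<lambda>x. g x - k x) \<le> p (\<lambda>x. g x - h x) + p (\<lambda>x. h x - k x)"
  shows "limitin (seminorm_topology V P) f l F"
proof -
  let ?S = "{{g \<in> V. p (\<lambda>x. g x - f x) < e} | f p e. f \<in> V \<and> p \<in> P \<and> (0::real) < e}"
  have "eventually (\<lambda>i. f i \<in> U) F" if "generate_topology_on ?S U" "l \<in> U" for U
    using that
  proof induction
    case (Basis U)
    then obtain g p e where U: "U = {h \<in> V. p (\<lambda>x. h x - g x) < e}" "g \<in> V" "p \<in> P" "0 < e" by auto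
    with \<open>l \<in> U\<close> have "0 < e - p (\<lambda>x. l x - g x)" by simp
    then have "eventually (\<lambda>i. p (\<lambda>x. f i x - l x) < e - p (\<lambda>x. l x - g x)) F"
      by (rule order_tendstoD[OF lim[OF U(3)]])
    then show ?case using fV
    proof eventually_elim
      case (elim i)
      then show ?case using tri[OF U(3) elim(2) l U(2)] by (simp add: U)
    qed
  next
    case (UN K)
    from UN.prems obtain X where X: "X \<in> K" "l \<in> X" by auto
    show ?case using UN.IH[OF X] X(1) by (auto elim!: eventually_mono)
  qed (auto intro: eventually_conj)
  moreover have "l \<in> topspace (topology_generated_by ?S)"
  proof -
    obtain p where p: "p \<in> P" using assms(1) by auto
    have "l \<in> {g \<in> V. p (\<lambda>x. g x - l x) < 1}" using assms(2)[OF p] l by simp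
    moreover have "{g \<in> V. p (\<lambda>x. g x - l x) < 1} \<in> ?S" using l p zero_less_one by blast
    ultimately show ?thesis unfolding topology_generated_by_topspace by blast
  qed
  ultimately show ?thesis
    unfolding limitin_def seminorm_topology_def openin_topology_generated_by_iff by blast
qed

lemma limitin_seminorm_topologyD:
  assumes "limitin (seminorm_topology V P) f l F" "p \<in> P" "l \<in> V" "p (\<lambda>x. 0) = 0" "0 < e"
  shows "\<forall>\<^sub>F i in F. f i \<in> V \<and> p (\<lambda>x. f i x - l x) < e"
proof -
  let ?U = "{g \<in> V. p (\<lambda>x. g x - l x) < e}"
  have "openin (seminorm_topology V P) ?U"
    unfolding seminorm_topology_def using assms by (intro topology_generated_by_Basis) blast
  moreover have "l \<in> ?U" using assms by simp
  ultimately have "\<forall>\<^sub>F i in F. f i \<in> ?U" using assms(1) unfolding limitin_def by blast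
  then show ?thesis by simp
qed

lemma linear_form_onD:
  assumes "linear_form_on V u"
  shows "f \<in> V \<Longrightarrow> g \<in> V \<Longrightarrow> u (\<lambda>x. f x + g x) = u f + u g" "f \<in> V \<Longrightarrow> u (\<lambda>x. c * f x) = c * u f"
  using assms by (auto simp: linear_form_on_def)

lemma schwartz_seminorm_zero: "\<forall>b\<in>set bs. b \<in> Basis \<Longrightarrow> schwartz_seminorm k bs (\<lambda>x. 0) = 0"
  using partial_deriv_cmult[OF schwartz_zero, of bs 0]
  by (simp add: schwartz_seminorm_def in_lists_conv_set)

text \<open>A general filter is allowed: sequences serve approximation, the filters
  \<open>atin\<close> and \<open>nhds\<close> serve continuity.\<close>

definition schwartz_lim :: "'i filter \<Rightarrow> ('i \<Rightarrow> 'a::euclidean_space \<Rightarrow> complex) \<Rightarrow> ('a \<Rightarrow> complex) \<Rightarrow> bool" where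
  "schwartz_lim F f l \<longleftrightarrow> l \<in> schwartz \<and> (\<forall>\<^sub>F i in F. f i \<in> schwartz) \<and>
     (\<forall>k. \<forall>bs\<in>lists Basis. ((\<lambda>i. schwartz_seminorm k bs (\<lambda>x. f i x - l x)) \<longlongrightarrow> 0) F)"

text \<open>Membership of l is listed separately because the topological space of S is identified
  only afterwards, by means of this equivalence and constant sequences.\<close>

lemma schwartz_lim_iff:
  fixes f :: "'i \<Rightarrow> 'a::euclidean_space \<Rightarrow> complex"
  shows "schwartz_lim F f l \<longleftrightarrow> limitin schwartz_topology f l F \<and> l \<in> schwartz"
proof (intro iffI conjI)
  assume *: "schwartz_lim F f l"
  then show "l \<in> schwartz" by (simp add: schwartz_lim_def)
  show "limitin schwartz_topology f l F"
    unfolding schwartz_topology_def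
  proof (rule limitin_seminorm_topology)
    fix p :: "('a \<Rightarrow> complex) \<Rightarrow> real" and g h j :: "'a \<Rightarrow> complex"
    assume "p \<in> {schwartz_seminorm k bs |k bs. bs \<in> lists Basis}" and S: "g \<in> schwartz" "h \<in> schwartz" "j \<in> schwartz"
    then obtain k bs where p: "p = schwartz_seminorm k bs" "bs \<in> lists Basis" by auto
    show "p (\<lambda>x. g x - j x) \<le> p (\<lambda>x. g x - h x) + p (\<lambda>x. h x - j x)"
      using schwartz_seminorm_triangle[OF schwartz_diff[OF S(1,2)] schwartz_diff[OF S(2,3)] p(2), of k] by (simp add: p)
  qed (use * in \<open>auto simp: schwartz_lim_def schwartz_seminorm_zero in_lists_conv_set intro: exI[of _ "[]"]\<close>)
next
  assume *: "limitin schwartz_topology f l F \<and> l \<in> schwartz"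
  have D: "\<forall>\<^sub>F i in F. f i \<in> schwartz \<and> schwartz_seminorm k bs (\<lambda>x. f i x - l x) < e" if "bs \<in> lists Basis" "0 < e" for k bs e
    using * that unfolding schwartz_topology_def
    by (intro limitin_seminorm_topologyD) (auto simp: schwartz_seminorm_zero)
  show "schwartz_lim F f l"
    unfolding schwartz_lim_def
  proof (intro conjI allI ballI)
    show "\<forall>\<^sub>F i in F. f i \<in> schwartz" using D[of "[]" 1 0] by (auto elim: eventually_mono)
    show "((\<lambda>i. schwartz_seminorm k bs (\<lambda>x. f i x - l x)) \<longlongrightarrow> 0) F" if bs: "bs \<in> lists Basis" for k bs
    proof (rule tendstoI)
      fix e :: real assume "0 < e"
      from D[OF bs this, of k] show "\<forall>\<^sub>F i in F. dist (schwartz_seminorm k bs (\<lambda>x. f i x - l x)) 0 < e"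
        by (rule eventually_mono) (use * bs in \<open>auto simp: abs_of_nonneg[OF schwartz_seminorm_nonneg[OF schwartz_diff]]\<close>)
    qed
  qed (use * in auto)
qed

lemma topspace_schwartz_topology [simp]:
  "topspace schwartz_topology = (schwartz :: ('a::euclidean_space \<Rightarrow> complex) set)"
proof
  show "topspace schwartz_topology \<subseteq> (schwartz :: ('a \<Rightarrow> complex) set)"
    by (auto simp: schwartz_topology_def seminorm_topology_def)
  show "(schwartz :: ('a \<Rightarrow> complex) set) \<subseteq> topspace schwartz_topology"
  proof
    fix f :: "'a \<Rightarrow> complex" assume f: "f \<in> schwartz"
    then have "schwartz_lim sequentially (\<lambda>i. f) f" by (auto simp: schwartz_lim_def schwartz_seminorm_zero)
    then show "f \<in> topspace schwartz_topology" by (simp add: schwartz_lim_iff limitin_def)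
  qed
qed

text \<open>Continuity of the identity, phrased so that continuity of another map at f becomes an
  estimate by seminorms along the punctured neighbourhoods of f.\<close>

lemma schwartz_lim_atin: "f \<in> schwartz \<Longrightarrow> schwartz_lim (atin schwartz_topology f) (\<lambda>g. g) f"
  for f :: "'a::euclidean_space \<Rightarrow> complex"
  unfolding schwartz_lim_iff
  using continuous_map_atin[of "schwartz_topology :: ('a \<Rightarrow> complex) topology" schwartz_topology "\<lambda>x. x"] by simp

lemma schwartz_continuous_mapD:
  assumes "continuous_map schwartz_topology schwartz_topology \<Phi>" "schwartz_lim F f l"
  shows "schwartz_lim F (\<lambda>i. \<Phi> (f i)) (\<Phi> l)"
proof -
  have l: "l \<in> schwartz" "limitin schwartz_topology f l F" using assms(2) by (auto simp: schwartz_lim_iff)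
  have "limitin schwartz_topology (\<Phi> \<circ> f) (\<Phi> l) F" using continuous_map_limit[OF assms(1) l(2)] .
  moreover have "\<Phi> l \<in> schwartz" using assms(1) l(1) by (auto simp: continuous_map_def Pi_iff)
  ultimately show ?thesis by (simp add: schwartz_lim_iff o_def)
qed

lemma schwartz_lim_uniform:
  assumes "schwartz_lim F f l" "0 < e"
  shows "\<forall>\<^sub>F i in F. f i \<in> schwartz \<and> (\<forall>x. norm (f i x - l x) < e)"
proof -
  have "((\<lambda>i. schwartz_seminorm 0 [] (\<lambda>x. f i x - l x)) \<longlongrightarrow> 0) F" "\<forall>\<^sub>F i in F. f i \<in> schwartz" and l: "l \<in> schwartz"
    using assms(1) by (auto simp: schwartz_lim_def)
  from order_tendstoD(2)[OF this(1) assms(2)] this(2) show ?thesis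
  proof eventually_elim
    case (elim i)
    show ?case using schwartz_decay[OF schwartz_diff[OF elim(2) l], of _ 0] elim by (auto intro: order_le_less_trans)
  qed
qed

section \<open>Tempered distributions\<close>

lemma temperedD:
  assumes "u \<in> tempered"
  shows "f \<in> schwartz \<Longrightarrow> g \<in> schwartz \<Longrightarrow> u (\<lambda>x. f x + g x) = u f + u g"
    "f \<in> schwartz \<Longrightarrow> u (\<lambda>x. c * f x) = c * u f"
    "schwartz_lim F h l \<Longrightarrow> ((\<lambda>i. u (h i)) \<longlongrightarrow> u l) F"
proof -
  show "f \<in> schwartz \<Longrightarrow> g \<in> schwartz \<Longrightarrow> u (\<lambda>x. f x + g x) = u f + u g"
    "f \<in> schwartz \<Longrightarrow> u (\<lambda>x. c * f x) = c * u f"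
    using assms by (auto simp: tempered_def linear_form_on_def)
  assume "schwartz_lim F h l"
  then have "limitin euclidean (u \<circ> h) (u l) F"
    using assms by (intro continuous_map_limit[of schwartz_topology]) (auto simp: schwartz_lim_iff tempered_def)
  then show "((\<lambda>i. u (h i)) \<longlongrightarrow> u l) F" by (simp add: o_def)
qed

text \<open>A bound by one seminorm free of derivatives is enough for the functionals that occur
  here, namely integrals against a square integrable function or against a character.\<close>

lemma temperedI:
  fixes u :: "('a::euclidean_space \<Rightarrow> complex) \<Rightarrow> complex"
  assumes "u \<in> extensional schwartz" "linear_form_on schwartz u"
    and b: "\<And>f. f \<in> schwartz \<Longrightarrow> norm (u f) \<le> C * schwartz_seminorm k [] f"
  shows "u \<in> tempered"
proof -
  have "continuous_map schwartz_topology euclidean u"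
    unfolding continuous_map_atin
  proof safe
    fix f :: "'a \<Rightarrow> complex" assume "f \<in> topspace schwartz_topology"
    then have f: "f \<in> schwartz" by simp
    have lim: "schwartz_lim (atin schwartz_topology f) (\<lambda>g. g) f" by (rule schwartz_lim_atin[OF f])
    have "((\<lambda>g. u g - u f) \<longlongrightarrow> 0) (atin schwartz_topology f)"
    proof (rule Lim_null_comparison)
      show "((\<lambda>g. C * schwartz_seminorm k [] (\<lambda>x. g x - f x)) \<longlongrightarrow> 0) (atin schwartz_topology f)"
        using lim by (intro tendsto_mult_right_zero) (auto simp: schwartz_lim_def)
      have "\<forall>\<^sub>F g in atin schwartz_topology f. g \<in> schwartz" using lim by (simp add: schwartz_lim_def)
      then show "\<forall>\<^sub>F g in atin schwartz_topology f. norm (u g - u f) \<le> C * schwartz_seminorm k [] (\<lambda>x. g x - f x)"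
      proof eventually_elim
        case (elim g)
        have "u (\<lambda>x. g x + - 1 * f x) = u g + u (\<lambda>x. - 1 * f x)"
          by (rule linear_form_onD(1)[OF assms(2) elim schwartz_cmult[OF f]])
        moreover have "u (\<lambda>x. - 1 * f x) = - 1 * u f"
          by (rule linear_form_onD(2)[OF assms(2) f])
        ultimately have "u (\<lambda>x. g x - f x) = u g - u f" by simp
        then show ?case using b[OF schwartz_diff[OF elim f]] by simp
      qed
    qed
    then show "limitin euclidean u (u f) (atin schwartz_topology f)"
      by (simp add: LIM_zero_iff)
  qed
  with assms show ?thesis by (simp add: tempered_def)
qed

text \<open>If u were unbounded on B, some elements \<phi> n of B would satisfy norm (u (\<phi> n))
  > n. Since B is bounded, \<phi> n / n tends to 0 in S, whereas its values under u stay above 1.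
  The seminorms of the strong dual are real suprema, and this is what makes them meaningful.\<close>

lemma tempered_bounded:
  fixes u :: "('a::euclidean_space \<Rightarrow> complex) \<Rightarrow> complex"
  assumes u: "u \<in> tempered" and B: "schwartz_bounded B"
  shows "bdd_above ((\<lambda>\<phi>. norm (u \<phi>)) ` B)"
proof (rule ccontr)
  assume "\<not> ?thesis"
  then have "\<forall>n::nat. \<exists>\<phi>\<in>B. norm (u \<phi>) > real n" by (auto simp: bdd_above_def not_le)
  then obtain \<phi> where \<phi>: "\<And>n::nat. \<phi> n \<in> B" "\<And>n. norm (u (\<phi> n)) > real n" by metis
  have S: "\<phi> n \<in> schwartz" for n using B \<phi>(1) by (auto simp: schwartz_bounded_def)
  \<comment> \<open>For n = 0 the factor is 0 by the convention for division; only large n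
    count.\<close>
  have "schwartz_lim sequentially (\<lambda>n x. (1 / of_nat n) * \<phi> n x) (\<lambda>x. 0)"
    unfolding schwartz_lim_def
  proof (intro conjI always_eventually allI ballI schwartz_zero schwartz_cmult S)
    fix k :: nat and bs :: "'a list" assume bs: "bs \<in> lists Basis"
    with B have "bdd_above (schwartz_seminorm k bs ` B)" unfolding schwartz_bounded_def by metis
    then obtain M where M: "\<And>f. f \<in> B \<Longrightarrow> schwartz_seminorm k bs f \<le> M" by (auto simp: bdd_above_def)
    show "(\<lambda>n. schwartz_seminorm k bs (\<lambda>x. (1 / of_nat n) * \<phi> n x - 0)) \<longlonglongrightarrow> 0"
    proof (rule Lim_null_comparison)
      show "(\<lambda>n. 1 / real n * M) \<longlonglongrightarrow> 0" by (intro tendsto_mult_left_zero lim_1_over_n)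
      show "\<forall>\<^sub>F n in sequentially. norm (schwartz_seminorm k bs (\<lambda>x. (1 / of_nat n) * \<phi> n x - 0)) \<le> 1 / real n * M"
      proof (intro always_eventually allI)
        fix n
        have "schwartz_seminorm k bs (\<lambda>x. (1 / of_nat n) * \<phi> n x) \<le> 1 / real n * M"
        proof (rule schwartz_seminorm_leI)
          fix x
          have "(1 + norm x) ^ k * norm (partial_deriv bs (\<phi> n) x) \<le> M"
            using schwartz_seminorm_ge[OF S bs, of x k n] M[OF \<phi>(1)] order_trans by blast
          then have "1 / real n * ((1 + norm x) ^ k * norm (partial_deriv bs (\<phi> n) x)) \<le> 1 / real n * M"
            by (intro mult_left_mono) auto
          then show "(1 + norm x) ^ k * norm (partial_deriv bs (\<lambda>x. (1 / of_nat n) * \<phi> n x) x) \<le> 1 / real n * M"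
            unfolding partial_deriv_cmult[OF S bs] by (simp add: norm_mult norm_divide)
        qed
        moreover have "0 \<le> schwartz_seminorm k bs (\<lambda>x. (1 / of_nat n) * \<phi> n x)"
          by (intro schwartz_seminorm_nonneg schwartz_cmult S bs)
        ultimately show "norm (schwartz_seminorm k bs (\<lambda>x. (1 / of_nat n) * \<phi> n x - 0)) \<le> 1 / real n * M"
          by simp
      qed
    qed
  qed
  from temperedD(3)[OF u this] have "(\<lambda>n. 1 / of_nat n * u (\<phi> n)) \<longlonglongrightarrow> u (\<lambda>x. 0)"
    by (simp only: temperedD(2)[OF u S])
  moreover have "u (\<lambda>x. 0) = 0" using temperedD(2)[OF u schwartz_zero, of 0] by simp
  ultimately have "\<forall>\<^sub>F n in sequentially. norm (1 / of_nat n * u (\<phi> n)) < 1"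
    by (intro order_tendstoD(2)[OF tendsto_norm_zero]) auto
  then have "\<forall>\<^sub>F n in sequentially. norm (1 / of_nat n * u (\<phi> n)) < 1 \<and> n > 0"
    using eventually_gt_at_top[of "0::nat"] by (rule eventually_conj)
  then obtain n :: nat where n: "norm (1 / of_nat n * u (\<phi> n)) < 1" "n > 0"
    using eventually_happens' sequentially_bot by blast
  then have "norm (u (\<phi> n)) < real n" by (simp add: norm_mult norm_divide field_simps)
  with \<phi>(2)[of n] show False by simp
qed

section \<open>Convolution and density of tensor products\<close>

lemma has_derivative_quadratic:
  fixes f :: "'a::real_normed_vector \<Rightarrow> 'b::real_normed_vector"
  assumes "bounded_linear D" and b: "\<And>h. norm h \<le> 1 \<Longrightarrow> norm (f (x + h) - f x - D h) \<le> C * (norm h)\<^sup>2"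
  shows "(f has_derivative D) (at x)"
  unfolding has_derivative_at
proof (intro conjI assms(1))
  show "(\<lambda>h. norm (f (x + h) - f x - D h) / norm h) \<midarrow>0\<rightarrow> 0"
  proof (rule Lim_null_comparison)
    show "((\<lambda>h::'a. C * norm h) \<longlongrightarrow> 0) (at 0)"
      by (intro tendsto_mult_right_zero tendsto_norm_zero tendsto_ident_at)
    have "\<forall>\<^sub>F h::'a in at 0. norm h < 1" "\<forall>\<^sub>F h::'a in at 0. h \<noteq> 0"
      by (auto simp: eventually_at dist_norm intro!: exI[of _ "1::real"])
    then show "\<forall>\<^sub>F h in at 0. norm (norm (f (x + h) - f x - D h) / norm h) \<le> C * norm h"
    proof eventually_elim
      case (elim h)
      then show ?case using b[of h] by (simp add: field_simps power2_eq_square)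
    qed
  qed
qed

section \<open>Convolution with a Schwartz function\<close>

text \<open>Integrability against all polynomial weights is what makes a convolution with a Schwartz
  function a Schwartz function. It also holds for continuous functions of bounded support, which the
  density of S in \<open>L\<^sup>2\<close> requires.\<close>

definition moments_finite :: "('a::euclidean_space \<Rightarrow> complex) \<Rightarrow> bool" where
  "moments_finite F \<longleftrightarrow> F \<in> borel_measurable borel \<and>
     (\<forall>k::nat. integrable lborel (\<lambda>w. (1 + norm w) ^ k * norm (F w)))"

definition moment :: "nat \<Rightarrow> ('a::euclidean_space \<Rightarrow> complex) \<Rightarrow> real" where
  "moment k F = (\<integral>w. (1 + norm w) ^ k * norm (F w) \<partial>lborel)"

lemma schwartz_moments_finite: "f \<in> schwartz \<Longrightarrow> moments_finite f"
  by (simp add: moments_finite_def schwartz_moment_integrable schwartz_measurable)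

text \<open>Convolutions, their Riemann sums and oscillatory integrals all integrate F against a
  function of polynomial growth; the estimates for them are instances of this one.\<close>

lemma moments_finite_bounded_integrable:
  fixes h :: "'a::euclidean_space \<Rightarrow> complex"
  assumes F: "moments_finite F" and [measurable]: "h \<in> borel_measurable borel"
    and b: "\<And>w. norm (h w) \<le> C * (1 + norm w) ^ k"
  shows "integrable lborel (\<lambda>w. F w * h w)" "norm (\<integral>w. F w * h w \<partial>lborel) \<le> C * moment k F"
proof -
  have [measurable]: "F \<in> borel_measurable borel" and i: "integrable lborel (\<lambda>w. (1 + norm w) ^ k * norm (F w))"
    using F by (auto simp: moments_finite_def)
  have bd: "norm (F w * h w) \<le> C * ((1 + norm w) ^ k * norm (F w))" for w
    using mult_left_mono[OF b[of w] norm_ge_zero[of "F w"]] by (simp add: norm_mult mult_ac)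
  have i': "integrable lborel (\<lambda>w. C * ((1 + norm w) ^ k * norm (F w)))" by (rule integrable_mult_right[OF i])
  show I: "integrable lborel (\<lambda>w. F w * h w)"
  proof (rule Bochner_Integration.integrable_bound[OF i'])
    show "AE w in lborel. norm (F w * h w) \<le> norm (C * ((1 + norm w) ^ k * norm (F w)))"
      using order_trans[OF bd abs_ge_self] unfolding real_norm_def by blast
  qed measurable
  have "norm (\<integral>w. F w * h w \<partial>lborel) \<le> (\<integral>w. C * ((1 + norm w) ^ k * norm (F w)) \<partial>lborel)"
    by (rule order_trans[OF integral_norm_bound integral_mono[OF integrable_norm[OF I] i' bd]])
  then show "norm (\<integral>w. F w * h w \<partial>lborel) \<le> C * moment k F"
    unfolding moment_def by (subst (asm) integral_mult_right_zero)
qed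

definition conv :: "('a::euclidean_space \<Rightarrow> complex) \<Rightarrow> ('a \<Rightarrow> complex) \<Rightarrow> 'a \<Rightarrow> complex" where
  "conv F g x = (\<integral>w. F w * g (x - w) \<partial>lborel)"

lemma conv_integrable:
  assumes F: "moments_finite F" and g: "g \<in> schwartz"
  shows "integrable lborel (\<lambda>w. F w * g (x - w))"
proof (rule moments_finite_bounded_integrable(1)[OF F, where k=0 and C="schwartz_seminorm 0 [] g"])
  have [measurable]: "g \<in> borel_measurable borel" by (rule schwartz_measurable[OF g])
  show "(\<lambda>w. g (x - w)) \<in> borel_measurable borel" by measurable
  show "norm (g (x - w)) \<le> schwartz_seminorm 0 [] g * (1 + norm w) ^ 0" for w
    using schwartz_decay[OF g, of _ 0] by simp
qed

lemma conv_decay: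
  assumes F: "moments_finite F" and g: "g \<in> schwartz"
  shows "(1 + norm x) ^ k * norm (conv F g x) \<le> schwartz_seminorm k [] g * moment k F"
proof -
  have [measurable]: "g \<in> borel_measurable borel" by (rule schwartz_measurable[OF g])
  have "norm (\<integral>w. F w * (of_real ((1 + norm x) ^ k) * g (x - w)) \<partial>lborel) \<le> schwartz_seminorm k [] g * moment k F"
  proof (rule moments_finite_bounded_integrable(2)[OF F])
    fix w
    have "norm (of_real ((1 + norm x) ^ k) * g (x - w)) = (1 + norm x) ^ k * norm (g (x - w))"
      unfolding norm_mult norm_of_real by simp
    also have "\<dots> \<le> ((1 + norm (x - w)) * (1 + norm w)) ^ k * norm (g (x - w))"
      by (intro mult_right_mono power_mono one_plus_norm_le) auto
    also have "\<dots> = ((1 + norm (x - w)) ^ k * norm (g (x - w))) * (1 + norm w) ^ k"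
      by (simp add: power_mult_distrib)
    also have "\<dots> \<le> schwartz_seminorm k [] g * (1 + norm w) ^ k"
      by (intro mult_right_mono schwartz_decay g) auto
    finally show "norm (of_real ((1 + norm x) ^ k) * g (x - w)) \<le> schwartz_seminorm k [] g * (1 + norm w) ^ k" .
  qed measurable
  also have "(\<integral>w. F w * (of_real ((1 + norm x) ^ k) * g (x - w)) \<partial>lborel) = of_real ((1 + norm x) ^ k) * conv F g x"
    unfolding conv_def by (subst integral_mult_right_zero[symmetric]) (simp only: mult_ac)
  finally show ?thesis unfolding norm_mult norm_of_real by simp
qed

text \<open>The derivative falls on g alone. The Taylor bound is uniform in the base point, so
  integrating it against F leaves an error of order \<open>(norm h)\<^sup>2\<close>.\<close>

lemma conv_has_derivative:
  fixes F :: "'a::euclidean_space \<Rightarrow> complex"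
  assumes F: "moments_finite F" and g: "g \<in> schwartz"
  shows "(conv F g has_derivative (\<lambda>h. \<Sum>b\<in>Basis. (h \<bullet> b) *\<^sub>R conv F (partial_deriv [b] g) x)) (at x)"
proof -
  obtain C where C: "C \<ge> 0" "\<And>x h. norm h \<le> 1 \<Longrightarrow>
      (1 + norm x) ^ 0 * norm (g (x + h) - g x - (\<Sum>b\<in>Basis. (h \<bullet> b) *\<^sub>R partial_deriv [b] g x)) \<le> C * (norm h)\<^sup>2"
    by (rule schwartz_taylor_bound[OF g, of 0]) (rule that)
  have [measurable]: "g \<in> borel_measurable borel" by (rule schwartz_measurable[OF g])
  have m [measurable]: "partial_deriv [b] g \<in> borel_measurable borel" if "b \<in> Basis" for b
    by (rule schwartz_measurable[OF partial_deriv_single_schwartz[OF g that]])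
  show ?thesis
  proof (rule has_derivative_quadratic)
    show "bounded_linear (\<lambda>h. \<Sum>b\<in>Basis. (h \<bullet> b) *\<^sub>R conv F (partial_deriv [b] g) x)"
      by (intro bounded_linear_sum bounded_linear_scaleR_const bounded_linear_inner_left)
    fix h :: 'a assume h: "norm h \<le> 1"
    have "conv F g (x + h) - conv F g x - (\<Sum>b\<in>Basis. (h \<bullet> b) *\<^sub>R conv F (partial_deriv [b] g) x)
       = (\<integral>w. F w * (g (x - w + h) - g (x - w) - (\<Sum>b\<in>Basis. (h \<bullet> b) *\<^sub>R partial_deriv [b] g (x - w))) \<partial>lborel)"
    proof -
      have i1: "integrable lborel (\<lambda>w. F w * g (x - w + h))"
        using conv_integrable[OF F g, of "x + h"] by (simp add: algebra_simps)
      note i2 = conv_integrable[OF F g, of x]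
      have i3: "integrable lborel (\<lambda>w. (h \<bullet> b) *\<^sub>R (F w * partial_deriv [b] g (x - w)))" if "b \<in> Basis" for b
        by (intro integrable_scaleR_right conv_integrable F partial_deriv_single_schwartz g that)
      have "(\<integral>w. F w * (g (x - w + h) - g (x - w) - (\<Sum>b\<in>Basis. (h \<bullet> b) *\<^sub>R partial_deriv [b] g (x - w))) \<partial>lborel)
        = (\<integral>w. F w * g (x - w + h) - F w * g (x - w) - (\<Sum>b\<in>Basis. (h \<bullet> b) *\<^sub>R (F w * partial_deriv [b] g (x - w))) \<partial>lborel)"
        by (simp only: right_diff_distrib sum_distrib_left mult_scaleR_right)
      also have "\<dots> = (\<integral>w. F w * g (x - w + h) \<partial>lborel) - (\<integral>w. F w * g (x - w) \<partial>lborel)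
          - (\<integral>w. (\<Sum>b\<in>Basis. (h \<bullet> b) *\<^sub>R (F w * partial_deriv [b] g (x - w))) \<partial>lborel)"
        by (simp only: Bochner_Integration.integral_diff[OF Bochner_Integration.integrable_diff[OF i1 i2] Bochner_Integration.integrable_sum[OF i3]]
            Bochner_Integration.integral_diff[OF i1 i2])
      also have "(\<integral>w. (\<Sum>b\<in>Basis. (h \<bullet> b) *\<^sub>R (F w * partial_deriv [b] g (x - w))) \<partial>lborel)
          = (\<Sum>b\<in>Basis. (h \<bullet> b) *\<^sub>R conv F (partial_deriv [b] g) x)"
        unfolding conv_def by (simp only: Bochner_Integration.integral_sum[OF i3] integral_scaleR_right)
      finally show ?thesis by (simp add: conv_def algebra_simps)
    qed
    also have "norm \<dots> \<le> (C * (norm h)\<^sup>2) * moment 0 F"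
    proof (rule moments_finite_bounded_integrable(2)[OF F])
      show "(\<lambda>w. g (x - w + h) - g (x - w) - (\<Sum>b\<in>Basis. (h \<bullet> b) *\<^sub>R partial_deriv [b] g (x - w))) \<in> borel_measurable borel"
        by measurable
    qed (use C(2)[OF h] in \<open>simp del: partial_deriv.simps\<close>)
    finally show "norm (conv F g (x + h) - conv F g x - (\<Sum>b\<in>Basis. (h \<bullet> b) *\<^sub>R conv F (partial_deriv [b] g) x)) \<le> C * moment 0 F * (norm h)\<^sup>2"
      by (simp add: mult_ac)
  qed
qed

lemma conv_schwartz:
  fixes F :: "'a::euclidean_space \<Rightarrow> complex"
  assumes F: "moments_finite F" and g: "g \<in> schwartz"
  shows "conv F g \<in> schwartz"
proof (rule schwartz_coinduct[where A="{conv F g | g. g \<in> schwartz}"])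
  fix f :: "'a \<Rightarrow> complex" and k assume "f \<in> {conv F g | g. g \<in> schwartz}"
  then obtain g where f: "f = conv F g" and g: "g \<in> schwartz" by auto
  show "\<exists>D. (\<forall>x. (f has_derivative D x) (at x)) \<and> (\<forall>b\<in>Basis. (\<lambda>x. D x b) \<in> {conv F g | g. g \<in> schwartz})"
    using conv_has_derivative[OF F g] partial_deriv_single_schwartz[OF g]
    by (intro exI[of _ "\<lambda>x h. \<Sum>b\<in>Basis. (h \<bullet> b) *\<^sub>R conv F (partial_deriv [b] g) x"])
       (auto simp: f simp del: partial_deriv.simps)
  show "\<exists>C. \<forall>x. (1 + norm x) ^ k * norm (f x) \<le> C"
    using conv_decay[OF F g] f by blast
qed (use g in auto)

lemma partial_deriv_conv:
  assumes F: "moments_finite F" and g: "g \<in> schwartz" and bs: "bs \<in> lists Basis"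
  shows "partial_deriv bs (conv F g) = conv F (partial_deriv bs g)"
  using bs
proof (induction bs)
  case (Cons b bs)
  then have S: "partial_deriv bs g \<in> schwartz" and b: "b \<in> Basis" using schwartz_partial_deriv[OF g] by auto
  have "partial_deriv [b] (conv F (partial_deriv bs g)) = conv F (partial_deriv [b] (partial_deriv bs g))"
    using partial_derivI[OF conv_has_derivative[OF F S], of b] b by (simp del: partial_deriv.simps)
  then show ?case using Cons by simp
qed auto

section \<open>Riemann sums of translates\<close>

text \<open>Each coordinate is rounded down to a multiple of 1 / ((n + 1) DIM). The factor DIM makes
  the sum of all coordinate errors at most 1 / (n + 1).\<close>

definition grid :: "nat \<Rightarrow> 'a::euclidean_space \<Rightarrow> 'a" where
  "grid n w = (\<Sum>b\<in>Basis. (of_int \<lfloor>(w \<bullet> b) * (real (Suc n) * DIM('a))\<rfloor> / (real (Suc n) * DIM('a))) *\<^sub>R b)"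

lemma grid_measurable [measurable]: "grid n \<in> borel_measurable borel"
  unfolding grid_def[abs_def] by measurable

lemma grid_dist: "norm (grid n w - w) \<le> 1 / real (Suc n)"
  for w :: "'a::euclidean_space"
proof -
  define N where "N = real (Suc n) * DIM('a)"
  have N: "N > 0" by (simp add: N_def)
  have "norm (grid n w - w) = norm (\<Sum>b\<in>Basis. (of_int \<lfloor>(w \<bullet> b) * N\<rfloor> / N - w \<bullet> b) *\<^sub>R b)"
    unfolding grid_def N_def[symmetric]
    by (subst (3) euclidean_representation[symmetric]) (simp add: scaleR_diff_left sum_subtractf del: euclidean_representation)
  also have "\<dots> \<le> (\<Sum>b\<in>(Basis::'a set). 1 / N)"
  proof (rule order_trans[OF norm_sum sum_mono])
    fix b :: 'a assume b: "b \<in> Basis"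
    have "of_int \<lfloor>(w \<bullet> b) * N\<rfloor> / N - w \<bullet> b = (of_int \<lfloor>(w \<bullet> b) * N\<rfloor> - (w \<bullet> b) * N) / N"
      using N by (simp add: field_simps)
    also have "\<bar>\<dots>\<bar> \<le> 1 / N"
    proof -
      have "\<bar>of_int \<lfloor>(w \<bullet> b) * N\<rfloor> - (w \<bullet> b) * N\<bar> \<le> 1" by linarith
      then show ?thesis unfolding abs_divide using N by (simp add: divide_right_mono)
    qed
    finally show "norm ((of_int \<lfloor>(w \<bullet> b) * N\<rfloor> / N - w \<bullet> b) *\<^sub>R b) \<le> 1 / N" using b by simp
  qed
  also have "\<dots> = 1 / real (Suc n)" by (simp add: N_def)
  finally show ?thesis .
qed

lemma finite_grid_cball: "finite (grid n ` cball (0::'a::euclidean_space) r)"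
proof -
  define N where "N = real (Suc n) * DIM('a)"
  have N: "N > 0" by (simp add: N_def)
  let ?K = "(Basis :: 'a set) \<rightarrow>\<^sub>E {\<lfloor>- r * N\<rfloor>..\<lfloor>r * N\<rfloor>}"
  have "grid n ` cball (0::'a) r \<subseteq> (\<lambda>k. \<Sum>b\<in>Basis. (of_int (k b) / N) *\<^sub>R b) ` ?K"
  proof
    fix p assume "p \<in> grid n ` cball (0::'a) r"
    then obtain w :: 'a where w: "norm w \<le> r" "p = grid n w" by auto
    have "\<bar>w \<bullet> b\<bar> \<le> r" if "b \<in> Basis" for b using w(1) Basis_le_norm[OF that, of w] by simp
    then have "\<lfloor>(w \<bullet> b) * N\<rfloor> \<in> {\<lfloor>- r * N\<rfloor>..\<lfloor>r * N\<rfloor>}" if "b \<in> Basis" for b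
      using that N unfolding atLeastAtMost_iff by (intro conjI floor_mono mult_right_mono) (auto simp: abs_le_iff minus_le_iff)
    then have "restrict (\<lambda>b. \<lfloor>(w \<bullet> b) * N\<rfloor>) Basis \<in> ?K" by auto
    moreover have "p = (\<Sum>b\<in>Basis. (of_int (restrict (\<lambda>b. \<lfloor>(w \<bullet> b) * N\<rfloor>) Basis b) / N) *\<^sub>R b)"
      by (simp add: w grid_def N_def)
    ultimately show "p \<in> (\<lambda>k. \<Sum>b\<in>Basis. (of_int (k b) / N) *\<^sub>R b) ` ?K" by blast
  qed
  then show ?thesis by (rule finite_subset) (intro finite_imageI finite_PiE; simp)
qed

text \<open>The coefficients are exact masses of F on the grid cells, not sampled values of F. The
  sum is therefore the convolution integral, cut to a ball, with w rounded in the argument of g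
  only, and F may be merely measurable with finite moments.\<close>

definition riemann_sum :: "nat \<Rightarrow> ('a::euclidean_space \<Rightarrow> complex) \<Rightarrow> ('a \<Rightarrow> complex) \<Rightarrow> 'a \<Rightarrow> complex" where
  "riemann_sum n F g x = (\<Sum>p\<in>grid n ` cball 0 (Suc n).
     (\<integral>w. F w * indicator {w. norm w \<le> Suc n \<and> grid n w = p} w \<partial>lborel) * g (x - p))"

lemma riemann_sum_eq:
  assumes F: "moments_finite F"
  shows "riemann_sum n F g x = (\<integral>w. F w * (indicator (cball 0 (Suc n)) w * g (x - grid n w)) \<partial>lborel)"
proof -
  let ?A = "\<lambda>p. {w. norm w \<le> Suc n \<and> grid n w = p}"
  have i: "integrable lborel (\<lambda>w. F w * indicator (?A p) w * g (x - p))" for p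
    by (intro integrable_mult_left moments_finite_bounded_integrable(1)[OF F, where k=0 and C=1])
      (auto split: split_indicator)
  have "riemann_sum n F g x = (\<integral>w. (\<Sum>p\<in>grid n ` cball 0 (Suc n). F w * indicator (?A p) w * g (x - p)) \<partial>lborel)"
    unfolding riemann_sum_def by (simp only: Bochner_Integration.integral_sum[OF i] integral_mult_left_zero)
  also have "\<dots> = (\<integral>w. F w * (indicator (cball 0 (Suc n)) w * g (x - grid n w)) \<partial>lborel)"
  proof (rule Bochner_Integration.integral_cong[OF refl])
    fix w
    have "(\<Sum>p\<in>grid n ` cball 0 (Suc n). F w * indicator (?A p) w * g (x - p))
      = (\<Sum>p\<in>grid n ` cball 0 (Suc n). if p = grid n w then F w * (indicator (cball 0 (Suc n)) w * g (x - p)) else 0)"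
      by (intro sum.cong) (auto simp: indicator_def)
    also have "\<dots> = F w * (indicator (cball 0 (Suc n)) w * g (x - grid n w))"
      by (subst sum.delta[OF finite_grid_cball]) (auto simp: indicator_def)
    finally show "(\<Sum>p\<in>grid n ` cball 0 (Suc n). F w * indicator (?A p) w * g (x - p)) = F w * (indicator (cball 0 (Suc n)) w * g (x - grid n w))" .
  qed
  finally show ?thesis .
qed

lemma partial_deriv_sum:
  assumes "\<And>i. i \<in> I \<Longrightarrow> f i \<in> schwartz" "bs \<in> lists Basis"
  shows "partial_deriv bs (\<lambda>x. \<Sum>i\<in>I. f i x) = (\<lambda>x. \<Sum>i\<in>I. partial_deriv bs (f i) x)"
  using assms(1)
proof (induction I rule: infinite_finite_induct)
  case (insert i I)
  then show ?case
    using partial_deriv_add[OF _ schwartz_sum[of I f] assms(2), of "f i"] by simp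
qed (use partial_deriv_cmult[OF schwartz_zero assms(2), of 0] in auto)

lemma riemann_sum_schwartz: "g \<in> schwartz \<Longrightarrow> riemann_sum n F g \<in> schwartz"
  unfolding riemann_sum_def[abs_def] by (intro schwartz_sum schwartz_cmult schwartz_translate)

lemma partial_deriv_riemann_sum:
  assumes g: "g \<in> schwartz" and bs: "bs \<in> lists Basis"
  shows "partial_deriv bs (riemann_sum n F g) = riemann_sum n F (partial_deriv bs g)"
  unfolding riemann_sum_def[abs_def]
  by (subst partial_deriv_sum[OF schwartz_cmult[OF schwartz_translate[OF g]] bs])
    (simp only: partial_deriv_cmult[OF schwartz_translate[OF g] bs] partial_deriv_translate[OF g bs])

text \<open>Inside the ball the error comes from rounding, outside it from truncation. There
  \<open>1 \<le> (1 + norm w) / (n + 1)\<close>, so the tail has the same rate at the cost of one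
  more power of the weight; hence the moment of order k + 1.\<close>

lemma riemann_sum_bound:
  fixes F :: "'a::euclidean_space \<Rightarrow> complex"
  assumes F: "moments_finite F" and g: "g \<in> schwartz"
  obtains C where "\<And>n x. (1 + norm x) ^ k * norm (riemann_sum n F g x - conv F g x) \<le> C / real (Suc n)"
proof -
  obtain C where C: "C \<ge> 0"
    "\<And>x v w. norm (v - w) \<le> 1 \<Longrightarrow> (1 + norm x) ^ k * norm (g (x - v) - g (x - w)) \<le> C * norm (v - w) * (1 + norm w) ^ k"
    by (rule schwartz_translate_bound[OF g, of k]) (rule that)
  have [measurable]: "g \<in> borel_measurable borel" by (rule schwartz_measurable[OF g])
  have [measurable]: "cball (0::'a) r \<in> sets borel" for r by simp
  define E where "E = C + schwartz_seminorm k [] g"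
  have E: "C \<le> E" "schwartz_seminorm k [] g \<le> E" "0 \<le> E"
    using C(1) schwartz_seminorm_nonneg[OF g, of "[]" k] by (auto simp: E_def)
  have "(1 + norm x) ^ k * norm (riemann_sum n F g x - conv F g x) \<le> (E * moment (Suc k) F) / real (Suc n)" for n x
  proof -
    let ?i = "\<lambda>w. indicator (cball 0 (real (Suc n))) w :: complex"
    have "riemann_sum n F g x - conv F g x = (\<integral>w. F w * (?i w * g (x - grid n w) - g (x - w)) \<partial>lborel)"
      unfolding riemann_sum_eq[OF F] conv_def right_diff_distrib
    proof (rule Bochner_Integration.integral_diff[symmetric])
      show "integrable lborel (\<lambda>w. F w * (?i w * g (x - grid n w)))"
      proof (rule moments_finite_bounded_integrable(1)[OF F, where k=0 and C="schwartz_seminorm 0 [] g"])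
        show "norm (?i w * g (x - grid n w)) \<le> schwartz_seminorm 0 [] g * (1 + norm w) ^ 0" for w
          using schwartz_decay[OF g, of _ 0] schwartz_seminorm_nonneg[OF g, of "[]" 0] by (auto simp: indicator_def)
      qed measurable
    qed (rule conv_integrable[OF F g])
    then have "of_real ((1 + norm x) ^ k) * (riemann_sum n F g x - conv F g x)
      = (\<integral>w. F w * (of_real ((1 + norm x) ^ k) * (?i w * g (x - grid n w) - g (x - w))) \<partial>lborel)"
      by (simp only: integral_mult_right_zero[symmetric]) (simp only: mult.left_commute)
    also have "norm \<dots> \<le> (E / real (Suc n)) * moment (Suc k) F"
    proof (rule moments_finite_bounded_integrable(2)[OF F])
      fix w :: 'a
      have "(1 + norm x) ^ k * norm (?i w * g (x - grid n w) - g (x - w)) \<le> E / real (Suc n) * (1 + norm w) ^ Suc k"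
      proof (cases "norm w \<le> Suc n")
        case True
        have "norm (grid n w - w) \<le> 1" using grid_dist[of n w] order_trans by fastforce
        then have "(1 + norm x) ^ k * norm (?i w * g (x - grid n w) - g (x - w)) \<le> C * norm (grid n w - w) * (1 + norm w) ^ k"
          using C(2) True by simp
        also have "\<dots> \<le> E * (1 / real (Suc n)) * (1 + norm w) ^ Suc k"
          using E C(1) by (intro mult_mono grid_dist power_increasing mult_nonneg_nonneg) auto
        finally show ?thesis by simp
      next
        case False
        have "(1 + norm x) ^ k * norm (?i w * g (x - grid n w) - g (x - w)) = (1 + norm x) ^ k * norm (g (x - w))"
          using False by simp
        also have "\<dots> \<le> ((1 + norm (x - w)) * (1 + norm w)) ^ k * norm (g (x - w))"
          by (intro mult_right_mono power_mono one_plus_norm_le) auto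
        also have "\<dots> = ((1 + norm (x - w)) ^ k * norm (g (x - w))) * (1 + norm w) ^ k"
          by (simp add: power_mult_distrib)
        also have "\<dots> \<le> E * (1 + norm w) ^ k"
          using E(2) schwartz_decay[OF g, of "x - w" k] by (intro mult_right_mono) auto
        also have "\<dots> \<le> E * ((1 / real (Suc n) * (1 + norm w)) * (1 + norm w) ^ k)"
        proof -
          have "1 \<le> 1 / real (Suc n) * (1 + norm w)" using False by (simp add: field_simps)
          from mult_right_mono[OF this, of "(1 + norm w) ^ k"] show ?thesis
            using E(3) by (intro mult_left_mono) auto
        qed
        finally show ?thesis by simp
      qed
      then show "norm (of_real ((1 + norm x) ^ k) * (?i w * g (x - grid n w) - g (x - w))) \<le> E / real (Suc n) * (1 + norm w) ^ Suc k"
        unfolding norm_mult norm_of_real by simp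
    qed measurable
    finally show ?thesis unfolding norm_mult norm_of_real by simp
  qed
  then show thesis using that by blast
qed

lemma schwartz_lim_seqI:
  assumes l: "l \<in> schwartz" and f: "\<And>n. f n \<in> schwartz"
    and b: "\<And>k bs. bs \<in> lists Basis \<Longrightarrow> \<exists>C. \<forall>n x. (1 + norm x) ^ k * norm (partial_deriv bs (f n) x - partial_deriv bs l x) \<le> C / real (Suc n)"
  shows "schwartz_lim sequentially f l"
  unfolding schwartz_lim_def
proof (intro conjI allI ballI l always_eventually f)
  fix k and bs :: "'a list" assume bs: "bs \<in> lists Basis"
  obtain C where C: "\<And>n x. (1 + norm x) ^ k * norm (partial_deriv bs (f n) x - partial_deriv bs l x) \<le> C / real (Suc n)"
    using b[OF bs] by blast
  show "(\<lambda>n. schwartz_seminorm k bs (\<lambda>x. f n x - l x)) \<longlonglongrightarrow> 0"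
  proof (rule Lim_null_comparison)
    have "(\<lambda>n. C * (1 / real (Suc n))) \<longlonglongrightarrow> C * 0"
      by (intro tendsto_mult_left) (use LIMSEQ_inverse_real_of_nat in \<open>simp add: inverse_eq_divide\<close>)
    then show "(\<lambda>n. C / real (Suc n)) \<longlonglongrightarrow> 0" by simp
    show "\<forall>\<^sub>F n in sequentially. norm (schwartz_seminorm k bs (\<lambda>x. f n x - l x)) \<le> C / real (Suc n)"
    proof (intro always_eventually allI)
      fix n
      have "schwartz_seminorm k bs (\<lambda>x. f n x - l x) \<le> C / real (Suc n)"
        by (rule schwartz_seminorm_leI) (simp only: partial_deriv_diff[OF f l bs] C)
      then show "norm (schwartz_seminorm k bs (\<lambda>x. f n x - l x)) \<le> C / real (Suc n)"
        using schwartz_seminorm_nonneg[OF schwartz_diff[OF f l] bs] by simp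
    qed
  qed
qed

lemma riemann_sum_lim:
  assumes F: "moments_finite F" and g: "g \<in> schwartz"
  shows "schwartz_lim sequentially (\<lambda>n. riemann_sum n F g) (conv F g)"
proof (rule schwartz_lim_seqI[OF conv_schwartz[OF F g] riemann_sum_schwartz[OF g]])
  fix k and bs :: "'a list" assume bs: "bs \<in> lists Basis"
  show "\<exists>C. \<forall>n x. (1 + norm x) ^ k * norm (partial_deriv bs (riemann_sum n F g) x - partial_deriv bs (conv F g) x) \<le> C / real (Suc n)"
    unfolding partial_deriv_riemann_sum[OF g bs] partial_deriv_conv[OF F g bs]
    by (rule riemann_sum_bound[OF F schwartz_partial_deriv[OF g bs], of k]) blast
qed

section \<open>Gaussian mollifiers\<close>

lemma integral_affine:
  fixes f :: "'a::euclidean_space \<Rightarrow> complex"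
  assumes c: "c \<noteq> 0" and f: "f \<in> borel_measurable borel"
  shows "(\<integral>x. f x \<partial>lborel) = \<bar>c\<bar> ^ DIM('a) *\<^sub>R (\<integral>x. f (t + c *\<^sub>R x) \<partial>lborel)"
  by (subst lborel_affine[OF c, of t])
    (use f in \<open>simp add: integral_density integral_distr\<close>)

lemma conv_commute:
  assumes [measurable]: "F \<in> borel_measurable borel" "g \<in> borel_measurable borel"
  shows "conv F g = conv g F"
proof
  fix x
  show "conv F g x = conv g F x"
    unfolding conv_def by (subst integral_affine[of "-1" _ x]) (simp_all add: mult.commute)
qed

definition gauss_kernel :: "'a::euclidean_space \<Rightarrow> complex" where
  "gauss_kernel x = of_real (1 / sqrt (2 * pi) ^ DIM('a)) * gaussian x"

definition mollifier :: "nat \<Rightarrow> 'a::euclidean_space \<Rightarrow> complex" where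
  "mollifier n x = of_real (real (Suc n) ^ DIM('a)) * gauss_kernel (real (Suc n) *\<^sub>R x)"

lemma gauss_kernel_schwartz: "gauss_kernel \<in> schwartz"
  unfolding gauss_kernel_def[abs_def] by (intro schwartz_cmult gaussian_schwartz)

lemma gauss_kernel_integral: "(\<integral>x. gauss_kernel x \<partial>(lborel :: 'a::euclidean_space measure)) = 1"
proof -
  have [measurable]: "gaussian \<in> borel_measurable (borel :: 'a measure)"
    by (rule schwartz_measurable[OF gaussian_schwartz])
  have "integral\<^sup>L lborel (\<lambda>x::'a. norm (gaussian x)) = sqrt (2 * pi) ^ DIM('a)"
    using gaussian_nn_integral[where 'a='a] integral_eq_nn_integral[of "\<lambda>x::'a. norm (gaussian x)" lborel]
    by simp
  moreover have "(\<lambda>x::'a. gaussian x) = (\<lambda>x. complex_of_real (norm (gaussian x)))"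
    by (simp add: gaussian_def fun_eq_iff)
  ultimately have "integral\<^sup>L lborel (\<lambda>x::'a. gaussian x) = of_real (sqrt (2 * pi) ^ DIM('a))"
    by (metis integral_complex_of_real)
  then show ?thesis unfolding gauss_kernel_def by (subst integral_mult_right_zero) simp
qed

lemma mollifier_schwartz: "mollifier n \<in> schwartz"
  unfolding mollifier_def[abs_def]
  by (intro schwartz_cmult schwartz_comp_linear[OF gauss_kernel_schwartz, where c="1"])
     (auto simp: linear_scaleR mult_le_cancel_right1)

lemma mollifier_tensor: "mollifier n = tensor (mollifier n) (mollifier n)"
  by (simp add: fun_eq_iff tensor_def mollifier_def gauss_kernel_def gaussian_tensor[unfolded fun_eq_iff, rule_format] power_add)

text \<open>After rescaling, n occurs only in the argument of F while the Gaussian weight is fixed.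
  In this form estimates uniform in n and dominated convergence become available.\<close>

lemma conv_mollifier:
  fixes F :: "'a::euclidean_space \<Rightarrow> complex"
  assumes [measurable]: "F \<in> borel_measurable borel"
  shows "conv (mollifier n) F x = (\<integral>w. gauss_kernel w * F (x - w /\<^sub>R real (Suc n)) \<partial>lborel)"
proof -
  have [measurable]: "gauss_kernel \<in> borel_measurable (borel :: 'a measure)" "mollifier n \<in> borel_measurable (borel :: 'a measure)"
    by (intro schwartz_measurable gauss_kernel_schwartz mollifier_schwartz)+
  have "conv (mollifier n) F x = \<bar>1 / real (Suc n)\<bar> ^ DIM('a) *\<^sub>R
     (\<integral>w. mollifier n (0 + (1 / real (Suc n)) *\<^sub>R w) * F (x - (0 + (1 / real (Suc n)) *\<^sub>R w)) \<partial>lborel)"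
    unfolding conv_def by (rule integral_affine) auto
  also have "\<dots> = (\<integral>w. \<bar>1 / real (Suc n)\<bar> ^ DIM('a) *\<^sub>R (mollifier n (0 + (1 / real (Suc n)) *\<^sub>R w) * F (x - (0 + (1 / real (Suc n)) *\<^sub>R w))) \<partial>lborel)"
    by (rule integral_scaleR_right[symmetric])
  also have "\<dots> = (\<integral>w. gauss_kernel w * F (x - w /\<^sub>R real (Suc n)) \<partial>lborel)"
    by (intro Bochner_Integration.integral_cong refl)
      (simp add: mollifier_def scaleR_conv_of_real power_one_over divide_inverse del: of_nat_Suc flip: power_mult_distrib)
  finally show ?thesis .
qed

lemma mollifier_bound:
  fixes f :: "'a::euclidean_space \<Rightarrow> complex"
  assumes f: "f \<in> schwartz"
  obtains C where "\<And>n x. (1 + norm x) ^ k * norm (conv (mollifier n) f x - f x) \<le> C / real (Suc n)"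
proof -
  obtain C where C: "C \<ge> 0"
    "\<And>x v w. norm (v - w) \<le> 1 \<Longrightarrow> (1 + norm x) ^ k * norm (f (x - v) - f (x - w)) \<le> C * norm (v - w) * (1 + norm w) ^ k"
    by (rule schwartz_translate_bound[OF f, of k]) (rule that)
  have [measurable]: "f \<in> borel_measurable borel" by (rule schwartz_measurable[OF f])
  define B where "B = schwartz_seminorm k [] f"
  define E where "E = C + 2 * B"
  have B: "B \<ge> 0" using schwartz_seminorm_nonneg[OF f] by (simp add: B_def)
  have mf: "moments_finite (gauss_kernel :: 'a \<Rightarrow> complex)" by (rule schwartz_moments_finite[OF gauss_kernel_schwartz])
  \<comment> \<open>A Lipschitz bound for all v, large ones included: for norm v > 1 each of the two
    terms is estimated separately, and the factor norm v only helps.\<close>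
  have shift: "(1 + norm x) ^ k * norm (f (x - v) - f x) \<le> E * norm v * (1 + norm v) ^ k" for x v
  proof (cases "norm v \<le> 1")
    case True
    have "(1 + norm x) ^ k * norm (f (x - v) - f x) \<le> C * norm v" using C(2)[of v 0 x] True by simp
    also have "\<dots> \<le> E * norm v * (1 + norm v) ^ k"
      using mult_mono[of "C * norm v" "E * norm v" 1 "(1 + norm v) ^ k"] B C(1)
      by (simp add: E_def mult_right_mono)
    finally show ?thesis .
  next
    case False
    have "(1 + norm x) ^ k * norm (f (x - v)) \<le> ((1 + norm (x - v)) * (1 + norm v)) ^ k * norm (f (x - v))"
      by (intro mult_right_mono power_mono one_plus_norm_le) auto
    also have "\<dots> = ((1 + norm (x - v)) ^ k * norm (f (x - v))) * (1 + norm v) ^ k"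
      by (simp add: power_mult_distrib)
    also have "\<dots> \<le> B * (1 + norm v) ^ k"
      unfolding B_def by (intro mult_right_mono schwartz_decay f) auto
    finally have 1: "(1 + norm x) ^ k * norm (f (x - v)) \<le> B * (1 + norm v) ^ k" .
    have "(1 + norm x) ^ k * norm (f x) \<le> B * 1" using schwartz_decay[OF f] by (simp add: B_def)
    also have "\<dots> \<le> B * (1 + norm v) ^ k" using B by (intro mult_left_mono one_le_power) auto
    finally have 2: "(1 + norm x) ^ k * norm (f x) \<le> B * (1 + norm v) ^ k" .
    have "(1 + norm x) ^ k * norm (f (x - v) - f x) \<le> (1 + norm x) ^ k * (norm (f (x - v)) + norm (f x))"
      by (intro mult_left_mono norm_triangle_ineq4) auto
    also have "\<dots> \<le> 2 * B * (1 + norm v) ^ k" using 1 2 by (simp add: distrib_left)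
    also have "\<dots> \<le> (E * norm v) * (1 + norm v) ^ k"
      using False B C(1) mult_mono[of "2 * B" E 1 "norm v"] by (intro mult_right_mono) (auto simp: E_def)
    finally show ?thesis .
  qed
  have "(1 + norm x) ^ k * norm (conv (mollifier n) f x - f x) \<le> (E * moment (Suc k) (gauss_kernel :: 'a \<Rightarrow> complex)) / real (Suc n)" for n x
  proof -
    have i1: "integrable lborel (\<lambda>w. gauss_kernel w * f (x - w /\<^sub>R real (Suc n)))"
      using schwartz_decay[OF f, of _ 0]
      by (intro moments_finite_bounded_integrable(1)[OF mf, where k=0 and C="schwartz_seminorm 0 [] f"]) auto
    have i2: "integrable lborel (\<lambda>w. gauss_kernel w * f x)"
      by (intro integrable_mult_left schwartz_integrable gauss_kernel_schwartz)
    have "conv (mollifier n) f x - f x = (\<integral>w. gauss_kernel w * (f (x - w /\<^sub>R real (Suc n)) - f x) \<partial>lborel)"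
      by (simp only: right_diff_distrib Bochner_Integration.integral_diff[OF i1 i2] integral_mult_left_zero gauss_kernel_integral mult_1)
        (simp add: conv_mollifier)
    then have "of_real ((1 + norm x) ^ k) * (conv (mollifier n) f x - f x)
       = (\<integral>w. gauss_kernel w * (of_real ((1 + norm x) ^ k) * (f (x - w /\<^sub>R real (Suc n)) - f x)) \<partial>lborel)"
      by (simp only: integral_mult_right_zero[symmetric]) (simp only: mult.left_commute)
    also have "norm \<dots> \<le> (E / real (Suc n)) * moment (Suc k) (gauss_kernel :: 'a \<Rightarrow> complex)"
    proof (rule moments_finite_bounded_integrable(2)[OF mf])
      fix w :: 'a
      let ?v = "w /\<^sub>R real (Suc n)"
      \<comment> \<open>The first bound supplies the rate 1 / (n + 1), the second keeps the
        remaining weight independent of n.\<close>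
      have v: "norm ?v \<le> norm w / real (Suc n)" "norm ?v \<le> norm w" by (auto simp: divide_simps mult_le_cancel_left1)
      have "(1 + norm x) ^ k * norm (f (x - ?v) - f x) \<le> E * norm ?v * (1 + norm ?v) ^ k" by (rule shift)
      also have "\<dots> \<le> E * ((1 + norm w) / real (Suc n)) * (1 + norm w) ^ k"
        using v B C(1) order_trans[OF v(1) divide_right_mono[of "norm w" "1 + norm w" "real (Suc n)"]]
        by (intro mult_mono mult_left_mono power_mono mult_nonneg_nonneg) (auto simp: E_def)
      finally show "norm (of_real ((1 + norm x) ^ k) * (f (x - w /\<^sub>R real (Suc n)) - f x)) \<le> E / real (Suc n) * (1 + norm w) ^ Suc k"
        unfolding norm_mult norm_of_real by simp
    qed measurable
    finally show ?thesis unfolding norm_mult norm_of_real by simp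
  qed
  then show thesis using that by blast
qed

lemma mollifier_lim:
  assumes f: "f \<in> schwartz"
  shows "schwartz_lim sequentially (\<lambda>n. conv (mollifier n) f) f"
proof (rule schwartz_lim_seqI[OF f conv_schwartz[OF schwartz_moments_finite[OF mollifier_schwartz] f]])
  fix k and bs :: "'a list" assume bs: "bs \<in> lists Basis"
  show "\<exists>C. \<forall>n x. (1 + norm x) ^ k * norm (partial_deriv bs (conv (mollifier n) f) x - partial_deriv bs f x) \<le> C / real (Suc n)"
    unfolding partial_deriv_conv[OF schwartz_moments_finite[OF mollifier_schwartz] f bs]
    by (rule mollifier_bound[OF schwartz_partial_deriv[OF f bs], of k]) blast
qed

section \<open>Density of tensor products in the Schwartz space\<close>

text \<open>Riemann sums are finite combinations of translates of g and converge to the convolution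
  in S, so a closed linear property of all translates passes to the convolution.\<close>

lemma conv_closure:
  assumes F: "moments_finite F" and g: "g \<in> schwartz"
    and base: "\<And>w. P (\<lambda>x. g (x - w))"
    and add: "\<And>f h. f \<in> schwartz \<Longrightarrow> h \<in> schwartz \<Longrightarrow> P f \<Longrightarrow> P h \<Longrightarrow> P (\<lambda>x. f x + h x)"
    and cmult: "\<And>c f. f \<in> schwartz \<Longrightarrow> P f \<Longrightarrow> P (\<lambda>x. c * f x)"
    and lim: "\<And>f l. schwartz_lim sequentially f l \<Longrightarrow> (\<And>n. f n \<in> schwartz) \<Longrightarrow> (\<And>n. P (f n)) \<Longrightarrow> P l"
  shows "P (conv F g)"
proof (rule lim[OF riemann_sum_lim[OF F g] riemann_sum_schwartz[OF g]])
  have S: "P (\<lambda>x. \<Sum>p\<in>I. c p * g (x - p))" for I and c :: "'a \<Rightarrow> complex"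
  proof (induction I rule: infinite_finite_induct)
    case (insert p I)
    have "P (\<lambda>x. c p * g (x - p) + (\<Sum>p\<in>I. c p * g (x - p)))"
      by (intro add schwartz_cmult schwartz_sum schwartz_translate g cmult base insert)
    then show ?case using insert by simp
  qed (use cmult[OF schwartz_translate[OF g] base, of 0] in auto)
  show "P (riemann_sum n F g)" for n
    unfolding riemann_sum_def[abs_def] by (rule S)
qed

text \<open>Commutativity of the convolution exchanges the roles: F becomes the density that is cut
  into cells, and only translates of the Gaussian are left as building blocks. These factor.\<close>

lemma schwartz_tensor_induct:
  fixes F :: "'a::euclidean_space \<times> 'b::euclidean_space \<Rightarrow> complex"
  assumes F: "F \<in> schwartz"
    and base: "\<And>f g. f \<in> schwartz \<Longrightarrow> g \<in> schwartz \<Longrightarrow> P (tensor f g)"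
    and add: "\<And>f h. f \<in> schwartz \<Longrightarrow> h \<in> schwartz \<Longrightarrow> P f \<Longrightarrow> P h \<Longrightarrow> P (\<lambda>x. f x + h x)"
    and cmult: "\<And>c f. f \<in> schwartz \<Longrightarrow> P f \<Longrightarrow> P (\<lambda>x. c * f x)"
    and lim: "\<And>f l. schwartz_lim sequentially f l \<Longrightarrow> (\<And>n. f n \<in> schwartz) \<Longrightarrow> (\<And>n. P (f n)) \<Longrightarrow> P l"
  shows "P F"
proof (rule lim[OF mollifier_lim[OF F] conv_schwartz[OF schwartz_moments_finite[OF mollifier_schwartz] F]])
  fix n
  have "P (conv F (mollifier n))"
  proof (rule conv_closure[OF schwartz_moments_finite[OF F] mollifier_schwartz _ add cmult lim])
    fix w :: "'a \<times> 'b"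
    have "(\<lambda>x. mollifier n (x - w)) = tensor (\<lambda>x. mollifier n (x - fst w)) (\<lambda>x. mollifier n (x - snd w))"
      by (subst mollifier_tensor) (auto simp: tensor_def fun_eq_iff case_prod_beta)
    then show "P (\<lambda>x. mollifier n (x - w))"
      by (simp add: base schwartz_translate[OF mollifier_schwartz])
  qed
  then show "P (conv (mollifier n) F)"
    by (subst conv_commute) (auto intro: schwartz_measurable mollifier_schwartz F)
qed

section \<open>The Hilbert space \<open>L\<^sup>2\<close>\<close>

definition L2_norm :: "'a measure \<Rightarrow> ('a \<Rightarrow> complex) \<Rightarrow> real" where
  "L2_norm \<mu> f = sqrt (\<integral>x. (norm (f x))\<^sup>2 \<partial>\<mu>)"

definition L2_inner :: "'a measure \<Rightarrow> ('a \<Rightarrow> complex) \<Rightarrow> ('a \<Rightarrow> complex) \<Rightarrow> complex" where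
  "L2_inner \<mu> f g = (\<integral>x. f x * cnj (g x) \<partial>\<mu>)"

lemma L2_D: "f \<in> L2 \<mu> \<Longrightarrow> f \<in> borel_measurable \<mu>" "f \<in> L2 \<mu> \<Longrightarrow> integrable \<mu> (\<lambda>x. (norm (f x))\<^sup>2)"
  by (auto simp: L2_def)

lemma L2_norm_nonneg: "0 \<le> L2_norm \<mu> f"
  by (simp add: L2_norm_def)

lemma L2_norm_sq: "(L2_norm \<mu> f)\<^sup>2 = (\<integral>x. (norm (f x))\<^sup>2 \<partial>\<mu>)"
  by (simp add: L2_norm_def)

lemma L2_zero: "(\<lambda>x. 0) \<in> L2 \<mu>"
  by (simp add: L2_def)

lemma L2_cmult: "f \<in> L2 \<mu> \<Longrightarrow> (\<lambda>x. c * f x) \<in> L2 \<mu>"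
  by (auto simp: L2_def norm_mult power_mult_distrib)

lemma cnj_borel_measurable [measurable]: "cnj \<in> borel_measurable borel"
  by (intro borel_measurable_continuous_onI continuous_intros)

lemma L2_cnj: "f \<in> L2 \<mu> \<Longrightarrow> (\<lambda>x. cnj (f x)) \<in> L2 \<mu>"
  by (auto simp: L2_def)

lemma L2_add:
  assumes "f \<in> L2 \<mu>" "g \<in> L2 \<mu>"
  shows "(\<lambda>x. f x + g x) \<in> L2 \<mu>"
proof -
  note [measurable] = assms[THEN L2_D(1)]
  have "integrable \<mu> (\<lambda>x. 2 * (norm (f x))\<^sup>2 + 2 * (norm (g x))\<^sup>2)"
    using assms by (intro Bochner_Integration.integrable_add integrable_mult_right L2_D)
  then have "integrable \<mu> (\<lambda>x. (norm (f x + g x))\<^sup>2)"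
  proof (rule Bochner_Integration.integrable_bound)
    show "AE x in \<mu>. norm ((norm (f x + g x))\<^sup>2) \<le> norm (2 * (norm (f x))\<^sup>2 + 2 * (norm (g x))\<^sup>2)"
    proof (intro AE_I2)
      fix x
      have "(norm (f x + g x))\<^sup>2 \<le> (norm (f x) + norm (g x))\<^sup>2" by (intro power_mono norm_triangle_ineq) auto
      also have "\<dots> \<le> 2 * (norm (f x))\<^sup>2 + 2 * (norm (g x))\<^sup>2"
        using zero_le_power2[of "norm (f x) - norm (g x)"] by (simp add: power2_eq_square algebra_simps)
      finally show "norm ((norm (f x + g x))\<^sup>2) \<le> norm (2 * (norm (f x))\<^sup>2 + 2 * (norm (g x))\<^sup>2)" by simp
    qed
  qed measurable
  then show ?thesis by (simp add: L2_def)
qed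

lemma L2_diff: "f \<in> L2 \<mu> \<Longrightarrow> g \<in> L2 \<mu> \<Longrightarrow> (\<lambda>x. f x - g x) \<in> L2 \<mu>"
  using L2_add[of f \<mu> "\<lambda>x. -1 * g x"] L2_cmult[of g \<mu> "-1"] by simp

lemma L2_Cauchy_Schwarz:
  assumes "f \<in> L2 \<mu>" "g \<in> L2 \<mu>"
  shows "integrable \<mu> (\<lambda>x. f x * g x)" "(\<integral>x. norm (f x) * norm (g x) \<partial>\<mu>) \<le> L2_norm \<mu> f * L2_norm \<mu> g"
    "norm (\<integral>x. f x * g x \<partial>\<mu>) \<le> L2_norm \<mu> f * L2_norm \<mu> g"
proof -
  note [measurable] = assms[THEN L2_D(1)]
  have i: "integrable \<mu> (\<lambda>x. (norm (f x))\<^sup>2 + (norm (g x))\<^sup>2)"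
    using assms by (intro Bochner_Integration.integrable_add L2_D)
  show I: "integrable \<mu> (\<lambda>x. f x * g x)"
  proof (rule Bochner_Integration.integrable_bound[OF i], measurable, intro AE_I2)
    fix x
    have "2 * (norm (f x) * norm (g x)) \<le> (norm (f x))\<^sup>2 + (norm (g x))\<^sup>2"
      using sum_squares_bound[of "norm (f x)" "norm (g x)"] by simp
    moreover have "0 \<le> norm (f x) * norm (g x)" by simp
    ultimately show "norm (f x * g x) \<le> norm ((norm (f x))\<^sup>2 + (norm (g x))\<^sup>2)"
      unfolding norm_mult real_norm_def by argo
  qed
  have I': "integrable \<mu> (\<lambda>x. norm (f x) * norm (g x))"
    using integrable_norm[OF I] by (simp add: norm_mult)
  let ?J = "\<integral>x. norm (f x) * norm (g x) \<partial>\<mu>"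
  have "(\<integral>\<^sup>+x. ennreal (norm (f x)) * ennreal (norm (g x)) \<partial>\<mu>)\<^sup>2
      \<le> (\<integral>\<^sup>+x. ennreal (norm (f x)) ^ 2 \<partial>\<mu>) * (\<integral>\<^sup>+x. ennreal (norm (g x)) ^ 2 \<partial>\<mu>)"
    by (rule Cauchy_Schwarz_nn_integral) measurable
  also have "(\<integral>\<^sup>+x. ennreal (norm (f x)) * ennreal (norm (g x)) \<partial>\<mu>) = ennreal ?J"
    using nn_integral_eq_integral[OF I'] by (simp add: ennreal_mult)
  also have "(\<integral>\<^sup>+x. ennreal (norm (f x)) ^ 2 \<partial>\<mu>) = ennreal ((L2_norm \<mu> f)\<^sup>2)"
    unfolding L2_norm_sq using nn_integral_eq_integral[OF L2_D(2)[OF assms(1)]] by (simp add: ennreal_power)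
  also have "(\<integral>\<^sup>+x. ennreal (norm (g x)) ^ 2 \<partial>\<mu>) = ennreal ((L2_norm \<mu> g)\<^sup>2)"
    unfolding L2_norm_sq using nn_integral_eq_integral[OF L2_D(2)[OF assms(2)]] by (simp add: ennreal_power)
  finally have "?J\<^sup>2 \<le> (L2_norm \<mu> f * L2_norm \<mu> g)\<^sup>2"
    by (simp add: ennreal_power ennreal_mult[symmetric] power_mult_distrib integral_nonneg)
  then show 1: "?J \<le> L2_norm \<mu> f * L2_norm \<mu> g"
    by (rule power2_le_imp_le) (simp add: L2_norm_nonneg)
  show "norm (\<integral>x. f x * g x \<partial>\<mu>) \<le> L2_norm \<mu> f * L2_norm \<mu> g"
    using order_trans[OF integral_norm_bound 1[folded norm_mult]] .
qed

lemma L2_norm_add_sq: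
  assumes f: "f \<in> L2 \<mu>" and g: "g \<in> L2 \<mu>"
  shows "(L2_norm \<mu> (\<lambda>x. f x + g x))\<^sup>2 = (L2_norm \<mu> f)\<^sup>2 + (L2_norm \<mu> g)\<^sup>2 + 2 * Re (L2_inner \<mu> f g)"
proof -
  have i: "integrable \<mu> (\<lambda>x. f x * cnj (g x))" by (rule L2_Cauchy_Schwarz(1)[OF f L2_cnj[OF g]])
  have "(norm (f x + g x))\<^sup>2 = (norm (f x))\<^sup>2 + (norm (g x))\<^sup>2 + 2 * Re (f x * cnj (g x))" for x
    by (simp add: cmod_power2) (simp add: power2_eq_square algebra_simps)
  then have "(L2_norm \<mu> (\<lambda>x. f x + g x))\<^sup>2 = (\<integral>x. (norm (f x))\<^sup>2 + (norm (g x))\<^sup>2 + 2 * Re (f x * cnj (g x)) \<partial>\<mu>)"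
    by (simp add: L2_norm_sq)
  also have "\<dots> = (L2_norm \<mu> f)\<^sup>2 + (L2_norm \<mu> g)\<^sup>2 + (\<integral>x. 2 * Re (f x * cnj (g x)) \<partial>\<mu>)"
    by (simp only: L2_norm_sq Bochner_Integration.integral_add[OF Bochner_Integration.integrable_add[OF L2_D(2)[OF f] L2_D(2)[OF g]]
        integrable_mult_right[OF integrable_Re[OF i], of 2]] Bochner_Integration.integral_add[OF L2_D(2)[OF f] L2_D(2)[OF g]])
  also have "(\<integral>x. 2 * Re (f x * cnj (g x)) \<partial>\<mu>) = 2 * Re (L2_inner \<mu> f g)"
    unfolding L2_inner_def by (simp only: integral_mult_right_zero integral_Re[OF i])
  finally show ?thesis .
qed

lemma L2_norm_cmult: "L2_norm \<mu> (\<lambda>x. c * f x) = norm c * L2_norm \<mu> f"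
  by (simp add: L2_norm_def norm_mult power_mult_distrib real_sqrt_mult)

lemma L2_norm_cnj: "L2_norm \<mu> (\<lambda>x. cnj (f x)) = L2_norm \<mu> f"
  by (simp add: L2_norm_def)

lemma L2_inner_bound:
  "f \<in> L2 \<mu> \<Longrightarrow> g \<in> L2 \<mu> \<Longrightarrow> norm (L2_inner \<mu> f g) \<le> L2_norm \<mu> f * L2_norm \<mu> g"
  unfolding L2_inner_def using L2_Cauchy_Schwarz(3)[OF _ L2_cnj] by (metis L2_norm_cnj)

lemma L2_norm_triangle:
  assumes f: "f \<in> L2 \<mu>" and g: "g \<in> L2 \<mu>"
  shows "L2_norm \<mu> (\<lambda>x. f x + g x) \<le> L2_norm \<mu> f + L2_norm \<mu> g"
proof (rule power2_le_imp_le)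
  have "Re (L2_inner \<mu> f g) \<le> L2_norm \<mu> f * L2_norm \<mu> g"
    using complex_Re_le_cmod L2_inner_bound[OF f g] order_trans by blast
  then show "(L2_norm \<mu> (\<lambda>x. f x + g x))\<^sup>2 \<le> (L2_norm \<mu> f + L2_norm \<mu> g)\<^sup>2"
    unfolding L2_norm_add_sq[OF f g] by (simp add: power2_sum)
qed (simp add: L2_norm_nonneg)

lemma L2_norm_minus_commute: "L2_norm \<mu> (\<lambda>x. f x - g x) = L2_norm \<mu> (\<lambda>x. g x - f x)"
  by (simp add: L2_norm_def norm_minus_commute)

lemma L2_norm_triangle_diff:
  assumes "f \<in> L2 \<mu>" "g \<in> L2 \<mu>" "h \<in> L2 \<mu>"
  shows "L2_norm \<mu> (\<lambda>x. f x - h x) \<le> L2_norm \<mu> (\<lambda>x. f x - g x) + L2_norm \<mu> (\<lambda>x. g x - h x)"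
  using L2_norm_triangle[OF L2_diff[OF assms(1,2)] L2_diff[OF assms(2,3)]] by simp

lemma L2_norm_diff_bound:
  assumes f: "f \<in> L2 \<mu>" and g: "g \<in> L2 \<mu>"
  shows "\<bar>L2_norm \<mu> f - L2_norm \<mu> g\<bar> \<le> L2_norm \<mu> (\<lambda>x. f x - g x)"
  using L2_norm_triangle[OF L2_diff[OF f g] g] L2_norm_triangle[OF L2_diff[OF g f] f]
  by (simp add: L2_norm_minus_commute[of \<mu> g f])

lemma L2_norm_eq_0:
  assumes f: "f \<in> L2 \<mu>" and g: "g \<in> L2 \<mu>"
  shows "L2_norm \<mu> (\<lambda>x. f x - g x) = 0 \<longleftrightarrow> (AE x in \<mu>. f x = g x)"
  unfolding L2_norm_def real_sqrt_eq_0_iff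
  by (subst integral_nonneg_eq_0_iff_AE) (use L2_D(2)[OF L2_diff[OF f g]] in auto)

lemma L2_norm_AE_cong: "AE x in \<mu>. f x = g x \<Longrightarrow> f \<in> borel_measurable \<mu> \<Longrightarrow> g \<in> borel_measurable \<mu> \<Longrightarrow> L2_norm \<mu> f = L2_norm \<mu> g"
  unfolding L2_norm_def by (intro arg_cong[where f=sqrt] integral_cong_AE) auto

lemma L2_I_dominated:
  assumes [measurable]: "f \<in> borel_measurable \<mu>" and w: "w \<in> L2 \<mu>" and b: "AE x in \<mu>. norm (f x) \<le> norm (w x)"
  shows "f \<in> L2 \<mu>"
proof -
  have "integrable \<mu> (\<lambda>x. (norm (f x))\<^sup>2)"
    by (rule Bochner_Integration.integrable_bound[OF L2_D(2)[OF w]]) (use b in \<open>auto simp: power_mono\<close>)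
  then show ?thesis by (simp add: L2_def)
qed

section \<open>Convergence and completeness in \<open>L\<^sup>2\<close>\<close>

definition L2_lim :: "'a measure \<Rightarrow> (nat \<Rightarrow> 'a \<Rightarrow> complex) \<Rightarrow> ('a \<Rightarrow> complex) \<Rightarrow> bool" where
  "L2_lim \<mu> f l \<longleftrightarrow> l \<in> L2 \<mu> \<and> (\<forall>n. f n \<in> L2 \<mu>) \<and> (\<lambda>n. L2_norm \<mu> (\<lambda>x. f n x - l x)) \<longlonglongrightarrow> 0"

text \<open>The limit inherits the bound by w, so the squared differences are dominated by four
  times the square of norm (w x).\<close>

lemma L2_lim_dominated:
  assumes f: "\<And>n. f n \<in> borel_measurable \<mu>" and l: "l \<in> borel_measurable \<mu>" and w: "w \<in> L2 \<mu>"
    and b: "\<And>n. AE x in \<mu>. norm (f n x) \<le> norm (w x)" and lim: "AE x in \<mu>. (\<lambda>n. f n x) \<longlonglongrightarrow> l x"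
  shows "L2_lim \<mu> f l"
  unfolding L2_lim_def
proof (intro conjI allI)
  note [measurable] = f l L2_D(1)[OF w]
  show "f n \<in> L2 \<mu>" for n by (rule L2_I_dominated[OF f w b])
  have "AE x in \<mu>. \<forall>n. norm (f n x) \<le> norm (w x)" using b by (simp add: AE_all_countable)
  with lim have bl: "AE x in \<mu>. norm (l x) \<le> norm (w x)"
  proof eventually_elim
    case (elim x)
    show ?case by (rule tendsto_upperbound[OF tendsto_norm[OF elim(1)]]) (use elim in auto)
  qed
  then show "l \<in> L2 \<mu>" by (rule L2_I_dominated[OF l w])
  have "(\<lambda>n. \<integral>x. (norm (f n x - l x))\<^sup>2 \<partial>\<mu>) \<longlonglongrightarrow> (\<integral>x. 0 \<partial>\<mu>)"
  proof (rule integral_dominated_convergence[where w="\<lambda>x. 4 * (norm (w x))\<^sup>2"])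
    show "integrable \<mu> (\<lambda>x. 4 * (norm (w x))\<^sup>2)" by (intro integrable_mult_right L2_D w)
    show "AE x in \<mu>. (\<lambda>n. (norm (f n x - l x))\<^sup>2) \<longlonglongrightarrow> 0"
      using lim by eventually_elim (auto intro!: tendsto_null_power tendsto_norm_zero LIM_zero)
    show "AE x in \<mu>. norm ((norm (f n x - l x))\<^sup>2) \<le> 4 * (norm (w x))\<^sup>2" for n
      using b[of n] bl
    proof eventually_elim
      case (elim x)
      have "norm (f n x - l x) \<le> 2 * norm (w x)" using elim norm_triangle_ineq4[of "f n x" "l x"] by linarith
      from power_mono[OF this, of 2] show ?case by (simp add: power_mult_distrib)
    qed
  qed auto
  then show "(\<lambda>n. L2_norm \<mu> (\<lambda>x. f n x - l x)) \<longlonglongrightarrow> 0"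
    unfolding L2_norm_def using tendsto_real_sqrt[of _ 0] by fastforce
qed

text \<open>Integrability of \<open>\<Sum>n. 2 ^ n * \<bar>f (n + 1) - f n\<bar>\<^sup>2\<close> gives convergence almost everywhere, and Fatou's lemma
  convergence in \<open>L\<^sup>2\<close>.\<close>

lemma L2_complete:
  assumes f: "\<And>n. f n \<in> L2 \<mu>" and c: "\<And>m n. n \<le> m \<Longrightarrow> L2_norm \<mu> (\<lambda>x. f m x - f n x) \<le> (1/2) ^ n"
  obtains l where "L2_lim \<mu> f l"
proof -
  note [measurable] = L2_D(1)[OF f]
  have e: "(\<integral>\<^sup>+x. ennreal ((norm (f m x - f n x))\<^sup>2) \<partial>\<mu>) \<le> ennreal ((1/4) ^ n)" if "n \<le> m" for m n
  proof -
    have "(\<integral>\<^sup>+x. ennreal ((norm (f m x - f n x))\<^sup>2) \<partial>\<mu>) = ennreal ((L2_norm \<mu> (\<lambda>x. f m x - f n x))\<^sup>2)"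
      unfolding L2_norm_sq by (rule nn_integral_eq_integral[OF L2_D(2)[OF L2_diff[OF f f]]]) simp
    also have "\<dots> \<le> ennreal (((1/2) ^ n)\<^sup>2)" by (intro ennreal_leI power_mono c that L2_norm_nonneg)
    also have "((1/2) ^ n)\<^sup>2 = ((1/4) ^ n :: real)"
      unfolding power2_eq_square power_mult_distrib[symmetric] by simp
    finally show ?thesis .
  qed
  let ?d = "\<lambda>n x. ennreal (2 ^ n * (norm (f (Suc n) x - f n x))\<^sup>2)"
  have "(\<integral>\<^sup>+x. (\<Sum>n. ?d n x) \<partial>\<mu>) = (\<Sum>n. \<integral>\<^sup>+x. ?d n x \<partial>\<mu>)" by (rule nn_integral_suminf) auto
  also have "\<dots> \<le> (\<Sum>n. ennreal ((1/2) ^ n))"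
  proof (rule suminf_le)
    fix n
    have "(\<integral>\<^sup>+x. ?d n x \<partial>\<mu>) = ennreal (2 ^ n) * (\<integral>\<^sup>+x. ennreal ((norm (f (Suc n) x - f n x))\<^sup>2) \<partial>\<mu>)"
      by (subst nn_integral_cmult[symmetric]) (auto simp: ennreal_mult)
    also have "\<dots> \<le> ennreal (2 ^ n) * ennreal ((1/4) ^ n)" by (intro mult_left_mono e) auto
    also have "\<dots> = ennreal ((1/2) ^ n)" by (simp add: ennreal_mult[symmetric] power_mult_distrib[symmetric])
    finally show "(\<integral>\<^sup>+x. ?d n x \<partial>\<mu>) \<le> ennreal ((1/2) ^ n)" .
  qed auto
  also have "\<dots> < \<infinity>"
    by (subst suminf_ennreal_eq[where x=2]) (auto intro: power_half_series geometric_sums[of "1/2::real", simplified])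
  finally have "AE x in \<mu>. (\<Sum>n. ?d n x) \<noteq> \<infinity>" by (intro nn_integral_noteq_infinite) auto
  then have conv: "AE x in \<mu>. convergent (\<lambda>n. f n x)"
  proof eventually_elim
    case (elim x)
    then have sm: "summable (\<lambda>n. 2 ^ n * (norm (f (Suc n) x - f n x))\<^sup>2)"
      by (intro summable_suminf_not_top) auto
    from summable_LIMSEQ_zero[OF sm] have "Bseq (\<lambda>n. 2 ^ n * (norm (f (Suc n) x - f n x))\<^sup>2)"
      by (simp add: convergent_imp_Bseq convergentI)
    then obtain K where K: "K > 0" "\<And>n. norm (2 ^ n * (norm (f (Suc n) x - f n x))\<^sup>2) \<le> K" by (auto elim: BseqE)
    \<comment> \<open>The summands being bounded by K, the increments decay like (1 / sqrt 2) ^ n;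
      the telescoping series then converges absolutely.\<close>
    have "norm (f (Suc n) x - f n x) \<le> sqrt K * (sqrt (1/2)) ^ n" for n
    proof (rule power2_le_imp_le)
      have "2 ^ n * (norm (f (Suc n) x - f n x))\<^sup>2 \<le> K" using K(2)[of n] by simp
      then have "(norm (f (Suc n) x - f n x))\<^sup>2 \<le> K * (1/2) ^ n" by (simp add: field_simps)
      also have "\<dots> = (sqrt K * (sqrt (1/2)) ^ n)\<^sup>2"
      proof -
        have "(sqrt K * (sqrt (1/2)) ^ n)\<^sup>2 = (sqrt K)\<^sup>2 * ((sqrt (1/2))\<^sup>2) ^ n"
          by (metis power_mult_distrib power_mult mult.commute)
        then show ?thesis using K(1) by simp
      qed
      finally show "(norm (f (Suc n) x - f n x))\<^sup>2 \<le> (sqrt K * (sqrt (1/2)) ^ n)\<^sup>2" .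
    qed (use K in auto)
    then have g: "norm (f (Suc n) x - f n x) \<le> sqrt K * (sqrt (1/2)) ^ n" for n .
    have "summable (\<lambda>n. sqrt K * (sqrt (1/2)) ^ n)"
      by (intro summable_mult summable_geometric) (simp add: real_sqrt_divide)
    then have "summable (\<lambda>n. f (Suc n) x - f n x)" by (rule summable_comparison_test'[where N=0]) (rule g)
    then show ?case
      by (simp add: summable_iff_convergent sum_lessThan_telescope[of "\<lambda>n. f n x"] convergent_diff_const_right_iff)
  qed
  define l where "l x = lim (\<lambda>n. f n x)" for x
  have [measurable]: "l \<in> borel_measurable \<mu>" unfolding l_def[abs_def] by measurable
  have b: "(\<integral>\<^sup>+x. ennreal ((norm (l x - f n x))\<^sup>2) \<partial>\<mu>) \<le> ennreal ((1/4) ^ n)" for n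
  proof -
    have "(\<integral>\<^sup>+x. ennreal ((norm (l x - f n x))\<^sup>2) \<partial>\<mu>) \<le> (\<integral>\<^sup>+x. liminf (\<lambda>m. ennreal ((norm (f m x - f n x))\<^sup>2)) \<partial>\<mu>)"
    proof (rule nn_integral_mono_AE)
      show "AE x in \<mu>. ennreal ((norm (l x - f n x))\<^sup>2) \<le> liminf (\<lambda>m. ennreal ((norm (f m x - f n x))\<^sup>2))"
        using conv
      proof eventually_elim
        case (elim x)
        then have "(\<lambda>m. f m x) \<longlonglongrightarrow> l x" by (simp add: l_def convergent_LIMSEQ_iff)
        then have "(\<lambda>m. ennreal ((norm (f m x - f n x))\<^sup>2)) \<longlonglongrightarrow> ennreal ((norm (l x - f n x))\<^sup>2)"
          by (intro tendsto_ennrealI tendsto_intros)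
        from lim_imp_Liminf[OF sequentially_bot this] show ?case by simp
      qed
    qed
    also have "\<dots> \<le> liminf (\<lambda>m. \<integral>\<^sup>+x. ennreal ((norm (f m x - f n x))\<^sup>2) \<partial>\<mu>)"
      by (rule nn_integral_liminf) measurable
    also have "\<dots> \<le> ennreal ((1/4) ^ n)"
      by (intro Liminf_le eventually_sequentiallyI[of n] e) auto
    finally show ?thesis .
  qed
  have d: "(\<lambda>x. l x - f n x) \<in> L2 \<mu>" for n
  proof -
    have "integrable \<mu> (\<lambda>x. (norm (l x - f n x))\<^sup>2)"
      using b[of n] by (intro integrableI_bounded) (auto simp: order_le_less_trans)
    then show ?thesis by (simp add: L2_def)
  qed
  have "l \<in> L2 \<mu>" using L2_add[OF d[of 0] f[of 0]] by simp
  moreover have "(\<lambda>n. L2_norm \<mu> (\<lambda>x. f n x - l x)) \<longlonglongrightarrow> 0"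
  proof (rule Lim_null_comparison)
    show "\<forall>\<^sub>F n in sequentially. norm (L2_norm \<mu> (\<lambda>x. f n x - l x)) \<le> (1/2) ^ n"
    proof (intro always_eventually allI)
      fix n
      have "ennreal ((L2_norm \<mu> (\<lambda>x. l x - f n x))\<^sup>2) \<le> ennreal ((1/4) ^ n)"
        unfolding L2_norm_sq using b[of n] nn_integral_eq_integral[OF L2_D(2)[OF d[of n]]] by simp
      then have "(L2_norm \<mu> (\<lambda>x. l x - f n x))\<^sup>2 \<le> (1/4) ^ n" by (simp add: ennreal_le_iff)
      also have "\<dots> = ((1/2) ^ n)\<^sup>2" unfolding power2_eq_square power_mult_distrib[symmetric] by simp
      finally have "L2_norm \<mu> (\<lambda>x. l x - f n x) \<le> (1/2) ^ n" by (rule power2_le_imp_le) auto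
      then show "norm (L2_norm \<mu> (\<lambda>x. f n x - l x)) \<le> (1/2) ^ n"
        by (simp add: L2_norm_nonneg L2_norm_minus_commute)
    qed
  qed (auto intro: LIMSEQ_power_zero)
  ultimately show thesis using that f unfolding L2_lim_def by blast
qed

section \<open>Isometries and their extension from a dense span\<close>

text \<open>Unitarity without surjectivity: density arguments deliver this much, and surjectivity is
  supplied by an adjoint or an inverse.\<close>

definition isometry_on_L2 :: "'a measure \<Rightarrow> (('a \<Rightarrow> complex) \<Rightarrow> 'a \<Rightarrow> complex) \<Rightarrow> bool" where
  "isometry_on_L2 \<mu> U \<longleftrightarrow>
     (\<forall>f\<in>L2 \<mu>. U f \<in> L2 \<mu>) \<and>
     (\<forall>f\<in>L2 \<mu>. \<forall>g\<in>L2 \<mu>. (AE x in \<mu>. f x = g x) \<longrightarrow> (AE x in \<mu>. U f x = U g x)) \<and>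
     (\<forall>f\<in>L2 \<mu>. \<forall>g\<in>L2 \<mu>. AE x in \<mu>. U (\<lambda>y. f y + g y) x = U f x + U g x) \<and>
     (\<forall>c. \<forall>f\<in>L2 \<mu>. AE x in \<mu>. U (\<lambda>y. c * f y) x = c * U f x) \<and>
     (\<forall>f\<in>L2 \<mu>. \<forall>g\<in>L2 \<mu>. L2_inner \<mu> (U f) (U g) = L2_inner \<mu> f g)"

lemma unitary_on_L2_iff:
  "unitary_on_L2 \<mu> U \<longleftrightarrow> isometry_on_L2 \<mu> U \<and> (\<forall>g\<in>L2 \<mu>. \<exists>f\<in>L2 \<mu>. AE x in \<mu>. U f x = g x)"
  unfolding unitary_on_L2_def isometry_on_L2_def L2_inner_def by blast

lemma isometry_on_L2_D:
  assumes "isometry_on_L2 \<mu> U"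
  shows "f \<in> L2 \<mu> \<Longrightarrow> U f \<in> L2 \<mu>"
    "f \<in> L2 \<mu> \<Longrightarrow> g \<in> L2 \<mu> \<Longrightarrow> AE x in \<mu>. f x = g x \<Longrightarrow> AE x in \<mu>. U f x = U g x"
    "f \<in> L2 \<mu> \<Longrightarrow> g \<in> L2 \<mu> \<Longrightarrow> AE x in \<mu>. U (\<lambda>y. f y + g y) x = U f x + U g x"
    "f \<in> L2 \<mu> \<Longrightarrow> AE x in \<mu>. U (\<lambda>y. c * f y) x = c * U f x"
    "f \<in> L2 \<mu> \<Longrightarrow> g \<in> L2 \<mu> \<Longrightarrow> L2_inner \<mu> (U f) (U g) = L2_inner \<mu> f g"
  using assms unfolding isometry_on_L2_def by blast+

lemma L2_norm_inner: "f \<in> L2 \<mu> \<Longrightarrow> of_real ((L2_norm \<mu> f)\<^sup>2) = L2_inner \<mu> f f"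
  unfolding L2_inner_def L2_norm_sq complex_norm_square[symmetric] of_real_power[symmetric] integral_complex_of_real ..

lemma isometry_on_L2_norm:
  assumes "isometry_on_L2 \<mu> U" "f \<in> L2 \<mu>"
  shows "L2_norm \<mu> (U f) = L2_norm \<mu> f"
proof -
  have "complex_of_real ((L2_norm \<mu> (U f))\<^sup>2) = of_real ((L2_norm \<mu> f)\<^sup>2)"
    unfolding L2_norm_inner[OF assms(2)] L2_norm_inner[OF isometry_on_L2_D(1)[OF assms]]
    by (rule isometry_on_L2_D(5)[OF assms assms(2)])
  then show ?thesis unfolding of_real_eq_iff by (simp add: L2_norm_nonneg)
qed

lemma isometry_on_L2_diff:
  assumes U: "isometry_on_L2 \<mu> U" and f: "f \<in> L2 \<mu>" and g: "g \<in> L2 \<mu>"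
  shows "AE x in \<mu>. U (\<lambda>y. f y - g y) x = U f x - U g x"
  using isometry_on_L2_D(3)[OF U f L2_cmult[OF g, of "-1"]] isometry_on_L2_D(4)[OF U g, of "-1"]
  by eventually_elim simp

lemma isometry_on_L2_dist:
  assumes U: "isometry_on_L2 \<mu> U" and f: "f \<in> L2 \<mu>" and g: "g \<in> L2 \<mu>"
  shows "L2_norm \<mu> (\<lambda>x. U f x - U g x) = L2_norm \<mu> (\<lambda>x. f x - g x)"
proof -
  have "L2_norm \<mu> (\<lambda>x. U f x - U g x) = L2_norm \<mu> (U (\<lambda>x. f x - g x))"
    using isometry_on_L2_diff[OF assms] isometry_on_L2_D(1)[OF U] L2_diff f g
    by (intro L2_norm_AE_cong L2_D(1)) auto
  then show ?thesis using isometry_on_L2_norm[OF U L2_diff[OF f g]] by simp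
qed

lemma L2_lim_isometry:
  assumes U: "isometry_on_L2 \<mu> U" and l: "L2_lim \<mu> f l"
  shows "L2_lim \<mu> (\<lambda>n. U (f n)) (U l)"
  using l isometry_on_L2_dist[OF U] isometry_on_L2_D(1)[OF U] unfolding L2_lim_def by simp

lemma L2_lim_pairing:
  assumes l: "L2_lim \<mu> f l" and g: "g \<in> L2 \<mu>"
  shows "(\<lambda>n. \<integral>x. f n x * g x \<partial>\<mu>) \<longlonglongrightarrow> (\<integral>x. l x * g x \<partial>\<mu>)"
proof (rule Lim_transform2[OF tendsto_const], rule Lim_null_comparison)
  have f: "f n \<in> L2 \<mu>" and L: "l \<in> L2 \<mu>" for n using l by (auto simp: L2_lim_def)
  show "(\<lambda>n. L2_norm \<mu> (\<lambda>x. f n x - l x) * L2_norm \<mu> g) \<longlonglongrightarrow> 0"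
    using l by (intro tendsto_mult_left_zero) (simp add: L2_lim_def)
  show "\<forall>\<^sub>F n in sequentially. norm ((\<integral>x. l x * g x \<partial>\<mu>) - (\<integral>x. f n x * g x \<partial>\<mu>)) \<le> L2_norm \<mu> (\<lambda>x. f n x - l x) * L2_norm \<mu> g"
  proof (intro always_eventually allI)
    fix n
    have "(\<integral>x. f n x * g x \<partial>\<mu>) - (\<integral>x. l x * g x \<partial>\<mu>) = (\<integral>x. (f n x - l x) * g x \<partial>\<mu>)"
      by (simp only: left_diff_distrib Bochner_Integration.integral_diff[OF L2_Cauchy_Schwarz(1)[OF f g] L2_Cauchy_Schwarz(1)[OF L g]])
    then show "norm ((\<integral>x. l x * g x \<partial>\<mu>) - (\<integral>x. f n x * g x \<partial>\<mu>)) \<le> L2_norm \<mu> (\<lambda>x. f n x - l x) * L2_norm \<mu> g"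
      using L2_Cauchy_Schwarz(3)[OF L2_diff[OF f L] g, of n] norm_minus_commute[of "\<integral>x. l x * g x \<partial>\<mu>"] by simp
  qed
qed

text \<open>Pairs of combinations formed with the same coefficients on both sides. It is a relation
  because the second component is determined by the first only almost everywhere, and that is a
  consequence of the isometry property.\<close>

inductive L2_lspan :: "(('a \<Rightarrow> complex) \<Rightarrow> ('a \<Rightarrow> complex) \<Rightarrow> bool) \<Rightarrow> ('a \<Rightarrow> complex) \<Rightarrow> ('a \<Rightarrow> complex) \<Rightarrow> bool"
  for B where
  base: "B f h \<Longrightarrow> L2_lspan B f h"
| add: "L2_lspan B f h \<Longrightarrow> L2_lspan B g k \<Longrightarrow> L2_lspan B (\<lambda>x. f x + g x) (\<lambda>x. h x + k x)"
| cmult: "L2_lspan B f h \<Longrightarrow> L2_lspan B (\<lambda>x. c * f x) (\<lambda>x. c * h x)"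

lemma L2_lspan_diff: "L2_lspan B f h \<Longrightarrow> L2_lspan B g k \<Longrightarrow> L2_lspan B (\<lambda>x. f x - g x) (\<lambda>x. h x - k x)"
  using L2_lspan.add[of B f h "\<lambda>x. -1 * g x" "\<lambda>x. -1 * k x"] L2_lspan.cmult[of B g k "-1"] by simp

lemma L2_inner_add_left:
  "f \<in> L2 \<mu> \<Longrightarrow> g \<in> L2 \<mu> \<Longrightarrow> h \<in> L2 \<mu> \<Longrightarrow> L2_inner \<mu> (\<lambda>x. f x + g x) h = L2_inner \<mu> f h + L2_inner \<mu> g h"
  unfolding L2_inner_def distrib_right
  by (rule Bochner_Integration.integral_add) (intro L2_Cauchy_Schwarz L2_cnj; assumption)+

lemma L2_inner_cmult_left: "L2_inner \<mu> (\<lambda>x. c * f x) h = c * L2_inner \<mu> f h"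
  unfolding L2_inner_def mult.assoc by (rule integral_mult_right_zero)

lemma L2_inner_commute: "L2_inner \<mu> g f = cnj (L2_inner \<mu> f g)"
  unfolding L2_inner_def by (subst Bochner_Integration.integral_cnj[symmetric]) (simp add: mult.commute)

text \<open>Polarisation: c = 1 gives the real part of the inner product, c = \<i> the imaginary
  part.\<close>

lemma L2_inner_eqI:
  assumes "f \<in> L2 \<mu>" "g \<in> L2 \<mu>" "h \<in> L2 \<mu>" "k \<in> L2 \<mu>"
    and n: "\<And>c. L2_norm \<mu> (\<lambda>x. f x + c * g x) = L2_norm \<mu> (\<lambda>x. h x + c * k x)"
    and "L2_norm \<mu> f = L2_norm \<mu> h" "L2_norm \<mu> g = L2_norm \<mu> k"
  shows "L2_inner \<mu> f g = L2_inner \<mu> h k"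
proof -
  have R: "L2_inner \<mu> f (\<lambda>x. c * g x) = cnj c * L2_inner \<mu> f g" for f g c
    by (subst L2_inner_commute) (simp add: L2_inner_cmult_left L2_inner_commute[of \<mu> g f])
  have *: "Re (cnj c * L2_inner \<mu> f g) = Re (cnj c * L2_inner \<mu> h k)" for c
    using L2_norm_add_sq[OF assms(1) L2_cmult[OF assms(2), of c]] L2_norm_add_sq[OF assms(3) L2_cmult[OF assms(4), of c]]
    by (simp add: n assms(6,7) L2_norm_cmult R)
  show ?thesis using *[of 1] *[of "\<i>"] by (intro complex_eqI) auto
qed

text \<open>Inner products are extended from generators to the span in one argument at a time.
  Applied to differences, equality of norms says that the span is single valued up to null
  sets.\<close>

lemma L2_lspan_isometry:
  assumes "L2_lspan B f h"
    and B: "\<And>f h. B f h \<Longrightarrow> f \<in> L2 \<mu> \<and> h \<in> L2 \<mu>"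
    and iso: "\<And>f h g k. B f h \<Longrightarrow> B g k \<Longrightarrow> L2_inner \<mu> h k = L2_inner \<mu> f g"
  shows "f \<in> L2 \<mu> \<and> h \<in> L2 \<mu>" "L2_norm \<mu> h = L2_norm \<mu> f"
proof -
  have M: "f \<in> L2 \<mu> \<and> h \<in> L2 \<mu>" if "L2_lspan B f h" for f h
    using that by induction (auto intro: B[THEN conjunct1] B[THEN conjunct2] L2_add L2_cmult)
  show fh: "f \<in> L2 \<mu> \<and> h \<in> L2 \<mu>" by (rule M[OF assms(1)])
  have 1: "L2_inner \<mu> h k = L2_inner \<mu> f g" if "L2_lspan B f h" "B g k" for f h g k
    using that(1)
  proof induction
    case (add f h f' h')
    then show ?case using M[OF add(1)] M[OF add(2)] B[OF that(2)] by (simp add: L2_inner_add_left)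
  qed (use iso that in \<open>auto simp: L2_inner_cmult_left\<close>)
  have "L2_inner \<mu> k h = L2_inner \<mu> g f" if "L2_lspan B g k" for g k
    using that
  proof induction
    case (base g k)
    show ?case using 1[OF assms(1) base] by (simp add: L2_inner_commute[of \<mu> k] L2_inner_commute[of \<mu> g])
  next
    case (add g k g' k')
    then show ?case using M[OF add(1)] M[OF add(2)] fh by (simp add: L2_inner_add_left)
  qed (auto simp: L2_inner_cmult_left)
  from this[OF assms(1)] have "complex_of_real ((L2_norm \<mu> h)\<^sup>2) = of_real ((L2_norm \<mu> f)\<^sup>2)"
    using fh by (simp only: L2_norm_inner)
  then show "L2_norm \<mu> h = L2_norm \<mu> f" unfolding of_real_eq_iff by (simp add: L2_norm_nonneg)
qed

text \<open>The extension is the closure \<open>\<Gamma>\<close> of the span, taken as a graph.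
  Density and completeness make it total, preservation of norms makes it single valued up to null
  sets, and U selects a representative. With a graph, no approximating sequences have to be chosen
  compatibly with sums and multiples.\<close>

lemma L2_isometry_extension:
  fixes B :: "('a \<Rightarrow> complex) \<Rightarrow> ('a \<Rightarrow> complex) \<Rightarrow> bool"
  assumes B: "\<And>f h. B f h \<Longrightarrow> f \<in> L2 \<mu> \<and> h \<in> L2 \<mu>"
    and iso: "\<And>f h g k. B f h \<Longrightarrow> B g k \<Longrightarrow> L2_inner \<mu> h k = L2_inner \<mu> f g"
    and dense: "\<And>f e. f \<in> L2 \<mu> \<Longrightarrow> 0 < e \<Longrightarrow> \<exists>g h. L2_lspan B g h \<and> L2_norm \<mu> (\<lambda>x. f x - g x) < e"
  obtains U where "isometry_on_L2 \<mu> U" "\<And>f h. B f h \<Longrightarrow> AE x in \<mu>. U f x = h x"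
proof -
  note span = L2_lspan_isometry[OF _ B iso]
  define \<Gamma> where "\<Gamma> f u \<longleftrightarrow> f \<in> L2 \<mu> \<and> u \<in> L2 \<mu> \<and>
     (\<forall>e>0. \<exists>g h. L2_lspan B g h \<and> L2_norm \<mu> (\<lambda>x. f x - g x) < e \<and> L2_norm \<mu> (\<lambda>x. u x - h x) < e)" for f u
  have L: "f \<in> L2 \<mu>" "u \<in> L2 \<mu>" if "\<Gamma> f u" for f u using that by (auto simp: \<Gamma>_def)
  have \<Gamma>_span: "\<Gamma> f h" if "L2_lspan B f h" for f h
    unfolding \<Gamma>_def
    by (intro conjI allI impI exI[of _ f] exI[of _ h] that) (use span(1)[OF that] in \<open>simp_all add: L2_norm_def\<close>)
  have total: "\<exists>u. \<Gamma> f u" if f: "f \<in> L2 \<mu>" for f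
  proof -
    \<comment> \<open>Half of (1/2) ^ n, so that two approximation errors add up to the rate
      demanded by \<open>L2_complete\<close>.\<close>
    have "\<forall>n. \<exists>g h. L2_lspan B g h \<and> L2_norm \<mu> (\<lambda>x. f x - g x) < (1/2) ^ n / 2"
      by (intro allI dense f) simp
    then obtain g h where gh: "\<And>n. L2_lspan B (g n) (h n)" "\<And>n. L2_norm \<mu> (\<lambda>x. f x - g n x) < (1/2) ^ n / 2"
      by metis
    note S = span(1)[OF gh(1)]
    have c: "L2_norm \<mu> (\<lambda>x. h m x - h n x) \<le> (1/2) ^ n" if "n \<le> m" for m n
    proof -
      have "L2_norm \<mu> (\<lambda>x. h m x - h n x) = L2_norm \<mu> (\<lambda>x. g m x - g n x)"
        by (rule span(2)[OF L2_lspan_diff[OF gh(1) gh(1)]])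
      also have "\<dots> \<le> L2_norm \<mu> (\<lambda>x. g m x - f x) + L2_norm \<mu> (\<lambda>x. f x - g n x)"
        using S f by (intro L2_norm_triangle_diff) auto
      also have "\<dots> \<le> (1/2) ^ m / 2 + (1/2) ^ n / 2"
        using gh(2)[of m] gh(2)[of n] by (simp add: L2_norm_minus_commute[of \<mu> "g m"])
      also have "\<dots> \<le> (1/2) ^ n"
      proof -
        have "(1/2) ^ m \<le> ((1/2) ^ n :: real)" by (rule power_decreasing[OF that]) auto
        then show ?thesis by linarith
      qed
      finally show ?thesis .
    qed
    have hL: "h n \<in> L2 \<mu>" for n using S by simp
    obtain u where u: "L2_lim \<mu> h u" using L2_complete[OF hL c] by blast
    have "\<Gamma> f u"
      unfolding \<Gamma>_def
    proof (intro conjI allI impI f)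
      show "u \<in> L2 \<mu>" using u by (simp add: L2_lim_def)
      fix e :: real assume e: "e > 0"
      have "(\<lambda>n. (1/2) ^ n / 2) \<longlonglongrightarrow> (0::real)" using tendsto_divide[OF LIMSEQ_power_zero[of "1/2::real"] tendsto_const[of "2::real"]] by simp
      then have "\<forall>\<^sub>F n in sequentially. (1/2) ^ n / 2 < e" by (rule order_tendstoD(2)) (rule e)
      moreover have "\<forall>\<^sub>F n in sequentially. L2_norm \<mu> (\<lambda>x. h n x - u x) < e"
        using u e by (auto simp: L2_lim_def intro: order_tendstoD(2))
      ultimately have "\<forall>\<^sub>F n in sequentially. (1/2) ^ n / 2 < e \<and> L2_norm \<mu> (\<lambda>x. h n x - u x) < e" by (rule eventually_conj)
      then obtain n where "(1/2) ^ n / 2 < e" "L2_norm \<mu> (\<lambda>x. h n x - u x) < e"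
        using eventually_happens' sequentially_bot by blast
      then show "\<exists>g h. L2_lspan B g h \<and> L2_norm \<mu> (\<lambda>x. f x - g x) < e \<and> L2_norm \<mu> (\<lambda>x. u x - h x) < e"
        using gh(1)[of n] gh(2)[of n] L2_norm_minus_commute[of \<mu> u "h n"] by (intro exI[of _ "g n"] exI[of _ "h n"]) auto
    qed
    then show ?thesis by blast
  qed
  have norm: "L2_norm \<mu> u = L2_norm \<mu> f" if "\<Gamma> f u" for f u
  proof -
    have "\<bar>L2_norm \<mu> u - L2_norm \<mu> f\<bar> \<le> e" if e: "e > 0" for e
    proof -
      obtain g h where gh: "L2_lspan B g h" "L2_norm \<mu> (\<lambda>x. f x - g x) < e/2" "L2_norm \<mu> (\<lambda>x. u x - h x) < e/2"
        using \<open>\<Gamma> f u\<close> e unfolding \<Gamma>_def by (meson half_gt_zero)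
      show ?thesis
        using L2_norm_diff_bound[OF L(2)[OF \<open>\<Gamma> f u\<close>], of h] L2_norm_diff_bound[OF L(1)[OF \<open>\<Gamma> f u\<close>], of g]
          span[OF gh(1)] gh(2,3) by linarith
    qed
    then have "\<bar>L2_norm \<mu> u - L2_norm \<mu> f\<bar> \<le> 0" by (rule field_le_epsilon[of _ 0, simplified])
    then show ?thesis by simp
  qed
  have add: "\<Gamma> (\<lambda>x. f x + g x) (\<lambda>x. u x + v x)" if 1: "\<Gamma> f u" and 2: "\<Gamma> g v" for f u g v
    unfolding \<Gamma>_def
  proof (intro conjI allI impI L2_add L[OF 1] L[OF 2])
    fix e :: real assume e: "e > 0"
    then have e': "e/2 > 0" by simp
    obtain p q where pq: "L2_lspan B p q" "L2_norm \<mu> (\<lambda>x. f x - p x) < e/2" "L2_norm \<mu> (\<lambda>x. u x - q x) < e/2"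
      using 1 e' unfolding \<Gamma>_def by meson
    obtain r s where rs: "L2_lspan B r s" "L2_norm \<mu> (\<lambda>x. g x - r x) < e/2" "L2_norm \<mu> (\<lambda>x. v x - s x) < e/2"
      using 2 e' unfolding \<Gamma>_def by meson
    have "L2_norm \<mu> (\<lambda>x. (f x - p x) + (g x - r x)) \<le> L2_norm \<mu> (\<lambda>x. f x - p x) + L2_norm \<mu> (\<lambda>x. g x - r x)"
      "L2_norm \<mu> (\<lambda>x. (u x - q x) + (v x - s x)) \<le> L2_norm \<mu> (\<lambda>x. u x - q x) + L2_norm \<mu> (\<lambda>x. v x - s x)"
      using span(1)[OF pq(1)] span(1)[OF rs(1)] L[OF 1] L[OF 2] by (intro L2_norm_triangle L2_diff; simp)+
    then have "L2_norm \<mu> (\<lambda>x. f x + g x - (p x + r x)) < e" "L2_norm \<mu> (\<lambda>x. u x + v x - (q x + s x)) < e"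
      using pq rs by (auto simp: algebra_simps)
    then show "\<exists>p q. L2_lspan B p q \<and> L2_norm \<mu> (\<lambda>x. f x + g x - p x) < e \<and> L2_norm \<mu> (\<lambda>x. u x + v x - q x) < e"
      using L2_lspan.add[OF pq(1) rs(1)] by (intro exI[of _ "\<lambda>x. p x + r x"] exI[of _ "\<lambda>x. q x + s x"]) auto
  qed
  have cmult: "\<Gamma> (\<lambda>x. c * f x) (\<lambda>x. c * u x)" if 1: "\<Gamma> f u" for f u c
    unfolding \<Gamma>_def
  proof (intro conjI allI impI L2_cmult L[OF 1])
    fix e :: real assume e: "e > 0"
    \<comment> \<open>Dividing by 1 + norm c instead of norm c covers c = 0.\<close>
    have pos: "0 < 1 + norm c" by (simp add: add_pos_nonneg)
    then have e': "e / (1 + norm c) > 0" using e by simp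
    obtain p q where pq: "L2_lspan B p q" "L2_norm \<mu> (\<lambda>x. f x - p x) < e / (1 + norm c)" "L2_norm \<mu> (\<lambda>x. u x - q x) < e / (1 + norm c)"
      using 1 e' unfolding \<Gamma>_def by meson
    have *: "norm c * t < e" if "t < e / (1 + norm c)" "0 \<le> t" for t
    proof -
      have "norm c * t \<le> (1 + norm c) * t" using that by (simp add: mult_right_mono)
      also have "\<dots> < e" using that pos by (simp add: field_simps)
      finally show ?thesis .
    qed
    have "L2_norm \<mu> (\<lambda>x. c * f x - c * p x) < e" "L2_norm \<mu> (\<lambda>x. c * u x - c * q x) < e"
      unfolding right_diff_distrib[symmetric] L2_norm_cmult using pq by (auto intro!: * L2_norm_nonneg)
    then show "\<exists>p q. L2_lspan B p q \<and> L2_norm \<mu> (\<lambda>x. c * f x - p x) < e \<and> L2_norm \<mu> (\<lambda>x. c * u x - q x) < e"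
      using L2_lspan.cmult[OF pq(1), of c] by (intro exI[of _ "\<lambda>x. c * p x"] exI[of _ "\<lambda>x. c * q x"]) auto
  qed
  have unique: "AE x in \<mu>. u x = v x" if 1: "\<Gamma> f u" and 2: "\<Gamma> g v" and eq: "AE x in \<mu>. f x = g x" for f g u v
  proof -
    have "\<Gamma> (\<lambda>x. f x - g x) (\<lambda>x. u x - v x)"
      using add[OF 1 cmult[OF 2, of "-1"]] by simp
    then have "L2_norm \<mu> (\<lambda>x. u x - v x) = L2_norm \<mu> (\<lambda>x. f x - g x)" by (rule norm)
    also have "\<dots> = 0" using L2_norm_eq_0[OF L(1)[OF 1] L(1)[OF 2]] eq by simp
    finally show ?thesis using L2_norm_eq_0[OF L(2)[OF 1] L(2)[OF 2]] by simp
  qed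
  define U where "U f = (SOME u. \<Gamma> f u)" for f
  have U: "\<Gamma> f (U f)" if "f \<in> L2 \<mu>" for f using someI_ex[OF total[OF that]] by (simp add: U_def)
  have "isometry_on_L2 \<mu> U"
    unfolding isometry_on_L2_def
  proof (intro conjI ballI allI impI)
    fix f assume f: "f \<in> L2 \<mu>"
    show "U f \<in> L2 \<mu>" by (rule L(2)[OF U[OF f]])
    show "AE x in \<mu>. U (\<lambda>y. c * f y) x = c * U f x" for c
      by (rule unique[OF U[OF L2_cmult[OF f]] cmult[OF U[OF f]]]) simp
    fix g assume g: "g \<in> L2 \<mu>"
    show "AE x in \<mu>. U (\<lambda>y. f y + g y) x = U f x + U g x"
      by (rule unique[OF U[OF L2_add[OF f g]] add[OF U[OF f] U[OF g]]]) simp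
    show "AE x in \<mu>. U f x = U g x" if "AE x in \<mu>. f x = g x"
      by (rule unique[OF U[OF f] U[OF g] that])
    show "L2_inner \<mu> (U f) (U g) = L2_inner \<mu> f g"
    proof (rule L2_inner_eqI)
      show "L2_norm \<mu> (\<lambda>x. U f x + c * U g x) = L2_norm \<mu> (\<lambda>x. f x + c * g x)" for c
        by (rule norm[OF add[OF U[OF f] cmult[OF U[OF g]]]])
    qed (use f g L(2)[OF U] norm[OF U] in auto)
  qed
  moreover have "AE x in \<mu>. U f x = h x" if "B f h" for f h
    using B[OF that] by (intro unique[OF U \<Gamma>_span[OF L2_lspan.base[of B, OF that]]]) auto
  ultimately show thesis using that by blast
qed

text \<open>Expanding the square of the norm of U (V g) - g with the adjoint relation gives 1 + 1 -
  2 times the square of the norm of g, that is 0; so V g is a preimage of g.\<close>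

lemma unitary_from_adjoint:
  assumes U: "isometry_on_L2 \<mu> U" and V: "\<And>f. f \<in> L2 \<mu> \<Longrightarrow> V f \<in> L2 \<mu>" "\<And>f. f \<in> L2 \<mu> \<Longrightarrow> L2_norm \<mu> (V f) = L2_norm \<mu> f"
    and adj: "\<And>f g. f \<in> L2 \<mu> \<Longrightarrow> g \<in> L2 \<mu> \<Longrightarrow> L2_inner \<mu> (U f) g = L2_inner \<mu> f (V g)"
  shows "unitary_on_L2 \<mu> U"
  unfolding unitary_on_L2_iff
proof (intro conjI U ballI)
  fix g assume g: "g \<in> L2 \<mu>"
  have UV: "U (V g) \<in> L2 \<mu>" by (intro isometry_on_L2_D(1)[OF U] V g)
  have "(L2_norm \<mu> (\<lambda>x. U (V g) x - g x))\<^sup>2 = (L2_norm \<mu> (U (V g)))\<^sup>2 + (L2_norm \<mu> g)\<^sup>2 - 2 * Re (L2_inner \<mu> (U (V g)) g)"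
  proof -
    have "L2_inner \<mu> (U (V g)) (\<lambda>x. - 1 * g x) = - L2_inner \<mu> (U (V g)) g"
      by (simp add: L2_inner_def)
    then show ?thesis
      using L2_norm_add_sq[OF UV L2_cmult[OF g, of "-1"]] L2_norm_cmult[of \<mu> "-1" g] by simp
  qed
  also have "L2_inner \<mu> (U (V g)) g = of_real ((L2_norm \<mu> (V g))\<^sup>2)"
    by (simp only: adj[OF V(1)[OF g] g] L2_norm_inner[OF V(1)[OF g]])
  finally have "(L2_norm \<mu> (\<lambda>x. U (V g) x - g x))\<^sup>2 = 0"
    by (simp add: isometry_on_L2_norm[OF U V(1)[OF g]] V(2)[OF g])
  then have "AE x in \<mu>. U (V g) x = g x" using L2_norm_eq_0[OF UV g] by simp
  with V(1)[OF g] show "\<exists>f\<in>L2 \<mu>. AE x in \<mu>. U f x = g x" by blast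
qed

text \<open>The relations for V hold only almost everywhere; they pass through U because U respects
  equality almost everywhere.\<close>

lemma isometry_comp:
  assumes U: "isometry_on_L2 \<mu> U" and V: "isometry_on_L2 \<mu> V"
  shows "isometry_on_L2 \<mu> (\<lambda>f. U (V f))"
proof -
  note u = isometry_on_L2_D[OF U] and v = isometry_on_L2_D[OF V]
  show ?thesis
    unfolding isometry_on_L2_def
  proof (intro conjI ballI allI impI)
    fix f assume f: "f \<in> L2 \<mu>"
    show "U (V f) \<in> L2 \<mu>" by (intro u v f)
    show "AE x in \<mu>. U (V (\<lambda>y. c * f y)) x = c * U (V f) x" for c
      using u(2)[OF v(1)[OF L2_cmult[OF f]] L2_cmult[OF v(1)[OF f]] v(4)[OF f, of c]] u(4)[OF v(1)[OF f], of c]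
      by eventually_elim simp
    fix g assume g: "g \<in> L2 \<mu>"
    show "AE x in \<mu>. U (V (\<lambda>y. f y + g y)) x = U (V f) x + U (V g) x"
      using u(2)[OF v(1)[OF L2_add[OF f g]] L2_add[OF v(1)[OF f] v(1)[OF g]] v(3)[OF f g]] u(3)[OF v(1)[OF f] v(1)[OF g]]
      by eventually_elim simp
    show "AE x in \<mu>. U (V f) x = U (V g) x" if "AE x in \<mu>. f x = g x"
      by (intro u(2) v f g that)
    show "L2_inner \<mu> (U (V f)) (U (V g)) = L2_inner \<mu> f g" by (simp add: u(5) v(5) v(1) f g)
  qed
qed

lemma unitary_comp:
  assumes U: "unitary_on_L2 \<mu> U" and V: "unitary_on_L2 \<mu> V"
  shows "unitary_on_L2 \<mu> (\<lambda>f. U (V f))"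
  unfolding unitary_on_L2_iff
proof (intro conjI ballI)
  have iU: "isometry_on_L2 \<mu> U" and iV: "isometry_on_L2 \<mu> V" using U V by (auto simp: unitary_on_L2_iff)
  show "isometry_on_L2 \<mu> (\<lambda>f. U (V f))" by (rule isometry_comp[OF iU iV])
  fix f assume f: "f \<in> L2 \<mu>"
  obtain g where g: "g \<in> L2 \<mu>" "AE x in \<mu>. U g x = f x" using U f unfolding unitary_on_L2_iff by blast
  obtain h where h: "h \<in> L2 \<mu>" "AE x in \<mu>. V h x = g x" using V g unfolding unitary_on_L2_iff by blast
  have "AE x in \<mu>. U (V h) x = f x"
    using isometry_on_L2_D(2)[OF iU isometry_on_L2_D(1)[OF iV h(1)] g(1) h(2)] g(2) by eventually_elim simp
  with h(1) show "\<exists>h\<in>L2 \<mu>. AE x in \<mu>. U (V h) x = f x" by blast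
qed

section \<open>Density of Schwartz functions in \<open>L\<^sup>2\<close>\<close>

text \<open>Dominated convergence twice: once under the convolution integral, where continuity of f
  gives the pointwise limit, and once in \<open>L\<^sup>2\<close>. The majorant for the latter
  decays like (1 + norm x) to the power - 2 DIM; it is independent of n because Peetre's inequality
  moves the weight onto the fixed Gaussian.\<close>

lemma lborel_mollifier_L2_lim:
  fixes f :: "'a::euclidean_space \<Rightarrow> complex"
  assumes c: "continuous_on UNIV f" and R: "\<And>x. norm x > R \<Longrightarrow> f x = 0"
  shows "moments_finite f" "L2_lim lborel (\<lambda>n. conv (mollifier n) f) f"
proof -
  have [measurable]: "f \<in> borel_measurable borel" by (rule borel_measurable_continuous_onI[OF c])
  have "bounded (f ` cball 0 R)"
    by (intro compact_imp_bounded compact_continuous_image continuous_on_subset[OF c]) auto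
  then obtain M0 where "\<forall>x\<in>cball 0 R. norm (f x) \<le> M0" by (auto simp: bounded_iff)
  then have M0: "\<And>x. norm x \<le> R \<Longrightarrow> norm (f x) \<le> M0" by simp
  \<comment> \<open>R may be negative, in which case M0 is arbitrary; absolute values repair the
    signs of both constants.\<close>
  define M where "M = \<bar>M0\<bar>"
  have M: "norm (f x) \<le> M" for x
    using M0[of x] R[of x] by (cases "norm x \<le> R") (auto simp: M_def)
  have M0': "0 \<le> M" by (simp add: M_def)
  define K where "K = \<bar>R\<bar>"
  have fk: "(1 + norm x) ^ k * norm (f x) \<le> (1 + K) ^ k * M" for x k
  proof (cases "norm x \<le> R")
    case True
    then show ?thesis using M[of x] by (intro mult_mono power_mono) (auto simp: K_def)
  qed (use R M0' in \<open>auto simp: K_def\<close>)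
  have dec: "(1 + norm x) ^ (2 * DIM('a)) * norm (of_real ((1 + norm x) ^ k * norm (f x)) :: complex) \<le> (1 + K) ^ (2 * DIM('a) + k) * M" for x k
    using fk[of x "2 * DIM('a) + k"] by (simp add: power_add mult.assoc norm_mult norm_power del: of_real_mult of_real_power of_real_add)
  have "integrable lborel (\<lambda>x. (1 + norm x) ^ k * norm (f x))" for k
    using weight_bound(1)[OF _ dec[of _ k]] by (simp only: complex_of_real_integrable_eq) measurable
  then show mf: "moments_finite f" by (simp add: moments_finite_def)
  let ?G = "gauss_kernel :: 'a \<Rightarrow> complex"
  have mG: "moments_finite ?G" by (rule schwartz_moments_finite[OF gauss_kernel_schwartz])
  have cS: "conv (mollifier n) f \<in> schwartz" for n
    by (subst conv_commute) (auto intro: schwartz_measurable mollifier_schwartz conv_schwartz[OF mf])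
  define k where "k = 2 * DIM('a)"
  define E where "E = (1 + K) ^ k * M"
  have E0: "E \<ge> 0" using M0' by (simp add: E_def K_def)
  have cb: "(1 + norm x) ^ k * norm (conv (mollifier n) f x) \<le> E * moment k ?G" for n x
  proof -
    have "norm (\<integral>w. ?G w * (of_real ((1 + norm x) ^ k) * f (x - w /\<^sub>R real (Suc n))) \<partial>lborel) \<le> E * moment k ?G"
    proof (rule moments_finite_bounded_integrable(2)[OF mG])
      fix w :: 'a
      let ?v = "w /\<^sub>R real (Suc n)"
      have v: "norm ?v \<le> norm w" by (auto simp: divide_simps mult_le_cancel_left1)
      have "(1 + norm x) ^ k * norm (f (x - ?v)) \<le> ((1 + norm (x - ?v)) * (1 + norm ?v)) ^ k * norm (f (x - ?v))"
        by (intro mult_right_mono power_mono one_plus_norm_le) auto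
      also have "\<dots> = ((1 + norm (x - ?v)) ^ k * norm (f (x - ?v))) * (1 + norm ?v) ^ k"
        by (simp add: power_mult_distrib)
      also have "\<dots> \<le> E * (1 + norm w) ^ k"
        unfolding E_def using v M0' by (intro mult_mono fk power_mono) (auto simp: K_def)
      finally show "norm (of_real ((1 + norm x) ^ k) * f (x - ?v)) \<le> E * (1 + norm w) ^ k"
        unfolding norm_mult norm_of_real by simp
    qed measurable
    also have "(\<integral>w. ?G w * (of_real ((1 + norm x) ^ k) * f (x - w /\<^sub>R real (Suc n))) \<partial>lborel) = of_real ((1 + norm x) ^ k) * conv (mollifier n) f x"
      by (simp only: conv_mollifier[OF \<open>f \<in> borel_measurable borel\<close>] integral_mult_right_zero[symmetric]) (simp only: mult.left_commute)
    finally show ?thesis unfolding norm_mult norm_of_real by simp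
  qed
  define w where "w x = complex_of_real ((E * moment k ?G) / (1 + norm x) ^ k)" for x :: 'a
  have mom0: "0 \<le> moment k ?G" unfolding moment_def by (rule Bochner_Integration.integral_nonneg) simp
  have pos: "0 < (1 + norm x) ^ k" for x :: 'a by (intro zero_less_power add_pos_nonneg) auto
  have wn: "norm (w x) = (E * moment k ?G) / (1 + norm x) ^ k" for x
    unfolding w_def norm_of_real using E0 mom0 pos[of x] by simp
  have [measurable]: "w \<in> borel_measurable borel" unfolding w_def[abs_def] by measurable
  have wL: "w \<in> L2 lborel"
  proof -
    have b: "(1 + norm x) ^ k * norm (of_real ((norm (w x))\<^sup>2) :: complex) \<le> (E * moment k ?G)\<^sup>2" for x
    proof -
      have "(1 + norm x) ^ k * norm (of_real ((norm (w x))\<^sup>2) :: complex) = (E * moment k ?G)\<^sup>2 / (1 + norm x) ^ k"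
        unfolding norm_of_real abs_power2 wn using pos[of x] by (simp add: power2_eq_square field_simps)
      also have "\<dots> \<le> (E * moment k ?G)\<^sup>2 / 1"
        using pos[of x] by (intro divide_left_mono one_le_power) auto
      finally show ?thesis by simp
    qed
    have "integrable lborel (\<lambda>x. complex_of_real ((norm (w x))\<^sup>2))"
      by (rule weight_bound(1)[OF _ b[unfolded k_def]]) (simp add: k_def; measurable)
    then have "integrable lborel (\<lambda>x. (norm (w x))\<^sup>2)" by (simp only: complex_of_real_integrable_eq)
    then show ?thesis by (simp add: L2_def)
  qed
  show "L2_lim lborel (\<lambda>n. conv (mollifier n) f) f"
  proof (rule L2_lim_dominated[OF _ _ wL])
    show "conv (mollifier n) f \<in> borel_measurable lborel" for n using schwartz_measurable[OF cS] by simp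
    show "AE x in lborel. norm (conv (mollifier n) f x) \<le> norm (w x)" for n
      unfolding wn using cb[of _ n] pos by (intro AE_I2) (simp add: pos_le_divide_eq mult.commute)
    show "AE x in lborel. (\<lambda>n. conv (mollifier n) f x) \<longlonglongrightarrow> f x"
    proof (rule AE_I2)
      fix x
      have [measurable]: "?G \<in> borel_measurable borel" by (rule schwartz_measurable[OF gauss_kernel_schwartz])
      have "(\<lambda>n. \<integral>w. ?G w * f (x - w /\<^sub>R real (Suc n)) \<partial>lborel) \<longlonglongrightarrow> (\<integral>w. ?G w * f x \<partial>lborel)"
      proof (rule integral_dominated_convergence[where w="\<lambda>w. M * norm (?G w)"])
        show "integrable lborel (\<lambda>w. M * norm (?G w))"
          by (intro integrable_mult_right integrable_norm schwartz_integrable gauss_kernel_schwartz)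
        show "AE w in lborel. (\<lambda>n. ?G w * f (x - w /\<^sub>R real (Suc n))) \<longlonglongrightarrow> ?G w * f x"
        proof (intro AE_I2 tendsto_mult_left)
          fix w :: 'a
          have "(\<lambda>n. x - w /\<^sub>R real (Suc n)) \<longlonglongrightarrow> x - 0 *\<^sub>R w"
            by (intro tendsto_diff tendsto_const tendsto_scaleR LIMSEQ_inverse_real_of_nat)
          moreover have "isCont f x" using c by (simp add: continuous_on_eq_continuous_at)
          ultimately show "(\<lambda>n. f (x - w /\<^sub>R real (Suc n))) \<longlonglongrightarrow> f x"
            by (auto intro: isCont_tendsto_compose)
        qed
        show "AE w in lborel. norm (?G w * f (x - w /\<^sub>R real (Suc n))) \<le> M * norm (?G w)" for n
          by (intro AE_I2) (simp add: norm_mult mult.commute[of M] mult_left_mono M)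
      qed auto
      then show "(\<lambda>n. conv (mollifier n) f x) \<longlonglongrightarrow> f x"
        by (simp add: conv_mollifier gauss_kernel_integral)
    qed
  qed measurable
qed

lemma schwartz_L2: "f \<in> schwartz \<Longrightarrow> f \<in> L2 lborel"
  by (simp add: L2_def schwartz_L2_bound schwartz_measurable)

text \<open>The property climbs from S by mollification to continuous functions of bounded support,
  then to indicators of bounded open sets, of bounded Borel sets, of Borel sets of finite measure,
  and finally by simple functions to everything. Sets are intersected with a fixed ball in the
  Dynkin step so that complements keep finite measure.\<close>

lemma L2_lborel_induct:
  fixes f :: "'a::euclidean_space \<Rightarrow> complex"
  assumes f: "f \<in> L2 lborel"
    and base: "\<And>f. f \<in> schwartz \<Longrightarrow> P f"
    and add: "\<And>f g. f \<in> L2 lborel \<Longrightarrow> g \<in> L2 lborel \<Longrightarrow> P f \<Longrightarrow> P g \<Longrightarrow> P (\<lambda>x. f x + g x)"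
    and cmult: "\<And>c f. f \<in> L2 lborel \<Longrightarrow> P f \<Longrightarrow> P (\<lambda>x. c * f x)"
    and lim: "\<And>f l. L2_lim lborel f l \<Longrightarrow> (\<And>n. P (f n)) \<Longrightarrow> P l"
  shows "P f"
proof -
  have zero: "P (\<lambda>x. 0)" by (rule base[OF schwartz_zero])
  have cc: "P f" if "continuous_on UNIV f" "\<And>x. norm x > R \<Longrightarrow> f x = 0" for f R
  proof (rule lim[OF lborel_mollifier_L2_lim(2)[OF that]])
    note mf = lborel_mollifier_L2_lim(1)[OF that]
    have [measurable]: "f \<in> borel_measurable borel" by (rule borel_measurable_continuous_onI[OF that(1)])
    show "P (conv (mollifier n) f)" for n
      by (subst conv_commute) (auto intro: schwartz_measurable mollifier_schwartz conv_schwartz[OF mf] base)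
  qed
  have indL: "indicator A \<in> L2 lborel" if "A \<in> sets borel" "emeasure lborel A < \<infinity>" for A :: "'a set"
  proof -
    have "integrable lborel (indicator A :: 'a \<Rightarrow> real)" using that by (simp add: integrable_indicator_iff)
    then have "integrable lborel (\<lambda>x. (norm (indicator A x :: complex))\<^sup>2)"
      by (rule Bochner_Integration.integrable_cong[THEN iffD1, rotated 2]) (auto simp: indicator_def)
    then show ?thesis using that by (simp add: L2_def)
  qed
  have bfin: "emeasure lborel A < \<infinity>" if "A \<subseteq> ball 0 r" "A \<in> sets borel" for A :: "'a set" and r
    using emeasure_bounded_finite[of A] that bounded_subset[OF bounded_ball] by blast
  have opn: "P (indicator U)" if U: "open U" "U \<subseteq> ball 0 r" for U :: "'a set" and r
  proof -
    \<comment> \<open>Continuous, zero off U, and equal to 1 at a point x of U as soon as n is at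
      least the reciprocal of the distance from x to the complement.\<close>
    define g where "g n x = complex_of_real (min 1 (real n * infdist x (- U)))" for n x
    \<comment> \<open>The distance to the empty set is 0 by convention, so the complement of U must
      not be empty; a bounded set is not the whole space.\<close>
    have ne: "- U \<noteq> {}"
    proof
      assume "- U = {}"
      then have "U = UNIV" by auto
      then show False using bounded_subset[OF bounded_ball U(2)] not_bounded_UNIV[where 'a='a] by simp
    qed
    have gz: "g n x = 0" if "x \<notin> U" for n x using that by (simp add: g_def)
    have gc: "continuous_on UNIV (g n)" for n
      unfolding g_def[abs_def] by (intro continuous_intros)
    have gb: "norm (g n x) \<le> 1" for n x
      unfolding g_def norm_of_real by (simp add: infdist_nonneg)
    have "L2_lim lborel g (indicator U)"
    proof (rule L2_lim_dominated[where w="indicator U"])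
      show "indicator U \<in> L2 lborel" using U bfin[of U] by (intro indL) auto
      show "g n \<in> borel_measurable lborel" for n using borel_measurable_continuous_onI[OF gc] by simp
      show "AE x in lborel. norm (g n x) \<le> norm (indicator U x :: complex)" for n
        using gb[of n] gz[of _ n] by (intro AE_I2) (auto simp: indicator_def)
      show "AE x in lborel. (\<lambda>n. g n x) \<longlonglongrightarrow> indicator U x"
      proof (rule AE_I2)
        fix x show "(\<lambda>n. g n x) \<longlonglongrightarrow> indicator U x"
        proof (cases "x \<in> U")
          case True
          then have "infdist x (- U) \<noteq> 0" using in_closed_iff_infdist_zero[of "- U" x] U(1) ne by auto
          then have i: "infdist x (- U) > 0" using infdist_nonneg[of x "- U"] by simp
          have "\<forall>\<^sub>F n in sequentially. g n x = 1"
          proof (rule eventually_sequentiallyI)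
            fix n assume "nat \<lceil>1 / infdist x (- U)\<rceil> \<le> n"
            then have "1 / infdist x (- U) \<le> real n" by linarith
            then show "g n x = 1" using i by (simp add: g_def field_simps min_def)
          qed
          then show ?thesis using True by (simp add: tendsto_eventually)
        qed (simp add: gz)
      qed
    qed (use U in auto)
    then show ?thesis
    proof (rule lim)
      show "P (g n)" for n
      proof (rule cc[OF gc])
        fix x :: 'a assume "norm x > r"
        then show "g n x = 0" using U(2) by (intro gz) auto
      qed
    qed
  qed
  have bdd: "P (indicator (A \<inter> ball 0 r))" if A: "A \<in> sets borel" for A :: "'a set" and r
  proof -
    have "Int_stable {S :: 'a set. open S}" "{S :: 'a set. open S} \<subseteq> Pow UNIV" "A \<in> sigma_sets UNIV {S. open S}"
      using A by (auto simp: sets_borel Int_stable_def)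
    then show ?thesis
    proof (induction rule: sigma_sets_induct_disjoint)
      case (basic A)
      then show ?case by (intro opn[where r=r]) auto
    next
      case empty
      show ?case using zero by (simp add: indicator_def)
    next
      case (compl A)
      have [measurable]: "A \<in> sets borel" using compl(1) by (simp add: sets_borel)
      have "P (\<lambda>x. indicator (UNIV \<inter> ball 0 r) x + - 1 * indicator (A \<inter> ball 0 r) x)"
        by (intro add cmult indL opn[where r=r] compl bfin[where r=r] L2_cmult) auto
      moreover have "(\<lambda>x. indicator (UNIV \<inter> ball 0 r) x + - 1 * indicator (A \<inter> ball 0 r) x) = (indicator ((UNIV - A) \<inter> ball 0 r) :: 'a \<Rightarrow> complex)"
        by (auto simp: indicator_def fun_eq_iff)
      ultimately show ?case by simp
    next
      case (union A)
      have mA [measurable]: "A i \<in> sets borel" for i using union(2) by (auto simp: sets_borel)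
      have [measurable]: "ball (0::'a) r \<in> sets borel" by simp
      have S: "P (indicator ((\<Union>i<n. A i) \<inter> ball 0 r))" for n
      proof (induction n)
        case (Suc n)
        have "P (\<lambda>x. indicator ((\<Union>i<n. A i) \<inter> ball 0 r) x + indicator (A n \<inter> ball 0 r) x)"
          by (intro add indL Suc union bfin[where r=r]) auto
        moreover have "(\<lambda>x. indicator ((\<Union>i<n. A i) \<inter> ball 0 r) x + indicator (A n \<inter> ball 0 r) x) = (indicator ((\<Union>i<Suc n. A i) \<inter> ball 0 r) :: 'a \<Rightarrow> complex)"
        proof -
          define B where "B = (\<Union>i<n. A i)"
          have "A n \<inter> A i = {}" if "i < n" for i
            using union(1) that by (intro disjoint_family_onD[of A UNIV]) auto
          then have d: "A n \<inter> B = {}" unfolding B_def by auto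
          have "(\<Union>i<Suc n. A i) = A n \<union> B" by (simp add: B_def lessThan_Suc)
          then show ?thesis
            unfolding B_def[symmetric] using d by (auto simp: indicator_def fun_eq_iff)
        qed
        ultimately show ?case by simp
      qed (use zero in \<open>simp add: indicator_def\<close>)
      have "L2_lim lborel (\<lambda>n. indicator ((\<Union>i<n. A i) \<inter> ball 0 r)) (indicator ((\<Union>i. A i) \<inter> ball 0 r))"
      proof (rule L2_lim_dominated[where w="indicator (ball 0 r)"])
        show "indicator (ball (0::'a) r) \<in> L2 lborel" by (intro indL bfin[where r=r]) auto
        show "AE x in lborel. (\<lambda>n. indicator ((\<Union>i<n. A i) \<inter> ball 0 r) x :: complex) \<longlonglongrightarrow> indicator ((\<Union>i. A i) \<inter> ball 0 r) x"
          unfolding indicator_inter_arith by (intro AE_I2 tendsto_mult LIMSEQ_indicator_UN tendsto_const)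
        show "indicator ((\<Union>i<n. A i) \<inter> ball 0 r) \<in> borel_measurable lborel"
          "indicator ((\<Union>i. A i) \<inter> ball 0 r) \<in> borel_measurable lborel" for n
          using mA by (auto intro!: borel_measurable_indicator sets.Int)
      qed (auto simp: indicator_def)
      then show ?case by (rule lim) (rule S)
    qed
  qed
  have ind: "P (indicator A)" if A: "A \<in> sets borel" "emeasure lborel A < \<infinity>" for A :: "'a set"
  proof -
    note [measurable] = A(1)
    have "L2_lim lborel (\<lambda>n. indicator (A \<inter> ball 0 (real n))) (indicator A)"
    proof (rule L2_lim_dominated[OF _ _ indL[OF A]])
      show "AE x in lborel. (\<lambda>n. indicator (A \<inter> ball 0 (real n)) x :: complex) \<longlonglongrightarrow> indicator A x"
      proof (rule AE_I2)
        fix x :: 'a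
        have "\<forall>\<^sub>F n in sequentially. indicator (A \<inter> ball 0 (real n)) x = (indicator A x :: complex)"
        proof (rule eventually_sequentiallyI)
          fix n assume "Suc (nat \<lceil>norm x\<rceil>) \<le> n"
          then have "norm x < real n" by linarith
          then show "indicator (A \<inter> ball 0 (real n)) x = (indicator A x :: complex)" by (simp add: indicator_def)
        qed
        then show "(\<lambda>n. indicator (A \<inter> ball 0 (real n)) x :: complex) \<longlonglongrightarrow> indicator A x" by (rule tendsto_eventually)
      qed
    qed (use A(1) in \<open>auto intro!: borel_measurable_indicator sets.Int simp: indicator_def\<close>)
    then show ?thesis by (rule lim) (rule bdd[OF A(1)])
  qed
  obtain s where s': "\<forall>i. simple_function lborel (s i)" "\<forall>x\<in>space lborel. (\<lambda>i. s i x) \<longlonglongrightarrow> f x"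
      "\<forall>i. \<forall>x\<in>space lborel. dist (s i x) 0 \<le> 2 * dist (f x) 0"
    using borel_measurable_implies_sequence_metric[OF L2_D(1)[OF f], of 0] by metis
  have s: "simple_function lborel (s i)" "(\<lambda>i. s i x) \<longlonglongrightarrow> f x" "norm (s i x) \<le> 2 * norm (f x)" for i x
    using s' by simp_all
  have sm: "s i \<in> borel_measurable lborel" for i using s(1) by (rule borel_measurable_simple_function)
  have l: "L2_lim lborel s f"
    by (rule L2_lim_dominated[OF sm L2_D(1)[OF f] L2_cmult[OF f, of 2]]) (use s(2,3) in \<open>auto simp: norm_mult\<close>)
  show ?thesis
  proof (rule lim[OF l])
    fix i
    have sL: "s i \<in> L2 lborel" using l by (simp add: L2_lim_def)
    note [measurable] = sm[of i]
    have fin: "finite (range (s i))" using simple_functionD(1)[OF s(1), of i] by simp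
    have A: "s i -` {y} \<in> sets borel" for y using simple_functionD(2)[OF s(1), of i "{y}"] by simp
    \<comment> \<open>On the level set of y the function has modulus norm y, and it is square
      integrable, so the set has finite measure. This fails for y = 0, which is why 0 is removed
      from the range.\<close>
    have em: "emeasure lborel (s i -` {y}) < \<infinity>" if y: "y \<noteq> 0" for y
    proof -
      have "integrable lborel (\<lambda>x. (norm y)\<^sup>2 * indicator (s i -` {y}) x :: real)"
        by (rule Bochner_Integration.integrable_bound[OF L2_D(2)[OF sL]]) (use A[of y] in \<open>auto simp: indicator_def\<close>)
      then have "integrable lborel (\<lambda>x. 1 / (norm y)\<^sup>2 * ((norm y)\<^sup>2 * indicator (s i -` {y}) x) :: real)"
        by (rule integrable_mult_right)
      then have "integrable lborel (indicator (s i -` {y}) :: 'a \<Rightarrow> real)" using y by simp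
      then show ?thesis by (simp add: integrable_indicator_iff)
    qed
    have "P (\<lambda>x. \<Sum>y\<in>I. y * indicator (s i -` {y}) x) \<and> (\<lambda>x. \<Sum>y\<in>I. y * indicator (s i -` {y}) x) \<in> L2 lborel"
      if "finite I" "0 \<notin> I" for I
      using that
    proof (induction I)
      case (insert y I)
      then have y: "y \<noteq> 0" by auto
      have "P (\<lambda>x. y * indicator (s i -` {y}) x + (\<Sum>y\<in>I. y * indicator (s i -` {y}) x))"
        using insert by (intro add cmult ind indL L2_cmult A em y) auto
      moreover have "(\<lambda>x. y * indicator (s i -` {y}) x + (\<Sum>y\<in>I. y * indicator (s i -` {y}) x)) \<in> L2 lborel"
        using insert by (intro L2_add indL L2_cmult A em y) auto
      ultimately show ?case by (simp only: sum.insert[OF insert.hyps] simp_thms)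
    qed (use zero L2_zero in auto)
    from this[OF finite_Diff[OF fin, of "{0}"]] have "P (\<lambda>x. \<Sum>y\<in>range (s i) - {0}. y * indicator (s i -` {y}) x)" by blast
    moreover have "(\<Sum>y\<in>range (s i) - {0}. y * indicator (s i -` {y}) x) = s i x" for x
    proof -
      have "(\<Sum>y\<in>range (s i) - {0}. y * indicator (s i -` {y}) x) = (\<Sum>y\<in>range (s i) - {0}. if y = s i x then y else 0)"
        by (intro sum.cong) (auto simp: indicator_def)
      also have "\<dots> = s i x" using fin by (subst sum.delta) auto
      finally show ?thesis .
    qed
    ultimately show "P (s i)" by (simp only:)
  qed
qed

section \<open>The symplectic Fourier transform\<close>

text \<open>The integrability behind exchanging integrals with an oscillating factor k: such a
  factor is bounded but has no decay, and all decay comes from f and g.\<close>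

lemma lborel_integrable_product_bounded:
  fixes f :: "'a::euclidean_space \<Rightarrow> complex" and g :: "'b::euclidean_space \<Rightarrow> complex" and k :: "'a \<Rightarrow> 'b \<Rightarrow> complex"
  assumes f: "integrable lborel f" and g: "integrable lborel g"
    and k: "case_prod k \<in> borel_measurable borel" and b: "\<And>x y. norm (k x y) \<le> C"
  shows "integrable (lborel \<Otimes>\<^sub>M lborel) (\<lambda>(x, y). f x * g y * k x y)"
proof -
  have [measurable]: "f \<in> borel_measurable lborel" "g \<in> borel_measurable lborel" using f g by auto
  have [measurable]: "case_prod k \<in> borel_measurable (lborel \<Otimes>\<^sub>M lborel)" using k by (simp add: lborel_prod)
  have "integrable (lborel \<Otimes>\<^sub>M lborel) (\<lambda>(x, y). f x * g y)"
  proof (rule lborel_pair.Fubini_integrable)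
    show "integrable lborel (\<lambda>x. \<integral>y. norm (case (x, y) of (x, y) \<Rightarrow> f x * g y) \<partial>lborel)"
      using f by (simp add: norm_mult)
    show "AE x in lborel. integrable lborel (\<lambda>y. case (x, y) of (x, y) \<Rightarrow> f x * g y)" using g by simp
  qed measurable
  then have "integrable (lborel \<Otimes>\<^sub>M lborel) (\<lambda>x. of_real C * (case x of (x, y) \<Rightarrow> f x * g y))"
    by (rule integrable_mult_right)
  then show ?thesis
  proof (rule Bochner_Integration.integrable_bound)
    show "AE x in lborel \<Otimes>\<^sub>M lborel. norm (case x of (x, y) \<Rightarrow> f x * g y * k x y) \<le> norm (of_real C * (case x of (x, y) \<Rightarrow> f x * g y))"
    proof (intro AE_I2, clarify)
      fix x :: 'a and y :: 'b
      have "norm (f x * g y * k x y) \<le> norm (f x * g y) * C" unfolding norm_mult[of _ "k x y"] by (intro mult_left_mono b) auto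
      also have "\<dots> \<le> norm (f x * g y) * norm (complex_of_real C)" by (intro mult_left_mono) auto
      finally show "norm (f x * g y * k x y) \<le> norm (of_real C * (f x * g y))" by (simp add: norm_mult mult_ac)
    qed
  qed measurable
qed

section \<open>The symplectic form and its characters\<close>

text \<open>The orthogonal matrix of the symplectic form; through it symplectic estimates reduce to
  Euclidean ones.\<close>

definition symp_dual :: "'n::finite phase \<Rightarrow> 'n phase" where
  "symp_dual Y = (snd Y, - fst Y)"

lemma sympl_inner: "sympl Y Z = symp_dual Y \<bullet> Z"
  by (simp add: sympl_def symp_dual_def inner_prod_def inner_commute)

lemma inner_symp_dual: "symp_dual Y \<bullet> symp_dual Z = Y \<bullet> Z"
  by (simp add: symp_dual_def inner_prod_def)

lemma norm_symp_dual [simp]: "norm (symp_dual Y) = norm Y"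
  by (simp add: norm_eq_sqrt_inner inner_symp_dual)

lemma sympl_bilinear:
  "sympl (X + Y) Z = sympl X Z + sympl Y Z" "sympl Z (X + Y) = sympl Z X + sympl Z Y"
  "sympl (- X) Z = - sympl X Z" "sympl Z (- X) = - sympl Z X"
  "sympl (X - Y) Z = sympl X Z - sympl Y Z" "sympl Z (X - Y) = sympl Z X - sympl Z Y"
  "sympl (r *\<^sub>R X) Z = r * sympl X Z" "sympl Z (r *\<^sub>R X) = r * sympl Z X" "sympl 0 Z = 0"
  by (auto simp: sympl_def inner_simps algebra_simps)

lemma sympl_antisym: "sympl Y Z = - sympl Z Y"
  by (simp add: sympl_def inner_commute)

lemma abs_sympl_le: "\<bar>sympl Y Z\<bar> \<le> norm Y * norm Z"
  unfolding sympl_inner using Cauchy_Schwarz_ineq2[of "symp_dual Y" Z] by simp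

lemma sympl_continuous [continuous_intros]:
  "continuous_on A f \<Longrightarrow> continuous_on A g \<Longrightarrow> continuous_on A (\<lambda>x. sympl (f x) (g x))"
  unfolding sympl_def by (intro continuous_intros)

lemma ee_norm [simp]: "norm (ee X Z) = 1"
  by (simp add: ee_def norm_exp_i_times)

lemma ee_continuous [continuous_intros]:
  "continuous_on A f \<Longrightarrow> continuous_on A g \<Longrightarrow> continuous_on A (\<lambda>x. ee (f x) (g x))"
  unfolding ee_def by (intro continuous_intros)

lemma ee_measurable [measurable]: "ee X \<in> borel_measurable borel" "(\<lambda>X. ee X Z) \<in> borel_measurable borel"
  "(\<lambda>(X, Z). ee X Z) \<in> borel_measurable borel"
  by (intro borel_measurable_continuous_onI continuous_intros; simp add: case_prod_beta; intro continuous_intros)+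

lemma ee_add: "ee (X + Y) Z = ee X Z * ee Y Z" "ee X (Y + Z) = ee X Y * ee X Z"
  by (simp_all add: ee_def sympl_bilinear distrib_left exp_add)

lemma ee_minus: "ee (- X) Z = cnj (ee X Z)" "ee X (- Z) = cnj (ee X Z)"
  by (simp_all add: ee_def sympl_bilinear exp_cnj)

lemma ee_commute: "ee X Z = cnj (ee Z X)"
  by (simp add: ee_def sympl_antisym[of X Z] exp_cnj)

lemma ee_remainder: "norm (ee X Z - 1 - \<i> * of_real (sympl X Z)) \<le> (sympl X Z)\<^sup>2"
proof -
  have "norm (ee X Z - 1 - \<i> * of_real (sympl X Z)) \<le> \<bar>sympl X Z\<bar>\<^sup>2 / 2"
    using iexp_approx1[of "sympl X Z" 1] by (simp add: ee_def numeral_2_eq_2 diff_diff_eq)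
  also have "\<dots> \<le> (sympl X Z)\<^sup>2" by simp
  finally show ?thesis .
qed

text \<open>The transposed Fourier transform, without the factor $(2\pi)^{-n}$.\<close>

definition osc_int :: "('n::finite phase \<Rightarrow> complex) \<Rightarrow> 'n phase \<Rightarrow> complex" where
  "osc_int f X = (\<integral>Z. f Z * ee X Z \<partial>lborel)"

section \<open>Oscillatory integrals of Schwartz functions\<close>

lemma osc_int_integrable: "f \<in> schwartz \<Longrightarrow> integrable lborel (\<lambda>Z. f Z * ee X Z)"
  by (rule moments_finite_bounded_integrable(1)[OF schwartz_moments_finite, where C=1 and k=0]) auto

lemma osc_int_bound: "f \<in> schwartz \<Longrightarrow> norm (osc_int f X) \<le> moment 0 f"
  unfolding osc_int_def
  using moments_finite_bounded_integrable(2)[OF schwartz_moments_finite, where C=1 and k=0, of f "ee X"] by auto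

lemma osc_int_cmult: "osc_int (\<lambda>Z. c * f Z) X = c * osc_int f X"
  unfolding osc_int_def mult.assoc by (rule integral_mult_right_zero)

lemma osc_int_sum:
  assumes "\<And>i. i \<in> I \<Longrightarrow> f i \<in> schwartz"
  shows "osc_int (\<lambda>Z. \<Sum>i\<in>I. f i Z) X = (\<Sum>i\<in>I. osc_int (f i) X)"
  unfolding osc_int_def sum_distrib_right
  by (rule Bochner_Integration.integral_sum) (intro osc_int_integrable assms)

lemma linear_sympl: "linear (\<lambda>Z. sympl X Z)"
  by (rule linearI) (auto simp: sympl_bilinear)

lemma schwartz_mult_sympl: "f \<in> schwartz \<Longrightarrow> (\<lambda>Z. \<i> * of_real (sympl X Z) * f Z) \<in> schwartz"
  unfolding mult.assoc by (intro schwartz_cmult schwartz_mult_linear linear_sympl)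

text \<open>The second-order bound \<open>ee_remainder\<close> on the character is integrable
  against f because f has a second moment, so differentiation under the integral is an explicit
  estimate.\<close>

lemma osc_int_has_derivative:
  fixes f :: "'n::finite phase \<Rightarrow> complex"
  assumes f: "f \<in> schwartz"
  shows "(osc_int f has_derivative (\<lambda>h. osc_int (\<lambda>Z. \<i> * of_real (sympl h Z) * f Z) X)) (at X)"
proof (rule has_derivative_quadratic)
  let ?D = "\<lambda>h. osc_int (\<lambda>Z. \<i> * of_real (sympl h Z) * f Z) X"
  have "linear ?D"
  proof (rule linearI)
    fix h k :: "'n phase" and r :: real
    have "?D (h + k) = (\<integral>Z. \<i> * of_real (sympl h Z) * f Z * ee X Z + \<i> * of_real (sympl k Z) * f Z * ee X Z \<partial>lborel)"
      by (simp add: osc_int_def sympl_bilinear algebra_simps)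
    then show "?D (h + k) = ?D h + ?D k"
      by (simp only: osc_int_def Bochner_Integration.integral_add[OF osc_int_integrable osc_int_integrable] schwartz_mult_sympl[OF f])
    have "?D (r *\<^sub>R h) = osc_int (\<lambda>Z. of_real r * (\<i> * of_real (sympl h Z) * f Z)) X"
      by (simp add: sympl_bilinear mult_ac)
    then show "?D (r *\<^sub>R h) = r *\<^sub>R ?D h" by (simp add: osc_int_cmult scaleR_conv_of_real)
  qed
  then show "bounded_linear ?D" by (simp add: linear_conv_bounded_linear)
  fix h :: "'n phase"
  have [measurable]: "f \<in> borel_measurable borel" by (rule schwartz_measurable[OF f])
  have "(\<lambda>Z. complex_of_real (sympl h Z)) \<in> borel_measurable borel"
    by (intro borel_measurable_continuous_onI continuous_intros)
  then have m: "(\<lambda>Z. ee X Z * (ee h Z - 1 - \<i> * of_real (sympl h Z))) \<in> borel_measurable borel" by measurable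
  have "osc_int f (X + h) - osc_int f X - ?D h = (\<integral>Z. f Z * ee (X + h) Z - f Z * ee X Z - \<i> * of_real (sympl h Z) * f Z * ee X Z \<partial>lborel)"
    unfolding osc_int_def
    by (simp only: Bochner_Integration.integral_diff[OF Bochner_Integration.integrable_diff[OF osc_int_integrable[OF f] osc_int_integrable[OF f]] osc_int_integrable[OF schwartz_mult_sympl[OF f]]]
      Bochner_Integration.integral_diff[OF osc_int_integrable[OF f] osc_int_integrable[OF f]])
  also have "\<dots> = (\<integral>Z. f Z * (ee X Z * (ee h Z - 1 - \<i> * of_real (sympl h Z))) \<partial>lborel)"
    by (simp add: ee_add algebra_simps)
  also have "norm \<dots> \<le> (norm h)\<^sup>2 * moment 2 f"
  proof (rule moments_finite_bounded_integrable(2)[OF schwartz_moments_finite[OF f] m])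
    fix Z
    have "norm (ee X Z * (ee h Z - 1 - \<i> * of_real (sympl h Z))) \<le> \<bar>sympl h Z\<bar>\<^sup>2"
      using ee_remainder[of h Z] by (simp add: norm_mult)
    also have "\<dots> \<le> (norm h * (1 + norm Z))\<^sup>2"
      by (intro power_mono order_trans[OF abs_sympl_le] mult_left_mono) auto
    finally show "norm (ee X Z * (ee h Z - 1 - \<i> * of_real (sympl h Z))) \<le> (norm h)\<^sup>2 * (1 + norm Z)\<^sup>2"
      by (simp add: power_mult_distrib)
  qed
  finally show "norm (osc_int f (X + h) - osc_int f X - ?D h) \<le> moment 2 f * (norm h)\<^sup>2" by (simp add: mult.commute)
qed

lemma norm_mult_diff_le: "norm (a * b - c) \<le> norm a * norm b + norm c"
  for a b c :: complex
  using norm_triangle_ineq4[of "a * b" c] by (simp add: norm_mult)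

text \<open>Integration by parts: compare the transform of \<open>f\<close> with that of its translate by \<open>t *\<^sub>R b\<close>, as \<open>t\<close> tends to \<open>0\<close>.\<close>

lemma osc_int_partial_deriv:
  fixes f :: "'n::finite phase \<Rightarrow> complex"
  assumes f: "f \<in> schwartz" and b: "b \<in> Basis"
  shows "osc_int (partial_deriv [b] f) X = - \<i> * of_real (sympl X b) * osc_int f X"
proof -
  let ?s = "sympl X b" and ?f' = "partial_deriv [b] f"
  let ?k = "2 * DIM('n phase)"
  note f' = partial_deriv_single_schwartz[OF f b]
  obtain C where C: "C \<ge> 0" "\<And>x h. norm h \<le> 1 \<Longrightarrow>
      (1 + norm x) ^ ?k * norm (f (x + h) - f x - (\<Sum>b\<in>Basis. (h \<bullet> b) *\<^sub>R partial_deriv [b] f x)) \<le> C * (norm h)\<^sup>2"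
    by (rule schwartz_taylor_bound[OF f, of ?k]) (rule that)
  \<comment> \<open>The constants of the two quadratic errors: the Taylor remainder of f, made
    integrable by the weight with exponent ?k, and the remainder of the character that the
    translation produces.\<close>
  define K where "K = weight_integral TYPE('n phase) * C + (sympl X b)\<^sup>2 * norm (osc_int f X)"
  have est: "norm (osc_int ?f' X + \<i> * of_real ?s * osc_int f X) \<le> K * t" if t: "0 < t" "t \<le> 1" for t
  proof -
    let ?r = "\<lambda>Z. f (Z + t *\<^sub>R b) - f Z - of_real t * ?f' Z"
    have ft: "(\<lambda>Z. f (Z + t *\<^sub>R b)) \<in> schwartz" using schwartz_translate[OF f, of "- (t *\<^sub>R b)"] by simp
    have rS: "?r \<in> schwartz" by (intro schwartz_diff schwartz_cmult ft f f')
    have "osc_int (\<lambda>Z. f (Z + t *\<^sub>R b)) X = (\<integral>Z. f Z * ee X (Z - t *\<^sub>R b) \<partial>lborel)"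
      unfolding osc_int_def
      by (subst (2) integral_affine[of 1 _ "t *\<^sub>R b"]) (use schwartz_measurable[OF f] in \<open>auto simp: add.commute\<close>)
    also have "\<dots> = (\<integral>Z. ee X (- (t *\<^sub>R b)) * (f Z * ee X Z) \<partial>lborel)"
      using ee_add(2)[of X _ "- (t *\<^sub>R b)"] by (simp add: mult_ac)
    also have "\<dots> = ee X (- (t *\<^sub>R b)) * osc_int f X"
      unfolding osc_int_def by (rule integral_mult_right_zero)
    finally have shift: "osc_int (\<lambda>Z. f (Z + t *\<^sub>R b)) X = ee X (- (t *\<^sub>R b)) * osc_int f X" .
    have "osc_int ?r X = (\<integral>Z. f (Z + t *\<^sub>R b) * ee X Z - f Z * ee X Z - of_real t * ?f' Z * ee X Z \<partial>lborel)"
      by (simp only: osc_int_def left_diff_distrib)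
    also have "\<dots> = osc_int (\<lambda>Z. f (Z + t *\<^sub>R b)) X - osc_int f X - osc_int (\<lambda>Z. of_real t * ?f' Z) X"
      unfolding osc_int_def
      by (simp only: Bochner_Integration.integral_diff[OF Bochner_Integration.integrable_diff[OF osc_int_integrable[OF ft] osc_int_integrable[OF f]] osc_int_integrable[OF schwartz_cmult[OF f']]]
        Bochner_Integration.integral_diff[OF osc_int_integrable[OF ft] osc_int_integrable[OF f]])
    finally have "of_real t * (osc_int ?f' X + \<i> * of_real ?s * osc_int f X)
        = (ee X (- (t *\<^sub>R b)) - 1 - \<i> * of_real (sympl X (- (t *\<^sub>R b)))) * osc_int f X - osc_int ?r X"
      unfolding shift osc_int_cmult sympl_bilinear by (simp add: algebra_simps)
    then have "norm (of_real t * (osc_int ?f' X + \<i> * of_real ?s * osc_int f X))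
      \<le> norm (ee X (- (t *\<^sub>R b)) - 1 - \<i> * of_real (sympl X (- (t *\<^sub>R b)))) * norm (osc_int f X) + norm (osc_int ?r X)"
      by (simp only: norm_mult_diff_le)
    also have "\<dots> \<le> (t * ?s)\<^sup>2 * norm (osc_int f X) + weight_integral TYPE('n phase) * (C * t\<^sup>2)"
    proof (intro add_mono mult_right_mono)
      show "norm (ee X (- (t *\<^sub>R b)) - 1 - \<i> * of_real (sympl X (- (t *\<^sub>R b)))) \<le> (t * ?s)\<^sup>2"
        using ee_remainder[of X "- (t *\<^sub>R b)"] by (simp add: sympl_bilinear)
      have "norm (osc_int ?r X) \<le> (\<integral>Z. norm (?r Z) \<partial>lborel)"
        unfolding osc_int_def
        using integral_norm_bound[of lborel "\<lambda>Z. ?r Z * ee X Z"] by (simp add: norm_mult)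
      also have "\<dots> \<le> weight_integral TYPE('n phase) * (C * t\<^sup>2)"
      proof (rule weight_bound(2)[OF schwartz_measurable[OF rS]])
        fix x :: "'n phase"
        have "(\<Sum>c\<in>Basis. ((t *\<^sub>R b) \<bullet> c) *\<^sub>R partial_deriv [c] f x) = of_real t * ?f' x"
        proof -
          have "(\<Sum>c\<in>Basis. ((t *\<^sub>R b) \<bullet> c) *\<^sub>R partial_deriv [c] f x) = t *\<^sub>R (\<Sum>c\<in>Basis. (b \<bullet> c) *\<^sub>R partial_deriv [c] f x)"
            by (simp only: scaleR_sum_right inner_scaleR_left scaleR_scaleR)
          also have "(\<Sum>c\<in>Basis. (b \<bullet> c) *\<^sub>R partial_deriv [c] f x) = ?f' x" by (rule sum_inner_Basis_scaleR[OF b])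
          finally show ?thesis by (simp only: scaleR_conv_of_real)
        qed
        then show "(1 + norm x) ^ (2 * DIM('n phase)) * norm (?r x) \<le> C * t\<^sup>2"
          using C(2)[of "t *\<^sub>R b" x] t b by simp
      qed
      finally show "norm (osc_int ?r X) \<le> weight_integral TYPE('n phase) * (C * t\<^sup>2)" .
    qed simp
    also have "\<dots> = K * t * t" by (simp add: K_def power2_eq_square algebra_simps)
    finally have "t * norm (osc_int ?f' X + \<i> * of_real ?s * osc_int f X) \<le> t * (K * t)"
      using t by (simp add: norm_mult mult_ac)
    then show ?thesis using t by simp
  qed
  have "norm (osc_int ?f' X + \<i> * of_real ?s * osc_int f X) \<le> 0"
  proof (rule field_le_epsilon)
    fix e :: real assume e: "0 < e"
    define t where "t = min 1 (e / (\<bar>K\<bar> + 1))"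
    have t: "0 < t" "t \<le> 1" using e by (auto simp: t_def)
    have "K * t \<le> \<bar>K\<bar> * t" using t by (intro mult_right_mono) auto
    also have "\<dots> \<le> (\<bar>K\<bar> + 1) * (e / (\<bar>K\<bar> + 1))" using e t by (intro mult_mono) (auto simp: t_def)
    also have "\<dots> = e" by simp
    finally show "norm (osc_int ?f' X + \<i> * of_real ?s * osc_int f X) \<le> 0 + e" using est[OF t] by simp
  qed
  then show ?thesis by (simp add: add_eq_0_iff)
qed

text \<open>One power of norm X is traded for one derivative of f: norm X is at most the sum of the
  absolute values of \<open>sympl X b\<close> over the basis, and each of these factors is a
  derivative of f under the integral. Hence the induction is over all f at once.\<close>

lemma osc_int_decay:
  fixes f :: "'n::finite phase \<Rightarrow> complex"
  assumes "f \<in> schwartz"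
  shows "\<exists>C. \<forall>X. (1 + norm X) ^ k * norm (osc_int f X) \<le> C"
  using assms
proof (induction k arbitrary: f)
  case 0
  then show ?case using osc_int_bound[OF 0] by auto
next
  case (Suc k)
  have "\<forall>b\<in>(Basis :: 'n phase set). \<exists>C. \<forall>X. (1 + norm X) ^ k * norm (osc_int (partial_deriv [b] f) X) \<le> C"
    using Suc.IH[OF partial_deriv_single_schwartz[OF Suc.prems]] by blast
  then obtain c where c: "\<And>b X. b \<in> (Basis :: 'n phase set) \<Longrightarrow> (1 + norm X) ^ k * norm (osc_int (partial_deriv [b] f) X) \<le> c b"
    by metis
  obtain C where C: "\<And>X. (1 + norm X) ^ k * norm (osc_int f X) \<le> C" using Suc by blast
  have "(1 + norm X) ^ Suc k * norm (osc_int f X) \<le> C + (\<Sum>b\<in>Basis. c b)" for X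
  proof -
    have "norm X = norm (symp_dual X)" by simp
    also have "\<dots> \<le> (\<Sum>b\<in>Basis. \<bar>sympl X b\<bar>)" unfolding sympl_inner by (rule norm_le_l1)
    finally have "(1 + norm X) * ((1 + norm X) ^ k * norm (osc_int f X)) \<le> (1 + (\<Sum>b\<in>Basis. \<bar>sympl X b\<bar>)) * ((1 + norm X) ^ k * norm (osc_int f X))"
      by (intro mult_right_mono) auto
    also have "\<dots> = (1 + norm X) ^ k * norm (osc_int f X) + (\<Sum>b\<in>Basis. (1 + norm X) ^ k * (\<bar>sympl X b\<bar> * norm (osc_int f X)))"
      by (simp only: distrib_right[of 1 "sum _ _"] sum_distrib_right mult_1) (simp only: mult_ac)
    also have "(\<Sum>b\<in>Basis. (1 + norm X) ^ k * (\<bar>sympl X b\<bar> * norm (osc_int f X))) = (\<Sum>b\<in>Basis. (1 + norm X) ^ k * norm (osc_int (partial_deriv [b] f) X))"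
      by (intro sum.cong refl) (simp add: osc_int_partial_deriv[OF Suc.prems] norm_mult del: partial_deriv.simps)
    also have "(1 + norm X) ^ k * norm (osc_int f X) + \<dots> \<le> C + (\<Sum>b\<in>Basis. c b)"
      by (intro add_mono sum_mono C c)
    finally show ?thesis by simp
  qed
  then show ?case by blast
qed

lemma osc_int_schwartz:
  fixes f :: "'n::finite phase \<Rightarrow> complex"
  assumes f: "f \<in> schwartz"
  shows "osc_int f \<in> schwartz"
proof (rule schwartz_coinduct[where A="osc_int ` schwartz"])
  fix g :: "'n phase \<Rightarrow> complex" and k assume "g \<in> osc_int ` schwartz"
  then obtain f where g: "g = osc_int f" and f: "f \<in> schwartz" by auto
  show "\<exists>D. (\<forall>x. (g has_derivative D x) (at x)) \<and> (\<forall>b\<in>Basis. (\<lambda>x. D x b) \<in> osc_int ` schwartz)"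
    unfolding g using osc_int_has_derivative[OF f] schwartz_mult_sympl[OF f]
    by (intro exI[of _ "\<lambda>X h. osc_int (\<lambda>Z. \<i> * of_real (sympl h Z) * f Z) X"]) auto
  show "\<exists>C. \<forall>x. (1 + norm x) ^ k * norm (g x) \<le> C" unfolding g by (rule osc_int_decay[OF f])
qed (use f in auto)

lemma partial_deriv_gaussian: "b \<in> Basis \<Longrightarrow> partial_deriv [b] gaussian = (\<lambda>Z. - (of_real (Z \<bullet> b) * gaussian Z))"
  by (rule partial_derivI) (rule gaussian_has_derivative)

text \<open>The transform of the Gaussian, divided by the Gaussian, has derivative \<open>0\<close>.\<close>

lemma osc_int_gaussian:
  "osc_int gaussian (X :: 'n::finite phase) = of_real ((2 * pi) ^ CARD('n)) * gaussian X"
proof -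
  let ?g = "gaussian :: 'n phase \<Rightarrow> complex"
  \<comment> \<open>Multiplying the Gaussian by a linear form amounts to differentiating it, and
    integration by parts turns the derivative into a linear form in X. The transform thus satisfies
    the same differential equation as the Gaussian.\<close>
  have D: "osc_int (\<lambda>Z. \<i> * of_real (sympl h Z) * ?g Z) X = - (of_real (X \<bullet> h) * osc_int ?g X)" for h X
  proof -
    have "\<i> * of_real (sympl h Z) * ?g Z = (\<Sum>c\<in>Basis. - \<i> * of_real (symp_dual h \<bullet> c) * partial_deriv [c] gaussian Z)" for Z
    proof -
      have "(\<Sum>c\<in>Basis. - \<i> * of_real (symp_dual h \<bullet> c) * partial_deriv [c] gaussian Z)
         = (\<Sum>c\<in>Basis. \<i> * of_real ((symp_dual h \<bullet> c) * (Z \<bullet> c)) * gaussian Z)"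
        by (intro sum.cong refl) (simp add: partial_deriv_gaussian del: partial_deriv.simps)
      also have "\<dots> = \<i> * of_real (\<Sum>c\<in>Basis. (symp_dual h \<bullet> c) * (Z \<bullet> c)) * gaussian Z"
        by (simp only: of_real_sum sum_distrib_left sum_distrib_right)
      also have "(\<Sum>c\<in>Basis. (symp_dual h \<bullet> c) * (Z \<bullet> c)) = sympl h Z"
        unfolding sympl_inner by (rule euclidean_inner[symmetric])
      finally show ?thesis ..
    qed
    then have "osc_int (\<lambda>Z. \<i> * of_real (sympl h Z) * ?g Z) X = osc_int (\<lambda>Z. \<Sum>c\<in>Basis. (- \<i> * of_real (symp_dual h \<bullet> c)) * partial_deriv [c] gaussian Z) X"
      by (simp only:)
    also have "\<dots> = (\<Sum>c\<in>Basis. (- \<i> * of_real (symp_dual h \<bullet> c)) * osc_int (partial_deriv [c] gaussian) X)"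
      by (subst osc_int_sum) (auto simp only: osc_int_cmult intro!: schwartz_cmult partial_deriv_single_schwartz gaussian_schwartz)
    also have "\<dots> = (\<Sum>c\<in>Basis. - of_real ((symp_dual X \<bullet> c) * (symp_dual h \<bullet> c)) * osc_int gaussian X)"
      by (intro sum.cong refl) (simp add: osc_int_partial_deriv[OF gaussian_schwartz] sympl_inner mult_ac del: partial_deriv.simps)
    also have "\<dots> = - of_real (\<Sum>c\<in>Basis. (symp_dual X \<bullet> c) * (symp_dual h \<bullet> c)) * osc_int gaussian X"
      by (simp only: of_real_sum sum_distrib_right sum_negf[symmetric])
    also have "(\<Sum>c\<in>Basis. (symp_dual X \<bullet> c) * (symp_dual h \<bullet> c)) = X \<bullet> h"
      by (simp only: euclidean_inner[symmetric] inner_symp_dual)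
    finally show ?thesis by simp
  qed
  let ?e = "\<lambda>X :: 'n phase. complex_of_real (exp ((X \<bullet> X) / 2))"
  have e: "(?e has_derivative (\<lambda>h. of_real ((X \<bullet> h) * exp ((X \<bullet> X) / 2)))) (at X)" for X
  proof -
    have "((\<lambda>X :: 'n phase. exp ((X \<bullet> X) / 2)) has_derivative (\<lambda>h. (X \<bullet> h) * exp ((X \<bullet> X) / 2))) (at X)"
      by (auto intro!: derivative_eq_intros simp: inner_commute)
    then show ?thesis by (rule bounded_linear.has_derivative[OF bounded_linear_of_real])
  qed
  have "((\<lambda>X. osc_int ?g X * ?e X) has_derivative (\<lambda>h. 0)) (at X)" for X
    using has_derivative_mult[OF osc_int_has_derivative[OF gaussian_schwartz] e, of X]
    unfolding D by (simp add: mult_ac)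
  then have "\<exists>c. \<forall>X\<in>UNIV. osc_int ?g X * ?e X = c"
    by (intro has_derivative_zero_constant) auto
  then obtain c where c: "\<And>X. osc_int ?g X * ?e X = c" by blast
  have eq: "osc_int ?g X * ?e X = osc_int ?g 0 * ?e 0" by (simp only: c)
  have zero: "osc_int ?g 0 = of_real ((2 * pi) ^ CARD('n))"
  proof -
    have "(\<lambda>Z :: 'n phase. gauss_kernel Z) = (\<lambda>Z. of_real (1 / sqrt (2 * pi) ^ DIM('n phase)) * gaussian Z)"
      by (simp add: gauss_kernel_def)
    then have "1 = complex_of_real (1 / sqrt (2 * pi) ^ DIM('n phase)) * (\<integral>Z. ?g Z \<partial>lborel)"
      using gauss_kernel_integral[where 'a="'n phase"] by (simp only: integral_mult_right_zero)
    then have "(\<integral>Z. ?g Z \<partial>lborel) = of_real (sqrt (2 * pi) ^ DIM('n phase))" by (simp add: field_simps)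
    also have "sqrt (2 * pi) ^ DIM('n phase) = (2 * pi) ^ CARD('n)"
    proof -
      have "DIM('n phase) = 2 * CARD('n)" by simp
      then show ?thesis by (simp only: power_mult) simp
    qed
    finally show ?thesis by (simp add: osc_int_def ee_def sympl_bilinear)
  qed
  have one: "?e X * gaussian X = 1"
    by (simp add: gaussian_def power2_norm_eq_inner exp_add[symmetric] flip: of_real_mult)
  have "osc_int ?g X = osc_int ?g X * ?e X * gaussian X" by (simp only: mult.assoc one mult_1_right)
  also have "\<dots> = of_real ((2 * pi) ^ CARD('n)) * ?e 0 * gaussian X" by (simp only: eq zero)
  also have "?e 0 = 1" by simp
  finally show ?thesis by (simp only: mult_1_right)
qed

text \<open>Points of phase space are pairs; from here on quantifiers over them are kept whole by
  simplification.\<close>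

declare split_paired_All [simp del] split_paired_Ex [simp del]

text \<open>With a Gaussian factor tending to \<open>1\<close> inserted, the double integral converges absolutely and equals a mollification of \<open>f\<close>.\<close>

lemma osc_int_twice:
  fixes f :: "'n::finite phase \<Rightarrow> complex"
  assumes f: "f \<in> schwartz"
  shows "osc_int (osc_int f) X = of_real ((2 * pi) ^ (2 * CARD('n))) * f X"
proof -
  let ?c = "(2 * pi) ^ CARD('n)"
  let ?N = "\<lambda>n. real (Suc n)"
  have fi: "integrable lborel f" and oi: "integrable lborel (osc_int f)"
    by (intro schwartz_integrable osc_int_schwartz f)+
  have [measurable]: "f \<in> borel_measurable borel" "osc_int f \<in> borel_measurable borel" "gaussian \<in> borel_measurable (borel :: 'n phase measure)"
    by (intro schwartz_measurable osc_int_schwartz f gaussian_schwartz)+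
  let ?g = "\<lambda>n (Y :: 'n phase). gaussian (Y /\<^sub>R ?N n)"
  have g1: "norm (gaussian Y) \<le> 1" for Y :: "'n phase" by (simp add: gaussian_def)
  have gS: "?g n \<in> schwartz" for n
    by (rule schwartz_comp_linear[OF gaussian_schwartz, where c="?N n"]) (simp_all add: linear_scaleR mult.assoc[symmetric] del: of_nat_Suc)
  have "(\<lambda>n. \<integral>Y. osc_int f Y * (?g n Y * ee X Y) \<partial>lborel) \<longlonglongrightarrow> (\<integral>Y. osc_int f Y * (1 * ee X Y) \<partial>lborel)"
  proof (rule integral_dominated_convergence[where w="\<lambda>Y. norm (osc_int f Y)"])
    show "integrable lborel (\<lambda>Y. norm (osc_int f Y))" by (intro integrable_norm oi)
    show "AE Y in lborel. (\<lambda>n. osc_int f Y * (?g n Y * ee X Y)) \<longlonglongrightarrow> osc_int f Y * (1 * ee X Y)"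
    proof (intro AE_I2 tendsto_mult tendsto_const)
      fix Y :: "'n phase"
      have "(\<lambda>n. Y /\<^sub>R ?N n) \<longlonglongrightarrow> 0 *\<^sub>R Y" by (intro tendsto_scaleR tendsto_const LIMSEQ_inverse_real_of_nat)
      moreover have "isCont gaussian (0 :: 'n phase)"
        by (rule has_derivative_continuous[OF gaussian_has_derivative])
      ultimately have "(\<lambda>n. ?g n Y) \<longlonglongrightarrow> gaussian (0 :: 'n phase)"
        by (auto intro: isCont_tendsto_compose)
      then show "(\<lambda>n. ?g n Y) \<longlonglongrightarrow> 1" by (simp add: gaussian_def)
    qed
    show "AE Y in lborel. norm (osc_int f Y * (?g n Y * ee X Y)) \<le> norm (osc_int f Y)" for n
      using mult_left_mono[OF g1 norm_ge_zero] by (intro AE_I2) (simp add: norm_mult)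
  qed measurable
  then have lim1: "(\<lambda>n. \<integral>Y. osc_int f Y * (?g n Y * ee X Y) \<partial>lborel) \<longlonglongrightarrow> osc_int (osc_int f) X"
    by (simp add: osc_int_def[of "osc_int f"])
  have eq: "(\<integral>Y. osc_int f Y * (?g n Y * ee X Y) \<partial>lborel) = of_real ((2 * pi) ^ (2 * CARD('n))) * conv f (mollifier n) X" for n
  proof -
    have I: "integrable (lborel \<Otimes>\<^sub>M lborel) (\<lambda>(Y, Z). ?g n Y * f Z * (ee Y Z * ee X Y))"
    proof (rule lborel_integrable_product_bounded[OF schwartz_integrable[OF gS] fi, where C=1])
      show "(\<lambda>(Y, Z). ee Y Z * ee X Y) \<in> borel_measurable borel"
        unfolding case_prod_beta by (intro borel_measurable_continuous_onI continuous_intros)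
    qed (simp add: norm_mult)
    have "(\<integral>Y. osc_int f Y * (?g n Y * ee X Y) \<partial>lborel) = (\<integral>Y. (\<integral>Z. ?g n Y * f Z * (ee Y Z * ee X Y) \<partial>lborel) \<partial>lborel)"
    proof (intro Bochner_Integration.integral_cong refl)
      fix Y
      show "osc_int f Y * (?g n Y * ee X Y) = (\<integral>Z. ?g n Y * f Z * (ee Y Z * ee X Y) \<partial>lborel)"
        unfolding osc_int_def by (subst integral_mult_left_zero[symmetric]) (simp only: mult_ac)
    qed
    also have "\<dots> = (\<integral>Z. (\<integral>Y. ?g n Y * f Z * (ee Y Z * ee X Y) \<partial>lborel) \<partial>lborel)"
      by (rule lborel_pair.Fubini_integral[OF I, symmetric])
    also have "\<dots> = (\<integral>Z. of_real (?c * ?c) * (f Z * mollifier n (X - Z)) \<partial>lborel)"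
    proof (intro Bochner_Integration.integral_cong refl)
      fix Z
      \<comment> \<open>Antisymmetry of the symplectic form combines the two characters into
        \<open>ee (X - Z) Y\<close>. This is why the transform applied twice returns f itself and
        not its reflection.\<close>
      have "(\<integral>Y. ?g n Y * f Z * (ee Y Z * ee X Y) \<partial>lborel) = (\<integral>Y. f Z * (?g n Y * ee (X - Z) Y) \<partial>lborel)"
        using ee_add(1)[of X "- Z"] by (simp add: ee_minus ee_commute[of _ Z] mult_ac)
      also have "\<dots> = f Z * (\<integral>Y. ?g n Y * ee (X - Z) Y \<partial>lborel)" by (rule integral_mult_right_zero)
      also have "(\<integral>Y. ?g n Y * ee (X - Z) Y \<partial>lborel) = of_real (?N n ^ DIM('n phase)) * osc_int gaussian (?N n *\<^sub>R (X - Z))"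
      proof -
        have e: "ee (X - Z) (?N n *\<^sub>R Y) = ee (?N n *\<^sub>R (X - Z)) Y" for Y by (simp add: ee_def sympl_bilinear)
        have [measurable]: "?g n \<in> borel_measurable borel" by (rule schwartz_measurable[OF gS])
        have "(\<integral>Y. ?g n Y * ee (X - Z) Y \<partial>lborel) = \<bar>?N n\<bar> ^ DIM('n phase) *\<^sub>R (\<integral>Y. ?g n (0 + ?N n *\<^sub>R Y) * ee (X - Z) (0 + ?N n *\<^sub>R Y) \<partial>lborel)"
          by (rule integral_affine) auto
        then show ?thesis by (simp add: osc_int_def e scaleR_conv_of_real del: of_nat_Suc)
      qed
      \<comment> \<open>One factor ?c is the value of the transform of the Gaussian at 0, the other
        undoes the normalisation of \<open>gauss_kernel\<close>.\<close>
      also have "osc_int gaussian (?N n *\<^sub>R (X - Z)) = of_real (?c * ?c) * gauss_kernel (?N n *\<^sub>R (X - Z))"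
      proof -
        have "sqrt (2 * pi) ^ DIM('n phase) = ?c"
        proof -
          have "DIM('n phase) = 2 * CARD('n)" by simp
          then show ?thesis by (simp only: power_mult) simp
        qed
        then show ?thesis by (simp add: osc_int_gaussian gauss_kernel_def)
      qed
      finally show "(\<integral>Y. ?g n Y * f Z * (ee Y Z * ee X Y) \<partial>lborel) = of_real (?c * ?c) * (f Z * mollifier n (X - Z))"
        by (simp add: mollifier_def mult_ac)
    qed
    also have "\<dots> = of_real ((2 * pi) ^ (2 * CARD('n))) * conv f (mollifier n) X"
      unfolding conv_def power_even_eq power2_eq_square by (rule integral_mult_right_zero)
    finally show ?thesis .
  qed
  have "(\<lambda>n. conv f (mollifier n) X) \<longlonglongrightarrow> f X"
  proof (rule tendstoI)
    fix e :: real assume "0 < e"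
    from schwartz_lim_uniform[OF mollifier_lim[OF f] this]
    show "\<forall>\<^sub>F n in sequentially. dist (conv f (mollifier n) X) (f X) < e"
      by eventually_elim (simp add: dist_norm conv_commute[OF \<open>f \<in> borel_measurable borel\<close> schwartz_measurable[OF mollifier_schwartz]])
  qed
  then have "(\<lambda>n. of_real ((2 * pi) ^ (2 * CARD('n))) * conv f (mollifier n) X) \<longlonglongrightarrow> of_real ((2 * pi) ^ (2 * CARD('n))) * f X"
    by (intro tendsto_mult_left)
  then show ?thesis using lim1 unfolding eq by (rule LIMSEQ_unique[rotated])
qed

section \<open>The measures \<open>dX\<close> and \<open>dXdY\<close>\<close>

lemma dX_borel [measurable_cong, simp]: "sets (dX :: 'n::finite phase measure) = sets borel"
  by (simp add: dX_def)

lemma space_dX [simp]: "space (dX :: 'n::finite phase measure) = UNIV"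
  by (simp add: dX_def)

lemma dX_measurable_iff [simp]: "f \<in> borel_measurable (dX :: 'n::finite phase measure) \<longleftrightarrow> f \<in> borel_measurable borel"
  by (simp cong: measurable_cong_sets)

lemma integrable_scaleR_iff:
  fixes f :: "'a \<Rightarrow> 'b::{banach, second_countable_topology}"
  assumes "c \<noteq> 0"
  shows "integrable M (\<lambda>x. c *\<^sub>R f x) \<longleftrightarrow> integrable M f"
proof
  assume "integrable M (\<lambda>x. c *\<^sub>R f x)"
  then have "integrable M (\<lambda>x. (1 / c) *\<^sub>R c *\<^sub>R f x)" by (rule integrable_scaleR_right)
  then show "integrable M f" using assms by simp
qed (rule integrable_scaleR_right)

lemma integral_dX:
  fixes f :: "'n::finite phase \<Rightarrow> 'b::{banach, second_countable_topology}"
  assumes "f \<in> borel_measurable borel"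
  shows "integral\<^sup>L dX f = (1 / (2 * pi) ^ CARD('n)) *\<^sub>R integral\<^sup>L lborel f"
  unfolding dX_def using assms by (subst integral_density) auto

lemma integrable_dX:
  fixes f :: "'n::finite phase \<Rightarrow> 'b::{banach, second_countable_topology}"
  assumes "f \<in> borel_measurable borel"
  shows "integrable dX f \<longleftrightarrow> integrable lborel f"
  unfolding dX_def using assms by (subst integrable_density) (auto simp: integrable_scaleR_iff)

lemma sigma_finite_dX: "sigma_finite_measure (dX :: 'n::finite phase measure)"
  unfolding dX_def by (subst sigma_finite_measure.sigma_finite_iff_density_finite[OF sigma_finite_lborel]) auto

interpretation dX: sigma_finite_measure "dX :: 'n::finite phase measure"
  by (rule sigma_finite_dX)

interpretation dX_pair: pair_sigma_finite "dX :: 'n::finite phase measure" "dX :: 'n phase measure" ..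

lemma dXdY_density:
  "(dXdY :: ('n::finite phase \<times> 'n phase) measure) = density lborel (\<lambda>_. ennreal (1 / (2 * pi) ^ (2 * CARD('n))))"
proof -
  have "(dXdY :: ('n phase \<times> 'n phase) measure) = density (lborel \<Otimes>\<^sub>M lborel)
      (\<lambda>(x, y). ennreal (1 / (2 * pi) ^ CARD('n)) * ennreal (1 / (2 * pi) ^ CARD('n)))"
    unfolding dXdY_def dX_def
    by (rule pair_measure_density) (use sigma_finite_dX[unfolded dX_def] sigma_finite_lborel in auto)
  moreover have "ennreal (1 / (2 * pi) ^ CARD('n)) * ennreal (1 / (2 * pi) ^ CARD('n)) = ennreal (1 / (2 * pi) ^ (2 * CARD('n)))"
    by (simp add: ennreal_mult[symmetric] power_even_eq power2_eq_square)
  ultimately show ?thesis by (simp only: lborel_prod case_prod_unfold)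
qed

lemma dXdY_borel [measurable_cong, simp]: "sets (dXdY :: ('n::finite phase \<times> 'n phase) measure) = sets borel"
  by (simp add: dXdY_density)

lemma space_dXdY [simp]: "space (dXdY :: ('n::finite phase \<times> 'n phase) measure) = UNIV"
  by (simp add: dXdY_density)

lemma dXdY_measurable_iff [simp]: "f \<in> borel_measurable (dXdY :: ('n::finite phase \<times> 'n phase) measure) \<longleftrightarrow> f \<in> borel_measurable borel"
  by (simp cong: measurable_cong_sets)

lemma integral_dXdY:
  fixes f :: "'n::finite phase \<times> 'n phase \<Rightarrow> 'b::{banach, second_countable_topology}"
  assumes "f \<in> borel_measurable borel"
  shows "integral\<^sup>L dXdY f = (1 / (2 * pi) ^ (2 * CARD('n))) *\<^sub>R integral\<^sup>L lborel f"
  unfolding dXdY_density using assms by (subst integral_density) auto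

lemma integrable_dXdY:
  fixes f :: "'n::finite phase \<times> 'n phase \<Rightarrow> 'b::{banach, second_countable_topology}"
  assumes "f \<in> borel_measurable borel"
  shows "integrable dXdY f \<longleftrightarrow> integrable lborel f"
  unfolding dXdY_density using assms by (subst integrable_density) (auto simp: integrable_scaleR_iff)

text \<open>The density is a positive constant: the spaces agree as sets and only norms are
  rescaled, so approximation may be carried out for Lebesgue measure.\<close>

lemma L2_dXdY: "L2 (dXdY :: ('n::finite phase \<times> 'n phase) measure) = L2 lborel"
proof -
  have "integrable dXdY (\<lambda>x. (norm (f x))\<^sup>2) \<longleftrightarrow> integrable lborel (\<lambda>x. (norm (f x))\<^sup>2)"
    if "f \<in> borel_measurable borel" for f :: "'n phase \<times> 'n phase \<Rightarrow> complex"
    using that by (intro integrable_dXdY) auto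
  then show ?thesis by (auto simp: L2_def)
qed

lemma L2_dX: "L2 (dX :: 'n::finite phase measure) = L2 lborel"
proof -
  have "integrable dX (\<lambda>x. (norm (f x))\<^sup>2) \<longleftrightarrow> integrable lborel (\<lambda>x. (norm (f x))\<^sup>2)"
    if "f \<in> borel_measurable borel" for f :: "'n phase \<Rightarrow> complex"
    using that by (intro integrable_dX) auto
  then show ?thesis by (auto simp: L2_def)
qed

lemma L2_norm_dXdY:
  fixes f :: "'n::finite phase \<times> 'n phase \<Rightarrow> complex"
  assumes "f \<in> L2 lborel"
  shows "L2_norm dXdY f = sqrt (1 / (2 * pi) ^ (2 * CARD('n))) * L2_norm lborel f"
proof -
  have "(\<lambda>x. (norm (f x))\<^sup>2) \<in> borel_measurable borel" using L2_D(1)[OF assms] by simp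
  then show ?thesis unfolding L2_norm_def by (simp only: integral_dXdY real_scaleR_def real_sqrt_mult)
qed

lemma tendsto_mult_left_0_iff:
  fixes c :: real
  assumes "c \<noteq> 0"
  shows "((\<lambda>x. c * f x) \<longlongrightarrow> 0) F \<longleftrightarrow> (f \<longlongrightarrow> 0) F"
  using tendsto_mult_left_iff[OF assms, of f 0 F] by simp

lemma L2_lim_dXdY:
  fixes l :: "'n::finite phase \<times> 'n phase \<Rightarrow> complex"
  shows "L2_lim dXdY f l \<longleftrightarrow> L2_lim lborel f l"
proof -
  have "(\<lambda>n. L2_norm dXdY (\<lambda>x. f n x - l x)) \<longlonglongrightarrow> 0 \<longleftrightarrow> (\<lambda>n. L2_norm lborel (\<lambda>x. f n x - l x)) \<longlonglongrightarrow> 0"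
    if "l \<in> L2 lborel" "\<And>n. f n \<in> L2 lborel"
    by (simp only: L2_norm_dXdY[OF L2_diff[OF that(2,1)]])
       (rule tendsto_mult_left_0_iff, simp)
  then show ?thesis unfolding L2_lim_def L2_dXdY by blast
qed

lemma schwartz_L2_norm_bound:
  fixes f :: "'a::euclidean_space \<Rightarrow> complex"
  assumes "f \<in> schwartz"
  shows "L2_norm lborel f \<le> sqrt (weight_integral TYPE('a)) * schwartz_seminorm (2 * DIM('a)) [] f"
proof -
  have "L2_norm lborel f \<le> sqrt (weight_integral TYPE('a) * (schwartz_seminorm (2 * DIM('a)) [] f)\<^sup>2)"
    unfolding L2_norm_def by (intro real_sqrt_le_mono schwartz_L2_bound(2) assms)
  also have "\<dots> = sqrt (weight_integral TYPE('a)) * schwartz_seminorm (2 * DIM('a)) [] f"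
    using schwartz_seminorm_nonneg[OF assms, of "[]"] by (simp add: real_sqrt_mult)
  finally show ?thesis .
qed

lemma schwartz_lim_L2_norm:
  fixes f :: "'i \<Rightarrow> 'a::euclidean_space \<Rightarrow> complex"
  assumes l: "schwartz_lim F f l"
  shows "((\<lambda>i. L2_norm lborel (\<lambda>x. f i x - l x)) \<longlongrightarrow> 0) F"
proof (rule Lim_null_comparison)
  let ?d = "2 * DIM('a)"
  show "((\<lambda>i. sqrt (weight_integral TYPE('a)) * schwartz_seminorm ?d [] (\<lambda>x. f i x - l x)) \<longlongrightarrow> 0) F"
    using l by (intro tendsto_mult_right_zero) (simp add: schwartz_lim_def)
  have "\<forall>\<^sub>F i in F. f i \<in> schwartz" and lS: "l \<in> schwartz" using l by (simp_all add: schwartz_lim_def)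
  from this(1) show "\<forall>\<^sub>F i in F. norm (L2_norm lborel (\<lambda>x. f i x - l x)) \<le> sqrt (weight_integral TYPE('a)) * schwartz_seminorm ?d [] (\<lambda>x. f i x - l x)"
    by eventually_elim (simp add: L2_norm_nonneg schwartz_L2_norm_bound schwartz_diff lS)
qed

lemma schwartz_lim_L2:
  assumes "schwartz_lim sequentially f l" "\<And>n. f n \<in> schwartz"
  shows "L2_lim lborel f l"
  using schwartz_lim_L2_norm[OF assms(1)] assms by (simp add: L2_lim_def schwartz_L2 schwartz_lim_def)

text \<open>Two density results are nested, S in \<open>L\<^sup>2\<close> and tensor products in S.
  Convergence in S implies convergence in \<open>L\<^sup>2\<close>, so one limit rule serves
  both.\<close>

lemma L2_dXdY_induct:
  fixes F :: "'n::finite phase \<times> 'n phase \<Rightarrow> complex"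
  assumes F: "F \<in> L2 dXdY"
    and base: "\<And>f g. f \<in> schwartz \<Longrightarrow> g \<in> schwartz \<Longrightarrow> P (tensor f g)"
    and add: "\<And>f g. f \<in> L2 dXdY \<Longrightarrow> g \<in> L2 dXdY \<Longrightarrow> P f \<Longrightarrow> P g \<Longrightarrow> P (\<lambda>x. f x + g x)"
    and cmult: "\<And>c f. f \<in> L2 dXdY \<Longrightarrow> P f \<Longrightarrow> P (\<lambda>x. c * f x)"
    and lim: "\<And>f l. L2_lim dXdY f l \<Longrightarrow> (\<And>n. P (f n)) \<Longrightarrow> P l"
  shows "P F"
  using F unfolding L2_dXdY
proof (rule L2_lborel_induct)
  fix F :: "'n phase \<times> 'n phase \<Rightarrow> complex" assume "F \<in> schwartz"
  then show "P F"
  proof (rule schwartz_tensor_induct)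
    show "P l" if "schwartz_lim sequentially f l" "\<And>n. f n \<in> schwartz" "\<And>n. P (f n)" for f l
      using lim[of f l] schwartz_lim_L2[OF that(1,2)] that(3) unfolding L2_lim_dXdY by blast
    show "P (\<lambda>x. f x + h x)" if "f \<in> schwartz" "h \<in> schwartz" "P f" "P h" for f h
      by (rule add) (use that in \<open>simp_all only: L2_dXdY schwartz_L2\<close>)
    show "P (\<lambda>x. c * f x)" if "f \<in> schwartz" "P f" for c f
      by (rule cmult) (use that in \<open>simp_all only: L2_dXdY schwartz_L2\<close>)
    show "P (tensor f g)" if "f \<in> schwartz" "g \<in> schwartz" for f g
      by (rule base[OF that])
  qed
next
  show "P (\<lambda>x. f x + h x)" if "f \<in> L2 lborel" "h \<in> L2 lborel" "P f" "P h" for f h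
    by (rule add) (use that in \<open>simp_all only: L2_dXdY\<close>)
  show "P (\<lambda>x. c * f x)" if "f \<in> L2 lborel" "P f" for c f
    by (rule cmult) (use that in \<open>simp_all only: L2_dXdY\<close>)
  show "P l" if "L2_lim lborel f l" "\<And>n. P (f n)" for f l
    using lim[of f l] that unfolding L2_lim_dXdY by blast
qed

section \<open>The normalised Fourier transform and its transpose\<close>

text \<open>The transpose of \<open>symp_fourier\<close> for the bilinear pairing. Since the form is
  antisymmetric, transposing the kernel amounts to changing the sign of the exponent.\<close>

definition fourier_transpose :: "('n::finite phase \<Rightarrow> complex) \<Rightarrow> 'n phase \<Rightarrow> complex" where
  "fourier_transpose f X = (\<integral>W. ee X W * f W \<partial>dX)"

lemma fourier_transpose_eq:
  fixes f :: "'n::finite phase \<Rightarrow> complex"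
  assumes [measurable]: "f \<in> borel_measurable borel"
  shows "fourier_transpose f X = of_real (1 / (2 * pi) ^ CARD('n)) * osc_int f X"
  unfolding fourier_transpose_def osc_int_def
  by (subst integral_dX) (auto simp: scaleR_conv_of_real mult.commute)

lemma symp_fourier_eq: "symp_fourier f X = fourier_transpose f (- X)"
  by (simp add: symp_fourier_def fourier_transpose_def ee_def sympl_bilinear)

lemma fourier_transpose_schwartz:
  fixes f :: "'n::finite phase \<Rightarrow> complex"
  assumes f: "f \<in> schwartz"
  shows "fourier_transpose f \<in> schwartz"
proof -
  have "fourier_transpose f = (\<lambda>X. of_real (1 / (2 * pi) ^ CARD('n)) * osc_int f X)"
    using fourier_transpose_eq[OF schwartz_measurable[OF f]] by auto
  then show ?thesis by (simp only: schwartz_cmult osc_int_schwartz f)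
qed

lemma symp_fourier_schwartz: "f \<in> schwartz \<Longrightarrow> symp_fourier f \<in> schwartz"
  unfolding symp_fourier_eq[abs_def]
  by (rule schwartz_comp_linear[OF fourier_transpose_schwartz, where c=1]) (auto intro: linear_uminus)

lemma fourier_transpose_twice:
  fixes f :: "'n::finite phase \<Rightarrow> complex"
  assumes f: "f \<in> schwartz"
  shows "fourier_transpose (fourier_transpose f) = f"
proof
  fix X
  let ?c = "complex_of_real (1 / (2 * pi) ^ CARD('n))"
  have 1: "fourier_transpose f = (\<lambda>X. ?c * osc_int f X)"
    using fourier_transpose_eq[OF schwartz_measurable[OF f]] by auto
  have "fourier_transpose (fourier_transpose f) X = ?c * osc_int (fourier_transpose f) X"
    by (rule fourier_transpose_eq[OF schwartz_measurable[OF fourier_transpose_schwartz[OF f]]])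
  also have "\<dots> = ?c * (?c * (of_real ((2 * pi) ^ (2 * CARD('n))) * f X))"
    by (simp only: 1 osc_int_cmult osc_int_twice[OF f])
  also have "\<dots> = complex_of_real (1 / (2 * pi) ^ CARD('n) * (1 / (2 * pi) ^ CARD('n)) * (2 * pi) ^ (2 * CARD('n))) * f X"
    by (simp only: of_real_mult mult.assoc)
  also have "1 / (2 * pi) ^ CARD('n) * (1 / (2 * pi) ^ CARD('n)) * (2 * pi) ^ (2 * CARD('n)) = (1 :: real)"
    unfolding power_even_eq power2_eq_square by simp
  finally show "fourier_transpose (fourier_transpose f) X = f X" by simp
qed

lemma symp_fourier_alt: "symp_fourier g W = (\<integral>X. ee X W * g X \<partial>dX)"
  by (simp add: symp_fourier_def ee_def sympl_antisym[of W])

lemma dX_pair_integrable_bounded: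
  fixes f g :: "'n::finite phase \<Rightarrow> complex"
  assumes "f \<in> schwartz" "g \<in> schwartz" "case_prod k \<in> borel_measurable borel" "\<And>x y. norm (k x y) \<le> C"
  shows "integrable (dX \<Otimes>\<^sub>M dX) (\<lambda>(x, y). f x * g y * k x y)"
proof -
  have i: "integrable lborel (\<lambda>(x, y). f x * g y * k x y)"
    using lborel_integrable_product_bounded[OF schwartz_integrable[OF assms(1)] schwartz_integrable[OF assms(2)] assms(3,4)]
    by (simp add: lborel_prod)
  then show ?thesis unfolding dXdY_def[symmetric] by (subst integrable_dXdY) auto
qed

lemma fourier_transpose_pairing:
  assumes f: "f \<in> schwartz" and g: "g \<in> schwartz"
  shows "(\<integral>X. fourier_transpose f X * g X \<partial>dX) = (\<integral>X. f X * symp_fourier g X \<partial>dX)"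
proof -
  have I: "integrable (dX \<Otimes>\<^sub>M dX) (\<lambda>(X, W). g X * f W * ee X W)"
    by (rule dX_pair_integrable_bounded[OF g f, where C=1]) auto
  have "(\<integral>X. fourier_transpose f X * g X \<partial>dX) = (\<integral>X. (\<integral>W. g X * f W * ee X W \<partial>dX) \<partial>dX)"
    unfolding fourier_transpose_def by (subst integral_mult_left_zero[symmetric]) (simp only: mult_ac)
  also have "\<dots> = (\<integral>W. (\<integral>X. g X * f W * ee X W \<partial>dX) \<partial>dX)"
    by (rule dX_pair.Fubini_integral[OF I, symmetric])
  also have "\<dots> = (\<integral>W. f W * symp_fourier g W \<partial>dX)"
    unfolding symp_fourier_alt integral_mult_right_zero[symmetric] by (simp only: mult_ac)
  finally show ?thesis .
qed

lemma symp_fourier_cnj: "symp_fourier (\<lambda>W. cnj (f W)) X = cnj (fourier_transpose f X)"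
  unfolding symp_fourier_eq fourier_transpose_def
  by (subst Bochner_Integration.integral_cnj[symmetric]) (simp add: ee_minus)

text \<open>The pairing moves the transform from f to the conjugate of the other function, where it
  becomes the conjugate of a second application of the transpose; that one restores g.\<close>

lemma fourier_transpose_L2_inner:
  assumes f: "f \<in> schwartz" and g: "g \<in> schwartz"
  shows "L2_inner dX (fourier_transpose f) (fourier_transpose g) = L2_inner dX f g"
  unfolding L2_inner_def fourier_transpose_pairing[OF f schwartz_cnj[OF fourier_transpose_schwartz[OF g]]]
    symp_fourier_cnj fourier_transpose_twice[OF g] ..

section \<open>Operators determined by their values on tensor products\<close>

lemma schwartz_L2_dX: "f \<in> schwartz \<Longrightarrow> f \<in> L2 dX"
  by (simp add: L2_dX schwartz_L2)

lemma schwartz_L2_dXdY: "F \<in> schwartz \<Longrightarrow> F \<in> L2 dXdY"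
  by (simp add: L2_dXdY schwartz_L2)

lemma tensor_L2: "f \<in> schwartz \<Longrightarrow> g \<in> schwartz \<Longrightarrow> tensor f g \<in> L2 dXdY"
  by (intro schwartz_L2_dXdY schwartz_tensor)

lemma integral_tensor_mult:
  fixes f g h k :: "'n::finite phase \<Rightarrow> complex"
  assumes "f \<in> schwartz" "g \<in> schwartz" "h \<in> schwartz" "k \<in> schwartz"
  shows "(\<integral>Z. tensor f g Z * tensor h k Z \<partial>dXdY) = (\<integral>X. f X * h X \<partial>dX) * (\<integral>Y. g Y * k Y \<partial>dX)"
proof -
  have eq: "(\<lambda>(X, Y). (f X * h X) * (g Y * k Y)) = (\<lambda>Z. tensor f g Z * tensor h k Z)"
    by (auto simp: tensor_def fun_eq_iff)
  have I: "integrable (dX \<Otimes>\<^sub>M dX) (\<lambda>(X, Y). (f X * h X) * (g Y * k Y))"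
    unfolding eq dXdY_def[symmetric] by (intro L2_Cauchy_Schwarz tensor_L2 assms)
  have "(\<integral>Z. tensor f g Z * tensor h k Z \<partial>dXdY) = (\<integral>Z. (case Z of (X, Y) \<Rightarrow> (f X * h X) * (g Y * k Y)) \<partial>(dX \<Otimes>\<^sub>M dX))"
    unfolding eq dXdY_def ..
  also have "\<dots> = (\<integral>X. (\<integral>Y. (f X * h X) * (g Y * k Y) \<partial>dX) \<partial>dX)"
    by (rule dX_pair.integral_fst[OF I, symmetric])
  also have "\<dots> = (\<integral>X. f X * h X \<partial>dX) * (\<integral>Y. g Y * k Y \<partial>dX)"
    by (simp only: integral_mult_right_zero integral_mult_left_zero)
  finally show ?thesis .
qed

lemma tensor_cnj: "(\<lambda>Z. cnj (tensor f g Z)) = tensor (\<lambda>X. cnj (f X)) (\<lambda>Y. cnj (g Y))"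
  by (auto simp: tensor_def)

lemma L2_inner_tensor:
  assumes "f \<in> schwartz" "g \<in> schwartz" "h \<in> schwartz" "k \<in> schwartz"
  shows "L2_inner dXdY (tensor f g) (tensor h k) = L2_inner dX f h * L2_inner dX g k"
  unfolding L2_inner_def tensor_cnj[of h k, unfolded fun_eq_iff, rule_format]
  by (rule integral_tensor_mult) (intro assms schwartz_cnj)+

lemma L2_lim_unique:
  assumes f: "L2_lim \<mu> f l" and g: "L2_lim \<mu> g k" and eq: "\<And>n. AE x in \<mu>. f n x = g n x"
  shows "AE x in \<mu>. l x = k x"
proof -
  have L: "l \<in> L2 \<mu>" "k \<in> L2 \<mu>" "\<And>n. f n \<in> L2 \<mu>" "\<And>n. g n \<in> L2 \<mu>" using f g by (auto simp: L2_lim_def)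
  have "L2_norm \<mu> (\<lambda>x. l x - k x) \<le> L2_norm \<mu> (\<lambda>x. f n x - l x) + L2_norm \<mu> (\<lambda>x. g n x - k x)" for n
  proof -
    have "L2_norm \<mu> (\<lambda>x. f n x - g n x) = 0" using L2_norm_eq_0[OF L(3,4)] eq by simp
    then show ?thesis
      using L2_norm_triangle_diff[OF L(1,3,2), of n] L2_norm_triangle_diff[OF L(3,4,2), of n n]
      by (simp add: L2_norm_minus_commute[of \<mu> l])
  qed
  moreover have "(\<lambda>n. L2_norm \<mu> (\<lambda>x. f n x - l x) + L2_norm \<mu> (\<lambda>x. g n x - k x)) \<longlonglongrightarrow> 0 + 0"
    using f g by (intro tendsto_add) (auto simp: L2_lim_def)
  ultimately have "L2_norm \<mu> (\<lambda>x. l x - k x) \<le> 0 + 0" by (intro LIMSEQ_le_const) auto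
  then show ?thesis using L2_norm_eq_0[OF L(1,2)] L2_norm_nonneg[of \<mu> "\<lambda>x. l x - k x"] by simp
qed

text \<open>Since B is an arbitrary relation here, membership of the approximant in
  \<open>L\<^sup>2\<close> is part of the inductive claim; the triangle inequality depends on
  it.\<close>

lemma L2_lspan_tensor_dense:
  fixes F :: "'n::finite phase \<times> 'n phase \<Rightarrow> complex"
  assumes B: "\<And>f g. f \<in> schwartz \<Longrightarrow> g \<in> schwartz \<Longrightarrow> \<exists>H. B (tensor f g) H"
    and F: "F \<in> L2 dXdY" and e: "0 < e"
  shows "\<exists>g h. L2_lspan B g h \<and> g \<in> L2 dXdY \<and> L2_norm dXdY (\<lambda>x. F x - g x) < e"
proof -
  have "\<forall>e>0. \<exists>g h. L2_lspan B g h \<and> g \<in> L2 dXdY \<and> L2_norm dXdY (\<lambda>x. F x - g x) < e"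
    using F
  proof (rule L2_dXdY_induct)
    fix f g :: "'n phase \<Rightarrow> complex" assume fg: "f \<in> schwartz" "g \<in> schwartz"
    then obtain H where "B (tensor f g) H" using B by blast
    then show "\<forall>e>0. \<exists>p h. L2_lspan B p h \<and> p \<in> L2 dXdY \<and> L2_norm dXdY (\<lambda>x. tensor f g x - p x) < e"
      by (intro allI impI exI[of _ "tensor f g"] exI[of _ H] conjI L2_lspan.base tensor_L2 fg) (auto simp: L2_norm_def)
  next
    fix f g :: "'n phase \<times> 'n phase \<Rightarrow> complex" assume fg: "f \<in> L2 dXdY" "g \<in> L2 dXdY"
      and P: "\<forall>e>0. \<exists>p h. L2_lspan B p h \<and> p \<in> L2 dXdY \<and> L2_norm dXdY (\<lambda>x. f x - p x) < e"
        "\<forall>e>0. \<exists>p h. L2_lspan B p h \<and> p \<in> L2 dXdY \<and> L2_norm dXdY (\<lambda>x. g x - p x) < e"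
    show "\<forall>e>0. \<exists>p h. L2_lspan B p h \<and> p \<in> L2 dXdY \<and> L2_norm dXdY (\<lambda>x. f x + g x - p x) < e"
    proof (intro allI impI)
      fix e :: real assume "0 < e"
      then have e': "0 < e/2" by simp
      obtain p h q k where *: "L2_lspan B p h" "p \<in> L2 dXdY" "L2_norm dXdY (\<lambda>x. f x - p x) < e/2"
          "L2_lspan B q k" "q \<in> L2 dXdY" "L2_norm dXdY (\<lambda>x. g x - q x) < e/2"
        using P(1)[rule_format, OF e'] P(2)[rule_format, OF e'] by blast
      have "L2_norm dXdY (\<lambda>x. (f x - p x) + (g x - q x)) < e"
        using L2_norm_triangle[OF L2_diff[OF fg(1) *(2)] L2_diff[OF fg(2) *(5)]] *(3,6) by simp
      then show "\<exists>p h. L2_lspan B p h \<and> p \<in> L2 dXdY \<and> L2_norm dXdY (\<lambda>x. f x + g x - p x) < e"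
        using L2_lspan.add[OF *(1,4)] L2_add[OF *(2,5)]
        by (intro exI[of _ "\<lambda>x. p x + q x"] exI[of _ "\<lambda>x. h x + k x"]) (simp add: algebra_simps)
    qed
  next
    fix c :: complex and f :: "'n phase \<times> 'n phase \<Rightarrow> complex" assume f: "f \<in> L2 dXdY"
      and P: "\<forall>e>0. \<exists>p h. L2_lspan B p h \<and> p \<in> L2 dXdY \<and> L2_norm dXdY (\<lambda>x. f x - p x) < e"
    show "\<forall>e>0. \<exists>p h. L2_lspan B p h \<and> p \<in> L2 dXdY \<and> L2_norm dXdY (\<lambda>x. c * f x - p x) < e"
    proof (intro allI impI)
      fix e :: real assume e: "0 < e"
      have pos: "0 < 1 + norm c" by (simp add: add_pos_nonneg)
      then have "0 < e / (1 + norm c)" using e by simp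
      then obtain p h where *: "L2_lspan B p h" "p \<in> L2 dXdY" "L2_norm dXdY (\<lambda>x. f x - p x) < e / (1 + norm c)"
        using P by blast
      have "L2_norm dXdY (\<lambda>x. c * f x - c * p x) = norm c * L2_norm dXdY (\<lambda>x. f x - p x)"
        unfolding right_diff_distrib[symmetric] L2_norm_cmult ..
      also have "\<dots> \<le> (1 + norm c) * L2_norm dXdY (\<lambda>x. f x - p x)" by (intro mult_right_mono) (auto simp: L2_norm_nonneg)
      also have "\<dots> < e" using *(3) pos by (simp add: field_simps)
      finally show "\<exists>p h. L2_lspan B p h \<and> p \<in> L2 dXdY \<and> L2_norm dXdY (\<lambda>x. c * f x - p x) < e"
        using L2_lspan.cmult[OF *(1)] L2_cmult[OF *(2)] by blast
    qed
  next
    fix f :: "nat \<Rightarrow> 'n phase \<times> 'n phase \<Rightarrow> complex" and l assume l: "L2_lim dXdY f l"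
      and P: "\<And>n. \<forall>e>0. \<exists>p h. L2_lspan B p h \<and> p \<in> L2 dXdY \<and> L2_norm dXdY (\<lambda>x. f n x - p x) < e"
    show "\<forall>e>0. \<exists>p h. L2_lspan B p h \<and> p \<in> L2 dXdY \<and> L2_norm dXdY (\<lambda>x. l x - p x) < e"
    proof (intro allI impI)
      fix e :: real assume "0 < e"
      then have e': "0 < e/2" by simp
      have L: "l \<in> L2 dXdY" "\<And>n. f n \<in> L2 dXdY" and lim: "(\<lambda>n. L2_norm dXdY (\<lambda>x. f n x - l x)) \<longlonglongrightarrow> 0"
        using l by (auto simp: L2_lim_def)
      from order_tendstoD(2)[OF lim e'] obtain n where n: "L2_norm dXdY (\<lambda>x. f n x - l x) < e/2"
        using eventually_happens' sequentially_bot by blast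
      obtain p h where *: "L2_lspan B p h" "p \<in> L2 dXdY" "L2_norm dXdY (\<lambda>x. f n x - p x) < e/2"
        using P[of n] e' by blast
      have "L2_norm dXdY (\<lambda>x. l x - p x) < e"
        using L2_norm_triangle_diff[OF L(1) L(2)[of n] *(2)] n *(3) L2_norm_minus_commute[of dXdY l "f n"] by simp
      with * show "\<exists>p h. L2_lspan B p h \<and> p \<in> L2 dXdY \<and> L2_norm dXdY (\<lambda>x. l x - p x) < e" by blast
    qed
  qed
  with e show ?thesis by blast
qed

text \<open>The identity of inner products alone makes A compatible with linear relations among
  tensor products: a combination of norm 0 is sent to a combination of norm 0.\<close>

lemma isometry_from_tensors:
  fixes A :: "('n::finite phase \<Rightarrow> complex) \<Rightarrow> ('n phase \<Rightarrow> complex) \<Rightarrow> 'n phase \<times> 'n phase \<Rightarrow> complex"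
  assumes A: "\<And>f g. f \<in> schwartz \<Longrightarrow> g \<in> schwartz \<Longrightarrow> A f g \<in> L2 dXdY"
    and iso: "\<And>f g h k. f \<in> schwartz \<Longrightarrow> g \<in> schwartz \<Longrightarrow> h \<in> schwartz \<Longrightarrow> k \<in> schwartz \<Longrightarrow>
      L2_inner dXdY (A f g) (A h k) = L2_inner dX f h * L2_inner dX g k"
  obtains U where "isometry_on_L2 dXdY U"
    "\<And>f g. f \<in> schwartz \<Longrightarrow> g \<in> schwartz \<Longrightarrow> AE Z in dXdY. U (tensor f g) Z = A f g Z"
proof -
  let ?B = "\<lambda>F H. \<exists>f g. f \<in> schwartz \<and> g \<in> schwartz \<and> F = tensor f g \<and> H = A f g"
  obtain U where U: "isometry_on_L2 dXdY U" "\<And>F H. ?B F H \<Longrightarrow> AE Z in dXdY. U F Z = H Z"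
  proof (rule L2_isometry_extension[of ?B dXdY])
    show "F \<in> L2 dXdY \<and> H \<in> L2 dXdY" if "?B F H" for F H using that A tensor_L2 by blast
    show "L2_inner dXdY H K = L2_inner dXdY F G" if FH: "?B F H" and GK: "?B G K" for F H G K
    proof -
      obtain f g where 1: "f \<in> schwartz" "g \<in> schwartz" "F = tensor f g" "H = A f g" using FH by blast
      obtain h k where 2: "h \<in> schwartz" "k \<in> schwartz" "G = tensor h k" "K = A h k" using GK by blast
      show ?thesis unfolding 1(3,4) 2(3,4) iso[OF 1(1,2) 2(1,2)] L2_inner_tensor[OF 1(1,2) 2(1,2)] ..
    qed
    show "\<exists>g h. L2_lspan ?B g h \<and> L2_norm dXdY (\<lambda>x. F x - g x) < e" if "F \<in> L2 dXdY" "0 < e" for F e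
      using L2_lspan_tensor_dense[of ?B, OF _ that] by blast
  qed (rule that)
  show thesis by (rule that[OF U(1)]) (rule U(2), blast)
qed

text \<open>Both sides are linear and continuous in F, so tensor products decide. With V the
  identity, the conclusion says that G' is the image of G under the transpose of U; this is how
  transposes are computed.\<close>

lemma pairing_eq_from_tensors:
  fixes U V :: "('n::finite phase \<times> 'n phase \<Rightarrow> complex) \<Rightarrow> 'n phase \<times> 'n phase \<Rightarrow> complex"
  assumes U: "isometry_on_L2 dXdY U" and V: "isometry_on_L2 dXdY V" and G: "G \<in> L2 dXdY" "G' \<in> L2 dXdY"
    and eq: "\<And>f g. f \<in> schwartz \<Longrightarrow> g \<in> schwartz \<Longrightarrow>
      (\<integral>Z. U (tensor f g) Z * G Z \<partial>dXdY) = (\<integral>Z. V (tensor f g) Z * G' Z \<partial>dXdY)"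
    and F: "F \<in> L2 dXdY"
  shows "(\<integral>Z. U F Z * G Z \<partial>dXdY) = (\<integral>Z. V F Z * G' Z \<partial>dXdY)"
proof -
  have add: "(\<integral>Z. U (\<lambda>x. f x + g x) Z * G Z \<partial>dXdY) = (\<integral>Z. U f Z * G Z \<partial>dXdY) + (\<integral>Z. U g Z * G Z \<partial>dXdY)"
    if U: "isometry_on_L2 dXdY U" and G: "G \<in> L2 dXdY" and fg: "f \<in> L2 dXdY" "g \<in> L2 dXdY"
    for U :: "('n::finite phase \<times> 'n phase \<Rightarrow> complex) \<Rightarrow> 'n phase \<times> 'n phase \<Rightarrow> complex" and G f g
  proof -
    note u = isometry_on_L2_D(1)[OF U]
    have "(\<integral>Z. U (\<lambda>x. f x + g x) Z * G Z \<partial>dXdY) = (\<integral>Z. U f Z * G Z + U g Z * G Z \<partial>dXdY)"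
    proof (rule integral_cong_AE)
      show "AE Z in dXdY. U (\<lambda>x. f x + g x) Z * G Z = U f Z * G Z + U g Z * G Z"
        using isometry_on_L2_D(3)[OF U fg] by eventually_elim (simp add: distrib_right)
      show "(\<lambda>Z. U (\<lambda>x. f x + g x) Z * G Z) \<in> borel_measurable dXdY"
        by (intro borel_measurable_integrable L2_Cauchy_Schwarz u L2_add fg G)
      show "(\<lambda>Z. U f Z * G Z + U g Z * G Z) \<in> borel_measurable dXdY"
        by (intro borel_measurable_integrable Bochner_Integration.integrable_add L2_Cauchy_Schwarz u fg G)
    qed
    also have "\<dots> = (\<integral>Z. U f Z * G Z \<partial>dXdY) + (\<integral>Z. U g Z * G Z \<partial>dXdY)"
      by (intro Bochner_Integration.integral_add L2_Cauchy_Schwarz u fg G)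
    finally show ?thesis .
  qed
  have cmult: "(\<integral>Z. U (\<lambda>x. c * f x) Z * G Z \<partial>dXdY) = c * (\<integral>Z. U f Z * G Z \<partial>dXdY)"
    if U: "isometry_on_L2 dXdY U" and G: "G \<in> L2 dXdY" and f: "f \<in> L2 dXdY"
    for U :: "('n::finite phase \<times> 'n phase \<Rightarrow> complex) \<Rightarrow> 'n phase \<times> 'n phase \<Rightarrow> complex" and G f c
  proof -
    note u = isometry_on_L2_D(1)[OF U]
    have "(\<integral>Z. U (\<lambda>x. c * f x) Z * G Z \<partial>dXdY) = (\<integral>Z. c * (U f Z * G Z) \<partial>dXdY)"
    proof (rule integral_cong_AE)
      show "AE Z in dXdY. U (\<lambda>x. c * f x) Z * G Z = c * (U f Z * G Z)"
        using isometry_on_L2_D(4)[OF U f, of c] by eventually_elim (simp add: mult.assoc)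
      show "(\<lambda>Z. U (\<lambda>x. c * f x) Z * G Z) \<in> borel_measurable dXdY"
        by (intro borel_measurable_integrable L2_Cauchy_Schwarz u L2_cmult f G)
      show "(\<lambda>Z. c * (U f Z * G Z)) \<in> borel_measurable dXdY"
        by (intro borel_measurable_integrable integrable_mult_right L2_Cauchy_Schwarz u f G)
    qed
    also have "\<dots> = c * (\<integral>Z. U f Z * G Z \<partial>dXdY)" by (rule integral_mult_right_zero)
    finally show ?thesis .
  qed
  show ?thesis
    using F
  proof (rule L2_dXdY_induct)
    fix f l assume l: "L2_lim dXdY f l"
      and eq: "\<And>n. (\<integral>Z. U (f n) Z * G Z \<partial>dXdY) = (\<integral>Z. V (f n) Z * G' Z \<partial>dXdY)"
    show "(\<integral>Z. U l Z * G Z \<partial>dXdY) = (\<integral>Z. V l Z * G' Z \<partial>dXdY)"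
      using L2_lim_pairing[OF L2_lim_isometry[OF U l] G(1)] L2_lim_pairing[OF L2_lim_isometry[OF V l] G(2)]
      unfolding eq by (rule LIMSEQ_unique)
  next
    fix f g assume fg: "f \<in> L2 dXdY" "g \<in> L2 dXdY"
      and "(\<integral>Z. U f Z * G Z \<partial>dXdY) = (\<integral>Z. V f Z * G' Z \<partial>dXdY)" "(\<integral>Z. U g Z * G Z \<partial>dXdY) = (\<integral>Z. V g Z * G' Z \<partial>dXdY)"
    then show "(\<integral>Z. U (\<lambda>x. f x + g x) Z * G Z \<partial>dXdY) = (\<integral>Z. V (\<lambda>x. f x + g x) Z * G' Z \<partial>dXdY)"
      by (simp only: add[OF U G(1) fg] add[OF V G(2) fg])
  next
    fix c f assume f: "f \<in> L2 dXdY" and "(\<integral>Z. U f Z * G Z \<partial>dXdY) = (\<integral>Z. V f Z * G' Z \<partial>dXdY)"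
    then show "(\<integral>Z. U (\<lambda>x. c * f x) Z * G Z \<partial>dXdY) = (\<integral>Z. V (\<lambda>x. c * f x) Z * G' Z \<partial>dXdY)"
      by (simp only: cmult[OF U G(1) f] cmult[OF V G(2) f])
  qed (rule eq)
qed

lemma isometry_id: "isometry_on_L2 \<mu> (\<lambda>f. f)"
  by (simp add: isometry_on_L2_def)

text \<open>The operator that acts by a on the first variable and by b on the second. It is its own
  inverse almost everywhere, since this holds on tensor products, and therefore surjective; a' and
  b' are transposes, which describe it by its pairings. It is applied to Fourier transforms in one
  or in both variables.\<close>

lemma tensor_involution_unitary:
  fixes a b a' b' :: "('n::finite phase \<Rightarrow> complex) \<Rightarrow> 'n phase \<Rightarrow> complex"
  assumes S: "\<And>f. f \<in> schwartz \<Longrightarrow> a f \<in> schwartz" "\<And>f. f \<in> schwartz \<Longrightarrow> b f \<in> schwartz"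
      "\<And>f. f \<in> schwartz \<Longrightarrow> a' f \<in> schwartz" "\<And>f. f \<in> schwartz \<Longrightarrow> b' f \<in> schwartz"
    and inv: "\<And>f. f \<in> schwartz \<Longrightarrow> a (a f) = f" "\<And>f. f \<in> schwartz \<Longrightarrow> b (b f) = f"
    and iso: "\<And>f g. f \<in> schwartz \<Longrightarrow> g \<in> schwartz \<Longrightarrow> L2_inner dX (a f) (a g) = L2_inner dX f g"
      "\<And>f g. f \<in> schwartz \<Longrightarrow> g \<in> schwartz \<Longrightarrow> L2_inner dX (b f) (b g) = L2_inner dX f g"
    and tr: "\<And>f g. f \<in> schwartz \<Longrightarrow> g \<in> schwartz \<Longrightarrow> (\<integral>X. a f X * g X \<partial>dX) = (\<integral>X. f X * a' g X \<partial>dX)"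
      "\<And>f g. f \<in> schwartz \<Longrightarrow> g \<in> schwartz \<Longrightarrow> (\<integral>X. b f X * g X \<partial>dX) = (\<integral>X. f X * b' g X \<partial>dX)"
  obtains U where "unitary_on_L2 dXdY U"
    "\<And>F g h. F \<in> L2 dXdY \<Longrightarrow> g \<in> schwartz \<Longrightarrow> h \<in> schwartz \<Longrightarrow>
      (\<integral>Z. U F Z * tensor g h Z \<partial>dXdY) = (\<integral>Z. F Z * tensor (a' g) (b' h) Z \<partial>dXdY)"
proof -
  obtain U where U: "isometry_on_L2 dXdY U"
    and t: "\<And>f g. f \<in> schwartz \<Longrightarrow> g \<in> schwartz \<Longrightarrow> AE Z in dXdY. U (tensor f g) Z = tensor (a f) (b g) Z"
    by (rule isometry_from_tensors[of "\<lambda>f g. tensor (a f) (b g)"])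
      (auto simp: L2_inner_tensor S iso intro: tensor_L2)
  note u = isometry_on_L2_D[OF U]
  have UU: "AE Z in dXdY. U (U G) Z = G Z" if "G \<in> L2 dXdY" for G
    using that
  proof (rule L2_dXdY_induct)
    fix f g :: "'n phase \<Rightarrow> complex" assume fg: "f \<in> schwartz" "g \<in> schwartz"
    show "AE Z in dXdY. U (U (tensor f g)) Z = tensor f g Z"
      using u(2)[OF u(1)[OF tensor_L2[OF fg]] tensor_L2[OF S(1)[OF fg(1)] S(2)[OF fg(2)]] t[OF fg]]
        t[OF S(1)[OF fg(1)] S(2)[OF fg(2)]]
      by eventually_elim (simp add: inv fg)
  next
    fix f g assume fg: "f \<in> L2 dXdY" "g \<in> L2 dXdY" and P: "AE Z in dXdY. U (U f) Z = f Z" "AE Z in dXdY. U (U g) Z = g Z"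
    show "AE Z in dXdY. U (U (\<lambda>x. f x + g x)) Z = f Z + g Z"
      using u(2)[OF u(1)[OF L2_add[OF fg]] L2_add[OF u(1)[OF fg(1)] u(1)[OF fg(2)]] u(3)[OF fg]]
        u(3)[OF u(1)[OF fg(1)] u(1)[OF fg(2)]] P
      by eventually_elim simp
  next
    fix c f assume f: "f \<in> L2 dXdY" and P: "AE Z in dXdY. U (U f) Z = f Z"
    show "AE Z in dXdY. U (U (\<lambda>x. c * f x)) Z = c * f Z"
      using u(2)[OF u(1)[OF L2_cmult[OF f]] L2_cmult[OF u(1)[OF f]] u(4)[OF f, of c]] u(4)[OF u(1)[OF f], of c] P
      by eventually_elim simp
  next
    fix f l assume l: "L2_lim dXdY f l" and P: "\<And>n. AE Z in dXdY. U (U (f n)) Z = f n Z"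
    show "AE Z in dXdY. U (U l) Z = l Z"
      by (rule L2_lim_unique[OF L2_lim_isometry[OF U L2_lim_isometry[OF U l]] l P])
  qed
  have "unitary_on_L2 dXdY U"
    unfolding unitary_on_L2_iff using U UU u(1) by blast
  moreover have "(\<integral>Z. U F Z * tensor g h Z \<partial>dXdY) = (\<integral>Z. F Z * tensor (a' g) (b' h) Z \<partial>dXdY)"
    if F: "F \<in> L2 dXdY" and gh: "g \<in> schwartz" "h \<in> schwartz" for F g h
    using F
  proof (rule pairing_eq_from_tensors[OF U isometry_id, rotated 3])
    fix p q :: "'n phase \<Rightarrow> complex" assume pq: "p \<in> schwartz" "q \<in> schwartz"
    have "(\<integral>Z. U (tensor p q) Z * tensor g h Z \<partial>dXdY) = (\<integral>Z. tensor (a p) (b q) Z * tensor g h Z \<partial>dXdY)"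
    proof (rule integral_cong_AE)
      show "AE Z in dXdY. U (tensor p q) Z * tensor g h Z = tensor (a p) (b q) Z * tensor g h Z"
        using t[OF pq] by eventually_elim simp
    qed (intro borel_measurable_integrable L2_Cauchy_Schwarz u tensor_L2 pq gh S)+
    then show "(\<integral>Z. U (tensor p q) Z * tensor g h Z \<partial>dXdY) = (\<integral>Z. tensor p q Z * tensor (a' g) (b' h) Z \<partial>dXdY)"
      by (simp only: integral_tensor_mult S pq gh tr)
  qed (intro tensor_L2 gh S)+
  ultimately show thesis by (rule that)
qed

section \<open>Uniqueness and existence of the maps determined by a form on tensor products\<close>

text \<open>Density is used once per argument: first in the test function, on which the value of T
  is a continuous functional, then in F. For the latter, a one-element set is bounded, so strong
  convergence contains convergence at each test function.\<close>

lemma tempered_bilinear_unique: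
  fixes b :: "('n::finite phase \<Rightarrow> complex) \<Rightarrow> ('n phase \<Rightarrow> complex) \<Rightarrow> ('n phase \<Rightarrow> complex) \<Rightarrow> ('n phase \<Rightarrow> complex) \<Rightarrow> complex"
  assumes T: "determined_by b T" and T': "determined_by b T'"
  shows "T = T'"
proof -
  have D: "T \<in> schwartz \<rightarrow>\<^sub>E tempered" "\<And>G. G \<in> schwartz \<Longrightarrow> linear_form_on schwartz (\<lambda>F. T F G)"
    "continuous_map schwartz_topology tempered_topology T"
    "\<And>f1 f2 g1 g2. f1 \<in> schwartz \<Longrightarrow> f2 \<in> schwartz \<Longrightarrow> g1 \<in> schwartz \<Longrightarrow> g2 \<in> schwartz \<Longrightarrow> T (tensor f1 f2) (tensor g1 g2) = b f1 f2 g1 g2"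
    if "determined_by b T" for T
    using that by (auto simp: determined_by_def)
  have mem: "T F \<in> tempered" if "determined_by b T" "F \<in> schwartz" for T F using D(1)[OF that(1)] that(2) by auto
  have lim1: "(\<lambda>n. T (F n) G) \<longlonglongrightarrow> T L G"
    if T: "determined_by b T" and L: "schwartz_lim sequentially F L" and G: "G \<in> schwartz" for T F L G
  proof (rule tendstoI)
    fix e :: real assume e: "0 < e"
    have LS: "L \<in> schwartz" using L by (simp add: schwartz_lim_def)
    have lim: "limitin tempered_topology (T \<circ> F) (T L) sequentially"
      by (rule continuous_map_limit[OF D(3)[OF T]]) (use L in \<open>simp add: schwartz_lim_iff\<close>)
    have "schwartz_bounded {G}" using G by (auto simp: schwartz_bounded_def)
    then have p: "(\<lambda>u. SUP \<phi>\<in>{G}. norm (u \<phi> :: complex)) \<in> {\<lambda>u. SUP \<phi>\<in>B. norm (u \<phi>) | B. schwartz_bounded B \<and> B \<noteq> {}}" by blast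
    have "\<forall>\<^sub>F n in sequentially. (T \<circ> F) n \<in> tempered \<and> (SUP \<phi>\<in>{G}. norm ((T \<circ> F) n \<phi> - T L \<phi>)) < e"
      by (rule limitin_seminorm_topologyD[OF lim[unfolded tempered_topology_def] p mem[OF T LS] _ e]) simp
    then show "\<forall>\<^sub>F n in sequentially. dist (T (F n) G) (T L G) < e"
      by (auto elim!: eventually_mono simp: dist_norm)
  qed
  have 1: "T (tensor f g) G = T' (tensor f g) G" if fg: "f \<in> schwartz" "g \<in> schwartz" and G: "G \<in> schwartz" for f g G
    using G
  proof (rule schwartz_tensor_induct)
    note m = mem[OF T schwartz_tensor[OF fg]] and m' = mem[OF T' schwartz_tensor[OF fg]]
    show "T (tensor f g) (tensor h k) = T' (tensor f g) (tensor h k)" if "h \<in> schwartz" "k \<in> schwartz" for h k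
      by (simp only: D(4)[OF T fg that] D(4)[OF T' fg that])
    show "T (tensor f g) (\<lambda>x. h x + k x) = T' (tensor f g) (\<lambda>x. h x + k x)" if "h \<in> schwartz" "k \<in> schwartz"
      "T (tensor f g) h = T' (tensor f g) h" "T (tensor f g) k = T' (tensor f g) k" for h k
      by (simp only: temperedD(1)[OF m that(1,2)] temperedD(1)[OF m' that(1,2)] that(3,4))
    show "T (tensor f g) (\<lambda>x. c * h x) = T' (tensor f g) (\<lambda>x. c * h x)" if "h \<in> schwartz" "T (tensor f g) h = T' (tensor f g) h" for c h
      by (simp only: temperedD(2)[OF m that(1)] temperedD(2)[OF m' that(1)] that(2))
    show "T (tensor f g) l = T' (tensor f g) l" if l: "schwartz_lim sequentially h l"
      and eq: "\<And>n. T (tensor f g) (h n) = T' (tensor f g) (h n)" for h l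
      using temperedD(3)[OF m l] temperedD(3)[OF m' l] unfolding eq by (rule LIMSEQ_unique)
  qed
  have 2: "T F G = T' F G" if F: "F \<in> schwartz" and G: "G \<in> schwartz" for F G
    using F
  proof (rule schwartz_tensor_induct)
    note l = D(2)[OF T G] and l' = D(2)[OF T' G]
    show "T (tensor f g) G = T' (tensor f g) G" if "f \<in> schwartz" "g \<in> schwartz" for f g by (rule 1[OF that G])
    show "T (\<lambda>x. h x + k x) G = T' (\<lambda>x. h x + k x) G" if "h \<in> schwartz" "k \<in> schwartz" "T h G = T' h G" "T k G = T' k G" for h k
      using linear_form_onD(1)[OF l that(1,2)] linear_form_onD(1)[OF l' that(1,2)] that(3,4) by simp
    show "T (\<lambda>x. c * h x) G = T' (\<lambda>x. c * h x) G" if "h \<in> schwartz" "T h G = T' h G" for c h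
      using linear_form_onD(2)[OF l that(1), of c] linear_form_onD(2)[OF l' that(1), of c] that(2) by simp
    show "T k G = T' k G" if k: "schwartz_lim sequentially h k" and eq: "\<And>n. T (h n) G = T' (h n) G" for h k
      using lim1[OF T k G] lim1[OF T' k G] unfolding eq by (rule LIMSEQ_unique)
  qed
  have 3: "T F = T' F" if F: "F \<in> schwartz" for F
  proof (rule extensionalityI[of _ schwartz])
    show "T F \<in> extensional schwartz" "T' F \<in> extensional schwartz"
      using mem[OF T F] mem[OF T' F] by (auto simp: tempered_def)
  qed (rule 2[OF F])
  show ?thesis
  proof (rule extensionalityI[of _ schwartz])
    show "T \<in> extensional schwartz" "T' \<in> extensional schwartz" using D(1)[OF T] D(1)[OF T'] by (auto simp: PiE_def)
  qed (rule 3)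
qed

lemma distr_of_tempered:
  fixes F :: "'n::finite phase \<times> 'n phase \<Rightarrow> complex"
  assumes F: "F \<in> L2 dXdY"
  shows "distr_of dXdY F \<in> tempered"
proof -
  let ?d = "2 * DIM('n phase \<times> 'n phase)"
  let ?w = "weight_integral TYPE('n phase \<times> 'n phase)"
  let ?c = "sqrt (1 / (2 * pi) ^ (2 * CARD('n))) * sqrt ?w"
  show ?thesis
  proof (rule temperedI[where k="?d" and C="L2_norm dXdY F * ?c"])
    show "distr_of dXdY F \<in> extensional schwartz" by (simp add: distr_of_def)
    note i = L2_Cauchy_Schwarz(1)[OF F schwartz_L2_dXdY]
    show "linear_form_on schwartz (distr_of dXdY F)"
      unfolding linear_form_on_def
    proof (intro conjI ballI allI)
      show "distr_of dXdY F (\<lambda>x. f x + g x) = distr_of dXdY F f + distr_of dXdY F g" if "f \<in> schwartz" "g \<in> schwartz" for f g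
        by (simp add: distr_of_def that schwartz_add distrib_left Bochner_Integration.integral_add[OF i[OF that(1)] i[OF that(2)]])
      show "distr_of dXdY F (\<lambda>x. c * f x) = c * distr_of dXdY F f" if "f \<in> schwartz" for f c
        by (simp add: distr_of_def that schwartz_cmult mult.left_commute[of _ c])
    qed
    show "norm (distr_of dXdY F f) \<le> L2_norm dXdY F * ?c * schwartz_seminorm ?d [] f" if f: "f \<in> schwartz" for f
    proof -
      have "L2_norm dXdY f \<le> ?c * schwartz_seminorm ?d [] f"
        unfolding L2_norm_dXdY[OF schwartz_L2[OF f]] mult.assoc
        by (intro mult_left_mono schwartz_L2_norm_bound f) simp
      then have "L2_norm dXdY F * L2_norm dXdY f \<le> L2_norm dXdY F * (?c * schwartz_seminorm ?d [] f)"
        by (intro mult_left_mono L2_norm_nonneg)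
      moreover have "norm (distr_of dXdY F f) \<le> L2_norm dXdY F * L2_norm dXdY f"
        using L2_Cauchy_Schwarz(3)[OF F schwartz_L2_dXdY[OF f]] f by (simp add: distr_of_def)
      ultimately show ?thesis by (simp only: mult.assoc)
    qed
  qed
qed

lemma schwartz_lim_L2_norm_dXdY:
  fixes f :: "'i \<Rightarrow> 'n::finite phase \<times> 'n phase \<Rightarrow> complex"
  assumes l: "schwartz_lim F f l"
  shows "((\<lambda>i. L2_norm dXdY (\<lambda>x. f i x - l x)) \<longlongrightarrow> 0) F"
proof (rule Lim_transform_eventually)
  let ?c = "sqrt (1 / (2 * pi) ^ (2 * CARD('n)))"
  show "((\<lambda>i. ?c * L2_norm lborel (\<lambda>x. f i x - l x)) \<longlongrightarrow> 0) F"
    by (rule tendsto_mult_right_zero[OF schwartz_lim_L2_norm[OF l]])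
  have "\<forall>\<^sub>F i in F. f i \<in> schwartz" and lS: "l \<in> schwartz" using l by (simp_all add: schwartz_lim_def)
  from this(1) show "\<forall>\<^sub>F i in F. ?c * L2_norm lborel (\<lambda>x. f i x - l x) = L2_norm dXdY (\<lambda>x. f i x - l x)"
    by eventually_elim (simp only: L2_norm_dXdY[OF schwartz_L2[OF schwartz_diff[OF _ lS]]])
qed

text \<open>Continuity into the strong dual means uniformity over bounded sets of test functions. By
  Cauchy-Schwarz the difference of two values is at most the \<open>L\<^sup>2\<close> distance of
  the arguments times the norm of the test function, and these norms are bounded on a bounded
  set.\<close>

lemma determined_by_isometry:
  fixes U :: "('n::finite phase \<times> 'n phase \<Rightarrow> complex) \<Rightarrow> 'n phase \<times> 'n phase \<Rightarrow> complex"
  assumes U: "isometry_on_L2 dXdY U"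
    and b: "\<And>f1 f2 g1 g2. f1 \<in> schwartz \<Longrightarrow> f2 \<in> schwartz \<Longrightarrow> g1 \<in> schwartz \<Longrightarrow> g2 \<in> schwartz \<Longrightarrow>
      (\<integral>Z. U (tensor f1 f2) Z * tensor g1 g2 Z \<partial>dXdY) = b f1 f2 g1 g2"
  shows "determined_by b (\<lambda>F\<in>schwartz. distr_of dXdY (U F))"
proof -
  let ?T = "\<lambda>F\<in>schwartz. distr_of dXdY (U F)"
  note u = isometry_on_L2_D[OF U]
  have UF: "U F \<in> L2 dXdY" if "F \<in> schwartz" for F by (intro u schwartz_L2_dXdY that)
  have TF: "?T F G = (\<integral>Z. U F Z * G Z \<partial>dXdY)" if "F \<in> schwartz" "G \<in> schwartz" for F G
    using that by (simp add: distr_of_def)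
  have m: "(\<lambda>Z. U F Z * G Z) \<in> borel_measurable dXdY" if "F \<in> schwartz" "G \<in> schwartz" for F G
    by (intro borel_measurable_integrable L2_Cauchy_Schwarz UF schwartz_L2_dXdY that)
  have lin: "linear_form_on schwartz (\<lambda>F. ?T F G)" if G: "G \<in> schwartz" for G
    unfolding linear_form_on_def
  proof (intro conjI ballI allI)
    fix f g :: "'n phase \<times> 'n phase \<Rightarrow> complex" assume fg: "f \<in> schwartz" "g \<in> schwartz"
    note i = L2_Cauchy_Schwarz(1)[OF UF schwartz_L2_dXdY[OF G]]
    have "?T (\<lambda>x. f x + g x) G = (\<integral>Z. U f Z * G Z + U g Z * G Z \<partial>dXdY)"
      unfolding TF[OF schwartz_add[OF fg] G]
    proof (rule integral_cong_AE)
      show "AE Z in dXdY. U (\<lambda>x. f x + g x) Z * G Z = U f Z * G Z + U g Z * G Z"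
        using u(3)[OF fg[THEN schwartz_L2_dXdY]] by eventually_elim (simp add: distrib_right)
    qed (intro m schwartz_add fg G borel_measurable_add)+
    also have "\<dots> = ?T f G + ?T g G"
      unfolding TF[OF fg(1) G] TF[OF fg(2) G] by (rule Bochner_Integration.integral_add[OF i[OF fg(1)] i[OF fg(2)]])
    finally show "?T (\<lambda>x. f x + g x) G = ?T f G + ?T g G" .
  next
    fix c and f :: "'n phase \<times> 'n phase \<Rightarrow> complex" assume f: "f \<in> schwartz"
    have "?T (\<lambda>x. c * f x) G = (\<integral>Z. c * (U f Z * G Z) \<partial>dXdY)"
      unfolding TF[OF schwartz_cmult[OF f] G]
    proof (rule integral_cong_AE)
      show "AE Z in dXdY. U (\<lambda>x. c * f x) Z * G Z = c * (U f Z * G Z)"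
        using u(4)[OF schwartz_L2_dXdY[OF f], of c] by eventually_elim (simp add: mult.assoc)
    qed (intro m schwartz_cmult f G borel_measurable_times borel_measurable_const)+
    also have "\<dots> = c * ?T f G" unfolding TF[OF f G] by (rule integral_mult_right_zero)
    finally show "?T (\<lambda>x. c * f x) G = c * ?T f G" .
  qed
  have cont: "continuous_map schwartz_topology tempered_topology ?T"
    unfolding continuous_map_atin
  proof (rule ballI)
    fix F :: "'n phase \<times> 'n phase \<Rightarrow> complex" assume "F \<in> topspace schwartz_topology"
    then have F: "F \<in> schwartz" by simp
    let ?A = "atin schwartz_topology F"
    have lim: "schwartz_lim ?A (\<lambda>g. g) F" by (rule schwartz_lim_atin[OF F])
    then have ev: "\<forall>\<^sub>F g in ?A. g \<in> schwartz" by (simp add: schwartz_lim_def)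
    show "limitin tempered_topology ?T (?T F) ?A"
      unfolding tempered_topology_def
    proof (rule limitin_seminorm_topology)
      have "schwartz_bounded {F}" using F by (auto simp: schwartz_bounded_def)
      then show "{\<lambda>u. SUP \<phi>\<in>B. norm (u \<phi> :: complex) | B. schwartz_bounded (B :: ('n phase \<times> 'n phase \<Rightarrow> complex) set) \<and> B \<noteq> {}} \<noteq> {}"
        by blast
      show "?T F \<in> tempered" using distr_of_tempered[OF UF[OF F]] F by simp
      show "\<forall>\<^sub>F g in ?A. ?T g \<in> tempered"
        using ev by eventually_elim (simp add: distr_of_tempered UF)
    next
      fix p assume "p \<in> {\<lambda>u. SUP \<phi>\<in>B. norm (u \<phi> :: complex) | B. schwartz_bounded (B :: ('n phase \<times> 'n phase \<Rightarrow> complex) set) \<and> B \<noteq> {}}"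
      then obtain B :: "('n phase \<times> 'n phase \<Rightarrow> complex) set" where p: "p = (\<lambda>u. SUP \<phi>\<in>B. norm (u \<phi> :: complex))" and B: "schwartz_bounded B" "B \<noteq> {}" by blast
      have BS: "\<phi> \<in> schwartz" if "\<phi> \<in> B" for \<phi> using B(1) that by (auto simp: schwartz_bounded_def)
      show "p (\<lambda>x. 0) = 0" using B(2) by (simp add: p)
      show "p (\<lambda>x. g x - k x) \<le> p (\<lambda>x. g x - h x) + p (\<lambda>x. h x - k x)"
        if T: "g \<in> tempered" "h \<in> tempered" "k \<in> tempered" for g h k
        unfolding p
      proof (rule cSUP_least[OF B(2)])
        \<comment> \<open>A real supremum obeys the triangle inequality only over sets bounded
          above, which tempered distributions guarantee on bounded sets.\<close>
        have bd: "bdd_above ((\<lambda>\<phi>. norm (u \<phi> - v \<phi>)) ` B)" if uv: "u \<in> tempered" "v \<in> tempered" for u v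
        proof -
          obtain M N where "\<And>\<phi>. \<phi> \<in> B \<Longrightarrow> norm (u \<phi>) \<le> M" "\<And>\<phi>. \<phi> \<in> B \<Longrightarrow> norm (v \<phi>) \<le> N"
            using tempered_bounded[OF uv(1) B(1)] tempered_bounded[OF uv(2) B(1)] by (auto simp: bdd_above_def)
          then show ?thesis
            by (intro bdd_aboveI2[of _ _ "M + N"] order_trans[OF norm_triangle_ineq4] add_mono) auto
        qed
        fix \<phi> assume \<phi>: "\<phi> \<in> B"
        have "norm (g \<phi> - k \<phi>) \<le> norm (g \<phi> - h \<phi>) + norm (h \<phi> - k \<phi>)"
          using norm_triangle_ineq[of "g \<phi> - h \<phi>" "h \<phi> - k \<phi>"] by simp
        also have "\<dots> \<le> (SUP \<phi>\<in>B. norm (g \<phi> - h \<phi>)) + (SUP \<phi>\<in>B. norm (h \<phi> - k \<phi>))"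
          by (intro add_mono cSUP_upper \<phi> bd T)
        finally show "norm (g \<phi> - k \<phi>) \<le> (SUP \<phi>\<in>B. norm (g \<phi> - h \<phi>)) + (SUP \<phi>\<in>B. norm (h \<phi> - k \<phi>))" .
      qed
      let ?d = "2 * DIM('n phase \<times> 'n phase)"
      let ?w = "weight_integral TYPE('n phase \<times> 'n phase)"
      have "bdd_above (schwartz_seminorm ?d [] ` B)" using B(1) unfolding schwartz_bounded_def by (metis lists.Nil)
      then obtain M where M: "\<And>\<phi>. \<phi> \<in> B \<Longrightarrow> schwartz_seminorm ?d [] \<phi> \<le> M" by (auto simp: bdd_above_def)
      \<comment> \<open>A common bound for the \<open>L\<^sup>2\<close> norms of all test functions
        in B, from the bound M on a single seminorm.\<close>
      let ?K = "sqrt (1 / (2 * pi) ^ (2 * CARD('n))) * (sqrt ?w * M)"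
      have nB: "L2_norm dXdY \<phi> \<le> ?K" if "\<phi> \<in> B" for \<phi>
        unfolding L2_norm_dXdY[OF schwartz_L2[OF BS[OF that]]]
        by (intro mult_left_mono order_trans[OF schwartz_L2_norm_bound[OF BS[OF that]]] M that)
           (simp_all add: weight_integral_nonneg)
      show "((\<lambda>g. p (\<lambda>x. ?T g x - ?T F x)) \<longlongrightarrow> 0) ?A"
      proof (rule Lim_null_comparison)
        show "((\<lambda>g. L2_norm dXdY (\<lambda>x. g x - F x) * ?K) \<longlongrightarrow> 0) ?A"
          by (intro tendsto_mult_left_zero schwartz_lim_L2_norm_dXdY lim)
        show "\<forall>\<^sub>F g in ?A. norm (p (\<lambda>x. ?T g x - ?T F x)) \<le> L2_norm dXdY (\<lambda>x. g x - F x) * ?K"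
          using ev
        proof eventually_elim
          case (elim g)
          have le: "norm (?T g \<phi> - ?T F \<phi>) \<le> L2_norm dXdY (\<lambda>x. g x - F x) * ?K" if \<phi>: "\<phi> \<in> B" for \<phi>
          proof -
            note i = L2_Cauchy_Schwarz(1)[OF UF schwartz_L2_dXdY[OF BS[OF \<phi>]]]
            have "?T g \<phi> - ?T F \<phi> = (\<integral>Z. (U g Z - U F Z) * \<phi> Z \<partial>dXdY)"
              unfolding TF[OF elim BS[OF \<phi>]] TF[OF F BS[OF \<phi>]] left_diff_distrib
              by (rule Bochner_Integration.integral_diff[OF i[OF elim] i[OF F], symmetric])
            also have "norm \<dots> \<le> L2_norm dXdY (\<lambda>Z. U g Z - U F Z) * L2_norm dXdY \<phi>"
              by (intro L2_Cauchy_Schwarz L2_diff UF elim F schwartz_L2_dXdY BS \<phi>)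
            also have "\<dots> = L2_norm dXdY (\<lambda>x. g x - F x) * L2_norm dXdY \<phi>"
              by (simp only: isometry_on_L2_dist[OF U schwartz_L2_dXdY[OF elim] schwartz_L2_dXdY[OF F]])
            also have "\<dots> \<le> L2_norm dXdY (\<lambda>x. g x - F x) * ?K"
              by (intro mult_left_mono nB \<phi> L2_norm_nonneg)
            finally show ?thesis .
          qed
          obtain \<phi> where \<phi>: "\<phi> \<in> B" using B(2) by blast
          have "0 \<le> norm (?T g \<phi> - ?T F \<phi>)" by simp
          also have "\<dots> \<le> p (\<lambda>x. ?T g x - ?T F x)"
            unfolding p by (rule cSUP_upper[OF \<phi>]) (rule bdd_aboveI2, rule le)
          finally have "0 \<le> p (\<lambda>x. ?T g x - ?T F x)" .
          moreover have "p (\<lambda>x. ?T g x - ?T F x) \<le> L2_norm dXdY (\<lambda>x. g x - F x) * ?K"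
            unfolding p by (rule cSUP_least[OF B(2)]) (rule le)
          ultimately show ?case by simp
        qed
      qed
    qed
  qed
  show ?thesis
    unfolding determined_by_def
  proof (intro conjI ballI lin cont)
    show "?T \<in> schwartz \<rightarrow>\<^sub>E tempered" by (auto simp: distr_of_tempered UF)
    show "?T (tensor f1 f2) (tensor g1 g2) = b f1 f2 g1 g2"
      if "f1 \<in> schwartz" "f2 \<in> schwartz" "g1 \<in> schwartz" "g2 \<in> schwartz" for f1 f2 g1 g2
      using TF[OF schwartz_tensor[OF that(1,2)] schwartz_tensor[OF that(3,4)]] b[OF that] by simp
  qed
qed

section \<open>Measure-preserving changes of variables\<close>

lemma nn_integral_dX_affine:
  fixes f :: "'n::finite phase \<Rightarrow> ennreal"
  assumes f: "f \<in> borel_measurable borel" and c: "\<bar>c\<bar> = 1"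
  shows "(\<integral>\<^sup>+x. f (t + c *\<^sub>R x) \<partial>dX) = (\<integral>\<^sup>+x. f x \<partial>dX)"
proof -
  have [measurable]: "f \<in> borel_measurable borel" by (rule f)
  have "(\<integral>\<^sup>+x. f x \<partial>lborel) = (\<integral>\<^sup>+x. f (t + c *\<^sub>R x) \<partial>lborel)"
    by (subst lborel_affine[of c t]) (use c in \<open>auto simp: nn_integral_density nn_integral_distr\<close>)
  then show ?thesis unfolding dX_def by (simp add: nn_integral_density nn_integral_cmult)
qed

lemma dXdY_distr_eqI:
  fixes T :: "'n::finite phase \<times> 'n phase \<Rightarrow> 'n phase \<times> 'n phase"
  assumes T: "T \<in> borel_measurable borel"
    and eq: "\<And>f :: 'n phase \<times> 'n phase \<Rightarrow> ennreal. f \<in> borel_measurable borel \<Longrightarrow> (\<integral>\<^sup>+Z. f (T Z) \<partial>dXdY) = (\<integral>\<^sup>+Z. f Z \<partial>dXdY)"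
  shows "distr dXdY dXdY T = dXdY"
proof (rule measure_eqI)
  fix A assume "A \<in> sets (distr dXdY dXdY T)"
  then have A: "A \<in> sets borel" by simp
  have TM: "T \<in> measurable dXdY dXdY" using T by (simp cong: measurable_cong_sets)
  have "emeasure (distr dXdY dXdY T) A = (\<integral>\<^sup>+Z. indicator A Z \<partial>distr dXdY dXdY T)" using A by simp
  also have "\<dots> = (\<integral>\<^sup>+Z. indicator A (T Z) \<partial>dXdY)" using A TM by (subst nn_integral_distr) auto
  also have "\<dots> = (\<integral>\<^sup>+Z. indicator A Z \<partial>dXdY)" using A by (intro eq) auto
  also have "\<dots> = emeasure dXdY A" using A by simp
  finally show "emeasure (distr dXdY dXdY T) A = emeasure dXdY A" .
qed simp

lemma nn_integral_dXdY:
  fixes f :: "'n::finite phase \<times> 'n phase \<Rightarrow> ennreal"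
  assumes "f \<in> borel_measurable borel"
  shows "(\<integral>\<^sup>+Z. f Z \<partial>dXdY) = (\<integral>\<^sup>+X. \<integral>\<^sup>+Y. f (X, Y) \<partial>dX \<partial>dX)"
    "(\<integral>\<^sup>+Z. f Z \<partial>dXdY) = (\<integral>\<^sup>+Y. \<integral>\<^sup>+X. f (X, Y) \<partial>dX \<partial>dX)"
proof -
  have m: "f \<in> borel_measurable (dX \<Otimes>\<^sub>M dX)" using assms unfolding dXdY_def[symmetric] by simp
  show "(\<integral>\<^sup>+Z. f Z \<partial>dXdY) = (\<integral>\<^sup>+X. \<integral>\<^sup>+Y. f (X, Y) \<partial>dX \<partial>dX)"
    unfolding dXdY_def by (rule dX.nn_integral_fst[OF m, symmetric])
  show "(\<integral>\<^sup>+Z. f Z \<partial>dXdY) = (\<integral>\<^sup>+Y. \<integral>\<^sup>+X. f (X, Y) \<partial>dX \<partial>dX)"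
    unfolding dXdY_def by (rule dX_pair.nn_integral_snd[OF m, symmetric])
qed

lemma C_change_measurable [measurable]: "C_change \<in> borel_measurable borel"
  unfolding C_change_def case_prod_beta by (intro borel_measurable_continuous_onI continuous_intros)

text \<open>The change is triangular: for fixed X a reflected translation in Y, followed by a
  reflection in X, each of which preserves dX.\<close>

lemma distr_C_change: "distr dXdY dXdY C_change = (dXdY :: ('n::finite phase \<times> 'n phase) measure)"
proof (rule dXdY_distr_eqI[OF C_change_measurable])
  fix f :: "'n phase \<times> 'n phase \<Rightarrow> ennreal" assume f [measurable]: "f \<in> borel_measurable borel"
  have [measurable]: "f \<in> borel_measurable (borel \<Otimes>\<^sub>M borel)" by (simp add: borel_prod)
  have s: "(\<lambda>Y. f (X, Y)) \<in> borel_measurable borel" for X by measurable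
  have g: "(\<lambda>X. \<integral>\<^sup>+Y. f (X, Y) \<partial>dX) \<in> borel_measurable borel" by measurable
  have "(\<integral>\<^sup>+Z. f (C_change Z) \<partial>dXdY) = (\<integral>\<^sup>+X. \<integral>\<^sup>+Y. f (- X, X + (-1) *\<^sub>R Y) \<partial>dX \<partial>dX)"
    by (subst nn_integral_dXdY(1)[OF measurable_compose[OF C_change_measurable f]]) (simp add: C_change_def)
  also have "\<dots> = (\<integral>\<^sup>+X. \<integral>\<^sup>+Y. f (0 + (-1) *\<^sub>R X, Y) \<partial>dX \<partial>dX)"
    by (subst nn_integral_dX_affine[OF s]) auto
  also have "\<dots> = (\<integral>\<^sup>+X. \<integral>\<^sup>+Y. f (X, Y) \<partial>dX \<partial>dX)"
    by (rule nn_integral_dX_affine[OF g]) simp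
  also have "\<dots> = (\<integral>\<^sup>+Z. f Z \<partial>dXdY)" by (rule nn_integral_dXdY(1)[OF f, symmetric])
  finally show "(\<integral>\<^sup>+Z. f (C_change Z) \<partial>dXdY) = (\<integral>\<^sup>+Z. f Z \<partial>dXdY)" .
qed

lemma distr_swap: "distr dXdY dXdY prod.swap = (dXdY :: ('n::finite phase \<times> 'n phase) measure)"
proof (rule dXdY_distr_eqI)
  show m: "prod.swap \<in> borel_measurable borel"
    unfolding prod.swap_def by (intro borel_measurable_continuous_onI continuous_intros)
  fix f :: "'n phase \<times> 'n phase \<Rightarrow> ennreal" assume f [measurable]: "f \<in> borel_measurable borel"
  have "(\<integral>\<^sup>+Z. f (prod.swap Z) \<partial>dXdY) = (\<integral>\<^sup>+Y. \<integral>\<^sup>+X. f (Y, X) \<partial>dX \<partial>dX)"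
    by (subst nn_integral_dXdY(2)) (use m in \<open>auto intro: measurable_compose\<close>)
  also have "\<dots> = (\<integral>\<^sup>+Z. f Z \<partial>dXdY)" by (rule nn_integral_dXdY(1)[OF f, symmetric])
  finally show "(\<integral>\<^sup>+Z. f (prod.swap Z) \<partial>dXdY) = (\<integral>\<^sup>+Z. f Z \<partial>dXdY)" .
qed

lemma L2_comp:
  assumes T: "T \<in> measurable \<mu> \<mu>" "distr \<mu> \<mu> T = \<mu>" and f: "f \<in> L2 \<mu>"
  shows "(\<lambda>x. f (T x)) \<in> L2 \<mu>"
proof -
  have "integrable (distr \<mu> \<mu> T) (\<lambda>x. (norm (f x))\<^sup>2)" using L2_D(2)[OF f] by (simp add: T(2))
  then have "integrable \<mu> (\<lambda>x. (norm (f (T x)))\<^sup>2)" by (rule integrable_distr[OF T(1)])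
  then show ?thesis using measurable_compose[OF T(1) L2_D(1)[OF f]] by (simp add: L2_def)
qed

lemma integral_comp:
  fixes f :: "'a \<Rightarrow> complex"
  assumes T: "T \<in> measurable \<mu> \<mu>" "distr \<mu> \<mu> T = \<mu>" and f: "f \<in> borel_measurable \<mu>"
  shows "(\<integral>x. f (T x) \<partial>\<mu>) = (\<integral>x. f x \<partial>\<mu>)"
  using integral_distr[OF T(1) f] by (simp add: T(2))

lemma L2_inner_comp:
  assumes T: "T \<in> measurable \<mu> \<mu>" "distr \<mu> \<mu> T = \<mu>" and f: "f \<in> L2 \<mu>" and g: "g \<in> L2 \<mu>"
  shows "L2_inner \<mu> (\<lambda>x. f (T x)) (\<lambda>x. g (T x)) = L2_inner \<mu> f g"
  unfolding L2_inner_def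
  using integral_comp[OF T borel_measurable_integrable[OF L2_Cauchy_Schwarz(1)[OF f L2_cnj[OF g]]]] .

lemma L2_norm_comp:
  assumes T: "T \<in> measurable \<mu> \<mu>" "distr \<mu> \<mu> T = \<mu>" and f: "f \<in> L2 \<mu>"
  shows "L2_norm \<mu> (\<lambda>x. f (T x)) = L2_norm \<mu> f"
proof -
  have "complex_of_real ((L2_norm \<mu> (\<lambda>x. f (T x)))\<^sup>2) = of_real ((L2_norm \<mu> f)\<^sup>2)"
    unfolding L2_norm_inner[OF f] L2_norm_inner[OF L2_comp[OF T f]] by (rule L2_inner_comp[OF T f f])
  then show ?thesis unfolding of_real_eq_iff by (simp add: L2_norm_nonneg)
qed

lemma AE_comp:
  assumes T: "T \<in> measurable \<mu> \<mu>" "distr \<mu> \<mu> T = \<mu>" and P: "AE x in \<mu>. P x"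
  shows "AE x in \<mu>. P (T x)"
proof -
  have "AE x in distr \<mu> \<mu> T. P x" unfolding T(2) by (rule P)
  then show ?thesis by (rule AE_distrD[OF T(1)])
qed

lemma unitary_comp_measure_preserving:
  assumes T: "T \<in> measurable \<mu> \<mu>" "distr \<mu> \<mu> T = \<mu>" and S: "S \<in> measurable \<mu> \<mu>" "distr \<mu> \<mu> S = \<mu>"
    and inv: "\<And>x. S (T x) = x"
  shows "unitary_on_L2 \<mu> (\<lambda>f x. f (T x))"
  unfolding unitary_on_L2_iff isometry_on_L2_def
proof (intro conjI ballI allI impI)
  fix f assume f: "f \<in> L2 \<mu>"
  show "(\<lambda>x. f (T x)) \<in> L2 \<mu>" by (rule L2_comp[OF T f])
  show "\<exists>g\<in>L2 \<mu>. AE x in \<mu>. g (T x) = f x"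
    using L2_comp[OF S f] by (intro bexI[of _ "\<lambda>x. f (S x)"]) (auto simp: inv)
  fix g assume g: "g \<in> L2 \<mu>"
  show "AE x in \<mu>. f (T x) = g (T x)" if "AE x in \<mu>. f x = g x" by (rule AE_comp[OF T that])
  show "L2_inner \<mu> (\<lambda>x. f (T x)) (\<lambda>x. g (T x)) = L2_inner \<mu> f g" by (rule L2_inner_comp[OF T f g])
qed auto

section \<open>The kernel of a composition law\<close>

lemma mollifier_minus: "mollifier n (- x) = mollifier n x"
  by (simp add: mollifier_def gauss_kernel_def gaussian_def)

lemma conv_mollifier_lim:
  assumes f: "f \<in> schwartz"
  shows "(\<lambda>n. conv f (mollifier n) x) \<longlonglongrightarrow> f x"
proof (rule tendstoI)
  fix e :: real assume "0 < e"
  from schwartz_lim_uniform[OF mollifier_lim[OF f] this]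
  show "\<forall>\<^sub>F n in sequentially. dist (conv f (mollifier n) x) (f x) < e"
    by eventually_elim (simp add: dist_norm conv_commute[OF schwartz_measurable[OF f] schwartz_measurable[OF mollifier_schwartz]])
qed

lemma conv_mollifier_dX:
  fixes f :: "'n::finite phase \<Rightarrow> complex"
  assumes f: "f \<in> schwartz"
  shows "conv f (mollifier n) X = of_real ((2 * pi) ^ CARD('n)) * (\<integral>Z. f Z * mollifier n (Z - X) \<partial>dX)"
proof -
  have [measurable]: "f \<in> borel_measurable borel" "mollifier n \<in> borel_measurable (borel :: 'n phase measure)"
    by (intro schwartz_measurable f mollifier_schwartz)+
  have "mollifier n (X - Z) = mollifier n (Z - X)" for Z :: "'n phase"
    using mollifier_minus[of n "Z - X"] by simp
  then show ?thesis
    unfolding conv_def by (subst integral_dX) (auto simp: scaleR_conv_of_real)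
qed

text \<open>Testing against translated mollifiers recovers point values in the limit. Consequently
  the definite description in \<open>smooth_sandwich\<close> denotes at most one function.\<close>

lemma schwartz_pairing_eqI:
  fixes f g :: "'n::finite phase \<Rightarrow> complex"
  assumes f: "f \<in> schwartz" and g: "g \<in> schwartz"
    and eq: "\<And>h. h \<in> schwartz \<Longrightarrow> (\<integral>X. f X * h X \<partial>dX) = (\<integral>X. g X * h X \<partial>dX)"
  shows "f = g"
proof
  fix X
  have c: "conv f (mollifier n) X = conv g (mollifier n) X" for n
    by (simp only: conv_mollifier_dX[OF f] conv_mollifier_dX[OF g] eq[OF schwartz_translate[OF mollifier_schwartz]])
  show "f X = g X"
    using conv_mollifier_lim[OF f, of X] conv_mollifier_lim[OF g, of X] unfolding c by (rule LIMSEQ_unique)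
qed

lemma symp_fourier_twice:
  assumes g: "g \<in> schwartz"
  shows "symp_fourier (symp_fourier g) = g"
proof (rule schwartz_pairing_eqI)
  fix f :: "'a phase \<Rightarrow> complex" assume f: "f \<in> schwartz"
  have "(\<integral>X. f X * symp_fourier (symp_fourier g) X \<partial>dX) = (\<integral>X. fourier_transpose (fourier_transpose f) X * g X \<partial>dX)"
    by (simp only: fourier_transpose_pairing[OF f symp_fourier_schwartz[OF g]] fourier_transpose_pairing[OF fourier_transpose_schwartz[OF f] g])
  then show "(\<integral>X. symp_fourier (symp_fourier g) X * f X \<partial>dX) = (\<integral>X. g X * f X \<partial>dX)"
    by (simp only: fourier_transpose_twice[OF f] mult.commute)
qed (intro symp_fourier_schwartz g)+

text \<open>Continuity of translation as a map into S. Composed with the separate continuity of the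
  product, it makes the products with translated mollifiers depend continuously on the
  translation.\<close>

lemma schwartz_lim_translate:
  fixes g :: "'a::euclidean_space \<Rightarrow> complex"
  assumes g: "g \<in> schwartz"
  shows "schwartz_lim (nhds W) (\<lambda>V x. g (x - V)) (\<lambda>x. g (x - W))"
  unfolding schwartz_lim_def
proof (intro conjI allI ballI always_eventually schwartz_translate g)
  fix k and bs :: "'a list" assume bs: "bs \<in> lists Basis"
  obtain C where C: "C \<ge> 0"
    "\<And>x v w. norm (v - w) \<le> 1 \<Longrightarrow> (1 + norm x) ^ k * norm (partial_deriv bs g (x - v) - partial_deriv bs g (x - w)) \<le> C * norm (v - w) * (1 + norm w) ^ k"
    by (rule schwartz_translate_bound[OF schwartz_partial_deriv[OF g bs], of k]) (rule that)
  show "((\<lambda>V. schwartz_seminorm k bs (\<lambda>x. g (x - V) - g (x - W))) \<longlongrightarrow> 0) (nhds W)"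
  proof (rule Lim_null_comparison)
    have "((\<lambda>V. C * norm (V - W) * (1 + norm W) ^ k) \<longlongrightarrow> C * norm (W - W) * (1 + norm W) ^ k) (nhds W)"
      by (intro tendsto_intros filterlim_ident)
    then show "((\<lambda>V. C * norm (V - W) * (1 + norm W) ^ k) \<longlongrightarrow> 0) (nhds W)" by simp
    have "\<forall>\<^sub>F V in nhds W. norm (V - W) < 1"
      unfolding eventually_nhds_metric by (intro exI[of _ 1]) (simp add: dist_norm)
    then show "\<forall>\<^sub>F V in nhds W. norm (schwartz_seminorm k bs (\<lambda>x. g (x - V) - g (x - W))) \<le> C * norm (V - W) * (1 + norm W) ^ k"
    proof eventually_elim
      case (elim V)
      have S: "(\<lambda>x. g (x - V)) \<in> schwartz" "(\<lambda>x. g (x - W)) \<in> schwartz" by (intro schwartz_translate g)+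
      have "schwartz_seminorm k bs (\<lambda>x. g (x - V) - g (x - W)) \<le> C * norm (V - W) * (1 + norm W) ^ k"
      proof (rule schwartz_seminorm_leI)
        fix x
        show "(1 + norm x) ^ k * norm (partial_deriv bs (\<lambda>x. g (x - V) - g (x - W)) x) \<le> C * norm (V - W) * (1 + norm W) ^ k"
          using C(2)[of V W x] elim unfolding partial_deriv_diff[OF S bs] partial_deriv_translate[OF g bs] by simp
      qed
      then show ?case using schwartz_seminorm_nonneg[OF schwartz_diff[OF S] bs, of k] by simp
    qed
  qed
qed

text \<open>Convergence in S is in particular uniform; uniform convergence in the parameter and
  continuity in the point give joint continuity.\<close>

lemma schwartz_lim_joint_continuous:
  fixes k :: "'b::topological_space \<Rightarrow> 'a::euclidean_space \<Rightarrow> complex"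
  assumes "\<And>W. schwartz_lim (nhds W) k (k W)"
  shows "continuous_on UNIV (\<lambda>p. k (fst p) (snd p))"
  unfolding continuous_on_def
proof (intro ballI)
  fix p :: "'b \<times> 'a"
  have S: "k (fst p) \<in> schwartz" using assms by (simp add: schwartz_lim_def)
  have "((\<lambda>q. k (fst q) (snd q)) \<longlongrightarrow> k (fst p) (snd p)) (nhds p)"
  proof (rule tendstoI)
    fix e :: real assume "0 < e"
    then have e: "0 < e / 2" by simp
    have "\<forall>\<^sub>F V in nhds (fst p). \<forall>x. norm (k V x - k (fst p) x) < e / 2"
      using schwartz_lim_uniform[OF assms[of "fst p"] e] by (auto elim: eventually_mono)
    moreover have "filterlim fst (nhds (fst p)) (nhds p)" by (intro tendsto_fst filterlim_ident)
    ultimately have 1: "\<forall>\<^sub>F q in nhds p. \<forall>x. norm (k (fst q) x - k (fst p) x) < e / 2"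
      by (rule eventually_compose_filterlim)
    have "isCont (k (fst p)) (snd p)" using schwartz_continuous[OF S, of UNIV] by (simp add: continuous_on_eq_continuous_at)
    then have "((\<lambda>q. k (fst p) (snd q)) \<longlongrightarrow> k (fst p) (snd p)) (nhds p)"
      by (intro isCont_tendsto_compose[of _ "k (fst p)"] tendsto_snd filterlim_ident)
    from tendstoD[OF this e] 1 show "\<forall>\<^sub>F q in nhds p. dist (k (fst q) (snd q)) (k (fst p) (snd p)) < e"
    proof eventually_elim
      case (elim q)
      have "dist (k (fst q) (snd q)) (k (fst p) (snd p)) \<le> norm (k (fst q) (snd q) - k (fst p) (snd q)) + dist (k (fst p) (snd q)) (k (fst p) (snd p))"
        using dist_triangle[of "k (fst q) (snd q)" "k (fst p) (snd p)" "k (fst p) (snd q)"] by (simp add: dist_norm)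
      also have "\<dots> < e / 2 + e / 2" by (intro add_strict_mono) (use elim in auto)
      finally show ?case by simp
    qed
  qed
  then show "((\<lambda>q. k (fst q) (snd q)) \<longlongrightarrow> k (fst p) (snd p)) (at p within UNIV)"
    by (rule tendsto_mono[rotated]) (simp add: at_within_def)
qed

lemma distr_ee_tempered: "distr_of dX (ee Y) \<in> tempered"
  for Y :: "'n::finite phase"
proof -
  let ?d = "2 * DIM('n phase)"
  have i: "integrable dX (\<lambda>x. ee Y x * f x)" if "f \<in> schwartz" for f
    using osc_int_integrable[OF that, of Y] schwartz_measurable[OF that] by (subst integrable_dX) (auto simp: mult.commute)
  show ?thesis
  proof (rule temperedI[where k="?d" and C="1 / (2 * pi) ^ CARD('n) * weight_integral TYPE('n phase)"])
    show "distr_of dX (ee Y) \<in> extensional schwartz" by (simp add: distr_of_def)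
    show "linear_form_on schwartz (distr_of dX (ee Y))"
      unfolding linear_form_on_def
    proof (intro conjI ballI allI)
      show "distr_of dX (ee Y) (\<lambda>x. f x + g x) = distr_of dX (ee Y) f + distr_of dX (ee Y) g" if "f \<in> schwartz" "g \<in> schwartz" for f g
        by (simp add: distr_of_def that schwartz_add distrib_left Bochner_Integration.integral_add[OF i[OF that(1)] i[OF that(2)]])
      show "distr_of dX (ee Y) (\<lambda>x. c * f x) = c * distr_of dX (ee Y) f" if "f \<in> schwartz" for f c
        by (simp add: distr_of_def that schwartz_cmult mult.left_commute[of _ c])
    qed
    show "norm (distr_of dX (ee Y) f) \<le> 1 / (2 * pi) ^ CARD('n) * weight_integral TYPE('n phase) * schwartz_seminorm ?d [] f" if f: "f \<in> schwartz" for f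
    proof -
      have [measurable]: "f \<in> borel_measurable borel" by (rule schwartz_measurable[OF f])
      have "norm (distr_of dX (ee Y) f) = norm (\<integral>x. ee Y x * f x \<partial>dX)" by (simp add: distr_of_def f)
      also have "\<dots> \<le> (\<integral>x. norm (ee Y x * f x) \<partial>dX)" by (rule integral_norm_bound)
      also have "\<dots> = (\<integral>x. norm (f x) \<partial>dX)" by (simp add: norm_mult)
      also have "\<dots> = 1 / (2 * pi) ^ CARD('n) * (\<integral>x. norm (f x) \<partial>lborel)" by (subst integral_dX) auto
      also have "\<dots> \<le> 1 / (2 * pi) ^ CARD('n) * (weight_integral TYPE('n phase) * schwartz_seminorm ?d [] f)"
        by (intro mult_left_mono weight_bound(2) schwartz_decay f) auto
      finally show ?thesis by (simp only: mult.assoc)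
    qed
  qed
qed

section \<open>Composition laws satisfying the three hypotheses\<close>

locale composition_law =
  fixes m :: "'n::finite composition"
  assumes A: "hypothesis_A m" and B: "hypothesis_B m" and C: "hypothesis_C m"
begin

lemma closed: "f \<in> schwartz \<Longrightarrow> g \<in> schwartz \<Longrightarrow> m f g \<in> schwartz"
  and assoc: "f \<in> schwartz \<Longrightarrow> g \<in> schwartz \<Longrightarrow> h \<in> schwartz \<Longrightarrow> m (m f g) h = m f (m g h)"
  and lin_left: "g \<in> schwartz \<Longrightarrow> linear_form_on schwartz (\<lambda>f. m f g X)"
  and lin_right: "f \<in> schwartz \<Longrightarrow> linear_form_on schwartz (\<lambda>g. m f g X)"
  and cont_left: "g \<in> schwartz \<Longrightarrow> continuous_map schwartz_topology schwartz_topology (\<lambda>f. m f g)"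
  and cont_right: "f \<in> schwartz \<Longrightarrow> continuous_map schwartz_topology schwartz_topology (\<lambda>g. m f g)"
  and cnj_mult: "f \<in> schwartz \<Longrightarrow> g \<in> schwartz \<Longrightarrow> (\<lambda>X. cnj (m f g X)) = m (\<lambda>X. cnj (g X)) (\<lambda>X. cnj (f X))"
  and trace: "f \<in> schwartz \<Longrightarrow> g \<in> schwartz \<Longrightarrow> (\<integral>X. m f g X \<partial>dX) = (\<integral>X. f X * g X \<partial>dX)"
  using A by (auto simp: hypothesis_A_def)

lemma pairing_assoc:
  assumes "f \<in> schwartz" "g \<in> schwartz" "h \<in> schwartz"
  shows "(\<integral>X. m f g X * h X \<partial>dX) = (\<integral>X. f X * m g h X \<partial>dX)"
  using trace[OF closed[OF assms(1,2)] assms(3)] trace[OF assms(1) closed[OF assms(2,3)]] assoc[OF assms] by simp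

text \<open>Cyclicity of the trace: the pairing is the integral of f # g # h, and since pointwise
  multiplication commutes, the last factor may be brought to the front.\<close>

lemma pairing_rotate:
  assumes "f \<in> schwartz" "g \<in> schwartz" "h \<in> schwartz"
  shows "(\<integral>X. m f g X * h X \<partial>dX) = (\<integral>X. g X * m h f X \<partial>dX)"
proof -
  have "(\<integral>X. m f g X * h X \<partial>dX) = (\<integral>X. h X * m f g X \<partial>dX)" by (simp only: mult.commute)
  also have "\<dots> = (\<integral>X. m h f X * g X \<partial>dX)" by (rule pairing_assoc[OF assms(3,1,2), symmetric])
  also have "\<dots> = (\<integral>X. g X * m h f X \<partial>dX)" by (simp only: mult.commute)
  finally show ?thesis .
qed

definition kernel :: "('n phase \<Rightarrow> complex) \<Rightarrow> ('n phase \<Rightarrow> complex) \<Rightarrow> 'n phase \<Rightarrow> 'n phase \<Rightarrow> complex" where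
  "kernel f g Y = smooth_sandwich m f (distr_of dX (ee Y)) g"

text \<open>Unfolding the two one-sided products places the outer factors around the test function
  in cyclic order: pairing f # e # g with h is pairing e with g # h # f.\<close>

lemma distr_sandwich_iff:
  assumes "f \<in> schwartz" "g \<in> schwartz" "\<phi> \<in> schwartz"
  shows "distr_mult m (mult_distr m f (distr_of dX (ee Y))) g = distr_of dX \<phi> \<longleftrightarrow>
    (\<forall>h\<in>schwartz. (\<integral>W. \<phi> W * h W \<partial>dX) = (\<integral>V. ee Y V * m (m g h) f V \<partial>dX))"
proof -
  have "distr_mult m (mult_distr m f (distr_of dX (ee Y))) g = (\<lambda>h\<in>schwartz. \<integral>V. ee Y V * m (m g h) f V \<partial>dX)"
    unfolding distr_mult_def
    by (rule restrict_ext) (simp add: mult_distr_def distr_of_def closed assms)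
  then show ?thesis unfolding distr_of_def[of dX \<phi>] by (auto simp: fun_eq_iff restrict_def)
qed

lemma kernel:
  assumes fg: "f \<in> schwartz" "g \<in> schwartz"
  shows kernel_schwartz: "kernel f g Y \<in> schwartz"
    and kernel_pairing: "h \<in> schwartz \<Longrightarrow> (\<integral>W. kernel f g Y W * h W \<partial>dX) = (\<integral>V. ee Y V * m (m g h) f V \<partial>dX)"
proof -
  let ?P = "\<lambda>\<phi>. \<phi> \<in> schwartz \<and> distr_mult m (mult_distr m f (distr_of dX (ee Y))) g = distr_of dX \<phi>"
  obtain \<phi> where \<phi>: "?P \<phi>" using B fg distr_ee_tempered unfolding hypothesis_B_def by blast
  have w: "\<forall>h\<in>schwartz. (\<integral>W. \<theta> W * h W \<partial>dX) = (\<integral>V. ee Y V * m (m g h) f V \<partial>dX)" if "?P \<theta>" for \<theta>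
    using iffD1[OF distr_sandwich_iff[OF fg conjunct1[OF that]] conjunct2[OF that]] .
  have P: "?P (kernel f g Y)"
    unfolding kernel_def smooth_sandwich_def
  proof (rule theI[of ?P, OF \<phi>])
    fix \<psi> assume \<psi>: "?P \<psi>"
    show "\<psi> = \<phi>"
    proof (rule schwartz_pairing_eqI)
      fix h :: "'n phase \<Rightarrow> complex" assume "h \<in> schwartz"
      then show "(\<integral>X. \<psi> X * h X \<partial>dX) = (\<integral>X. \<phi> X * h X \<partial>dX)"
        using w[OF \<phi>] w[OF \<psi>] by simp
    qed (use \<phi> \<psi> in auto)
  qed
  show "kernel f g Y \<in> schwartz" "h \<in> schwartz \<Longrightarrow> (\<integral>W. kernel f g Y W * h W \<partial>dX) = (\<integral>V. ee Y V * m (m g h) f V \<partial>dX)"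
    using P w[OF P] by auto
qed

lemma kernel_eqI:
  assumes fg: "f \<in> schwartz" "g \<in> schwartz" and \<phi>: "\<phi> \<in> schwartz"
    and "\<And>h. h \<in> schwartz \<Longrightarrow> (\<integral>W. \<phi> W * h W \<partial>dX) = (\<integral>V. ee Y V * m (m g h) f V \<partial>dX)"
  shows "kernel f g Y = \<phi>"
  by (rule schwartz_pairing_eqI) (use assms kernel[OF fg] in auto)

text \<open>Pairings with \<open>kernel f g Y\<close> are known, its point values are not; these are recovered as limits of pairings with mollifiers.\<close>

lemma kernel_measurable:
  assumes fg: "f \<in> schwartz" "g \<in> schwartz"
  shows "(\<lambda>p. kernel f g (snd p) (fst p)) \<in> borel_measurable borel"
proof -
  \<comment> \<open>The mollified kernel at W is the integral of \<open>ee Y\<close> against this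
    function of V, by \<open>kernel_pairing\<close>. Being jointly continuous in W and V, it gives a
    measurable function of W and Y after integration over V.\<close>
  let ?k = "\<lambda>n W. m (m g (\<lambda>Z. mollifier n (Z - W))) f"
  have kc: "continuous_on UNIV (\<lambda>p. ?k n (fst p) (snd p))" for n
  proof (rule schwartz_lim_joint_continuous)
    show "schwartz_lim (nhds W) (?k n) (?k n W)" for W
      by (intro schwartz_continuous_mapD[OF cont_left[OF fg(1)]] schwartz_continuous_mapD[OF cont_right[OF fg(2)]]
          schwartz_lim_translate mollifier_schwartz)
  qed
  have "(\<lambda>p. \<integral>V. ee (snd p) V * ?k n (fst p) V \<partial>dX) \<in> borel_measurable (borel :: ('n phase \<times> 'n phase) measure)" for n
  proof (rule dX.borel_measurable_lebesgue_integral)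
    have "continuous_on UNIV (\<lambda>q :: ('n phase \<times> 'n phase) \<times> 'n phase. ee (snd (fst q)) (snd q) * ?k n (fst (fst q)) (snd q))"
    proof (intro continuous_on_mult continuous_intros)
      show "continuous_on UNIV (\<lambda>q :: ('n phase \<times> 'n phase) \<times> 'n phase. ?k n (fst (fst q)) (snd q))"
        using continuous_on_compose2[OF kc, of UNIV "\<lambda>q :: ('n phase \<times> 'n phase) \<times> 'n phase. (fst (fst q), snd q)" n]
        by (simp add: continuous_on_Pair continuous_on_fst continuous_on_snd)
    qed
    then have "(\<lambda>q. ee (snd (fst q)) (snd q) * ?k n (fst (fst q)) (snd q)) \<in> borel_measurable (borel :: (('n phase \<times> 'n phase) \<times> 'n phase) measure)"
      by (rule borel_measurable_continuous_onI)
    moreover have "sets ((borel :: ('n phase \<times> 'n phase) measure) \<Otimes>\<^sub>M (dX :: 'n phase measure)) = sets borel"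
      by (simp add: borel_prod[symmetric] cong: sets_pair_measure_cong)
    ultimately show "(\<lambda>(p, V). ee (snd p) V * ?k n (fst p) V) \<in> borel_measurable ((borel :: ('n phase \<times> 'n phase) measure) \<Otimes>\<^sub>M dX)"
      by (simp add: case_prod_beta cong: measurable_cong_sets)
  qed
  then have m1: "(\<lambda>p. of_real ((2 * pi) ^ CARD('n)) * (\<integral>V. ee (snd p) V * ?k n (fst p) V \<partial>dX)) \<in> borel_measurable (borel :: ('n phase \<times> 'n phase) measure)" for n
    by (intro borel_measurable_times borel_measurable_const)
  show ?thesis
  proof (rule borel_measurable_LIMSEQ_metric[OF m1])
    fix p :: "'n phase \<times> 'n phase"
    have "of_real ((2 * pi) ^ CARD('n)) * (\<integral>V. ee (snd p) V * ?k n (fst p) V \<partial>dX) = conv (kernel f g (snd p)) (mollifier n) (fst p)" for n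
      by (simp only: conv_mollifier_dX[OF kernel_schwartz[OF fg]] kernel_pairing[OF fg schwartz_translate[OF mollifier_schwartz]])
    then show "(\<lambda>n. of_real ((2 * pi) ^ CARD('n)) * (\<integral>V. ee (snd p) V * ?k n (fst p) V \<partial>dX)) \<longlonglongrightarrow> kernel f g (snd p) (fst p)"
      using conv_mollifier_lim[OF kernel_schwartz[OF fg], of "snd p" "fst p"] by (simp only:)
  qed
qed

lemma Theta_kernel:
  assumes "f \<in> schwartz" "g \<in> schwartz"
  shows "Theta m Y f g = (\<integral>V. ee (- Y) V * kernel f g Y V \<partial>dX)"
  unfolding Theta_def distr_sandwich_def
  unfolding kernel_def[symmetric]
  by (simp add: distr_of_def kernel_schwartz assms)

text \<open>Moving the second factor to the other side of the pairing turns the inner product into \<open>\<Theta>\<^sup>#\<close>.\<close>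

lemma kernel_inner:
  assumes f1: "f1 \<in> schwartz" and g1: "g1 \<in> schwartz" and f2: "f2 \<in> schwartz" and g2: "g2 \<in> schwartz"
  shows "(\<integral>W. kernel f1 g1 Y W * cnj (kernel f2 g2 Y W) \<partial>dX)
    = Theta m Y (m (\<lambda>X. cnj (f2 X)) f1) (m g1 (\<lambda>X. cnj (g2 X)))"
proof -
  let ?f = "\<lambda>X. cnj (f2 X)" and ?g = "\<lambda>X. cnj (g2 X)" and ?K = "kernel f1 g1 Y"
  have S: "?f \<in> schwartz" "?g \<in> schwartz" "?K \<in> schwartz" by (intro schwartz_cnj f2 g2 kernel_schwartz f1 g1)+
  \<comment> \<open>Conjugation brings the second kernel into the position where its pairing is
    known, and afterwards turns \<open>ee Y\<close> into \<open>ee (- Y)\<close>, the left character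
    of \<open>Theta\<close>.\<close>
  have "(\<integral>W. ?K W * cnj (kernel f2 g2 Y W) \<partial>dX) = cnj (\<integral>W. kernel f2 g2 Y W * cnj (?K W) \<partial>dX)"
    by (subst Bochner_Integration.integral_cnj[symmetric]) (simp add: mult.commute)
  also have "\<dots> = cnj (\<integral>V. ee Y V * m (m g2 (\<lambda>W. cnj (?K W))) f2 V \<partial>dX)"
    by (simp only: kernel_pairing[OF f2 g2 schwartz_cnj[OF S(3)]])
  also have "\<dots> = (\<integral>V. ee (- Y) V * cnj (m (m g2 (\<lambda>W. cnj (?K W))) f2 V) \<partial>dX)"
    by (subst Bochner_Integration.integral_cnj[symmetric]) (simp add: ee_minus)
  also have "(\<lambda>V. cnj (m (m g2 (\<lambda>W. cnj (?K W))) f2 V)) = m ?f (m ?K ?g)"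
    using cnj_mult[OF closed[OF g2 schwartz_cnj[OF S(3)]] f2] cnj_mult[OF g2 schwartz_cnj[OF S(3)]] by simp
  then have "(\<integral>V. ee (- Y) V * cnj (m (m g2 (\<lambda>W. cnj (?K W))) f2 V) \<partial>dX) = (\<integral>V. ee (- Y) V * m ?f (m ?K ?g) V \<partial>dX)"
    by (simp add: fun_eq_iff)
  \<comment> \<open>By associativity the outer factors are absorbed into those of the kernel. As the
    middle factor is only a distribution, this is verified on pairings.\<close>
  also have "m ?f (m ?K ?g) = kernel (m ?f f1) (m g1 ?g) Y"
  proof (rule kernel_eqI[symmetric])
    fix h :: "'n phase \<Rightarrow> complex" assume h: "h \<in> schwartz"
    have "(\<integral>W. m ?f (m ?K ?g) W * h W \<partial>dX) = (\<integral>W. m ?K ?g W * m h ?f W \<partial>dX)"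
      by (rule pairing_rotate[OF S(1) closed[OF S(3,2)] h])
    also have "\<dots> = (\<integral>W. ?K W * m ?g (m h ?f) W \<partial>dX)"
      by (rule pairing_assoc[OF S(3,2) closed[OF h S(1)]])
    also have "\<dots> = (\<integral>V. ee Y V * m (m g1 (m ?g (m h ?f))) f1 V \<partial>dX)"
      by (rule kernel_pairing[OF f1 g1 closed[OF S(2) closed[OF h S(1)]]])
    also have "m (m g1 (m ?g (m h ?f))) f1 = m (m (m g1 ?g) h) (m ?f f1)"
      by (simp add: assoc closed f1 g1 h S)
    finally show "(\<integral>W. m ?f (m ?K ?g) W * h W \<partial>dX) = (\<integral>V. ee Y V * m (m (m g1 ?g) h) (m ?f f1) V \<partial>dX)" .
  qed (intro closed S f1 g1)+
  also have "(\<integral>V. ee (- Y) V * kernel (m ?f f1) (m g1 ?g) Y V \<partial>dX) = Theta m Y (m ?f f1) (m g1 ?g)"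
    by (rule Theta_kernel[symmetric]) (intro closed S f1 g1)+
  finally show ?thesis .
qed

text \<open>Hypothesis C yields the product of two integrals of products, and the trace property
  reads each of them as an inner product.\<close>

lemma Theta_integral:
  assumes f1: "f1 \<in> schwartz" and g1: "g1 \<in> schwartz" and f2: "f2 \<in> schwartz" and g2: "g2 \<in> schwartz"
  shows "(\<integral>Y. \<integral>W. kernel f1 g1 Y W * cnj (kernel f2 g2 Y W) \<partial>dX \<partial>dX) = L2_inner dX f1 f2 * L2_inner dX g1 g2"
proof -
  have "(\<integral>Y. \<integral>W. kernel f1 g1 Y W * cnj (kernel f2 g2 Y W) \<partial>dX \<partial>dX)
      = (\<integral>X. m (\<lambda>X. cnj (f2 X)) f1 X \<partial>dX) * (\<integral>X. m g1 (\<lambda>X. cnj (g2 X)) X \<partial>dX)"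
    unfolding kernel_inner[OF assms] using C closed schwartz_cnj assms unfolding hypothesis_C_def by blast
  then show ?thesis
    by (simp add: trace schwartz_cnj assms L2_inner_def mult.commute)
qed

text \<open>Settles the degenerate case of the integrability argument, in which the product of the
  two norms is 0.\<close>

lemma kernel_zero:
  assumes fg: "f \<in> schwartz" "g \<in> schwartz" and z: "f = (\<lambda>X. 0) \<or> g = (\<lambda>X. 0)"
  shows "kernel f g Y = (\<lambda>X. 0)"
proof (rule kernel_eqI[OF fg schwartz_zero])
  fix h :: "'n phase \<Rightarrow> complex" assume h: "h \<in> schwartz"
  have l: "m (\<lambda>X. 0) k = (\<lambda>X. 0)" if "k \<in> schwartz" for k
    using linear_form_onD(2)[OF lin_left[OF that] schwartz_zero, of 0] by (simp add: fun_eq_iff)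
  have r: "m k (\<lambda>X. 0) = (\<lambda>X. 0)" if "k \<in> schwartz" for k
    using linear_form_onD(2)[OF lin_right[OF that] schwartz_zero, of 0] by (simp add: fun_eq_iff)
  have "m (m g h) f = (\<lambda>X. 0)" using z l r h fg closed by auto
  then show "(\<integral>W. 0 * h W \<partial>dX) = (\<integral>V. ee Y V * m (m g h) f V \<partial>dX)" by simp
qed

text \<open>A non-integrable function has Bochner integral \<open>0\<close>, so Hypothesis C implies integrability unless \<open>f\<close> or \<open>g\<close> vanishes.\<close>

lemma kernel_sq_integrable:
  assumes f: "f \<in> schwartz" and g: "g \<in> schwartz"
  shows "integrable dX (\<lambda>Y. \<integral>W. (norm (kernel f g Y W))\<^sup>2 \<partial>dX)"
proof (rule ccontr)
  let ?q = "\<lambda>Y. \<integral>W. (norm (kernel f g Y W))\<^sup>2 \<partial>dX"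
  assume n: "\<not> integrable dX ?q"
  have q: "(\<integral>W. kernel f g Y W * cnj (kernel f g Y W) \<partial>dX) = of_real (?q Y)" for Y
    unfolding complex_norm_square[symmetric] of_real_power[symmetric] integral_complex_of_real ..
  have "complex_of_real (\<integral>Y. ?q Y \<partial>dX) = L2_inner dX f f * L2_inner dX g g"
    unfolding Theta_integral[OF f g f g, symmetric] q integral_complex_of_real ..
  also have "\<dots> = of_real ((L2_norm dX f)\<^sup>2 * (L2_norm dX g)\<^sup>2)"
    by (simp only: L2_norm_inner[OF schwartz_L2_dX[OF f]] L2_norm_inner[OF schwartz_L2_dX[OF g]] of_real_mult)
  finally have "(L2_norm dX f)\<^sup>2 * (L2_norm dX g)\<^sup>2 = 0"
    using not_integrable_integral_eq[OF n] by (simp only: of_real_eq_iff)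
  then have "L2_norm dX f = 0 \<or> L2_norm dX g = 0" by simp
  moreover have "h = (\<lambda>X. 0)" if h: "h \<in> schwartz" and z: "L2_norm dX h = 0" for h :: "'n phase \<Rightarrow> complex"
  proof (rule schwartz_pairing_eqI[OF h schwartz_zero])
    fix k :: "'n phase \<Rightarrow> complex" assume "k \<in> schwartz"
    then have "norm (\<integral>X. h X * k X \<partial>dX) \<le> 0"
      using L2_Cauchy_Schwarz(3)[OF schwartz_L2_dX[OF h] schwartz_L2_dX] z by fastforce
    then show "(\<integral>X. h X * k X \<partial>dX) = (\<integral>X. 0 * k X \<partial>dX)" by simp
  qed
  ultimately have "kernel f g Y = (\<lambda>X. 0)" for Y using kernel_zero[OF f g] f g by blast
  with n show False by simp
qed

section \<open>The kernel as an element of \<open>L\<^sup>2\<close>\<close>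

text \<open>The point of the kernel comes first and its parameter second: pairing with
  \<open>tensor h k\<close> then tests the kernel by h and integrates its parameter against
  k.\<close>

definition kernel_fun :: "('n phase \<Rightarrow> complex) \<Rightarrow> ('n phase \<Rightarrow> complex) \<Rightarrow> 'n phase \<times> 'n phase \<Rightarrow> complex" where
  "kernel_fun f g = (\<lambda>p. kernel f g (snd p) (fst p))"

text \<open>By Tonelli, the inner integral is the finite square norm of a Schwartz function, and
  integrability of this norm in the parameter is what Hypothesis C provides.\<close>

lemma kernel_fun_L2:
  assumes f: "f \<in> schwartz" and g: "g \<in> schwartz"
  shows "kernel_fun f g \<in> L2 dXdY"
proof -
  have [measurable]: "kernel_fun f g \<in> borel_measurable borel"
    unfolding kernel_fun_def by (rule kernel_measurable[OF f g])
  have "integrable dXdY (\<lambda>p. (norm (kernel_fun f g p))\<^sup>2)"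
  proof (rule integrableI_bounded)
    have mm: "(\<lambda>p. ennreal (norm ((norm (kernel_fun f g p))\<^sup>2))) \<in> borel_measurable borel" by measurable
    have "(\<integral>\<^sup>+p. ennreal (norm ((norm (kernel_fun f g p))\<^sup>2)) \<partial>dXdY) = (\<integral>\<^sup>+Y. \<integral>\<^sup>+W. ennreal ((norm (kernel f g Y W))\<^sup>2) \<partial>dX \<partial>dX)"
      by (subst nn_integral_dXdY(2)[OF mm]) (simp add: kernel_fun_def)
    also have "\<dots> = (\<integral>\<^sup>+Y. ennreal (\<integral>W. (norm (kernel f g Y W))\<^sup>2 \<partial>dX) \<partial>dX)"
      by (intro nn_integral_cong nn_integral_eq_integral L2_D schwartz_L2_dX kernel_schwartz f g) auto
    also have "\<dots> < \<infinity>"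
      using kernel_sq_integrable[OF f g] by (simp add: integrable_iff_bounded)
    finally show "(\<integral>\<^sup>+p. ennreal (norm ((norm (kernel_fun f g p))\<^sup>2)) \<partial>dXdY) < \<infinity>" .
  qed measurable
  then show ?thesis by (simp add: L2_def)
qed

lemma kernel_fun_integral:
  assumes f: "f \<in> schwartz" and g: "g \<in> schwartz" and H: "H \<in> L2 dXdY"
  shows "(\<integral>p. kernel_fun f g p * H p \<partial>dXdY) = (\<integral>Y. \<integral>W. kernel f g Y W * H (W, Y) \<partial>dX \<partial>dX)"
proof -
  have e: "case_prod (\<lambda>W Y. kernel f g Y W * H (W, Y)) = (\<lambda>p. kernel_fun f g p * H p)"
    by (auto simp: kernel_fun_def fun_eq_iff)
  have "integrable (dX \<Otimes>\<^sub>M dX) (case_prod (\<lambda>W Y. kernel f g Y W * H (W, Y)))"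
    unfolding e dXdY_def[symmetric] by (rule L2_Cauchy_Schwarz(1)[OF kernel_fun_L2[OF f g] H])
  from dX_pair.integral_snd[OF this] show ?thesis
    unfolding e dXdY_def by (rule sym)
qed

lemma kernel_fun_inner:
  assumes "f1 \<in> schwartz" "g1 \<in> schwartz" "f2 \<in> schwartz" "g2 \<in> schwartz"
  shows "L2_inner dXdY (kernel_fun f1 g1) (kernel_fun f2 g2) = L2_inner dX f1 f2 * L2_inner dX g1 g2"
  unfolding L2_inner_def[of dXdY] kernel_fun_integral[OF assms(1,2) L2_cnj[OF kernel_fun_L2[OF assms(3,4)]]]
  using Theta_integral[OF assms] by (simp add: kernel_fun_def)

text \<open>Integrating the characters \<open>ee Y\<close> against k produces the Fourier transform
  of k. This accounts for the single Fourier transform between the kernel and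
  \<open>R\<close>.\<close>

lemma kernel_fun_pairing:
  assumes f: "f \<in> schwartz" and g: "g \<in> schwartz" and h: "h \<in> schwartz" and k: "k \<in> schwartz"
  shows "(\<integral>p. kernel_fun f g p * tensor h k p \<partial>dXdY) = (\<integral>X. m h f X * m (symp_fourier k) g X \<partial>dX)"
proof -
  let ?p = "m (m g h) f" and ?k = "symp_fourier k"
  have S: "?p \<in> schwartz" "?k \<in> schwartz" by (intro closed f g h symp_fourier_schwartz k)+
  have "(\<integral>p. kernel_fun f g p * tensor h k p \<partial>dXdY) = (\<integral>Y. \<integral>W. kernel f g Y W * h W * k Y \<partial>dX \<partial>dX)"
    unfolding kernel_fun_integral[OF f g tensor_L2[OF h k]] by (simp add: tensor_def mult.assoc)
  also have "\<dots> = (\<integral>Y. fourier_transpose ?p Y * k Y \<partial>dX)"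
    by (simp only: integral_mult_left_zero kernel_pairing[OF f g h] fourier_transpose_def)
  also have "\<dots> = (\<integral>X. ?p X * ?k X \<partial>dX)" by (rule fourier_transpose_pairing[OF S(1) k])
  also have "\<dots> = (\<integral>X. m g (m h f) X * ?k X \<partial>dX)" by (simp only: assoc[OF g h f])
  also have "\<dots> = (\<integral>X. m h f X * m ?k g X \<partial>dX)" by (rule pairing_rotate[OF g closed[OF h f] S(2)])
  finally show ?thesis .
qed

end

section \<open>Unitarity\<close>

lemma C_change_inverse:
  "inv C_change = (\<lambda>(X :: 'n phase, Y). (- X, - X - Y))" "C_change (inv C_change Z) = Z" "inv C_change (C_change Z) = Z"
  for Z :: "'n::finite phase \<times> 'n phase"
proof -
  let ?D = "\<lambda>(X, Y). (- X, - X - Y) :: 'n phase \<times> 'n phase"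
  show 1: "inv C_change = ?D"
    by (rule inv_unique_comp) (auto simp: C_change_def fun_eq_iff)
  show "C_change (inv C_change Z) = Z" "inv C_change (C_change Z) = Z"
    unfolding 1 by (auto simp: C_change_def case_prod_beta)
qed

lemma inv_C_change_schwartz:
  fixes G :: "'n::finite phase \<times> 'n phase \<Rightarrow> complex"
  assumes "G \<in> schwartz"
  shows "G \<circ> inv C_change \<in> schwartz"
proof -
  let ?L = "inv (C_change :: 'n phase \<times> 'n phase \<Rightarrow> _)"
  have L: "linear ?L" unfolding C_change_inverse(1) by (rule linearI) (auto simp: case_prod_beta algebra_simps)
  have n: "norm Z \<le> 3 * norm (?L Z)" for Z
  proof -
    obtain P Q where PQ: "?L Z = (P, Q)" by (cases "?L Z")
    have "Z = C_change (P, Q)" using C_change_inverse(2)[of Z] by (simp add: PQ)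
    then have "norm Z = norm (- P, P - Q)" by (simp add: C_change_def)
    also have "\<dots> \<le> norm (- P) + norm (P - Q)" by (rule norm_Pair_le)
    also have "\<dots> \<le> norm P + (norm P + norm Q)" by (intro add_mono norm_triangle_ineq4) simp
    also have "\<dots> \<le> 3 * norm (?L Z)"
      using norm_fst_le[of P Q] norm_snd_le[of Q P] by (simp add: PQ)
    finally show ?thesis .
  qed
  show ?thesis using schwartz_comp_linear[OF assms L n] by (simp add: o_def)
qed

text \<open>The explicit form of the described map is kept as well, because \<open>M\<close> is
  defined by composing \<open>N\<close> with a change of variables.\<close>

lemma extends_to_unitary_if_determined:
  fixes b :: "('n::finite phase \<Rightarrow> complex) \<Rightarrow> ('n phase \<Rightarrow> complex) \<Rightarrow> ('n phase \<Rightarrow> complex) \<Rightarrow> ('n phase \<Rightarrow> complex) \<Rightarrow> complex"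
  assumes U: "unitary_on_L2 dXdY U"
    and b: "\<And>f1 f2 g1 g2. f1 \<in> schwartz \<Longrightarrow> f2 \<in> schwartz \<Longrightarrow> g1 \<in> schwartz \<Longrightarrow> g2 \<in> schwartz \<Longrightarrow>
      (\<integral>Z. U (tensor f1 f2) Z * tensor g1 g2 Z \<partial>dXdY) = b f1 f2 g1 g2"
  shows "(THE T. determined_by b T) = (\<lambda>F\<in>schwartz. distr_of dXdY (U F))"
    "extends_to_unitary (THE T. determined_by b T)"
proof -
  have "isometry_on_L2 dXdY U" using U by (simp add: unitary_on_L2_iff)
  from determined_by_isometry[OF this b]
  have d: "determined_by b (\<lambda>F\<in>schwartz. distr_of dXdY (U F))" .
  show e: "(THE T. determined_by b T) = (\<lambda>F\<in>schwartz. distr_of dXdY (U F))"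
    by (rule the_equality[of "determined_by b", OF d]) (rule tempered_bilinear_unique[OF _ d])
  show "extends_to_unitary (THE T. determined_by b T)"
    unfolding extends_to_unitary_def e using U by auto
qed

context composition_law
begin

section \<open>Symmetry of \<open>R\<close> and the unitarity of all three maps\<close>

text \<open>Both sides are integrals of the four-fold product in cyclic order. Up to a flip, the
  functions acted upon and the test functions exchange roles.\<close>

lemma R_symmetric:
  assumes "f1 \<in> schwartz" "f2 \<in> schwartz" "g1 \<in> schwartz" "g2 \<in> schwartz"
  shows "(\<integral>X. m g1 f1 X * m g2 f2 X \<partial>dX) = (\<integral>X. m f2 g1 X * m f1 g2 X \<partial>dX)"
proof -
  have "(\<integral>X. m g1 f1 X * m g2 f2 X \<partial>dX) = (\<integral>X. f1 X * m (m g2 f2) g1 X \<partial>dX)"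
    by (rule pairing_rotate) (intro closed assms)+
  also have "\<dots> = (\<integral>X. f1 X * m g2 (m f2 g1) X \<partial>dX)" by (simp only: assoc assms)
  also have "\<dots> = (\<integral>X. m f1 g2 X * m f2 g1 X \<partial>dX)"
    by (rule pairing_assoc[symmetric]) (intro closed assms)+
  finally show ?thesis by (simp only: mult.commute)
qed

lemma R_unitary_exists:
  obtains U where "unitary_on_L2 dXdY U"
    "\<And>f1 f2 g1 g2. f1 \<in> schwartz \<Longrightarrow> f2 \<in> schwartz \<Longrightarrow> g1 \<in> schwartz \<Longrightarrow> g2 \<in> schwartz \<Longrightarrow>
      (\<integral>Z. U (tensor f1 f2) Z * tensor g1 g2 Z \<partial>dXdY) = (\<integral>X. m g1 f1 X * m g2 f2 X \<partial>dX)"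
proof -
  obtain L where L: "isometry_on_L2 dXdY L"
    and Lt: "\<And>f g. f \<in> schwartz \<Longrightarrow> g \<in> schwartz \<Longrightarrow> AE Z in dXdY. L (tensor f g) Z = kernel_fun f g Z"
    by (rule isometry_from_tensors[of kernel_fun, OF kernel_fun_L2]) (auto intro: kernel_fun_inner)
  \<comment> \<open>The Fourier transform in the second variable, described by its transpose. On the
    second test function it cancels the transform left there by
    \<open>kernel_fun_pairing\<close>.\<close>
  obtain W :: "('n phase \<times> 'n phase \<Rightarrow> complex) \<Rightarrow> 'n phase \<times> 'n phase \<Rightarrow> complex" where W: "unitary_on_L2 dXdY W"
    and Wt: "\<And>F g h. F \<in> L2 dXdY \<Longrightarrow> g \<in> schwartz \<Longrightarrow> h \<in> schwartz \<Longrightarrow>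
      (\<integral>Z. W F Z * tensor g h Z \<partial>dXdY) = (\<integral>Z. F Z * tensor g (symp_fourier h) Z \<partial>dXdY)"
    by (rule tensor_involution_unitary[of "\<lambda>f. f" fourier_transpose "\<lambda>f. f" symp_fourier])
       (auto intro: fourier_transpose_schwartz symp_fourier_schwartz fourier_transpose_twice fourier_transpose_L2_inner fourier_transpose_pairing)
  have Wi: "isometry_on_L2 dXdY W" using W by (simp add: unitary_on_L2_iff)
  note l = isometry_on_L2_D[OF L]
  define U where "U F = W (L F)" for F
  have U: "isometry_on_L2 dXdY U"
    unfolding U_def by (rule isometry_comp[OF Wi L])
  note u = isometry_on_L2_D[OF U]
  have Ut: "(\<integral>Z. U (tensor f1 f2) Z * tensor g1 g2 Z \<partial>dXdY) = (\<integral>X. m g1 f1 X * m g2 f2 X \<partial>dX)"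
    if f: "f1 \<in> schwartz" "f2 \<in> schwartz" and g: "g1 \<in> schwartz" "g2 \<in> schwartz" for f1 f2 g1 g2
  proof -
    have "(\<integral>Z. U (tensor f1 f2) Z * tensor g1 g2 Z \<partial>dXdY) = (\<integral>Z. L (tensor f1 f2) Z * tensor g1 (symp_fourier g2) Z \<partial>dXdY)"
      unfolding U_def by (rule Wt[OF l(1)[OF tensor_L2[OF f]] g])
    also have "\<dots> = (\<integral>Z. kernel_fun f1 f2 Z * tensor g1 (symp_fourier g2) Z \<partial>dXdY)"
    proof (rule integral_cong_AE)
      show "AE Z in dXdY. L (tensor f1 f2) Z * tensor g1 (symp_fourier g2) Z = kernel_fun f1 f2 Z * tensor g1 (symp_fourier g2) Z"
        using Lt[OF f] by eventually_elim simp
    qed (intro borel_measurable_integrable L2_Cauchy_Schwarz l kernel_fun_L2 tensor_L2 symp_fourier_schwartz f g)+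
    also have "\<dots> = (\<integral>X. m g1 f1 X * m g2 f2 X \<partial>dX)"
      unfolding kernel_fun_pairing[OF f g(1) symp_fourier_schwartz[OF g(2)]] symp_fourier_twice[OF g(2)] ..
    finally show ?thesis .
  qed
  let ?s = "prod.swap :: 'n phase \<times> 'n phase \<Rightarrow> _"
  have sm: "?s \<in> measurable dXdY dXdY"
    unfolding prod.swap_def by (simp cong: measurable_cong_sets) (intro borel_measurable_continuous_onI continuous_intros)
  note swap = sm distr_swap
  have ss: "isometry_on_L2 dXdY (\<lambda>f x. f (?s x))"
    using unitary_comp_measure_preserving[OF swap swap] by (simp add: unitary_on_L2_iff)
  \<comment> \<open>The transpose of U is U preceded by the flip. Only one argument at a time can be
    freed by density: F here, the test function in \<open>sym\<close>.\<close>
  have sym1: "(\<integral>Z. U F Z * tensor g1 g2 Z \<partial>dXdY) = (\<integral>Z. F Z * U (\<lambda>x. tensor g1 g2 (?s x)) Z \<partial>dXdY)"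
    if F: "F \<in> L2 dXdY" and g: "g1 \<in> schwartz" "g2 \<in> schwartz" for F g1 g2
  proof (rule pairing_eq_from_tensors[OF U isometry_id tensor_L2[OF g] _ _ F])
    have sw: "(\<lambda>x. tensor g1 g2 (?s x)) = tensor g2 g1" by (auto simp: tensor_def fun_eq_iff)
    show "U (\<lambda>x. tensor g1 g2 (?s x)) \<in> L2 dXdY" unfolding sw by (intro u tensor_L2 g)
    fix f1 f2 :: "'n phase \<Rightarrow> complex" assume f: "f1 \<in> schwartz" "f2 \<in> schwartz"
    have "(\<integral>Z. U (tensor f1 f2) Z * tensor g1 g2 Z \<partial>dXdY) = (\<integral>Z. U (tensor g2 g1) Z * tensor f1 f2 Z \<partial>dXdY)"
      unfolding Ut[OF f g] Ut[OF g(2,1) f] by (subst R_symmetric[OF f g]) (simp only: mult.commute)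
    then show "(\<integral>Z. U (tensor f1 f2) Z * tensor g1 g2 Z \<partial>dXdY) = (\<integral>Z. tensor f1 f2 Z * U (\<lambda>x. tensor g1 g2 (?s x)) Z \<partial>dXdY)"
      unfolding sw by (simp only: mult.commute)
  qed
  have sU: "isometry_on_L2 dXdY (\<lambda>G. U (\<lambda>x. G (?s x)))" by (rule isometry_comp[OF U ss])
  have sym: "(\<integral>Z. U F Z * G Z \<partial>dXdY) = (\<integral>Z. F Z * U (\<lambda>x. G (?s x)) Z \<partial>dXdY)"
    if F: "F \<in> L2 dXdY" and G: "G \<in> L2 dXdY" for F G
  proof -
    have "(\<integral>Z. U (\<lambda>x. G (?s x)) Z * F Z \<partial>dXdY) = (\<integral>Z. G Z * U F Z \<partial>dXdY)"
    proof (rule pairing_eq_from_tensors[OF sU isometry_id F u(1)[OF F] _ G])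
      fix f g :: "'n phase \<Rightarrow> complex" assume fg: "f \<in> schwartz" "g \<in> schwartz"
      show "(\<integral>Z. U (\<lambda>x. tensor f g (?s x)) Z * F Z \<partial>dXdY) = (\<integral>Z. tensor f g Z * U F Z \<partial>dXdY)"
        using sym1[OF F fg] by (simp only: mult.commute)
    qed
    then show ?thesis by (simp only: mult.commute)
  qed
  have "unitary_on_L2 dXdY U"
  proof (rule unitary_from_adjoint[OF U])
    \<comment> \<open>The Hilbert space adjoint is the bilinear transpose between two conjugations;
      it preserves norms because U, conjugation and the flip do.\<close>
    let ?V = "\<lambda>G x. cnj (U (\<lambda>x. cnj (G (?s x))) x)"
    fix G :: "'n phase \<times> 'n phase \<Rightarrow> complex" assume G: "G \<in> L2 dXdY"
    have cG: "(\<lambda>x. cnj (G (?s x))) \<in> L2 dXdY" by (intro L2_cnj L2_comp[OF swap G])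
    show "?V G \<in> L2 dXdY" by (intro L2_cnj u cG)
    show "L2_norm dXdY (?V G) = L2_norm dXdY G"
      by (simp only: L2_norm_cnj isometry_on_L2_norm[OF U cG] L2_norm_comp[OF swap G])
    fix F :: "'n phase \<times> 'n phase \<Rightarrow> complex" assume F: "F \<in> L2 dXdY"
    show "L2_inner dXdY (U F) G = L2_inner dXdY F (?V G)"
      unfolding L2_inner_def complex_cnj_cnj by (rule sym[OF F L2_cnj[OF G]])
  qed
  with Ut show thesis using that by blast
qed

lemma all_unitary:
  "extends_to_unitary (M_map m) \<and> extends_to_unitary (N_map m) \<and> extends_to_unitary (R_map m)"
proof -
  obtain R :: "('n phase \<times> 'n phase \<Rightarrow> complex) \<Rightarrow> 'n phase \<times> 'n phase \<Rightarrow> complex" where R: "unitary_on_L2 dXdY R"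
    and Rt: "\<And>f1 f2 g1 g2. f1 \<in> schwartz \<Longrightarrow> f2 \<in> schwartz \<Longrightarrow> g1 \<in> schwartz \<Longrightarrow> g2 \<in> schwartz \<Longrightarrow>
      (\<integral>Z. R (tensor f1 f2) Z * tensor g1 g2 Z \<partial>dXdY) = (\<integral>X. m g1 f1 X * m g2 f2 X \<partial>dX)"
    using R_unitary_exists by blast
  obtain W :: "('n phase \<times> 'n phase \<Rightarrow> complex) \<Rightarrow> 'n phase \<times> 'n phase \<Rightarrow> complex" where W: "unitary_on_L2 dXdY W"
    and Wt: "\<And>F g h. F \<in> L2 dXdY \<Longrightarrow> g \<in> schwartz \<Longrightarrow> h \<in> schwartz \<Longrightarrow>
      (\<integral>Z. W F Z * tensor g h Z \<partial>dXdY) = (\<integral>Z. F Z * tensor (symp_fourier g) (symp_fourier h) Z \<partial>dXdY)"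
    by (rule tensor_involution_unitary[of fourier_transpose fourier_transpose symp_fourier symp_fourier])
       (auto intro: fourier_transpose_schwartz symp_fourier_schwartz fourier_transpose_twice fourier_transpose_L2_inner fourier_transpose_pairing)
  \<comment> \<open>\<open>N\<close> is \<open>R\<close> with both test functions replaced by their
    transforms. The transpose of W performs this replacement, so W is applied after R.\<close>
  let ?N = "\<lambda>F. W (R F)"
  have N: "unitary_on_L2 dXdY ?N" by (rule unitary_comp[OF W R])
  have Nt: "(\<integral>Z. ?N (tensor f1 f2) Z * tensor g1 g2 Z \<partial>dXdY) = (\<integral>X. m (symp_fourier g1) f1 X * m (symp_fourier g2) f2 X \<partial>dX)"
    if "f1 \<in> schwartz" "f2 \<in> schwartz" "g1 \<in> schwartz" "g2 \<in> schwartz" for f1 f2 g1 g2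
  proof -
    have "R (tensor f1 f2) \<in> L2 dXdY" using R tensor_L2[OF that(1,2)] by (simp add: unitary_on_L2_def)
    from Wt[OF this that(3,4)] show ?thesis
      by (simp only: Rt[OF that(1,2) symp_fourier_schwartz symp_fourier_schwartz] that)
  qed
  note N_ext = extends_to_unitary_if_determined[OF N Nt]
  have 1: "extends_to_unitary (R_map m)"
    unfolding R_map_def by (rule extends_to_unitary_if_determined(2)[OF R Rt])
  have 2: "extends_to_unitary (N_map m)"
    unfolding N_map_def by (rule N_ext(2))
  have 3: "extends_to_unitary (M_map m)"
  proof -
    let ?C = "C_change :: 'n phase \<times> 'n phase \<Rightarrow> _" and ?D = "inv C_change :: 'n phase \<times> 'n phase \<Rightarrow> _"
    have CM: "?C \<in> measurable dXdY dXdY" using C_change_measurable by (simp cong: measurable_cong_sets)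
    have "continuous_on UNIV ?D"
      unfolding C_change_inverse(1) case_prod_beta by (intro continuous_intros)
    then have DM: "?D \<in> measurable dXdY dXdY"
      by (simp add: borel_measurable_continuous_onI cong: measurable_cong_sets)
    have DD: "distr dXdY dXdY ?D = dXdY"
    proof -
      have "distr dXdY dXdY ?D = distr (distr dXdY dXdY ?C) dXdY ?D" by (simp only: distr_C_change)
      also have "\<dots> = distr dXdY dXdY (?D \<circ> ?C)" by (rule distr_distr[OF DM CM])
      also have "?D \<circ> ?C = (\<lambda>Z. Z)" by (simp add: fun_eq_iff C_change_inverse(3))
      finally show ?thesis by (simp add: distr_id[unfolded id_def])
    qed
    have U: "unitary_on_L2 dXdY (\<lambda>F Z. ?N F (?C Z))"
      by (rule unitary_comp[OF unitary_comp_measure_preserving[OF CM distr_C_change DM DD C_change_inverse(3)] N])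
    have "M_map m F = distr_of dXdY (\<lambda>Z. ?N F (?C Z))" if F: "F \<in> schwartz" for F
    proof -
      have NF: "?N F \<in> L2 dXdY" using N schwartz_L2_dXdY[OF F] by (simp add: unitary_on_L2_def)
      have "N_map m = (\<lambda>F\<in>schwartz. distr_of dXdY (?N F))" unfolding N_map_def by (rule N_ext(1))
      then have "N_map m F = distr_of dXdY (?N F)" using F by simp
      then have "M_map m F = (\<lambda>G\<in>schwartz. distr_of dXdY (?N F) (G \<circ> ?D))"
        using F by (simp add: M_map_def C_map_def)
      also have "\<dots> = distr_of dXdY (\<lambda>Z. ?N F (?C Z))"
        unfolding distr_of_def[of dXdY "\<lambda>Z. ?N F (?C Z)"]
      proof (rule restrict_ext)
        fix G :: "'n phase \<times> 'n phase \<Rightarrow> complex" assume G: "G \<in> schwartz"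
        note GD = inv_C_change_schwartz[OF G]
        have "distr_of dXdY (?N F) (G \<circ> ?D) = (\<integral>Z. ?N F Z * (G \<circ> ?D) Z \<partial>dXdY)"
          by (simp add: distr_of_def GD)
        \<comment> \<open>Transposition by the inverse becomes composition with the map itself,
          because the map preserves the measure.\<close>
        also have "\<dots> = (\<integral>Z. ?N F (?C Z) * (G \<circ> ?D) (?C Z) \<partial>dXdY)"
          by (rule integral_comp[OF CM distr_C_change, symmetric])
             (intro borel_measurable_integrable L2_Cauchy_Schwarz NF schwartz_L2_dXdY GD)
        also have "\<dots> = (\<integral>Z. ?N F (?C Z) * G Z \<partial>dXdY)" by (simp add: C_change_inverse(3))
        finally show "distr_of dXdY (?N F) (G \<circ> ?D) = (\<integral>Z. ?N F (?C Z) * G Z \<partial>dXdY)" .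
      qed
      finally show ?thesis .
    qed
    then show ?thesis unfolding extends_to_unitary_def using U by blast
  qed
  from 1 2 3 show ?thesis by blast
qed

end

theorem theorem2p6:
  fixes m :: "'n::finite composition"
  assumes "hypothesis_A m" and "hypothesis_B m" and "hypothesis_C m"
  shows "extends_to_unitary (M_map m) \<and> extends_to_unitary (N_map m) \<and> extends_to_unitary (R_map m)"
  by (rule composition_law.all_unitary) (unfold_locales; fact assms)

end
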